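(* Assume that $(X,d,T)$ has the $g$-almost product property and the uniform separation property, and let $\varphi\in C(X,\mathbb{R})$. Fix $S_1\subset\Xi(M(X,T))$ and $S_2\subset Y$. (1) If $S_1=\emptyset$, then $$P(\Delta(S_1,S_2),\varphi)=\sup_{x\in S_2}\Lambda(x,\varphi).$$ (2) If $S_1\ne\emptyset$ and $S_1$ is contained in a connected component of $S_2$, then $$\sup_{Q}\ \inf_{x\in Q}\Lambda(x,\varphi)\ \le\ P(\Delta(S_1,S_2),\varphi)\ \le\ \inf_{x\in S_1}\Lambda(x,\varphi),$$ where the supremum is over all sets $Q$ with $S_1\subset Q\subset S_2$ such that $Q\subseteq\Xi(M(X,T))$ is compact and connected. (3) If $S_1\ne\emptyset$ and $S_1$ is not contained in a connected component of $S_2$, then $\{x\in X:S_1\subset A(\Xi L_nx)\subset S_2\}=\emptyset$.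
   Context: Setting. $(X,d)$ is a compact metric space and $T:X\to X$ is continuous. $M(X)$ is the set of Borel probability measures on $X$ with the weak* topology, $M(X,T)$ the subset of $T$-invariant ones, and $h(T,\mu)$ the metric (measure-theoretic) entropy. Fix a countable dense subset $\{f_1,f_2,\dots\}$ of $C(X,[0,1])$ and metrize $M(X)$ by $\rho(\mu,\nu)=\sum_{k\ge1}2^{-k}|\int f_k\,d\mu-\int f_k\,d\nu|$; the metric on $X$ is taken to be $d(x,y)=\rho(\delta_x,\delta_y)$ (equivalent to the original one). The $n$-th empirical measure is $L_nx=\frac1n\sum_{k=0}^{n-1}\delta_{T^kx}$. $Y$ is a real vector space with a metric $d'$ that is linearly compatible: $d'(x_1+x_2,y_1+y_2)\le d'(x_1,y_1)+d'(x_2,y_2)$ and $d'(\lambda x,\lambda y)\le|\lambda|d'(x,y)$ for all vectors in $Y$ and $\lambda\in\mathbb{R}$. $\Xi:M(X)\to Y$ is continuous and affine. $A(x_n)$ denotes the set of accumulation points (limits of subsequences) of a sequence $(x_n)$; $A(\Xi L_nx)$ is that of $(\Xi L_nx)_{n\ge1}$. $\Delta(S_1,S_2)=\{x\in X:S_1\subset A(\Xi L_nx)\subset S_2\}$. For $y\in Y$, $\Lambda(y,\varphi)=\sup\{h(T,\mu)+\int\varphi\,d\mu:\mu\in M(X,T),\ \Xi\mu=y\}$ if $y\in\Xi(M(X,T))$, and $\Lambda(y,\varphi)=-\infty$ otherwise. Conventions: $\sup\emptyset=-\infty$; the definition of pressure below gives $P(\emptyset,\varphi)=-\infty$. $g$-almost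 product property: A blow-up function is a nondecreasing unbounded map $g:\mathbb{N}\to\mathbb{N}$ with $g(n)<n$ (for $n\ge1$; the value $0$ is allowed) and $g(n)/n\to0$. Let $\Lambda_n=\{0,\dots,n-1\}$ and $B_n(g;x,\epsilon)=\{y\in X:\exists\Lambda\subset\Lambda_n,\ \#(\Lambda_n\setminus\Lambda)\le g(n),\ \max\{d(T^jx,T^jy):j\in\Lambda\}\le\epsilon\}$. $(X,d,T)$ has the $g$-almost product property (with blow-up function $g$) if there is a nonincreasing $m:\mathbb{R}^+\to\mathbb{N}$ such that for all $k\ge1$, $x_1,\dots,x_k\in X$, $\epsilon_1,\dots,\epsilon_k>0$ and integers $n_j\ge m(\epsilon_j)$ ($n_j\geq 1$), $\bigcap_{j=1}^kT^{-M_{j-1}}B_{n_j}(g;x_j,\epsilon_j)\ne\emptyset$, where $M_0=0$, $M_i=n_1+\cdots+n_i$. Uniform separation property: Points $x,y$ are $(\delta,n,\epsilon)$-separated if $\#\{0\le j\le n-1:d(T^jx,T^jy)>\epsilon\}\ge\delta n$; a set is $(\delta,n,\epsilon)$-separated if any two distinct points of it are. For $F\subset M(X)$, $X_{n,F}=\{x:L_nx\in F\}$ and $N(F;\delta,n,\epsilon)$ is the maximal cardinality of a $(\delta,n,\epsilon)$-separated subset of $X_{n,F}$. The property holds if for every $\eta>0$ there are $\delta^*>0,\epsilon^*>0$ such that for every ergodic $\mu\in M(X,T)$ and every neighborhood $F\subset M(X)$ of $\mu$ there is $n^*_{F,\mu,\eta}$ with $N(F;\delta^*,n,\epsilon^*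 )\ge\exp(n(h(T,\mu)-\eta))$ for all $n\ge n^*_{F,\mu,\eta}$. Topological pressure of an arbitrary set $Z\subset X$: $B_n(x,\epsilon)=\{y:\max_{0\le i\le n-1}d(T^ix,T^iy)\le\epsilon\}$, $S_n\varphi=\sum_{i=0}^{n-1}\varphi\circ T^i$, $\Gamma_n(Z,\epsilon)$ is the collection of finite or countable covers of $Z$ by sets $B_m(x,\epsilon)$ with $m\ge n$; $M(Z,t,\varphi,n,\epsilon)=\inf_{\mathcal{C}\in\Gamma_n(Z,\epsilon)}\sum_{B_m(x,\epsilon)\in\mathcal{C}}\exp(-tm+\sup_{y\in B_m(x,\epsilon)}S_m\varphi(y))$, $M(Z,t,\varphi,\epsilon)=\lim_{n\to\infty}M(Z,t,\varphi,n,\epsilon)$, $P(Z,\varphi,\epsilon)=\inf\{t:M(Z,t,\varphi,\epsilon)=0\}=\sup\{t:M(Z,t,\varphi,\epsilon)=\infty\}$, $P(Z,\varphi)=\lim_{\epsilon\to0}P(Z,\varphi,\epsilon)$. *)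

theory Defs
  imports "HOL-Probability.Probability"
begin

section \<open>Borel probability measures and the weak* topology\<close>

definition prob_measures :: "'a::topological_space measure set" where
  "prob_measures = {\<mu>. sets \<mu> = sets borel \<and> prob_space \<mu>}"

definition weak_star_topology :: "'a::topological_space measure topology" where
  "weak_star_topology = topology_generated_by
     {{\<mu> \<in> prob_measures. (\<integral>x. u x \<partial>\<mu>) \<in> U} | u U.
        continuous_on UNIV (u :: 'a \<Rightarrow> real) \<and> open U}"

lemma topspace_weak_star_topology: "topspace weak_star_topology = prob_measures"
proof -
  have "\<exists>u U. {\<mu> \<in> prob_measures. (\<integral>x. u x \<partial>\<mu>) \<in> U} = (prob_measures :: 'a measure set)
      \<and> continuous_on UNIV (u :: 'a \<Rightarrow> real) \<and> open U"
    by (rule exI[of _ "\<lambda>_. 0"], rule exI[of _ UNIV]) auto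
  then show ?thesis
    unfolding weak_star_topology_def topology_generated_by_topspace by blast
qed

definition unit_functions :: "('a::topological_space \<Rightarrow>\<^sub>C real) set" where
  "unit_functions = {u. \<forall>x. apply_bcontfun u x \<in> {0..1}}"

text \<open>The sequence is indexed from 0, so the weights are \<open>2 ^ (- (k + 1))\<close>.\<close>

definition rho :: "(nat \<Rightarrow> 'a::topological_space \<Rightarrow>\<^sub>C real) \<Rightarrow> 'a measure \<Rightarrow> 'a measure \<Rightarrow> real" where
  "rho f \<mu> \<nu> =
     (\<Sum>k. (1 / 2) ^ Suc k * \<bar>(\<integral>x. apply_bcontfun (f k) x \<partial>\<mu>) - (\<integral>x. apply_bcontfun (f k) x \<partial>\<nu>)\<bar>)"

definition rho_dist :: "(nat \<Rightarrow> 'a::topological_space \<Rightarrow>\<^sub>C real) \<Rightarrow> 'a \<Rightarrow> 'a \<Rightarrow> real" where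
  "rho_dist f x y = rho f (return borel x) (return borel y)"

definition invariant_measures :: "('a::topological_space \<Rightarrow> 'a) \<Rightarrow> 'a measure set" where
  "invariant_measures T = {\<mu> \<in> prob_measures. distr \<mu> borel T = \<mu>}"

definition ergodic_measures :: "('a::topological_space \<Rightarrow> 'a) \<Rightarrow> 'a measure set" where
  "ergodic_measures T = {\<mu> \<in> invariant_measures T.
     \<forall>A \<in> sets borel. T -` A = A \<longrightarrow> measure \<mu> A = 0 \<or> measure \<mu> A = 1}"

definition affine_on_prob_measures :: "('a::topological_space measure \<Rightarrow> 'y::real_vector) \<Rightarrow> bool" where
  "affine_on_prob_measures \<Xi> \<longleftrightarrow>
     (\<forall>\<mu> \<in> prob_measures. \<forall>\<nu> \<in> prob_measures. \<forall>\<kappa> \<in> prob_measures. \<forall>a \<in> {0..1}.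
        (\<forall>A \<in> sets borel. measure \<kappa> A = a * measure \<mu> A + (1 - a) * measure \<nu> A) \<longrightarrow>
        \<Xi> \<kappa> = a *\<^sub>R \<Xi> \<mu> + (1 - a) *\<^sub>R \<Xi> \<nu>)"

text \<open>The empirical measure is the image of the uniform distribution on \<open>{0, \<dots>, n - 1}\<close>
  under \<open>k \<mapsto> T\<^sup>k x\<close>.\<close>

definition empirical :: "('a::topological_space \<Rightarrow> 'a) \<Rightarrow> nat \<Rightarrow> 'a \<Rightarrow> 'a measure" where
  "empirical T n x = distr (uniform_count_measure {..<n}) borel (\<lambda>k. (T ^^ k) x)"

lemma measure_empirical:
  assumes "n \<ge> 1" "A \<in> sets borel"
  shows "measure (empirical T n x) A = (1 / real n) * (\<Sum>k<n. measure (return borel ((T ^^ k) x)) A)"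
proof -
  have eq: "(\<lambda>k. (T ^^ k) x) -` A \<inter> {..<n} = {k \<in> {..<n}. (T ^^ k) x \<in> A}" by auto
  have "measure (empirical T n x) A = measure (uniform_count_measure {..<n}) {k \<in> {..<n}. (T ^^ k) x \<in> A}"
    unfolding empirical_def
    by (subst measure_distr) (auto simp: assms measurable_def space_uniform_count_measure
      sets_uniform_count_measure eq)
  also have "\<dots> = card {k \<in> {..<n}. (T ^^ k) x \<in> A} / real n"
    by (subst measure_uniform_count_measure) auto
  also have "\<dots> = (1 / real n) * (\<Sum>k<n. measure (return borel ((T ^^ k) x)) A)"
    using assms by (simp add: measure_return indicator_def sum.If_cases Collect_conj_eq lessThan_def)
  finally show ?thesis .
qed

section \<open>Measure-theoretic entropy\<close>

definition finite_partition :: "'a::topological_space set set \<Rightarrow> bool" where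
  "finite_partition P \<longleftrightarrow> finite P \<and> P \<subseteq> sets borel \<and> partition_on UNIV P"

definition partition_entropy :: "'a measure \<Rightarrow> 'a set set \<Rightarrow> real" where
  "partition_entropy \<mu> P = - (\<Sum>A\<in>P. measure \<mu> A * ln (measure \<mu> A))"

definition pullback_partition :: "('a \<Rightarrow> 'a) \<Rightarrow> nat \<Rightarrow> 'a set set \<Rightarrow> 'a set set" where
  "pullback_partition T i P = (\<lambda>A. (T ^^ i) -` A) ` P - {{}}"

definition iterated_join :: "('a \<Rightarrow> 'a) \<Rightarrow> nat \<Rightarrow> 'a set set \<Rightarrow> 'a set set" where
  "iterated_join T n P = common_refinement ((\<lambda>i. pullback_partition T i P) ` {..<n})"

definition entropy_wrt :: "('a \<Rightarrow> 'a) \<Rightarrow> 'a measure \<Rightarrow> 'a set set \<Rightarrow> real" where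
  "entropy_wrt T \<mu> P = lim (\<lambda>n. partition_entropy \<mu> (iterated_join T n P) / real n)"

definition metric_entropy :: "('a::topological_space \<Rightarrow> 'a) \<Rightarrow> 'a measure \<Rightarrow> ereal" where
  "metric_entropy T \<mu> = (SUP P \<in> {P. finite_partition P}. ereal (entropy_wrt T \<mu> P))"

section \<open>The almost product property\<close>

definition blow_up :: "(nat \<Rightarrow> nat) \<Rightarrow> bool" where
  "blow_up g \<longleftrightarrow> mono g \<and> (\<forall>b. \<exists>n. b < g n) \<and> (\<forall>n\<ge>1. g n < n)
     \<and> (\<lambda>n. real (g n) / real n) \<longlonglongrightarrow> 0"

definition mistake_ball ::
  "('a \<Rightarrow> 'a \<Rightarrow> real) \<Rightarrow> ('a \<Rightarrow> 'a) \<Rightarrow> (nat \<Rightarrow> nat) \<Rightarrow> nat \<Rightarrow> 'a \<Rightarrow> real \<Rightarrow> 'a set" where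
  "mistake_ball d T g n x \<epsilon> = {y. \<exists>\<Lambda> \<subseteq> {..<n}. card ({..<n} - \<Lambda>) \<le> g n \<and>
     (\<forall>j\<in>\<Lambda>. d ((T ^^ j) x) ((T ^^ j) y) \<le> \<epsilon>)}"

text \<open>The blocks are indexed by \<open>j < k\<close>, so the \<open>j\<close>-th block starts at time \<open>n 0 + \<dots> + n (j - 1)\<close>.\<close>

definition almost_product_property ::
  "('a \<Rightarrow> 'a \<Rightarrow> real) \<Rightarrow> ('a \<Rightarrow> 'a) \<Rightarrow> (nat \<Rightarrow> nat) \<Rightarrow> bool" where
  "almost_product_property d T g \<longleftrightarrow>
     (\<exists>m :: real \<Rightarrow> nat. antimono_on {0<..} m \<and>
        (\<forall>k\<ge>1. \<forall>(x :: nat \<Rightarrow> 'a) (\<epsilon> :: nat \<Rightarrow> real) (n :: nat \<Rightarrow> nat).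
           (\<forall>j<k. 0 < \<epsilon> j \<and> m (\<epsilon> j) \<le> n j \<and> 1 \<le> n j) \<longrightarrow>
           (\<Inter>j<k. (T ^^ (\<Sum>i<j. n i)) -` mistake_ball d T g (n j) (x j) (\<epsilon> j)) \<noteq> {}))"

section \<open>The uniform separation property\<close>

definition separated_points ::
  "('a \<Rightarrow> 'a \<Rightarrow> real) \<Rightarrow> ('a \<Rightarrow> 'a) \<Rightarrow> real \<Rightarrow> nat \<Rightarrow> real \<Rightarrow> 'a \<Rightarrow> 'a \<Rightarrow> bool" where
  "separated_points d T \<delta> n \<epsilon> x y \<longleftrightarrow>
     real (card {j. j < n \<and> d ((T ^^ j) x) ((T ^^ j) y) > \<epsilon>}) \<ge> \<delta> * real n"

definition separated_set ::
  "('a \<Rightarrow> 'a \<Rightarrow> real) \<Rightarrow> ('a \<Rightarrow> 'a) \<Rightarrow> real \<Rightarrow> nat \<Rightarrow> real \<Rightarrow> 'a set \<Rightarrow> bool" where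
  "separated_set d T \<delta> n \<epsilon> E \<longleftrightarrow> (\<forall>x\<in>E. \<forall>y\<in>E. x \<noteq> y \<longrightarrow> separated_points d T \<delta> n \<epsilon> x y)"

text \<open>The supremum runs over finite sets because \<open>card\<close> is 0 on infinite ones; arbitrarily
  large finite separated sets would make it infinite.\<close>

definition max_separated ::
  "('a::topological_space \<Rightarrow> 'a \<Rightarrow> real) \<Rightarrow> ('a \<Rightarrow> 'a) \<Rightarrow> 'a measure set \<Rightarrow> real \<Rightarrow> nat \<Rightarrow> real \<Rightarrow> ereal" where
  "max_separated d T F \<delta> n \<epsilon> =
     (SUP E \<in> {E. finite E \<and> E \<subseteq> {x. empirical T n x \<in> F} \<and> separated_set d T \<delta> n \<epsilon> E}.
        ereal (real (card E)))"

definition exp_ereal :: "ereal \<Rightarrow> ereal" where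
  "exp_ereal t = (case t of ereal r \<Rightarrow> ereal (exp r) | PInfty \<Rightarrow> \<infinity> | MInfty \<Rightarrow> 0)"

definition weak_star_neighbourhood :: "'a::topological_space measure set \<Rightarrow> 'a measure \<Rightarrow> bool" where
  "weak_star_neighbourhood F \<mu> \<longleftrightarrow> F \<subseteq> prob_measures \<and>
     (\<exists>U. openin weak_star_topology U \<and> \<mu> \<in> U \<and> U \<subseteq> F)"

definition uniform_separation_property ::
  "('a::topological_space \<Rightarrow> 'a \<Rightarrow> real) \<Rightarrow> ('a \<Rightarrow> 'a) \<Rightarrow> bool" where
  "uniform_separation_property d T \<longleftrightarrow>
     (\<forall>\<eta>>0. \<exists>\<delta>>0. \<exists>\<epsilon>>0. \<forall>\<mu> \<in> ergodic_measures T. \<forall>F. weak_star_neighbourhood F \<mu> \<longrightarrow>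
        (\<exists>N. \<forall>n\<ge>N. max_separated d T F \<delta> n \<epsilon>
            \<ge> exp_ereal (ereal (real n) * (metric_entropy T \<mu> - ereal \<eta>))))"

section \<open>Topological pressure of an arbitrary set\<close>

definition bowen_ball :: "('a \<Rightarrow> 'a \<Rightarrow> real) \<Rightarrow> ('a \<Rightarrow> 'a) \<Rightarrow> nat \<Rightarrow> 'a \<Rightarrow> real \<Rightarrow> 'a set" where
  "bowen_ball d T n x \<epsilon> = {y. \<forall>i<n. d ((T ^^ i) x) ((T ^^ i) y) \<le> \<epsilon>}"

definition birkhoff_sum :: "('a \<Rightarrow> 'a) \<Rightarrow> ('a \<Rightarrow> real) \<Rightarrow> nat \<Rightarrow> 'a \<Rightarrow> real" where
  "birkhoff_sum T \<phi> n x = (\<Sum>i<n. \<phi> ((T ^^ i) x))"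

text \<open>A cover is given by the pairs \<open>(m, x)\<close> of its Bowen balls: the weight depends on the
  length \<open>m\<close>, which a ball does not determine as a set.\<close>

definition bowen_covers ::
  "('a \<Rightarrow> 'a \<Rightarrow> real) \<Rightarrow> ('a \<Rightarrow> 'a) \<Rightarrow> 'a set \<Rightarrow> nat \<Rightarrow> real \<Rightarrow> (nat \<times> 'a) set set" where
  "bowen_covers d T Z n \<epsilon> =
     {C. countable C \<and> (\<forall>(m, x) \<in> C. n \<le> m) \<and> Z \<subseteq> (\<Union>(m, x) \<in> C. bowen_ball d T m x \<epsilon>)}"

definition pressure_sum ::
  "('a \<Rightarrow> 'a \<Rightarrow> real) \<Rightarrow> ('a \<Rightarrow> 'a) \<Rightarrow> 'a set \<Rightarrow> real \<Rightarrow> ('a \<Rightarrow> real) \<Rightarrow> nat \<Rightarrow> real \<Rightarrow> ennreal" where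
  "pressure_sum d T Z t \<phi> n \<epsilon> =
     (INF C \<in> bowen_covers d T Z n \<epsilon>.
        \<Sum>\<^sub>\<infinity>(m, x)\<in>C. ennreal (exp (- t * real m + (SUP y \<in> bowen_ball d T m x \<epsilon>. birkhoff_sum T \<phi> m y))))"

definition pressure_outer ::
  "('a \<Rightarrow> 'a \<Rightarrow> real) \<Rightarrow> ('a \<Rightarrow> 'a) \<Rightarrow> 'a set \<Rightarrow> real \<Rightarrow> ('a \<Rightarrow> real) \<Rightarrow> real \<Rightarrow> ennreal" where
  "pressure_outer d T Z t \<phi> \<epsilon> = lim (\<lambda>n. pressure_sum d T Z t \<phi> n \<epsilon>)"

definition pressure_at ::
  "('a \<Rightarrow> 'a \<Rightarrow> real) \<Rightarrow> ('a \<Rightarrow> 'a) \<Rightarrow> 'a set \<Rightarrow> ('a \<Rightarrow> real) \<Rightarrow> real \<Rightarrow> ereal" where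
  "pressure_at d T Z \<phi> \<epsilon> = (INF t \<in> {t. pressure_outer d T Z t \<phi> \<epsilon> = 0}. ereal t)"

definition pressure ::
  "('a \<Rightarrow> 'a \<Rightarrow> real) \<Rightarrow> ('a \<Rightarrow> 'a) \<Rightarrow> 'a set \<Rightarrow> ('a \<Rightarrow> real) \<Rightarrow> ereal" where
  "pressure d T Z \<phi> = Lim (at_right 0) (\<lambda>\<epsilon>. pressure_at d T Z \<phi> \<epsilon>)"

section \<open>Multifractal sets\<close>

definition accumulation_points :: "(nat \<Rightarrow> 'y::topological_space) \<Rightarrow> 'y set" where
  "accumulation_points s = {l. \<exists>r. strict_mono r \<and> (s \<circ> r) \<longlonglongrightarrow> l}"

text \<open>\<open>Suc n\<close> makes the sequence of empirical measures start at index 1.\<close>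

definition Delta ::
  "('a::topological_space \<Rightarrow> 'a) \<Rightarrow> ('a measure \<Rightarrow> 'y::topological_space) \<Rightarrow> 'y set \<Rightarrow> 'y set \<Rightarrow> 'a set" where
  "Delta T \<Xi> S1 S2 =
     {x. S1 \<subseteq> accumulation_points (\<lambda>n. \<Xi> (empirical T (Suc n) x)) \<and>
         accumulation_points (\<lambda>n. \<Xi> (empirical T (Suc n) x)) \<subseteq> S2}"

text \<open>In \<open>ereal\<close> the supremum of the empty set is \<open>-\<infinity>\<close>, which is the value for
  \<open>y\<close> outside the image of the invariant measures.\<close>

definition Lam ::
  "('a::topological_space \<Rightarrow> 'a) \<Rightarrow> ('a measure \<Rightarrow> 'y) \<Rightarrow> ('a \<Rightarrow> real) \<Rightarrow> 'y \<Rightarrow> ereal" where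
  "Lam T \<Xi> \<phi> y =
     (SUP \<mu> \<in> {\<mu> \<in> invariant_measures T. \<Xi> \<mu> = y}. metric_entropy T \<mu> + ereal (\<integral>x. \<phi> x \<partial>\<mu>))"

end

theory Submission
  imports Defs "HOL-Real_Asymp.Real_Asymp"
begin

text \<open>The averages of \<open>\<Xi>\<close> along an orbit have a compact connected set of accumulation points, each of
  them the image of an invariant limit of empirical measures; this gives (3).
  For the upper bounds, a point whose empirical measures accumulate at \<open>\<mu>\<close> has, at infinitely many
  times \<open>n\<close>, one of about \<open>exp (n h(T, \<mu>))\<close> names for a fine partition with null boundaries, since its
  \<open>k\<close>-block frequencies have nearly the entropy of \<open>\<mu>\<close>; countably many weak* neighbourhoods
  suffice, and covering by the corresponding Bowen balls bounds the pressure.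
  For the lower bounds, take a sequence in \<open>Q\<close> that moves in vanishing steps and accumulates
  everywhere in \<open>Q\<close>, with invariant measures of large free energy above it. Each measure is
  approximated by a convex combination of ergodic ones, and uniform separation together with the
  almost product property glues their separated sets into separated sets for the combination.
  Tracing longer and longer repetitions of these blocks yields a Moran-type family of points with
  accumulation set \<open>Q\<close>, and a product measure on the choices bounds the weight of every cover
  from below.\<close>

section \<open>Sequences and blocks\<close>

text \<open>The lower bound meets infinitely many measures, one per stage, while a Bowen ball can
  tell different choices apart only if its radius is below the separation scale of every stage.
  Hence the quantifier order in \<open>separated_mixture\<close> and \<open>stage_exists\<close>:
  the scale \<epsilon> depends on the entropy loss \<eta> alone, whereas the proportion \<delta> of
  separated times may depend on the measure. Uniform separation supplies this for ergodic measures,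
  and the gluing must preserve it. Along \<open>Q\<close> entropy and integral vary separately and
  only their sum stays above \<open>c\<close>; each stage therefore carries its own entropy
  \<open>h\<close>, which cancels when the mass of a cylinder is compared with the weight of a ball.
  Wherever a real number is needed, entropy is taken with respect to one finite partition, since the
  supremum over partitions may be infinite. Ergodic components are not arranged in a measurable
  family: a generic point \<open>x\<close> carries a chosen measure \<open>\<kappa> x\<close>, and
  almost sure frequencies take the place of integration over components.\<close>

lemma fekete:
  fixes H :: "nat \<Rightarrow> real"
  assumes sub: "\<And>m n. H (m + n) \<le> H m + H n" and nonneg: "\<And>n. 0 \<le> H n"
  shows "\<exists>L. (\<lambda>n. H n / real n) \<longlonglongrightarrow> L \<and> (\<forall>n\<ge>1. L \<le> H n / real n)"
proof -
  define L where "L = (INF n\<in>{1..}. H n / real n)"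
  have bdd: "bdd_below ((\<lambda>n. H n / real n) ` {1..})"
    by (rule bdd_belowI[of _ 0]) (auto simp: nonneg)
  have low: "L \<le> H n / real n" if "n \<ge> 1" for n
    unfolding L_def by (rule cINF_lower[OF bdd]) (use that in auto)
  have mult: "H (q * k + r) \<le> real q * H k + H r" for q k r
  proof (induction q)
    case (Suc q)
    have "H (Suc q * k + r) \<le> H k + H (q * k + r)"
      using sub[of k "q * k + r"] by (simp add: add.assoc)
    with Suc show ?case by (simp add: algebra_simps)
  qed auto
  have "(\<lambda>n. H n / real n) \<longlonglongrightarrow> L"
  proof (rule LIMSEQ_I)
    fix e :: real assume e: "e > 0"
    obtain k where k: "k \<ge> 1" "H k / real k < L + e / 2"
    proof -
      have "\<exists>x\<in>(\<lambda>n. H n / real n) ` {1..}. x < L + e / 2"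
        unfolding L_def by (subst cInf_less_iff[symmetric]) (use e bdd in auto)
      then show ?thesis using that by auto
    qed
    \<comment> \<open>A crude bound for every remainder \<open>H (n mod k)\<close>; divided by
      \<open>n\<close> it vanishes.\<close>
    define C where "C = (\<Sum>r<k. H r)"
    have C: "H r \<le> C" if "r < k" for r
      unfolding C_def by (rule member_le_sum) (use that nonneg in auto)
    obtain N where N: "real N > 2 * C / e" using reals_Archimedean2 by blast
    have "norm (H n / real n - L) < e" if n: "n \<ge> Suc N" for n
    proof -
      have n0: "real n > 0" "n \<ge> 1" using n by auto
      have "H n = H ((n div k) * k + n mod k)" by simp
      also have "\<dots> \<le> real (n div k) * H k + H (n mod k)" by (rule mult)
      also have "\<dots> \<le> real (n div k) * H k + C"
        using C[of "n mod k"] k by auto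
      also have "real (n div k) * H k \<le> (real n / real k) * H k"
        by (rule mult_right_mono) (auto simp: nonneg of_nat_div_le_of_nat)
      finally have "H n / real n \<le> (real n * (H k / real k) + C) / real n"
        using n0 by (intro divide_right_mono) auto
      also have "\<dots> = H k / real k + C / real n"
        using n0 by (simp add: add_divide_distrib)
      also have "C / real n < e / 2"
      proof -
        have "2 * C / e < real n" using N n by simp
        then show ?thesis using e n0 by (simp add: field_simps)
      qed
      finally have "H n / real n < L + e" using k(2) by linarith
      then show ?thesis using low[OF n0(2)] by (simp add: abs_real_def)
    qed
    then show "\<exists>no. \<forall>n\<ge>no. norm (H n / real n - L) < e" by blast
  qed
  with low show ?thesis by blast
qed

text \<open>Replaces subsequences by infinitely many visits, the form used in later estimates.
  Conversely, visits to balls of radius \<open>1 / Suc n\<close> are chosen with increasing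
  indices.\<close>

lemma accumulation_points_iff:
  fixes s :: "nat \<Rightarrow> 'y::metric_space"
  shows "l \<in> accumulation_points s \<longleftrightarrow> (\<forall>e>0. \<forall>N. \<exists>n\<ge>N. dist (s n) l < e)"
proof
  assume "l \<in> accumulation_points s"
  then obtain r where r: "strict_mono r" "(s \<circ> r) \<longlonglongrightarrow> l"
    by (auto simp: accumulation_points_def)
  show "\<forall>e>0. \<forall>N. \<exists>n\<ge>N. dist (s n) l < e"
  proof (intro allI impI)
    fix e :: real and N assume "e > 0"
    with r(2) obtain M where M: "\<And>n. n \<ge> M \<Longrightarrow> dist (s (r n)) l < e"
      by (auto simp: lim_sequentially)
    have "r (max M N) \<ge> N" using seq_suble[OF r(1), of "max M N"] by simp
    with M[of "max M N"] show "\<exists>n\<ge>N. dist (s n) l < e" by auto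
  qed
next
  assume *: "\<forall>e>0. \<forall>N. \<exists>n\<ge>N. dist (s n) l < e"
  have "\<exists>r. \<forall>n. dist (s (r n)) l < 1 / real (Suc n) \<and> r n < r (Suc n)"
  proof (rule dependent_nat_choice)
    show "\<exists>x. dist (s x) l < 1 / real (Suc 0)" using *[rule_format, of 1 0] by auto
    show "\<exists>y. dist (s y) l < 1 / real (Suc (Suc n)) \<and> x < y" for x n
      using *[rule_format, of "1 / real (Suc (Suc n))" "Suc x"] by auto
  qed
  then obtain r where r: "\<And>n. dist (s (r n)) l < 1 / real (Suc n)" "\<And>n. r n < r (Suc n)" by blast
  have "strict_mono r" using r(2) by (simp add: strict_mono_Suc_iff)
  moreover have "(s \<circ> r) \<longlonglongrightarrow> l"
  proof (rule metric_tendsto_imp_tendsto)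
    show "(\<lambda>n. 1 / real (Suc n)) \<longlonglongrightarrow> 0" using LIMSEQ_inverse_real_of_nat
      by (simp add: inverse_eq_divide)
    show "\<forall>\<^sub>F n in sequentially. dist ((s \<circ> r) n) l \<le> dist (1 / real (Suc n)) 0"
      using r(1) by (intro always_eventually) (auto simp: less_imp_le)
  qed
  ultimately show "l \<in> accumulation_points s" by (auto simp: accumulation_points_def)
qed

text \<open>When block \<open>n\<close> occupies the next \<open>l n\<close> times, this is the
  number of the block that contains time \<open>k\<close>. It inverts the partial sums and is used
  on two levels: times within blocks, and blocks within stages.\<close>

definition block_index :: "(nat \<Rightarrow> nat) \<Rightarrow> nat \<Rightarrow> nat" where
  "block_index l k = (LEAST n. k < sum l {..<Suc n})"

context
  fixes l :: "nat \<Rightarrow> nat"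
  assumes pos: "\<And>n. 1 \<le> l n"
begin

lemma block_sum_ge: "n \<le> sum l {..<n}"
proof (induction n)
  case (Suc n) then show ?case using pos[of n] by simp
qed simp

lemma block_sum_mono: "m \<le> n \<Longrightarrow> sum l {..<m} \<le> sum l {..<n}"
  by (rule sum_mono2) auto

lemma block_index_upper: "k < sum l {..<Suc (block_index l k)}"
proof -
  have "\<exists>n. k < sum l {..<Suc n}" using block_sum_ge[of "Suc k"] by (intro exI[of _ k]) simp
  then show ?thesis unfolding block_index_def by (rule LeastI_ex)
qed

lemma block_index_lower: "sum l {..<block_index l k} \<le> k"
proof (cases "block_index l k")
  case (Suc m)
  then have "\<not> k < sum l {..<Suc m}" unfolding block_index_def by (intro not_less_Least) auto
  then show ?thesis using Suc by simp
qed simp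

lemma block_index_unique:
  assumes "sum l {..<n} \<le> k" "k < sum l {..<Suc n}"
  shows "block_index l k = n"
proof -
  let ?b = "block_index l k"
  have "\<not> n < ?b"
    using block_sum_mono[of "Suc n" ?b] block_index_lower[of k] assms by auto
  moreover have "\<not> ?b < n"
    using block_sum_mono[of "Suc ?b" n] block_index_upper[of k] assms by auto
  ultimately show ?thesis by simp
qed

lemma block_index_ge: "sum l {..<n} \<le> k \<Longrightarrow> n \<le> block_index l k"
  by (rule ccontr) (use block_sum_mono[of "Suc (block_index l k)" n] block_index_upper[of k] in auto)

lemma block_index_le: "k < sum l {..<Suc n} \<Longrightarrow> block_index l k \<le> n"
  unfolding block_index_def by (rule Least_le)

lemma block_index_at_top: "filterlim (block_index l) at_top sequentially"
  unfolding filterlim_at_top eventually_sequentially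
proof
  show "\<exists>N. \<forall>n\<ge>N. Z \<le> block_index l n" for Z
    by (rule exI[of _ "sum l {..<Z}"]) (auto intro: block_index_ge)
qed

lemma block_index_start: "block_index l (sum l {..<n}) = n"
  by (rule block_index_unique) (use pos[of n] in auto)

lemma block_index_Suc:
  "block_index l (Suc k) = block_index l k \<and> Suc k < sum l {..<Suc (block_index l k)} \<or>
   block_index l (Suc k) = Suc (block_index l k) \<and> Suc k = sum l {..<Suc (block_index l k)}"
proof (cases "Suc k < sum l {..<Suc (block_index l k)}")
  case True
  then have "block_index l (Suc k) = block_index l k"
    using block_index_lower[of k] by (intro block_index_unique) auto
  with True show ?thesis by blast
next
  case False
  then have "Suc k = sum l {..<Suc (block_index l k)}" using block_index_upper[of k] by linarith
  moreover from this have "block_index l (Suc k) = Suc (block_index l k)"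
    using block_index_start by metis
  ultimately show ?thesis by blast
qed

end

text \<open>Being joined by a chain in \<open>Q\<close> with steps below \<open>e\<close> is an
  equivalence relation with relatively open classes, since a point is joined to everything in its
  \<open>e\<close>-ball; connectedness leaves one class.\<close>

lemma connected_epsilon_chain:
  fixes Q :: "'y::metric_space set"
  assumes Q: "connected Q" "a \<in> Q" "b \<in> Q" and e: "e > 0"
  shows "\<exists>xs. xs \<noteq> [] \<and> hd xs = a \<and> last xs = b \<and> set xs \<subseteq> Q \<and> successively (\<lambda>x y. dist x y < e) xs"
proof -
  let ?R = "\<lambda>a b. \<exists>xs. xs \<noteq> [] \<and> hd xs = a \<and> last xs = b \<and> set xs \<subseteq> Q
      \<and> successively (\<lambda>x y. dist x y < e) xs"
  show "?R a b"
  proof (rule connected_equivalence_relation[OF Q, of ?R])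
    fix x y assume "?R x y"
    then obtain xs where xs: "xs \<noteq> []" "hd xs = x" "last xs = y" "set xs \<subseteq> Q"
      "successively (\<lambda>x y. dist x y < e) xs" by blast
    then show "?R y x"
      by (intro exI[of _ "rev xs"]) (auto simp: hd_rev last_rev dist_commute)
  next
    fix x y z assume "?R x y" "?R y z"
    then obtain xs ys where xs: "xs \<noteq> []" "hd xs = x" "last xs = y" "set xs \<subseteq> Q"
      "successively (\<lambda>x y. dist x y < e) xs"
      and ys: "ys \<noteq> []" "hd ys = y" "last ys = z" "set ys \<subseteq> Q"
      "successively (\<lambda>x y. dist x y < e) ys" by blast
    then show "?R x z" using e
      by (intro exI[of _ "xs @ ys"]) (auto simp: successively_append_iff)
  next
    fix x assume x: "x \<in> Q"
    show "\<exists>T. openin (top_of_set Q) T \<and> x \<in> T \<and> (\<forall>y\<in>T. ?R x y)"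
    proof (rule exI[of _ "Q \<inter> ball x e"], intro conjI ballI)
      show "openin (top_of_set Q) (Q \<inter> ball x e)" by (intro openin_open_Int) auto
      show "x \<in> Q \<inter> ball x e" using x e by auto
      fix y assume "y \<in> Q \<inter> ball x e"
      then show "?R x y" using x by (intro exI[of _ "[x, y]"]) (auto simp: dist_commute)
    qed
  qed
qed

text \<open>A closed tour rather than a path: tours for different \<open>e\<close> all start and end
  at \<open>a\<close> and can be strung together without a jump.\<close>

lemma connected_epsilon_loop:
  fixes Q :: "'y::metric_space set"
  assumes Q: "connected Q" "a \<in> Q" and e: "e > 0" and F: "finite F" "F \<subseteq> Q"
  shows "\<exists>xs. xs \<noteq> [] \<and> hd xs = a \<and> last xs = a \<and> F \<subseteq> set xs \<and> set xs \<subseteq> Q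
    \<and> successively (\<lambda>x y. dist x y < e) xs"
  using F
proof (induction F rule: finite_induct)
  case empty
  show ?case using Q by (intro exI[of _ "[a]"]) auto
next
  case (insert p F)
  then obtain xs where xs: "xs \<noteq> []" "hd xs = a" "last xs = a" "F \<subseteq> set xs" "set xs \<subseteq> Q"
    "successively (\<lambda>x y. dist x y < e) xs" by auto
  have p: "p \<in> Q" using insert by auto
  obtain ys where ys: "ys \<noteq> []" "hd ys = a" "last ys = p" "set ys \<subseteq> Q"
    "successively (\<lambda>x y. dist x y < e) ys" using connected_epsilon_chain[OF Q p e] by blast
  obtain zs where zs: "zs \<noteq> []" "hd zs = p" "last zs = a" "set zs \<subseteq> Q"
    "successively (\<lambda>x y. dist x y < e) zs" using connected_epsilon_chain[OF Q(1) p Q(2) e] by blast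
  have "p \<in> set ys" using ys by (metis last_in_set)
  then show ?case using xs ys zs e
    by (intro exI[of _ "xs @ ys @ zs"]) (auto simp: successively_append_iff)
qed

text \<open>Tours with steps below \<open>1 / Suc n\<close> through nets of the same fineness are
  listed one after another. At a junction both points equal \<open>a\<close>, so the steps tend to
  0, and each tour again comes close to every point of \<open>Q\<close>.\<close>

lemma slow_dense_sequence:
  fixes Q :: "'y::metric_space set"
  assumes "compact Q" "connected Q" "Q \<noteq> {}"
  shows "\<exists>y. (\<forall>k. y k \<in> Q) \<and> (\<lambda>k. dist (y k) (y (Suc k))) \<longlonglongrightarrow> 0
     \<and> (\<forall>q\<in>Q. \<forall>e>0. \<forall>N. \<exists>k\<ge>N. dist (y k) q < e)"
proof -
  obtain a where a: "a \<in> Q" using assms by auto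
  define e where "e n = 1 / real (Suc n)" for n
  have e: "e n > 0" for n by (simp add: e_def)
  have "\<exists>xs. xs \<noteq> [] \<and> hd xs = a \<and> last xs = a \<and> (\<forall>q\<in>Q. \<exists>x\<in>set xs. dist x q < e n)
     \<and> set xs \<subseteq> Q \<and> successively (\<lambda>x y. dist x y < e n) xs" for n
  proof -
    obtain F where F: "finite F" "F \<subseteq> Q" "Q \<subseteq> (\<Union>x\<in>F. ball x (e n))"
      using seq_compact_imp_totally_bounded[of Q] assms(1) e by (metis compact_imp_seq_compact)
    obtain xs where "xs \<noteq> []" "hd xs = a" "last xs = a" "F \<subseteq> set xs" "set xs \<subseteq> Q"
      "successively (\<lambda>x y. dist x y < e n) xs"
      using connected_epsilon_loop[OF assms(2) a e F(1,2)] by blast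
    moreover from F(3) this(4) have "\<forall>q\<in>Q. \<exists>x\<in>set xs. dist x q < e n" by (fastforce simp: )
    ultimately show ?thesis by blast
  qed
  then obtain L where L: "\<And>n. L n \<noteq> []" "\<And>n. hd (L n) = a" "\<And>n. last (L n) = a"
    "\<And>n q. q \<in> Q \<Longrightarrow> \<exists>x\<in>set (L n). dist x q < e n"
    "\<And>n. set (L n) \<subseteq> Q" "\<And>n. successively (\<lambda>x y. dist x y < e n) (L n)"
    by metis
  define l where "l n = length (L n)" for n
  have l: "1 \<le> l n" for n using L(1)[of n] by (cases "L n") (auto simp: l_def)
  let ?b = "block_index l"
  define y where "y k = L (?b k) ! (k - sum l {..<?b k})" for k
  have idx: "k - sum l {..<?b k} < l (?b k)" for k
    using block_index_lower[of l k, OF l] block_index_upper[of l k, OF l] by auto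
  have yQ: "y k \<in> Q" for k
    unfolding y_def using L(5)[of "?b k"] idx[of k] by (auto simp: l_def intro!: nth_mem)
  have step: "dist (y k) (y (Suc k)) < e (?b k)" for k
    using block_index_Suc[of l k, OF l]
  proof (elim disjE conjE)
    assume h: "?b (Suc k) = ?b k" "Suc k < sum l {..<Suc (?b k)}"
    have "Suc (k - sum l {..<?b k}) < length (L (?b k))"
      using h block_index_lower[of l k, OF l] by (auto simp: l_def)
    from successively_nth[OF L(6) this] show ?thesis
      using block_index_lower[of l k, OF l] by (simp add: y_def h Suc_diff_le)
  next
    assume h: "?b (Suc k) = Suc (?b k)" "Suc k = sum l {..<Suc (?b k)}"
    have "k - sum l {..<?b k} = l (?b k) - 1" using h(2) by simp
    then have "y k = last (L (?b k))" using L(1) by (simp add: y_def l_def last_conv_nth)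
    moreover have "y (Suc k) = hd (L (Suc (?b k)))"
    proof -
      have "Suc k - sum l {..<?b (Suc k)} = 0" using h by (simp only: diff_self_eq_0)
      then have "y (Suc k) = L (?b (Suc k)) ! 0" by (simp only: y_def)
      then show ?thesis using L(1) by (simp add: h(1) hd_conv_nth)
    qed
    ultimately show ?thesis using L(2,3) e by simp
  qed
  have "(\<lambda>k. dist (y k) (y (Suc k))) \<longlonglongrightarrow> 0"
  proof (rule Lim_null_comparison)
    have "e \<longlonglongrightarrow> 0" unfolding e_def using LIMSEQ_inverse_real_of_nat by (simp add: inverse_eq_divide)
    from filterlim_compose[OF this block_index_at_top[of l, OF l]]
    show "(\<lambda>k. e (?b k)) \<longlonglongrightarrow> 0" .
    show "\<forall>\<^sub>F k in sequentially. norm (dist (y k) (y (Suc k))) \<le> e (?b k)"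
      using step by (intro always_eventually) (auto simp: less_imp_le)
  qed
  moreover have "\<exists>k\<ge>N. dist (y k) q < r" if q: "q \<in> Q" "r > 0" for q r N
  proof -
    obtain M where M: "e n < r" if "n \<ge> M" for n
    proof -
      have "e \<longlonglongrightarrow> 0" unfolding e_def using LIMSEQ_inverse_real_of_nat by (simp add: inverse_eq_divide)
      from order_tendstoD(2)[OF this q(2)] show ?thesis using that by (auto simp: eventually_sequentially)
    qed
    define n where "n = max M N"
    obtain i where i: "i < l n" "dist (L n ! i) q < e n"
      using L(4)[OF q(1), of n] by (auto simp: in_set_conv_nth l_def)
    define k where "k = sum l {..<n} + i"
    have "?b k = n" unfolding k_def by (rule block_index_unique[of l, OF l]) (use i in auto)
    then have "dist (y k) q < e n" using i by (simp add: y_def k_def)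
    moreover have "k \<ge> N" using block_sum_ge[of l n, OF l] by (simp add: k_def n_def)
    moreover have "e n < r" using M[of n] by (simp add: n_def)
    ultimately show ?thesis by (intro exI[of _ k]) auto
  qed
  ultimately show ?thesis using yQ by blast
qed

section \<open>Counting words of low entropy\<close>

definition shannon :: "'b set \<Rightarrow> ('b \<Rightarrow> real) \<Rightarrow> real" where
  "shannon A p = (\<Sum>a\<in>A. - (p a * ln (p a)))"

text \<open>Nonnegativity of relative entropy, from \<open>ln x \<le> x - 1\<close>. It acts as a
  coding inequality: any admissible weights \<open>q\<close> bound the entropy of \<open>p\<close>
  by the mean of \<open>- ln q\<close>.\<close>

lemma gibbs:
  assumes A: "finite A" and p: "\<And>a. a \<in> A \<Longrightarrow> 0 \<le> p a" and q: "\<And>a. a \<in> A \<Longrightarrow> 0 \<le> q a"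
    and ps: "sum p A = 1" and qs: "sum q A \<le> 1"
    and pq: "\<And>a. a \<in> A \<Longrightarrow> 0 < p a \<Longrightarrow> 0 < q a"
  shows "shannon A p \<le> (\<Sum>a\<in>A. - (p a * ln (q a)))"
proof -
  have "p a * ln (q a) - p a * ln (p a) \<le> q a - p a" if a: "a \<in> A" for a
  proof (cases "p a = 0")
    case False
    then have pa: "p a > 0" using p[OF a] by simp
    then have qa: "q a > 0" using pq[OF a] by simp
    have "ln (q a) - ln (p a) = ln (q a / p a)" using pa qa by (simp add: ln_div)
    also have "\<dots> \<le> q a / p a - 1" using pa qa by (intro ln_le_minus_one) simp
    finally have "p a * (ln (q a) - ln (p a)) \<le> p a * (q a / p a - 1)"
      using pa by (intro mult_left_mono) auto
    also have "\<dots> = q a - p a" using pa by (simp add: field_simps)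
    finally show ?thesis by (simp add: algebra_simps)
  qed (use q[OF a] in simp)
  then have "(\<Sum>a\<in>A. p a * ln (q a) - p a * ln (p a)) \<le> (\<Sum>a\<in>A. q a - p a)" by (rule sum_mono)
  then show ?thesis using ps qs by (simp add: shannon_def sum_subtractf sum_negf)
qed

lemma shannon_nonneg:
  assumes "\<And>a. a \<in> A \<Longrightarrow> 0 \<le> p a \<and> p a \<le> 1"
  shows "0 \<le> shannon A p"
  unfolding shannon_def
proof (rule sum_nonneg)
  fix a assume "a \<in> A"
  then have "0 \<le> p a" "ln (p a) \<le> 0"
    using assms[of a] by (auto simp: ln_le_zero_iff) (metis ln_0 ln_le_zero_iff order_le_less)+
  then show "0 \<le> - (p a * ln (p a))" by (simp add: mult_nonneg_nonpos)
qed

text \<open>Gibbs' inequality against the product of the two marginals; the logarithm of the product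
  splits wherever \<open>r\<close> is positive.\<close>

lemma shannon_subadditive:
  assumes A: "finite A" and B: "finite B" and r: "\<And>a b. a \<in> A \<Longrightarrow> b \<in> B \<Longrightarrow> 0 \<le> r (a, b)"
    and rs: "sum r (A \<times> B) = 1"
    and p: "\<And>a. a \<in> A \<Longrightarrow> p a = (\<Sum>b\<in>B. r (a, b))" and q: "\<And>b. b \<in> B \<Longrightarrow> q b = (\<Sum>a\<in>A. r (a, b))"
  shows "shannon (A \<times> B) r \<le> shannon A p + shannon B q"
proof -
  have p0: "0 \<le> p a" if "a \<in> A" for a using that by (simp add: p sum_nonneg r)
  have q0: "0 \<le> q b" if "b \<in> B" for b using that by (simp add: q sum_nonneg r)
  have ps: "sum p A = 1" using rs by (simp add: p sum.cartesian_product)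
  have qs: "sum q B = 1"
  proof -
    have "sum q B = (\<Sum>a\<in>A. \<Sum>b\<in>B. r (a, b))" by (simp add: q, rule sum.swap)
    then show ?thesis using rs by (simp add: sum.cartesian_product)
  qed
  have pos: "p a > 0 \<and> q b > 0" if ab: "a \<in> A" "b \<in> B" and "r (a, b) > 0" for a b
  proof
    have "r (a, b) \<le> p a" unfolding p[OF ab(1)] by (rule member_le_sum) (use ab B r in auto)
    then show "p a > 0" using that by linarith
    have "r (a, b) \<le> q b" unfolding q[OF ab(2)]
      by (rule member_le_sum[of a A "\<lambda>a. r (a, b)"]) (use ab A r in auto)
    then show "q b > 0" using that by linarith
  qed
  have "shannon (A \<times> B) r \<le> (\<Sum>x\<in>A \<times> B. - (r x * ln (p (fst x) * q (snd x))))"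
  proof (rule gibbs)
    have "(\<Sum>x\<in>A \<times> B. p (fst x) * q (snd x)) = sum p A * sum q B"
      by (simp add: sum_product sum.cartesian_product case_prod_unfold)
    then show "(\<Sum>x\<in>A \<times> B. p (fst x) * q (snd x)) \<le> 1" using ps qs by simp
  qed (use A B r rs p0 q0 pos in auto)
  also have "\<dots> = (\<Sum>x\<in>A \<times> B. - (r x * ln (p (fst x))) - r x * ln (q (snd x)))"
  proof (rule sum.cong[OF refl])
    fix x assume x: "x \<in> A \<times> B"
    show "- (r x * ln (p (fst x) * q (snd x))) = - (r x * ln (p (fst x))) - r x * ln (q (snd x))"
    proof (cases "r x = 0")
      case False
      then have "p (fst x) > 0" "q (snd x) > 0" using pos[of "fst x" "snd x"] r[of "fst x" "snd x"] x by auto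
      then show ?thesis by (simp add: ln_mult algebra_simps)
    qed simp
  qed
  also have "\<dots> = (\<Sum>a\<in>A. \<Sum>b\<in>B. - (r (a, b) * ln (p a))) - (\<Sum>a\<in>A. \<Sum>b\<in>B. r (a, b) * ln (q b))"
    by (simp add: sum_subtractf sum.cartesian_product case_prod_unfold)
  also have "(\<Sum>a\<in>A. \<Sum>b\<in>B. - (r (a, b) * ln (p a))) = shannon A p"
    by (simp add: shannon_def p sum_distrib_right sum_negf)
  also have "(\<Sum>a\<in>A. \<Sum>b\<in>B. r (a, b) * ln (q b)) = - shannon B q"
    by (subst sum.swap) (simp add: shannon_def q sum_distrib_right sum_negf)
  finally show ?thesis by simp
qed

section \<open>Words, block products and window frequencies\<close>

definition words :: "'b set \<Rightarrow> nat \<Rightarrow> 'b list set" where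
  "words S n = {w. set w \<subseteq> S \<and> length w = n}"

lemma finite_words: "finite S \<Longrightarrow> finite (words S n)"
  unfolding words_def by (rule finite_lists_length_eq)

lemma card_words: "finite S \<Longrightarrow> card (words S n) = card S ^ n"
  unfolding words_def by (rule card_lists_length_eq)

lemma sum_words_append:
  "(\<Sum>w\<in>words S (m + n). F w) = (\<Sum>u\<in>words S m. \<Sum>v\<in>words S n. F (u @ v))"
proof -
  have "(\<Sum>u\<in>words S m. \<Sum>v\<in>words S n. F (u @ v)) = (\<Sum>x\<in>words S m \<times> words S n. F (fst x @ snd x))"
    by (simp add: sum.cartesian_product case_prod_unfold)
  also have "\<dots> = (\<Sum>w\<in>words S (m + n). F w)"
    by (rule sum.reindex_bij_witness[of _ "\<lambda>w. (take m w, drop m w)" "\<lambda>x. fst x @ snd x"])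
      (auto simp: words_def dest: in_set_takeD in_set_dropD)
  finally show ?thesis ..
qed

text \<open>Each complete block sums out to 1, so only the letters outside the blocks remain, each
  free to take \<open>card S\<close> values.\<close>

lemma sum_block_products_aligned:
  fixes q :: "'b list \<Rightarrow> real"
  assumes S: "finite S" and q: "\<And>w. 0 \<le> q w" and qs: "(\<Sum>w\<in>words S k. q w) = 1"
  shows "m * k \<le> N \<Longrightarrow>
    (\<Sum>w\<in>words S N. \<Prod>j<m. q (take k (drop (j * k) w))) = real (card S) ^ (N - m * k)"
proof (induction m arbitrary: N)
  case 0 then show ?case using S by (simp add: card_words)
next
  case (Suc m)
  then obtain N' where N: "N = k + N'" "m * k \<le> N'" by (metis add_le_cancel_left le_Suc_ex mult_Suc le_add1 order_trans)
  have "(\<Sum>w\<in>words S N. \<Prod>j<Suc m. q (take k (drop (j * k) w)))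
      = (\<Sum>a\<in>words S k. \<Sum>v\<in>words S N'. q a * (\<Prod>j<m. q (take k (drop (j * k) v))))"
    unfolding N sum_words_append
    by (intro sum.cong refl) (auto simp: words_def prod.lessThan_Suc_shift simp del: prod.lessThan_Suc)
  also have "\<dots> = (\<Sum>a\<in>words S k. q a) * (\<Sum>v\<in>words S N'. \<Prod>j<m. q (take k (drop (j * k) v)))"
    by (simp add: sum_product)
  also have "\<dots> = real (card S) ^ (N' - m * k)" using Suc.IH[OF N(2)] qs by simp
  finally show ?case using N by simp
qed

lemma sum_block_products:
  fixes q :: "'b list \<Rightarrow> real"
  assumes S: "finite S" and q: "\<And>w. 0 \<le> q w" and qs: "(\<Sum>w\<in>words S k. q w) = 1"
    and le: "s + m * k \<le> N"
  shows "(\<Sum>w\<in>words S N. \<Prod>j<m. q (take k (drop (s + j * k) w))) = real (card S) ^ (N - m * k)"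
proof -
  obtain N' where N: "N = s + N'" "m * k \<le> N'" using le by (metis add_le_cancel_left le_Suc_ex le_add1 order_trans)
  have "(\<Sum>w\<in>words S N. \<Prod>j<m. q (take k (drop (s + j * k) w)))
      = (\<Sum>u\<in>words S s. \<Sum>v\<in>words S N'. \<Prod>j<m. q (take k (drop (j * k) v)))"
    unfolding N sum_words_append by (intro sum.cong refl) (auto simp: words_def)
  also have "\<dots> = real (card S) ^ s * real (card S) ^ (N' - m * k)"
    using sum_block_products_aligned[OF S q qs N(2)] S by (simp add: card_words)
  also have "\<dots> = real (card S) ^ (N - m * k)" using N by (simp add: power_add[symmetric])
  finally show ?thesis .
qed

text \<open>Overlapping windows are counted at the \<open>n\<close> starting points
  \<open>0, ..., n - 1\<close>; a word therefore needs length \<open>n + k - 1\<close>, and the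
  frequencies then sum to exactly 1.\<close>

definition window_freq :: "nat \<Rightarrow> nat \<Rightarrow> 'b list \<Rightarrow> 'b list \<Rightarrow> real" where
  "window_freq k n w a = real (card {i. i < n \<and> take k (drop i w) = a}) / real n"

lemma take_drop_words: "w \<in> words S (n + k - 1) \<Longrightarrow> i < n \<Longrightarrow> take k (drop i w) \<in> words S k"
  by (auto simp: words_def dest!: in_set_takeD in_set_dropD)

lemma sum_window_freq:
  assumes S: "finite S" and w: "w \<in> words S (n + k - 1)" and n: "n \<ge> 1"
  shows "(\<Sum>a\<in>words S k. window_freq k n w a * g a) = (\<Sum>i<n. g (take k (drop i w))) / real n"
proof -
  have "(\<Sum>i<n. g (take k (drop i w))) = (\<Sum>a\<in>words S k. \<Sum>i\<in>{i\<in>{..<n}. take k (drop i w) = a}. g (take k (drop i w)))"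
    by (rule sum.group[symmetric]) (use S w finite_words take_drop_words in auto)
  also have "\<dots> = (\<Sum>a\<in>words S k. real (card {i. i < n \<and> take k (drop i w) = a}) * g a)"
    by (intro sum.cong refl) simp
  finally show ?thesis by (simp add: window_freq_def sum_divide_distrib)
qed

text \<open>The windows starting at \<open>s, s + k, s + 2 k, ...\<close> are disjoint, and the mean
  over the \<open>k\<close> offsets \<open>s\<close> of their total cost \<open>- ln q\<close> is at
  most \<open>h\<close>. Hence some offset makes the product of the \<open>q\<close>-weights at
  least \<open>exp (- h)\<close>. For one offset these products sum over all words to a power of
  \<open>card S\<close>, which limits how many words can reach that value.\<close>

lemma card_type_class:
  fixes q :: "'b list \<Rightarrow> real"
  assumes S: "finite S" "S \<noteq> {}" and k: "k \<ge> 1" and n: "n \<ge> 1"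
    and W: "\<And>w a. w \<in> W \<Longrightarrow> a \<in> words S k \<Longrightarrow> window_freq k n w a = q a"
      "W \<subseteq> words S (n + k - 1)"
  shows "real (card W) \<le> real k * real (card S) ^ (2 * k) * exp (real n * shannon (words S k) q / real k)"
proof (cases "W = {}")
  case False
  then obtain w0 where w0: "w0 \<in> W" by auto
  define h where "h = real n * shannon (words S k) q / real k"
  define m where "m = n div k"
  have mk: "m * k \<le> n" by (simp add: m_def)
  have cS: "real (card S) \<ge> 1" using S by (simp add: Suc_leI card_gt_0_iff)
  \<comment> \<open>\<open>q\<close> is controlled only on words of length \<open>k\<close>; the
    extension by 0 is nonnegative everywhere, as the product formula requires.\<close>
  define q' where "q' a = (if a \<in> words S k then q a else 0)" for a
  have q0: "0 \<le> q' a" for a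
  proof -
    have "0 \<le> window_freq k n w0 a" by (simp add: window_freq_def)
    then show ?thesis using W(1)[OF w0, of a] by (auto simp: q'_def)
  qed
  have qs: "sum q' (words S k) = 1"
    using sum_window_freq[OF S(1), of w0 n k "\<lambda>_. 1"] W w0 n by (auto simp: q'_def)
  have q1: "q' a \<le> 1" for a
  proof (cases "a \<in> words S k")
    case True
    then have "q' a \<le> sum q' (words S k)" by (intro member_le_sum) (use q0 finite_words S in auto)
    then show ?thesis using qs by simp
  qed (simp add: q'_def)
  define V where "V s = {w \<in> words S (n + k - 1). exp (- h) \<le> (\<Prod>j<m. q' (take k (drop (s + j * k) w)))}" for s
  have cV: "real (card (V s)) \<le> real (card S) ^ (2 * k) * exp h" if s: "s < k" for s
  proof -
    have le: "s + m * k \<le> n + k - 1" using s mk by linarith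
    have fin: "finite (words S (n + k - 1))" using S finite_words by blast
    have "real (card (V s)) * exp (- h) \<le> (\<Sum>w\<in>V s. \<Prod>j<m. q' (take k (drop (s + j * k) w)))"
      using sum_mono[of "V s" "\<lambda>_. exp (- h)" "\<lambda>w. \<Prod>j<m. q' (take k (drop (s + j * k) w))"]
      by (auto simp: V_def)
    also have "\<dots> \<le> (\<Sum>w\<in>words S (n + k - 1). \<Prod>j<m. q' (take k (drop (s + j * k) w)))"
      by (rule sum_mono2) (use fin q0 in \<open>auto simp: V_def intro!: prod_nonneg\<close>)
    also have "\<dots> = real (card S) ^ (n + k - 1 - m * k)"
      by (rule sum_block_products[OF S(1) q0 qs le])
    \<comment> \<open>Outside the \<open>m\<close> blocks lie the \<open>n mod k\<close> letters
      left by the division and \<open>k - 1\<close> further letters reached by the last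
      window.\<close>
    also have "\<dots> \<le> real (card S) ^ (2 * k)"
    proof (rule power_increasing)
      have "n = m * k + n mod k" "n mod k < k" using k by (auto simp: m_def)
      then show "n + k - 1 - m * k \<le> 2 * k" by linarith
    qed (use cS in auto)
    finally show ?thesis by (simp add: exp_minus field_simps)
  qed
  have "W \<subseteq> (\<Union>s<k. V s)"
  proof
    fix w assume w: "w \<in> W"
    then have wS: "w \<in> words S (n + k - 1)" using W by auto
    let ?g = "\<lambda>i. - ln (q' (take k (drop i w)))"
    have pos: "q' (take k (drop i w)) > 0" if "i < n" for i
    proof -
      have "take k (drop i w) \<in> words S k" using take_drop_words[OF wS that] .
      moreover have "{i'. i' < n \<and> take k (drop i' w) = take k (drop i w)} \<noteq> {}" using that by auto
      then have "card {i'. i' < n \<and> take k (drop i' w) = take k (drop i w)} > 0"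
        by (subst card_gt_0_iff) auto
      then have "window_freq k n w (take k (drop i w)) > 0"
        using n by (simp add: window_freq_def)
      ultimately show ?thesis using W(1)[OF w] by (simp add: q'_def)
    qed
    have g0: "?g i \<ge> 0" if "i < n" for i using pos[OF that] q1 by simp
    have "(\<Sum>i<n. ?g i) = real n * shannon (words S k) q"
    proof -
      have "(\<Sum>a\<in>words S k. window_freq k n w a * - ln (q' a)) = shannon (words S k) q"
        unfolding shannon_def by (intro sum.cong refl) (use W(1)[OF w] in \<open>auto simp: q'_def\<close>)
      then show ?thesis
        using sum_window_freq[OF S(1) wS n, of "\<lambda>a. - ln (q' a)"] n by (simp add: field_simps)
    qed
    then have tot: "(\<Sum>i<n. ?g i) = real k * h" using k by (simp add: h_def)
    \<comment> \<open>Offset \<open>s < k\<close> and block \<open>j < m\<close> together run once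
      through the times below \<open>m * k\<close>.\<close>
    have "(\<Sum>s<k. \<Sum>j<m. ?g (s + j * k)) = (\<Sum>j<m. \<Sum>s<k. ?g (s + j * k))" by (rule sum.swap)
    also have "\<dots> = (\<Sum>j<m. sum ?g {j * k..<j * k + k})"
    proof (rule sum.cong[OF refl])
      fix j
      show "(\<Sum>s<k. ?g (s + j * k)) = sum ?g {j * k..<j * k + k}"
        using sum.shift_bounds_nat_ivl[of ?g 0 "j * k" k] by (simp add: atLeast0LessThan add.commute)
    qed
    also have "\<dots> = (\<Sum>i<m * k. ?g i)" by (rule sum.nat_group)
    also have "\<dots> \<le> (\<Sum>i<n. ?g i)" by (rule sum_mono2) (use mk g0 in auto)
    finally have le: "(\<Sum>s<k. \<Sum>j<m. ?g (s + j * k)) \<le> (\<Sum>s<k. h)" using tot by simp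
    have "\<exists>s<k. (\<Sum>j<m. ?g (s + j * k)) \<le> h"
    proof (rule ccontr)
      assume "\<not> ?thesis"
      then have "(\<Sum>s<k. h) < (\<Sum>s<k. \<Sum>j<m. ?g (s + j * k))"
        by (intro sum_strict_mono) (use k in \<open>auto simp: not_le lessThan_empty_iff\<close>)
      with le show False by simp
    qed
    then obtain s where s: "s < k" "(\<Sum>j<m. ?g (s + j * k)) \<le> h" by blast
    have lt: "s + j * k < n" if "j < m" for j
    proof -
      have "s + j * k < Suc j * k" using s by simp
      also have "\<dots> \<le> m * k" using that by (intro mult_le_mono1) simp
      finally show ?thesis using mk by simp
    qed
    have "(\<Prod>j<m. q' (take k (drop (s + j * k) w))) = exp (\<Sum>j<m. - ?g (s + j * k))"
      unfolding exp_sum[OF finite_lessThan] using pos lt by (intro prod.cong refl) auto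
    also have "\<dots> \<ge> exp (- h)" using s by (simp add: sum_negf)
    finally show "w \<in> (\<Union>s<k. V s)" using s wS by (auto simp: V_def)
  qed
  then have "real (card W) \<le> real (card (\<Union>s<k. V s))"
  proof (intro of_nat_mono card_mono finite_UN_I)
    show "finite (V s)" for s using finite_words[OF S(1)] by (auto simp: V_def)
  qed auto
  also have "\<dots> \<le> real (\<Sum>s<k. card (V s))" by (intro of_nat_mono card_UN_le) auto
  also have "\<dots> \<le> (\<Sum>s<k. real (card S) ^ (2 * k) * exp h)"
    unfolding of_nat_sum by (rule sum_mono) (use cV in auto)
  finally show ?thesis by (simp add: h_def mult.assoc)
qed simp

text \<open>Method of types: there are at most \<open>(n + 1) ^ (card S ^ k)\<close> vectors of
  window counts, and each class of words with equal counts is bounded by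
  \<open>card_type_class\<close>.\<close>

lemma card_low_entropy_words_aux:
  fixes S :: "'b set"
  assumes S: "finite S" "S \<noteq> {}" and k: "k \<ge> 1" and n: "n \<ge> 1"
  shows "real (card {w \<in> words S (n + k - 1). shannon (words S k) (window_freq k n w) \<le> real k * c})
    \<le> real (n + 1) ^ (card S ^ k) * (real k * real (card S) ^ (2 * k)) * exp (real n * c)"
proof -
  let ?W = "{w \<in> words S (n + k - 1). shannon (words S k) (window_freq k n w) \<le> real k * c}"
  define \<tau> where "\<tau> w = (\<lambda>a\<in>words S k. card {i. i < n \<and> take k (drop i w) = a})" for w :: "'b list"
  have fin: "finite ?W" using finite_words[OF S(1)] by auto
  have "\<tau> ` ?W \<subseteq> PiE (words S k) (\<lambda>_. {0..n})"
  proof (rule image_subsetI)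
    fix w :: "'b list"
    have le: "card {i. i < n \<and> take k (drop i w) = a} \<le> n" for a
      using card_mono[of "{..<n}" "{i. i < n \<and> take k (drop i w) = a}"] by auto
    show "\<tau> w \<in> PiE (words S k) (\<lambda>_. {0..n})" using le unfolding \<tau>_def by (intro restrict_PiE_iff[THEN iffD2]) simp
  qed
  then have "card (\<tau> ` ?W) \<le> card (PiE (words S k) (\<lambda>_. {0..n}))"
    by (intro card_mono finite_PiE) (use finite_words[OF S(1)] in auto)
  also have "\<dots> = (n + 1) ^ (card S ^ k)" using S finite_words by (subst card_PiE) (auto simp: card_words)
  finally have types: "card (\<tau> ` ?W) \<le> (n + 1) ^ (card S ^ k)" .
  let ?C = "real k * real (card S) ^ (2 * k) * exp (real n * c)"
  have cls: "real (card {w \<in> ?W. \<tau> w = t}) \<le> ?C" if "t \<in> \<tau> ` ?W" for t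
  proof -
    obtain w0 where w0: "w0 \<in> ?W" "t = \<tau> w0" using \<open>t \<in> \<tau> ` ?W\<close> by (elim imageE)
    have "real (card {w \<in> ?W. \<tau> w = t})
      \<le> real k * real (card S) ^ (2 * k) * exp (real n * shannon (words S k) (window_freq k n w0) / real k)"
    proof (rule card_type_class[OF S k n])
      fix w a assume "w \<in> {w \<in> ?W. \<tau> w = t}" and a: "a \<in> words S k"
      then have "\<tau> w a = \<tau> w0 a" using w0 by auto
      then show "window_freq k n w a = window_freq k n w0 a" using a by (simp add: \<tau>_def window_freq_def)
    qed auto
    also have "\<dots> \<le> ?C"
    proof (intro mult_left_mono)
      have "shannon (words S k) (window_freq k n w0) / real k \<le> c"
        using w0 k by (simp add: field_simps)
      then have "real n * (shannon (words S k) (window_freq k n w0) / real k) \<le> real n * c"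
        by (intro mult_left_mono) auto
      then show "exp (real n * shannon (words S k) (window_freq k n w0) / real k) \<le> exp (real n * c)"
        by simp
    qed auto
    finally show ?thesis .
  qed
  have "real (card ?W) = (\<Sum>t\<in>\<tau> ` ?W. real (card {w \<in> ?W. \<tau> w = t}))"
    using sum.image_gen[OF fin, of "\<lambda>_. 1::real" \<tau>] by simp
  also have "\<dots> \<le> (\<Sum>t\<in>\<tau> ` ?W. ?C)" by (rule sum_mono) (rule cls)
  also have "\<dots> = real (card (\<tau> ` ?W)) * ?C" by simp
  also have "\<dots> \<le> real ((n + 1) ^ (card S ^ k)) * ?C"
    using types by (intro mult_right_mono of_nat_mono) auto
  finally show ?thesis by (simp add: mult.assoc)
qed

lemma eventually_poly_le_exp:
  fixes \<eta> C :: real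
  assumes "\<eta> > 0"
  shows "eventually (\<lambda>n. real (n + 1) ^ M * C \<le> exp (real n * \<eta>)) sequentially"
proof -
  have "(\<lambda>n. real (n + 1) ^ M * C / exp (real n * \<eta>)) \<longlonglongrightarrow> 0" using assms by real_asymp
  then have "eventually (\<lambda>n. real (n + 1) ^ M * C / exp (real n * \<eta>) < 1) sequentially"
    by (rule order_tendstoD) simp
  then show ?thesis by eventually_elim (simp add: field_simps)
qed

text \<open>The polynomial number of types and the constants disappear in
  \<open>exp (real n * \<eta>)\<close>; the threshold \<open>N\<close> serves all \<open>c\<close>
  at once.\<close>

lemma card_low_entropy_words:
  assumes S: "finite S" "S \<noteq> {}" and k: "k \<ge> 1" and \<eta>: "\<eta> > 0"
  shows "\<exists>N\<ge>1. \<forall>n\<ge>N. \<forall>c. real (card {w \<in> words S (n + k - 1). shannon (words S k) (window_freq k n w) \<le> real k * c})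
     \<le> exp (real n * (c + \<eta>))"
proof -
  obtain N where N: "\<And>n. n \<ge> N \<Longrightarrow> real (n + 1) ^ (card S ^ k) * (real k * real (card S) ^ (2 * k)) \<le> exp (real n * \<eta>)"
    using eventually_poly_le_exp[OF \<eta>] unfolding eventually_sequentially by blast
  show ?thesis
  proof (intro exI[of _ "max N 1"] conjI allI impI)
    fix n c assume n: "n \<ge> max N 1"
    have "real (card {w \<in> words S (n + k - 1). shannon (words S k) (window_freq k n w) \<le> real k * c})
      \<le> real (n + 1) ^ (card S ^ k) * (real k * real (card S) ^ (2 * k)) * exp (real n * c)"
      by (rule card_low_entropy_words_aux[OF S k]) (use n in auto)
    also have "\<dots> \<le> exp (real n * \<eta>) * exp (real n * c)"
      using N n by (intro mult_right_mono) auto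
    finally show "real (card {w \<in> words S (n + k - 1). shannon (words S k) (window_freq k n w) \<le> real k * c})
      \<le> exp (real n * (c + \<eta>))" by (simp add: exp_add[symmetric] algebra_simps)
  qed auto
qed

section \<open>Itineraries and entropy\<close>

locale partitioned_map =
  fixes T :: "'a::topological_space \<Rightarrow> 'a" and P :: "'a set set"
  assumes T_measurable [measurable]: "T \<in> borel_measurable borel"
    and P: "finite_partition P"
begin

definition cell :: "'a \<Rightarrow> 'a set" where
  "cell x = (THE A. A \<in> P \<and> x \<in> A)"

definition itinerary :: "nat \<Rightarrow> 'a \<Rightarrow> 'a set list" where
  "itinerary n x = map (\<lambda>i. cell ((T ^^ i) x)) [0..<n]"

definition word_prob :: "'a measure \<Rightarrow> 'a set list \<Rightarrow> real" where
  "word_prob \<mu> w = measure \<mu> {x. itinerary (length w) x = w}"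

definition word_entropy :: "'a measure \<Rightarrow> nat \<Rightarrow> real" where
  "word_entropy \<mu> n = shannon (words P n) (word_prob \<mu>)"

lemma finite_P: "finite P" and P_borel: "A \<in> P \<Longrightarrow> A \<in> sets borel"
  using P by (auto simp: finite_partition_def)

lemma cell_unique: "\<exists>!A. A \<in> P \<and> x \<in> A"
proof -
  have "partition_on UNIV P" using P by (simp add: finite_partition_def)
  then show ?thesis unfolding partition_on_def disjoint_def by (metis IntI UNIV_I UnionE empty_iff)
qed

lemma cell: "cell x \<in> P" "x \<in> cell x"
  using theI'[OF cell_unique[of x]] by (auto simp: cell_def)

lemma cell_eq: "A \<in> P \<Longrightarrow> x \<in> A \<Longrightarrow> cell x = A"
  using cell_unique[of x] cell[of x] by blast

lemma cell_eq_iff: "A \<in> P \<Longrightarrow> cell x = A \<longleftrightarrow> x \<in> A"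
  using cell_eq cell by blast

lemma P_nonempty: "P \<noteq> {}" using cell(1) by blast

lemma finite_wordsP: "finite (words P n)" by (rule finite_words[OF finite_P])

lemma funpow_measurable [measurable]: "T ^^ n \<in> borel_measurable borel"
proof (induction n)
  case (Suc n)
  have "T \<circ> (T ^^ n) \<in> borel_measurable borel" by (rule measurable_comp[OF Suc T_measurable])
  then show ?case by simp
qed simp

lemma itinerary_words: "itinerary n x \<in> words P n"
  using cell by (auto simp: itinerary_def words_def)

lemma length_itinerary [simp]: "length (itinerary n x) = n" by (simp add: itinerary_def)

lemma itinerary_eq_iff:
  assumes "w \<in> words P n"
  shows "itinerary n x = w \<longleftrightarrow> (\<forall>i<n. (T ^^ i) x \<in> w ! i)"
proof -
  have "itinerary n x = w \<longleftrightarrow> (\<forall>i<n. cell ((T ^^ i) x) = w ! i)"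
    using assms by (auto simp: itinerary_def words_def list_eq_iff_nth_eq)
  moreover have "cell ((T ^^ i) x) = w ! i \<longleftrightarrow> (T ^^ i) x \<in> w ! i" if "i < n" for i
    by (rule cell_eq_iff) (use assms that in \<open>auto simp: words_def\<close>)
  ultimately show ?thesis by simp
qed

lemma itinerary_append: "itinerary (m + n) x = itinerary m x @ itinerary n ((T ^^ m) x)"
  by (rule nth_equalityI) (auto simp: itinerary_def nth_append funpow_add[symmetric, THEN fun_cong, unfolded comp_def] add.commute)

lemma itinerary_window: "i + k \<le> n \<Longrightarrow> take k (drop i (itinerary n x)) = itinerary k ((T ^^ i) x)"
  by (rule nth_equalityI)
    (auto simp: itinerary_def funpow_add[symmetric, THEN fun_cong, unfolded comp_def] add.commute)

lemma cylinder_measurable [measurable]: "{x. itinerary n x = w} \<in> sets borel"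
proof (cases "w \<in> words P n")
  case True
  then have "{x. itinerary n x = w} = (\<Inter>i\<in>{..<n}. (T ^^ i) -` (w ! i) \<inter> space borel)"
    using itinerary_eq_iff[OF True] by auto
  also have "\<dots> \<in> sets borel"
  proof (cases "n = 0")
    case False
    have "w ! i \<in> sets borel" if "i < n" for i 
      by (rule P_borel) (use True that in \<open>auto simp: words_def\<close>)
    then show ?thesis using False by (intro sets.finite_INT measurable_sets[OF funpow_measurable]) auto
  qed simp
  finally show ?thesis .
next
  case False
  then have "{x. itinerary n x = w} = {}" using itinerary_words by blast
  then show ?thesis by simp
qed

lemma itinerary_pred_measurable [measurable]: "{x. Q (itinerary n x)} \<in> sets borel"
proof -
  have "{x. Q (itinerary n x)} = (\<Union>w\<in>{w\<in>words P n. Q w}. {x. itinerary n x = w})"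
    using itinerary_words by auto
  then show ?thesis using finite_wordsP by auto
qed

lemma word_prob_words: "w \<in> words P n \<Longrightarrow> word_prob \<mu> w = measure \<mu> {x. itinerary n x = w}"
  by (simp add: word_prob_def words_def)

lemma word_prob_01: "prob_space \<mu> \<Longrightarrow> 0 \<le> word_prob \<mu> w \<and> word_prob \<mu> w \<le> 1"
  by (simp add: word_prob_def prob_space.prob_le_1)

lemma sum_word_prob_pred:
  assumes \<mu>: "prob_space \<mu>" "sets \<mu> = sets borel"
  shows "(\<Sum>w\<in>{w\<in>words P n. Q w}. word_prob \<mu> w) = measure \<mu> {x. Q (itinerary n x)}"
proof -
  interpret prob_space \<mu> by fact
  have "measure \<mu> (\<Union>w\<in>{w\<in>words P n. Q w}. {x. itinerary n x = w})
      = (\<Sum>w\<in>{w\<in>words P n. Q w}. measure \<mu> {x. itinerary n x = w})"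
    by (rule finite_measure_finite_Union) (auto simp: finite_wordsP disjoint_family_on_def \<mu>)
  moreover have "(\<Union>w\<in>{w\<in>words P n. Q w}. {x. itinerary n x = w}) = {x. Q (itinerary n x)}"
    using itinerary_words by auto
  moreover have "(\<Sum>w\<in>{w\<in>words P n. Q w}. word_prob \<mu> w)
      = (\<Sum>w\<in>{w\<in>words P n. Q w}. measure \<mu> {x. itinerary n x = w})"
    by (intro sum.cong refl) (simp add: word_prob_words)
  ultimately show ?thesis by simp
qed

lemma sum_word_prob:
  assumes \<mu>: "prob_space \<mu>" "sets \<mu> = sets borel"
  shows "(\<Sum>w\<in>words P n. word_prob \<mu> w) = 1"
  using sum_word_prob_pred[OF \<mu>, of n "\<lambda>_. True"] prob_space.prob_space[OF \<mu>(1)] sets_eq_imp_space_eq[OF \<mu>(2)]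
  by simp

text \<open>\<open>common_refinement\<close> sees only the set of pulled back partitions, in which
  different times may coincide; its choice functions take a partition as argument, not a time.
  Picking the member that contains a fixed point respects this and identifies the atoms with
  itinerary classes.\<close>

lemma iterated_join_iff: "X \<in> iterated_join T n P \<longleftrightarrow> (\<exists>x. X = {y. itinerary n y = itinerary n x})"
proof -
  have same: "{y. itinerary n y = itinerary n x} = (\<Inter>i<n. (T ^^ i) -` cell ((T ^^ i) x))" for x
    using itinerary_eq_iff[OF itinerary_words] cell by (auto simp: itinerary_def)
  have mem: "B = (T ^^ i) -` cell ((T ^^ i) x)" if "B \<in> pullback_partition T i P" "x \<in> B" for B i x
    using that cell_eq by (auto simp: pullback_partition_def)
  have mem': "(T ^^ i) -` cell ((T ^^ i) x) \<in> pullback_partition T i P" for i x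
    using cell by (auto simp: pullback_partition_def)
  let ?\<P> = "(\<lambda>i. pullback_partition T i P) ` {..<n}"
  show ?thesis
  proof
    assume "X \<in> iterated_join T n P"
    then obtain f where f: "f \<in> (\<Pi> Q\<in>?\<P>. Q)" and X: "X = \<Inter> (f ` ?\<P>)" "X \<noteq> {}"
      by (auto simp: iterated_join_def common_refinement)
    then obtain x where x: "x \<in> X" by auto
    have "f (pullback_partition T i P) = (T ^^ i) -` cell ((T ^^ i) x)" if "i < n" for i
      using that f x X by (intro mem) auto
    then show "\<exists>x. X = {y. itinerary n y = itinerary n x}"
      unfolding same X by (intro exI[of _ x]) (simp add: image_image)
  next
    assume "\<exists>x. X = {y. itinerary n y = itinerary n x}"
    then obtain x where x: "X = {y. itinerary n y = itinerary n x}" by auto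
    define f where "f Q = (SOME B. B \<in> Q \<and> x \<in> B)" for Q
    have "f (pullback_partition T i P) \<in> pullback_partition T i P \<and> x \<in> f (pullback_partition T i P)" for i
      unfolding f_def by (rule someI[of _ "(T ^^ i) -` cell ((T ^^ i) x)"]) (use mem' cell in auto)
    then have f: "f (pullback_partition T i P) \<in> pullback_partition T i P"
      "f (pullback_partition T i P) = (T ^^ i) -` cell ((T ^^ i) x)" for i
      using mem by blast+
    have "X = \<Inter> (f ` ?\<P>)" unfolding x same by (simp add: image_image f(2))
    moreover have "f \<in> (\<Pi> Q\<in>?\<P>. Q)" using f(1) by auto
    moreover have "X \<noteq> {}" unfolding x by auto
    ultimately show "X \<in> iterated_join T n P" unfolding iterated_join_def common_refinement by blast
  qed
qed

text \<open>Words with empty cylinder contribute 0, and different words share a cylinder only if it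
  is empty; so summing over words amounts to summing over atoms.\<close>

lemma partition_entropy_eq: "partition_entropy \<mu> (iterated_join T n P) = word_entropy \<mu> n"
proof -
  let ?h = "\<lambda>w. {x. itinerary n x = w}" and ?g = "\<lambda>A. - (measure \<mu> A * ln (measure \<mu> A))"
  have "sum ?g (?h ` words P n) = sum (?g \<circ> ?h) (words P n)"
  proof (rule sum.reindex_nontrivial[OF finite_wordsP])
    fix v w assume "v \<noteq> w" "?h v = ?h w"
    then have "?h v = {}" by auto
    then show "?g (?h v) = 0" by simp
  qed
  also have "\<dots> = word_entropy \<mu> n"
    unfolding word_entropy_def shannon_def by (intro sum.cong refl) (simp add: word_prob_words)
  also have "sum ?g (?h ` words P n) = sum ?g (iterated_join T n P)"
  proof (rule sum.mono_neutral_right)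
    show "finite (?h ` words P n)" using finite_wordsP by blast
    show "iterated_join T n P \<subseteq> ?h ` words P n" using iterated_join_iff itinerary_words by blast
    show "\<forall>A\<in>?h ` words P n - iterated_join T n P. ?g A = 0"
    proof
      fix A assume A: "A \<in> ?h ` words P n - iterated_join T n P"
      then obtain w where w: "A = ?h w" by auto
      have "A = {}"
      proof (rule ccontr)
        assume "A \<noteq> {}"
        then obtain x where "x \<in> A" by auto
        then have "A = {y. itinerary n y = itinerary n x}" using w by auto
        then show False using A iterated_join_iff by blast
      qed
      then show "?g A = 0" by simp
    qed
  qed
  finally show ?thesis by (simp add: partition_entropy_def sum_negf)
qed

lemma word_entropy_nonneg: "prob_space \<mu> \<Longrightarrow> 0 \<le> word_entropy \<mu> n"
  unfolding word_entropy_def by (rule shannon_nonneg) (use word_prob_01 in blast)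

lemma funpow_preserves:
  assumes \<mu>: "sets \<mu> = sets borel" "distr \<mu> borel T = \<mu>" and A: "A \<in> sets borel"
  shows "measure \<mu> ((T ^^ n) -` A) = measure \<mu> A"
proof (induction n)
  case (Suc n)
  have T: "T \<in> measurable \<mu> borel" using \<mu>(1) by (simp cong: measurable_cong_sets)
  have sp: "space \<mu> = UNIV" using sets_eq_imp_space_eq[OF \<mu>(1)] by simp
  have m: "(T ^^ n) -` A \<in> sets borel" using measurable_sets[OF funpow_measurable A, of n] by simp
  have "(T ^^ Suc n) -` A = T -` ((T ^^ n) -` A)" by (simp add: funpow_Suc_right vimage_comp[symmetric] del: funpow.simps)
  also have "measure \<mu> \<dots> = measure (distr \<mu> borel T) ((T ^^ n) -` A)"
    using measure_distr[OF T m] sp by simp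
  finally show ?case using Suc \<mu>(2) by (simp del: funpow.simps)
qed simp

text \<open>The law of a word of length \<open>m + n\<close> is a joint law of its two parts. The
  first marginal is immediate; the second is the law of words of length \<open>n\<close> because
  \<mu> is invariant.\<close>

lemma word_entropy_subadditive:
  assumes \<mu>: "\<mu> \<in> invariant_measures T"
  shows "word_entropy \<mu> (m + n) \<le> word_entropy \<mu> m + word_entropy \<mu> n"
proof -
  have p: "prob_space \<mu>" and s: "sets \<mu> = sets borel" and d: "distr \<mu> borel T = \<mu>"
    using \<mu> by (auto simp: invariant_measures_def prob_measures_def)
  let ?r = "\<lambda>x. word_prob \<mu> (fst x @ snd x)"
  interpret prob_space \<mu> by fact
  have "word_entropy \<mu> (m + n) = shannon (words P m \<times> words P n) ?r"
    unfolding word_entropy_def shannon_def sum_words_append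
    by (simp add: sum.cartesian_product case_prod_unfold)
  also have "\<dots> \<le> shannon (words P m) (word_prob \<mu>) + shannon (words P n) (word_prob \<mu>)"
  proof (rule shannon_subadditive)
    have "sum ?r (words P m \<times> words P n) = (\<Sum>w\<in>words P (m + n). word_prob \<mu> w)"
      unfolding sum_words_append by (simp add: sum.cartesian_product case_prod_unfold)
    then show "sum ?r (words P m \<times> words P n) = 1" using sum_word_prob[OF p s] by simp
  next
    fix u assume u: "u \<in> words P m"
    have "(\<Sum>v\<in>words P n. word_prob \<mu> (u @ v)) = (\<Sum>v\<in>words P n. measure \<mu> {x. itinerary m x = u \<and> itinerary n ((T ^^ m) x) = v})"
      using u by (intro sum.cong refl) (auto simp: word_prob_def words_def itinerary_append)
    also have "\<dots> = measure \<mu> (\<Union>v\<in>words P n. {x. itinerary m x = u \<and> itinerary n ((T ^^ m) x) = v})"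
    proof (rule finite_measure_finite_Union[symmetric])
      show "(\<lambda>v. {x. itinerary m x = u \<and> itinerary n ((T ^^ m) x) = v}) ` words P n \<subseteq> sets \<mu>"
      proof safe
        fix v
        have "{x. itinerary m x = u \<and> itinerary n ((T ^^ m) x) = v} =
          {x. take m (itinerary (m + n) x) = u \<and> drop m (itinerary (m + n) x) = v}"
          by (simp add: itinerary_append)
        then show "{x. itinerary m x = u \<and> itinerary n ((T ^^ m) x) = v} \<in> sets \<mu>"
          using itinerary_pred_measurable[of "\<lambda>w. take m w = u \<and> drop m w = v" "m + n"] s by simp
      qed
    qed (auto simp: finite_wordsP disjoint_family_on_def)
    also have "(\<Union>v\<in>words P n. {x. itinerary m x = u \<and> itinerary n ((T ^^ m) x) = v}) = {x. itinerary m x = u}"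
      using itinerary_words by auto
    finally show "word_prob \<mu> u = (\<Sum>v\<in>words P n. ?r (u, v))" using u by (simp add: word_prob_words)
  next
    fix v assume v: "v \<in> words P n"
    have "(\<Sum>u\<in>words P m. word_prob \<mu> (u @ v)) = (\<Sum>u\<in>words P m. measure \<mu> {x. itinerary m x = u \<and> itinerary n ((T ^^ m) x) = v})"
      using v by (intro sum.cong refl) (auto simp: word_prob_def words_def itinerary_append)
    also have "\<dots> = measure \<mu> (\<Union>u\<in>words P m. {x. itinerary m x = u \<and> itinerary n ((T ^^ m) x) = v})"
    proof (rule finite_measure_finite_Union[symmetric])
      show "(\<lambda>u. {x. itinerary m x = u \<and> itinerary n ((T ^^ m) x) = v}) ` words P m \<subseteq> sets \<mu>"
      proof safe
        fix u
        have "{x. itinerary m x = u \<and> itinerary n ((T ^^ m) x) = v} =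
          {x. take m (itinerary (m + n) x) = u \<and> drop m (itinerary (m + n) x) = v}"
          by (simp add: itinerary_append)
        then show "{x. itinerary m x = u \<and> itinerary n ((T ^^ m) x) = v} \<in> sets \<mu>"
          using itinerary_pred_measurable[of "\<lambda>w. take m w = u \<and> drop m w = v" "m + n"] s by simp
      qed
    qed (auto simp: finite_wordsP disjoint_family_on_def)
    also have "(\<Union>u\<in>words P m. {x. itinerary m x = u \<and> itinerary n ((T ^^ m) x) = v})
        = (T ^^ m) -` {x. itinerary n x = v}"
      using itinerary_words by auto
    also have "measure \<mu> \<dots> = measure \<mu> {x. itinerary n x = v}"
      by (rule funpow_preserves[OF s d]) simp
    finally show "word_prob \<mu> v = (\<Sum>u\<in>words P m. ?r (u, v))" using v by (simp add: word_prob_words)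
  qed (auto simp: finite_wordsP word_prob_01[OF p])
  finally show ?thesis by (simp add: word_entropy_def)
qed

text \<open>Fekete's lemma shows that the \<open>lim\<close> in \<open>entropy_wrt\<close> is a
  genuine limit and a lower bound of the sequence; the latter gives an estimate at every finite
  length.\<close>

lemma word_entropy_tendsto:
  assumes \<mu>: "\<mu> \<in> invariant_measures T"
  shows "(\<lambda>n. word_entropy \<mu> n / real n) \<longlonglongrightarrow> entropy_wrt T \<mu> P"
    and "n \<ge> 1 \<Longrightarrow> entropy_wrt T \<mu> P \<le> word_entropy \<mu> n / real n"
proof -
  have p: "prob_space \<mu>" using \<mu> by (auto simp: invariant_measures_def prob_measures_def)
  obtain L where L: "(\<lambda>n. word_entropy \<mu> n / real n) \<longlonglongrightarrow> L" "\<forall>n\<ge>1. L \<le> word_entropy \<mu> n / real n"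
    using fekete[of "word_entropy \<mu>"] word_entropy_subadditive[OF \<mu>] word_entropy_nonneg[OF p] by blast
  have "entropy_wrt T \<mu> P = L"
    unfolding entropy_wrt_def partition_entropy_eq using L(1) by (rule limI)
  with L show "(\<lambda>n. word_entropy \<mu> n / real n) \<longlonglongrightarrow> entropy_wrt T \<mu> P"
    "n \<ge> 1 \<Longrightarrow> entropy_wrt T \<mu> P \<le> word_entropy \<mu> n / real n" by auto
qed

lemma entropy_wrt_le_metric_entropy: "ereal (entropy_wrt T \<mu> P) \<le> metric_entropy T \<mu>"
  unfolding metric_entropy_def by (rule SUP_upper) (use P in auto)

text \<open>Since \<mu> dominates each \<open>a i\<close> times \<open>\<nu> i\<close>, the cost
  \<open>- ln (word_prob \<mu> w)\<close> is at most
  \<open>- ln (a i) - ln (word_prob (\<nu> i) w)\<close> where the latter is meaningful. Averaging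
  adds only the entropy of the weights, a constant that vanishes after division by
  \<open>n\<close>.\<close>

lemma entropy_wrt_mixture:
  assumes \<mu>: "\<mu> \<in> invariant_measures T" and I: "finite I" and \<nu>: "\<And>i. i \<in> I \<Longrightarrow> \<nu> i \<in> invariant_measures T"
    and a: "\<And>i. i \<in> I \<Longrightarrow> 0 < a i" "sum a I = 1"
    and mix: "\<And>A. A \<in> sets borel \<Longrightarrow> measure \<mu> A = (\<Sum>i\<in>I. a i * measure (\<nu> i) A)"
  shows "entropy_wrt T \<mu> P \<le> (\<Sum>i\<in>I. a i * entropy_wrt T (\<nu> i) P)"
proof -
  have p\<nu>: "prob_space (\<nu> i)" "sets (\<nu> i) = sets borel" if "i \<in> I" for i
    using \<nu>[OF that] by (auto simp: invariant_measures_def prob_measures_def)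
  have bound: "word_entropy \<mu> n \<le> (\<Sum>i\<in>I. a i * word_entropy (\<nu> i) n) + shannon I a" for n
  proof -
    have summand: "- (word_prob \<mu> w * ln (word_prob \<mu> w))
        \<le> (\<Sum>i\<in>I. a i * (- (word_prob (\<nu> i) w * ln (word_prob (\<nu> i) w))) + (- (a i * ln (a i))) * word_prob (\<nu> i) w)"
      if w: "w \<in> words P n" for w
    proof -
      have eq: "word_prob \<mu> w = (\<Sum>i\<in>I. a i * word_prob (\<nu> i) w)"
        unfolding word_prob_def by (rule mix) simp
      have nn: "0 \<le> a i * word_prob (\<nu> i) w" if "i \<in> I" for i
        using a(1)[OF that] by (simp add: word_prob_def)
      have "- (word_prob \<mu> w * ln (word_prob \<mu> w)) = (\<Sum>i\<in>I. - (a i * word_prob (\<nu> i) w * ln (word_prob \<mu> w)))"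
        by (simp add: eq[symmetric] sum_negf sum_distrib_right[symmetric])
      also have "\<dots> \<le> (\<Sum>i\<in>I. a i * (- (word_prob (\<nu> i) w * ln (word_prob (\<nu> i) w))) + (- (a i * ln (a i))) * word_prob (\<nu> i) w)"
      proof (rule sum_mono)
        fix i assume i: "i \<in> I"
        show "- (a i * word_prob (\<nu> i) w * ln (word_prob \<mu> w))
          \<le> a i * (- (word_prob (\<nu> i) w * ln (word_prob (\<nu> i) w))) + (- (a i * ln (a i))) * word_prob (\<nu> i) w"
        proof (cases "word_prob (\<nu> i) w = 0")
          case False
          then have pos: "word_prob (\<nu> i) w > 0" using word_prob_01[OF p\<nu>(1)[OF i], of w] by auto
          have "a i * word_prob (\<nu> i) w \<le> word_prob \<mu> w"
            unfolding eq by (rule member_le_sum) (use i I nn in auto)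
          then have "ln (a i * word_prob (\<nu> i) w) \<le> ln (word_prob \<mu> w)"
            using pos a(1)[OF i] by (intro ln_mono) auto
          then have "ln (a i) + ln (word_prob (\<nu> i) w) \<le> ln (word_prob \<mu> w)"
            using pos a(1)[OF i] by (simp add: ln_mult)
          then have "a i * word_prob (\<nu> i) w * (ln (a i) + ln (word_prob (\<nu> i) w))
              \<le> a i * word_prob (\<nu> i) w * ln (word_prob \<mu> w)"
            using nn[OF i] by (rule mult_left_mono)
          then show ?thesis by (simp add: algebra_simps)
        qed simp
      qed
      finally show ?thesis .
    qed
    have "word_entropy \<mu> n \<le> (\<Sum>w\<in>words P n. \<Sum>i\<in>I. a i * (- (word_prob (\<nu> i) w * ln (word_prob (\<nu> i) w)))
        + (- (a i * ln (a i))) * word_prob (\<nu> i) w)"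
      unfolding word_entropy_def shannon_def by (rule sum_mono) (rule summand)
    also have "\<dots> = (\<Sum>i\<in>I. \<Sum>w\<in>words P n. a i * (- (word_prob (\<nu> i) w * ln (word_prob (\<nu> i) w)))
        + (- (a i * ln (a i))) * word_prob (\<nu> i) w)" by (rule sum.swap)
    also have "\<dots> = (\<Sum>i\<in>I. a i * word_entropy (\<nu> i) n + (- (a i * ln (a i))))"
    proof (rule sum.cong[OF refl])
      fix i assume i: "i \<in> I"
      show "(\<Sum>w\<in>words P n. a i * (- (word_prob (\<nu> i) w * ln (word_prob (\<nu> i) w)))
        + (- (a i * ln (a i))) * word_prob (\<nu> i) w) = a i * word_entropy (\<nu> i) n + (- (a i * ln (a i)))"
        unfolding sum.distrib sum_distrib_left[symmetric] word_entropy_def shannon_def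
        using sum_word_prob[OF p\<nu>[OF i]] by simp
    qed
    finally show ?thesis unfolding sum.distrib by (simp add: shannon_def)
  qed
  have "(\<lambda>n. (\<Sum>i\<in>I. a i * (word_entropy (\<nu> i) n / real n)) + shannon I a / real n)
      \<longlonglongrightarrow> (\<Sum>i\<in>I. a i * entropy_wrt T (\<nu> i) P) + 0"
    by (intro tendsto_intros word_entropy_tendsto \<nu> lim_const_over_n)
  then have lim: "(\<lambda>n. (\<Sum>i\<in>I. a i * (word_entropy (\<nu> i) n / real n)) + shannon I a / real n)
      \<longlonglongrightarrow> (\<Sum>i\<in>I. a i * entropy_wrt T (\<nu> i) P)" by simp
  show ?thesis
  proof (rule LIMSEQ_le[OF word_entropy_tendsto(1)[OF \<mu>] lim])
    show "\<exists>N. \<forall>n\<ge>N. word_entropy \<mu> n / real n \<le> (\<Sum>i\<in>I. a i * (word_entropy (\<nu> i) n / real n)) + shannon I a / real n"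
      using divide_right_mono[OF bound of_nat_0_le_iff]
      by (intro exI allI impI) (simp add: add_divide_distrib sum_divide_distrib)
  qed
qed

text \<open>Replaces the Shannon--McMillan--Breiman theorem: if most points have names whose empirical
  \<open>k\<close>-block entropy is small, counting those names bounds the entropy of \<open>\<mu>\<close>.\<close>

lemma entropy_wrt_le_of_itineraries:
  assumes \<mu>: "\<mu> \<in> invariant_measures T"
    and low: "\<And>\<tau>. \<tau> > 0 \<Longrightarrow> \<exists>k\<ge>1. \<exists>N. \<forall>n\<ge>N.
      1 - \<tau> \<le> measure \<mu> {x. shannon (words P k) (window_freq k n (itinerary (n + k - 1) x)) \<le> real k * c}"
  shows "entropy_wrt T \<mu> P \<le> c"
proof (rule ccontr)
  have p: "prob_space \<mu>" and s: "sets \<mu> = sets borel"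
    using \<mu> by (auto simp: invariant_measures_def prob_measures_def)
  define e where "e = entropy_wrt T \<mu> P"
  define K where "K = ln (real (card P))"
  assume "\<not> entropy_wrt T \<mu> P \<le> c"
  then have ec: "e > c" by (simp add: e_def)
  have cP: "real (card P) \<ge> 1" using finite_P P_nonempty by (simp add: Suc_leI card_gt_0_iff)
  then have K: "K \<ge> 0" by (simp add: K_def)
  define \<eta> where "\<eta> = (e - c) / 3"
  \<comment> \<open>The exceptional words cost at most a share \<tau> of the maximal entropy
    \<open>K\<close> per letter, that is, a third of the gap \<open>e - c\<close>; the bound 1/2
    keeps the set of good words nonempty.\<close>
  define \<tau> where "\<tau> = min (1/2) ((e - c) / (3 * (K + 1)))"
  have \<eta>: "\<eta> > 0" using ec by (simp add: \<eta>_def)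
  have \<tau>: "\<tau> > 0" "\<tau> < 1" using ec K by (auto simp: \<tau>_def)
  have \<tau>K: "\<tau> * K \<le> (e - c) / 3"
  proof -
    have "\<tau> * K \<le> (e - c) / (3 * (K + 1)) * (K + 1)"
      using K \<tau> by (intro mult_mono) (auto simp: \<tau>_def)
    also have "\<dots> = (e - c) / 3" using K by (simp add: field_simps)
    finally show ?thesis .
  qed
  obtain k N where k: "k \<ge> 1" and N: "\<And>n. n \<ge> N \<Longrightarrow>
      1 - \<tau> \<le> measure \<mu> {x. shannon (words P k) (window_freq k n (itinerary (n + k - 1) x)) \<le> real k * c}"
    using low[OF \<tau>(1)] by blast
  obtain N' where N': "\<And>n. n \<ge> N' \<Longrightarrow>
      real (card {w \<in> words P (n + k - 1). shannon (words P k) (window_freq k n w) \<le> real k * c}) \<le> exp (real n * (c + \<eta>))"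
    using card_low_entropy_words[OF finite_P P_nonempty k \<eta>] by blast
  have main: "e * real (n + k - 1) \<le> ln 2 + real n * (c + \<eta>) + \<tau> * (real (n + k - 1) * K)"
    if n: "n \<ge> N" "n \<ge> N'" "n \<ge> 1" for n
  proof -
    let ?m = "n + k - 1"
    let ?A = "words P ?m" and ?p = "word_prob \<mu>"
    define W where "W = {w \<in> ?A. shannon (words P k) (window_freq k n w) \<le> real k * c}"
    have W: "W \<subseteq> ?A" "finite W" using finite_wordsP by (auto simp: W_def)
    have pW: "1 - \<tau> \<le> sum ?p W"
      unfolding W_def sum_word_prob_pred[OF p s] by (rule N[OF n(1)])
    have "W \<noteq> {}" using pW \<tau> by auto
    then have cW: "real (card W) \<ge> 1" using W by (simp add: Suc_leI card_gt_0_iff)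
    have cA: "real (card ?A) = real (card P) ^ ?m" using finite_P by (simp add: card_words)
    then have cA1: "real (card ?A) \<ge> 1" using cP by simp
    \<comment> \<open>A two-part code: half of the mass is uniform on the few good words, half on
      all words. Good words then cost at most \<open>ln 2 + ln (card W)\<close>, the others at most
      an additional \<open>K\<close> per letter.\<close>
    define q where "q w = (if w \<in> W then 1 / (2 * real (card W)) else 0) + 1 / (2 * real (card ?A))" for w
    have q0: "q w > 0" for w using cA1 by (auto simp: q_def add_nonneg_pos)
    have qs: "sum q ?A = 1"
    proof -
      have "sum q ?A = (\<Sum>w\<in>?A. if w \<in> W then 1 / (2 * real (card W)) else 0) + real (card ?A) * (1 / (2 * real (card ?A)))"
        by (simp add: q_def sum.distrib)
      also have "(\<Sum>w\<in>?A. if w \<in> W then 1 / (2 * real (card W)) else 0) = real (card W) * (1 / (2 * real (card W)))"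
        using W finite_wordsP by (simp add: sum.If_cases Int_absorb1)
      finally show ?thesis using cW cA1 by simp
    qed
    have lnA: "ln (real (card ?A)) = real ?m * K"
      unfolding cA K_def using cP by (simp add: ln_realpow)
    have lnW: "ln (real (card W)) \<le> real n * (c + \<eta>)"
    proof -
      have "ln (real (card W)) \<le> ln (exp (real n * (c + \<eta>)))"
        using N'[OF n(2)] cW by (intro ln_mono) (auto simp: W_def)
      then show ?thesis by simp
    qed
    have "word_entropy \<mu> ?m \<le> (\<Sum>w\<in>?A. - (?p w * ln (q w)))"
      unfolding word_entropy_def
      by (rule gibbs) (use finite_wordsP q0 qs word_prob_01[OF p] sum_word_prob[OF p s] in \<open>auto intro: less_imp_le\<close>)
    also have "\<dots> \<le> (\<Sum>w\<in>?A. ?p w * (ln 2 + ln (real (card W)) + (if w \<in> W then 0 else real ?m * K)))"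
    proof (rule sum_mono)
      fix w assume w: "w \<in> ?A"
      have "- ln (q w) \<le> ln 2 + ln (real (card W)) + (if w \<in> W then 0 else real ?m * K)"
      proof (cases "w \<in> W")
        case True
        have "ln (1 / (2 * real (card W))) \<le> ln (q w)"
          using True cW cA1 by (intro ln_mono) (auto simp: q_def)
        then show ?thesis using True cW by (simp add: ln_div ln_mult)
      next
        case False
        have "ln (1 / (2 * real (card ?A))) \<le> ln (q w)"
          using cA1 by (intro ln_mono) (auto simp: q_def)
        moreover have "ln (1 / (2 * real (card ?A))) = - ln 2 - real ?m * K"
          using cA1 lnA by (simp add: ln_div ln_mult)
        moreover have "0 \<le> ln (real (card W))" using cW by simp
        ultimately show ?thesis using False by simp
      qed
      then have "?p w * - ln (q w) \<le> ?p w * (ln 2 + ln (real (card W)) + (if w \<in> W then 0 else real ?m * K))"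
        using word_prob_01[OF p, of w] by (intro mult_left_mono) auto
      then show "- (?p w * ln (q w)) \<le> ?p w * (ln 2 + ln (real (card W)) + (if w \<in> W then 0 else real ?m * K))"
        by simp
    qed
    also have "\<dots> = (ln 2 + ln (real (card W))) + (\<Sum>w\<in>?A. ?p w * (if w \<in> W then 0 else real ?m * K))"
      unfolding ring_distribs(1)[of _ "ln 2 + ln (real (card W))"] sum.distrib sum_distrib_right[symmetric]
      using sum_word_prob[OF p s, of ?m] by simp
    also have "(\<Sum>w\<in>?A. ?p w * (if w \<in> W then 0 else real ?m * K)) = (\<Sum>w\<in>?A - W. ?p w) * (real ?m * K)"
    proof -
      have "(\<Sum>w\<in>?A. ?p w * (if w \<in> W then 0 else real ?m * K)) = (\<Sum>w\<in>?A - W. ?p w * (if w \<in> W then 0 else real ?m * K))"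
        by (rule sum.mono_neutral_right) (use finite_wordsP in auto)
      also have "\<dots> = (\<Sum>w\<in>?A - W. ?p w * (real ?m * K))" by (intro sum.cong) auto
      finally show ?thesis by (simp add: sum_distrib_right)
    qed
    also have "(\<Sum>w\<in>?A - W. ?p w) = 1 - sum ?p W"
      using W finite_wordsP sum_word_prob[OF p s, of ?m] by (simp add: sum_diff)
    also have "(1 - sum ?p W) * (real ?m * K) \<le> \<tau> * (real ?m * K)"
      using pW K by (intro mult_right_mono) auto
    finally have "word_entropy \<mu> ?m \<le> ln 2 + real n * (c + \<eta>) + \<tau> * (real ?m * K)" using lnW by linarith
    moreover have "e * real ?m \<le> word_entropy \<mu> ?m"
      using word_entropy_tendsto(2)[OF \<mu>, of ?m] n k by (simp add: e_def field_simps)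
    ultimately show ?thesis by linarith
  qed
  \<comment> \<open>Collects what does not grow with \<open>n\<close>; a large \<open>n\<close> then
    contradicts the gap of \<eta> per letter.\<close>
  define B where "B = ln 2 + \<bar>e - \<tau> * K\<bar> * real k"
  obtain M where M: "real M > B / \<eta>" using reals_Archimedean2 by blast
  define n where "n = max (max N N') (max 1 M)"
  have n: "n \<ge> N" "n \<ge> N'" "n \<ge> 1" "real n > B / \<eta>" using M by (auto simp: n_def of_nat_max)
  have "real (n + k - 1) = real n + (real k - 1)" using k by (simp add: of_nat_diff)
  then have "(e - \<tau> * K) * real n + (e - \<tau> * K) * (real k - 1) \<le> ln 2 + real n * (c + \<eta>)"
    using main[OF n(1,2,3)] by (simp add: algebra_simps)
  moreover have "(e - \<tau> * K) * (real k - 1) \<ge> - (\<bar>e - \<tau> * K\<bar> * real k)"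
  proof -
    have "\<bar>(e - \<tau> * K) * (real k - 1)\<bar> \<le> \<bar>e - \<tau> * K\<bar> * real k"
      unfolding abs_mult using k by (intro mult_left_mono) auto
    then show ?thesis by linarith
  qed
  moreover have "(c + 2 * \<eta>) * real n \<le> (e - \<tau> * K) * real n"
    using \<tau>K by (intro mult_right_mono) (auto simp: \<eta>_def field_simps)
  ultimately have "\<eta> * real n \<le> B" by (simp add: B_def algebra_simps)
  moreover have "\<eta> * real n > B" using n(4) \<eta> by (simp add: field_simps)
  ultimately show False by simp
qed

end

section \<open>Weak compactness of probability measures\<close>

text \<open>With digits 0 and 1 in base 3 the tail after position \<open>n\<close> is at most half
  of the term at \<open>n\<close>, so the first difference cannot be cancelled; in base 2 it
  could.\<close>

lemma triadic_gap:
  fixes A B :: "nat set"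
  assumes n: "(n \<in> A) \<noteq> (n \<in> B)" and below: "\<And>m. m < n \<Longrightarrow> m \<in> A \<longleftrightarrow> m \<in> B"
  shows "(1/3) ^ n / 2 \<le> \<bar>(\<Sum>m. indicat_real A m * (1/3) ^ m) - (\<Sum>m. indicat_real B m * (1/3) ^ m)\<bar>"
proof -
  define c where "c m = indicat_real A m - indicat_real B m" for m
  have c: "\<bar>c m\<bar> \<le> 1" for m by (auto simp: c_def indicator_def)
  have geo: "summable (\<lambda>m. (1/3::real) ^ m)" by (rule summable_geometric) simp
  have sI: "summable (\<lambda>m. indicat_real A m * (1/3) ^ m)" for A
    by (rule summable_comparison_test'[OF geo, of 0]) (auto simp: indicator_def)
  have sc: "summable (\<lambda>m. c m * (1/3) ^ m)"
    using summable_diff[OF sI[of A] sI[of B]] by (simp add: c_def left_diff_distrib)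
  have eq: "(\<Sum>m. indicat_real A m * (1/3) ^ m) - (\<Sum>m. indicat_real B m * (1/3) ^ m) = (\<Sum>m. c m * (1/3) ^ m)"
    unfolding c_def left_diff_distrib by (rule suminf_diff[OF sI sI])
  have geo_tail: "summable (\<lambda>m. (1/3::real) ^ (m + Suc n))"
    using geo by (rule summable_ignore_initial_segment)
  have abs_s: "summable (\<lambda>m. \<bar>c (m + Suc n) * (1/3) ^ (m + Suc n)\<bar>)"
    by (rule summable_comparison_test'[OF geo_tail, of 0]) (use c in \<open>auto simp: abs_mult mult_left_le_one_le\<close>)
  have "(\<Sum>m. c m * (1/3) ^ m) = (\<Sum>m. c (m + Suc n) * (1/3) ^ (m + Suc n)) + (\<Sum>m<Suc n. c m * (1/3) ^ m)"
    by (rule suminf_split_initial_segment[OF sc])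
  also have "(\<Sum>m<Suc n. c m * (1/3) ^ m) = c n * (1/3) ^ n"
    using below by (simp add: c_def indicator_def)
  finally have split: "(\<Sum>m. c m * (1/3) ^ m) = (\<Sum>m. c (m + Suc n) * (1/3) ^ (m + Suc n)) + c n * (1/3) ^ n" .
  have "\<bar>\<Sum>m. c (m + Suc n) * (1/3) ^ (m + Suc n)\<bar> \<le> (\<Sum>m. \<bar>c (m + Suc n) * (1/3) ^ (m + Suc n)\<bar>)"
    by (rule summable_rabs[OF abs_s])
  also have "\<dots> \<le> (\<Sum>m. (1/3) ^ (m + Suc n))"
    by (rule suminf_le[OF _ abs_s geo_tail]) (use c in \<open>auto simp: abs_mult mult_left_le_one_le\<close>)
  also have "\<dots> = (\<Sum>m. (1/3) ^ m) * (1/3) ^ Suc n"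
    unfolding power_add by (rule suminf_mult2[OF geo, symmetric])
  also have "\<dots> = (1/3) ^ n / 2" by (simp add: suminf_geometric)
  finally have "\<bar>\<Sum>m. c (m + Suc n) * (1/3) ^ (m + Suc n)\<bar> \<le> (1/3) ^ n / 2" .
  moreover have "\<bar>c n * (1/3) ^ n\<bar> = (1/3) ^ n" using n by (auto simp: c_def indicator_def)
  ultimately show ?thesis unfolding eq split by linarith
qed

locale compact_system =
  fixes T :: "'a::metric_space \<Rightarrow> 'a"
  assumes compact_UNIV: "compact (UNIV :: 'a set)" and continuous_T: "continuous_on UNIV T"
begin

lemma T_measurable [measurable]: "T \<in> borel_measurable borel"
  by (rule borel_measurable_continuous_onI[OF continuous_T])

lemma convergent_subsequence:
  fixes x :: "nat \<Rightarrow> 'a"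
  obtains l r where "strict_mono (r :: nat \<Rightarrow> nat)" "(x \<circ> r) \<longlonglongrightarrow> l"
  using compact_UNIV unfolding compact_def by blast

lemma continuous_bounded:
  fixes u :: "'a \<Rightarrow> real"
  assumes "continuous_on UNIV u"
  obtains B where "B > 0" "\<And>x. \<bar>u x\<bar> \<le> B"
proof -
  have "bounded (range u)" using compact_continuous_image[OF assms compact_UNIV] by (rule compact_imp_bounded)
  then obtain B where "\<forall>x\<in>range u. norm x \<le> B" by (auto simp: bounded_iff)
  then show ?thesis by (intro that[of "max B 1"]) (auto intro: max.coboundedI1)
qed

lemma continuous_integrable:
  fixes u :: "'a \<Rightarrow> real"
  assumes u: "continuous_on UNIV u" and \<mu>: "\<mu> \<in> prob_measures"
  shows "integrable \<mu> u"
proof -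
  interpret prob_space \<mu> using \<mu> by (auto simp: prob_measures_def)
  obtain B where "\<And>x. \<bar>u x\<bar> \<le> B" using continuous_bounded[OF u] by blast
  moreover have "u \<in> borel_measurable \<mu>"
    using borel_measurable_continuous_onI[OF u] \<mu> by (auto simp: prob_measures_def cong: measurable_cong_sets)
  ultimately show ?thesis by (intro integrable_const_bound[of _ B]) auto
qed

text \<open>Balls of radius \<open>1 / Suc j\<close> around finite nets, enumerated. Given \<delta>,
  the finitely many balls of one small radius suffice: one of them contains \<open>x\<close>, and by
  agreement also \<open>y\<close>.\<close>

lemma coding_sets:
  "\<exists>U :: nat \<Rightarrow> 'a set. (\<forall>n. open (U n)) \<and>
     (\<forall>\<delta>>0. \<exists>N. \<forall>x y. (\<forall>n<N. x \<in> U n \<longleftrightarrow> y \<in> U n) \<longrightarrow> dist x y < \<delta>)"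
proof -
  have "\<exists>F :: 'a set. finite F \<and> UNIV \<subseteq> (\<Union>c\<in>F. ball c (1 / real (Suc j)))" for j
    using seq_compact_imp_totally_bounded[of "UNIV :: 'a set"] compact_UNIV
    by (auto simp: compact_eq_seq_compact_metric)
  then obtain F :: "nat \<Rightarrow> 'a set" where F: "\<And>j. finite (F j)" "\<And>j. UNIV \<subseteq> (\<Union>c\<in>F j. ball c (1 / real (Suc j)))"
    by metis
  define BB where "BB = (\<Union>j. (\<lambda>c. ball c (1 / real (Suc j))) ` F j)"
  have cBB: "countable BB" unfolding BB_def
    by (rule countable_UN[OF countableI_type]) (auto intro: countable_finite F(1))
  have "F 0 \<noteq> {}" using F(2)[of 0] by auto
  then have neBB: "BB \<noteq> {}" by (auto simp: BB_def)
  define U where "U = from_nat_into BB"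
  have U: "U n \<in> BB" for n unfolding U_def by (rule from_nat_into[OF neBB])
  have "\<exists>N. \<forall>x y. (\<forall>n<N. x \<in> U n \<longleftrightarrow> y \<in> U n) \<longrightarrow> dist x y < \<delta>" if \<delta>: "\<delta> > 0" for \<delta>
  proof -
    obtain j where j: "1 / real (Suc j) < \<delta> / 2"
      using \<delta> reals_Archimedean[of "\<delta> / 2"] by (auto simp: inverse_eq_divide)
    define N where "N = Suc (Max ((\<lambda>c. to_nat_on BB (ball c (1 / real (Suc j)))) ` F j))"
    have idx: "to_nat_on BB (ball c (1 / real (Suc j))) < N" if "c \<in> F j" for c
      unfolding N_def less_Suc_eq_le by (rule Max_ge) (use F(1) that in auto)
    have "dist x y < \<delta>" if xy: "\<forall>n<N. x \<in> U n \<longleftrightarrow> y \<in> U n" for x y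
    proof -
      obtain c where c: "c \<in> F j" "x \<in> ball c (1 / real (Suc j))" using F(2)[of j] UNIV_I[of x] by blast
      define n where "n = to_nat_on BB (ball c (1 / real (Suc j)))"
      have "ball c (1 / real (Suc j)) \<in> BB" using c by (auto simp: BB_def)
      then have Un: "U n = ball c (1 / real (Suc j))"
        unfolding U_def n_def by (rule from_nat_into_to_nat_on[OF cBB])
      have "y \<in> U n" using xy idx[OF c(1)] c(2) Un by (auto simp: n_def)
      then have "dist c y < \<delta> / 2" "dist c x < \<delta> / 2" using Un c(2) j by auto
      then show ?thesis using dist_triangle2[of x y c] by (simp add: dist_commute)
    qed
    then show ?thesis by blast
  qed
  moreover have "open (U n)" for n using U[of n] by (auto simp: BB_def)
  ultimately show ?thesis by blast
qed

text \<open>A Borel injection into the line whose inverse is uniformly continuous reduces weak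
  compactness to Helly's selection theorem.\<close>

lemma coding_function:
  "\<exists>s :: 'a \<Rightarrow> real. s \<in> borel_measurable borel \<and> (\<forall>x. 0 \<le> s x \<and> s x \<le> 3/2) \<and>
     (\<forall>\<delta>>0. \<exists>\<eta>>0. \<forall>x y. \<bar>s x - s y\<bar> < \<eta> \<longrightarrow> dist x y < \<delta>)"
proof -
  obtain U :: "nat \<Rightarrow> 'a set" where U: "\<And>n. open (U n)"
    "\<And>\<delta>. \<delta> > 0 \<Longrightarrow> \<exists>N. \<forall>x y. (\<forall>n<N. x \<in> U n \<longleftrightarrow> y \<in> U n) \<longrightarrow> dist x y < \<delta>"
    using coding_sets by blast
  define s where "s x = (\<Sum>n. indicat_real (U n) x * (1/3) ^ n)" for x
  have geo: "summable (\<lambda>m. (1/3::real) ^ m)" by (rule summable_geometric) simp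
  have su: "summable (\<lambda>n. indicat_real (U n) x * (1/3) ^ n)" for x
    by (rule summable_comparison_test'[OF geo, of 0]) (auto simp: indicator_def)
  have m: "s \<in> borel_measurable borel"
    unfolding s_def by (intro borel_measurable_suminf borel_measurable_times borel_measurable_indicator) (use U in auto)
  have "0 \<le> s x" for x unfolding s_def by (rule suminf_nonneg[OF su]) auto
  moreover have "s x \<le> 3/2" for x
  proof -
    have "s x \<le> (\<Sum>m. (1/3::real) ^ m)"
      unfolding s_def by (rule suminf_le[OF _ su geo]) (auto simp: indicator_def)
    then show ?thesis by (simp add: suminf_geometric)
  qed
  moreover have "\<exists>\<eta>>0. \<forall>x y. \<bar>s x - s y\<bar> < \<eta> \<longrightarrow> dist x y < \<delta>" if \<delta>: "\<delta> > 0" for \<delta>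
  proof -
    obtain N where N: "\<And>x y. (\<forall>n<N. x \<in> U n \<longleftrightarrow> y \<in> U n) \<Longrightarrow> dist x y < \<delta>" using U(2)[OF \<delta>] by blast
    have "dist x y < \<delta>" if xy: "\<bar>s x - s y\<bar> < (1/3) ^ N / 2" for x y
    proof (rule N, rule ccontr)
      assume "\<not> (\<forall>n<N. x \<in> U n \<longleftrightarrow> y \<in> U n)"
      then have ex: "\<exists>n. (x \<in> U n) \<noteq> (y \<in> U n) \<and> n < N" by blast
      define n where "n = (LEAST n. (x \<in> U n) \<noteq> (y \<in> U n) \<and> n < N)"
      have n: "(x \<in> U n) \<noteq> (y \<in> U n)" "n < N" using LeastI_ex[OF ex] by (auto simp: n_def)
      have b: "x \<in> U m \<longleftrightarrow> y \<in> U m" if "m < n" for m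
        using not_less_Least[of m "\<lambda>n. (x \<in> U n) \<noteq> (y \<in> U n) \<and> n < N"] that n by (auto simp: n_def)
      have "(1/3) ^ n / 2 \<le> \<bar>(\<Sum>m. indicat_real {n. x \<in> U n} m * (1/3) ^ m) - (\<Sum>m. indicat_real {n. y \<in> U n} m * (1/3) ^ m)\<bar>"
        by (rule triadic_gap) (use n b in auto)
      then have "(1/3) ^ n / 2 \<le> \<bar>s x - s y\<bar>" by (simp add: s_def indicator_def)
      moreover have "(1/3::real) ^ N \<le> (1/3) ^ n" using n(2) by (intro power_decreasing) auto
      ultimately show False using xy by linarith
    qed
    then show ?thesis by (intro exI[of _ "(1/3) ^ N / 2"]) auto
  qed
  ultimately show ?thesis using m by (intro exI[of _ s]) auto
qed

text \<open>The coding map \<open>s\<close> is only Borel, so its continuity cannot be used to bring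
  the limit \<open>N\<close> of the image laws back. Its inverse extends continuously to the closed
  set \<open>C\<close>, which carries \<open>N\<close>; the image of \<open>N\<close> under the
  extension is the limit, and test functions are transported to the line by Tietze
  extension.\<close>

lemma prob_measures_sequentially_compact:
  assumes \<mu>: "\<And>n. \<mu> n \<in> prob_measures"
  shows "\<exists>r \<nu>. strict_mono (r :: nat \<Rightarrow> nat) \<and> \<nu> \<in> prob_measures \<and>
    (\<forall>u :: 'a \<Rightarrow> real. continuous_on UNIV u \<longrightarrow> (\<lambda>n. \<integral>x. u x \<partial>\<mu> (r n)) \<longlonglongrightarrow> (\<integral>x. u x \<partial>\<nu>))"
proof -
  obtain s :: "'a \<Rightarrow> real" where s_meas: "s \<in> borel_measurable borel" and s_bd: "\<And>x. 0 \<le> s x" "\<And>x. s x \<le> 3/2"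
    and s_inv: "\<And>\<delta>. \<delta> > 0 \<Longrightarrow> \<exists>\<eta>>0. \<forall>x y. \<bar>s x - s y\<bar> < \<eta> \<longrightarrow> dist x y < \<delta>"
    using coding_function by blast
  have sets\<mu>: "sets (\<mu> n) = sets borel" and prob\<mu>: "prob_space (\<mu> n)" for n
    using \<mu>[of n] by (auto simp: prob_measures_def)
  have s_\<mu>: "s \<in> borel_measurable (\<mu> n)" for n
    using s_meas sets\<mu> by (simp cong: measurable_cong_sets)
  define M where "M n = distr (\<mu> n) borel s" for n
  have rd: "real_distribution (M n)" for n
    unfolding M_def using prob\<mu>[of n] s_\<mu>[of n] by (intro prob_space.real_distribution_distr) auto
  have "tight M"
    unfolding tight_def
  proof (intro conjI allI impI rd)
    fix \<epsilon> :: real assume \<epsilon>: "\<epsilon> > 0"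
    have "measure (M n) {-1<..2} = 1" for n
    proof -
      have "-1 < s x" "s x \<le> 2" for x using s_bd[of x] by linarith+
      then have "s -` {-1<..2} \<inter> space (\<mu> n) = space (\<mu> n)" by auto
      then show ?thesis unfolding M_def using prob_space.prob_space[OF prob\<mu>[of n]]
        by (subst measure_distr[OF s_\<mu>]) auto
    qed
    then show "\<exists>a b. a < b \<and> (\<forall>n. 1 - \<epsilon> < measure (M n) {a<..b})"
      using \<epsilon> by (intro exI[of _ "-1"] exI[of _ 2]) auto
  qed
  from tight_imp_convergent_subsubsequence[OF this strict_mono_id]
  obtain r N where r: "strict_mono r" and N: "real_distribution N" and conv: "weak_conv_m (M \<circ> id \<circ> r) N" by blast
  interpret N: real_distribution N by fact
  define C where "C = closure (range s)"
  \<comment> \<open>The graph of the extended inverse, described by sequences; \<open>R_unif\<close>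
    makes it single valued and uniformly continuous.\<close>
  define R where "R t x \<longleftrightarrow> (\<exists>xs. (\<lambda>n. s (xs n)) \<longlonglongrightarrow> t \<and> xs \<longlonglongrightarrow> x)" for t x
  have R_ex: "\<exists>x. R t x" if "t \<in> C" for t
  proof -
    obtain ts where ts: "\<And>n. ts n \<in> range s" "ts \<longlonglongrightarrow> t"
      using \<open>t \<in> C\<close> unfolding C_def closure_sequential by blast
    have "\<forall>n. \<exists>x. ts n = s x" using ts(1) by (simp add: image_iff)
    then obtain xs where xs: "\<And>n. ts n = s (xs n)" by (auto dest: choice)
    obtain l q where q: "strict_mono q" "(xs \<circ> q) \<longlonglongrightarrow> l" using convergent_subsequence by blast
    have "(\<lambda>n. s ((xs \<circ> q) n)) \<longlonglongrightarrow> t"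
      using LIMSEQ_subseq_LIMSEQ[OF ts(2) q(1)] xs by (simp add: o_def)
    then show ?thesis using q(2) unfolding R_def by blast
  qed
  define p where "p t = (SOME x. R t x)" for t
  have Rp: "R t (p t)" if "t \<in> C" for t unfolding p_def using R_ex[OF that] by (rule someI_ex)
  have R_unif: "\<exists>\<eta>>0. \<forall>t x t' x'. R t x \<and> R t' x' \<and> \<bar>t - t'\<bar> < \<eta> \<longrightarrow> dist x x' \<le> \<delta>" if \<delta>: "\<delta> > 0" for \<delta>
  proof -
    obtain \<eta> where \<eta>: "\<eta> > 0" "\<And>x y. \<bar>s x - s y\<bar> < \<eta> \<Longrightarrow> dist x y < \<delta>" using s_inv[OF \<delta>] by blast
    have "dist x x' \<le> \<delta>" if h: "R t x" "R t' x'" "\<bar>t - t'\<bar> < \<eta>" for t x t' x'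
    proof -
      obtain xs where xs: "(\<lambda>n. s (xs n)) \<longlonglongrightarrow> t" "xs \<longlonglongrightarrow> x" using h(1) by (auto simp: R_def)
      obtain ys where ys: "(\<lambda>n. s (ys n)) \<longlonglongrightarrow> t'" "ys \<longlonglongrightarrow> x'" using h(2) by (auto simp: R_def)
      have "(\<lambda>n. \<bar>s (xs n) - s (ys n)\<bar>) \<longlonglongrightarrow> \<bar>t - t'\<bar>" by (intro tendsto_intros xs ys)
      from order_tendstoD(2)[OF this h(3)]
      have "\<forall>\<^sub>F n in sequentially. dist (xs n) (ys n) \<le> \<delta>"
        by eventually_elim (use \<eta>(2) in \<open>auto intro: less_imp_le\<close>)
      moreover have "(\<lambda>n. dist (xs n) (ys n)) \<longlonglongrightarrow> dist x x'" by (intro tendsto_intros xs ys)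
      ultimately show ?thesis by (intro tendsto_upperbound[of _ _ sequentially]) auto
    qed
    then show ?thesis using \<eta>(1) by blast
  qed
  have p_cont: "continuous_on C p"
    unfolding continuous_on_iff
  proof (intro ballI allI impI)
    fix t e :: real assume t: "t \<in> C" and e: "e > 0"
    obtain \<eta> where "\<eta> > 0" "\<And>t x t' x'. R t x \<Longrightarrow> R t' x' \<Longrightarrow> \<bar>t - t'\<bar> < \<eta> \<Longrightarrow> dist x x' \<le> e / 2"
      using R_unif[of "e / 2"] e by auto
    then show "\<exists>d>0. \<forall>t'\<in>C. dist t' t < d \<longrightarrow> dist (p t') (p t) < e"
      using Rp t e by (intro exI[of _ \<eta>]) (force simp: dist_real_def)
  qed
  have p_s: "p (s x) = x" for x
  proof -
    have sC: "s x \<in> C" unfolding C_def by (rule closure_subset[THEN subsetD]) auto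
    have "R (s x) x" unfolding R_def by (intro exI[of _ "\<lambda>_. x"]) auto
    then have "dist (p (s x)) x \<le> \<delta>" if "\<delta> > 0" for \<delta>
      using R_unif[OF that] Rp[OF sC] by (metis abs_zero diff_self)
    then have "dist (p (s x)) x \<le> 0" by (rule field_le_epsilon[of _ 0, simplified])
    then show ?thesis by simp
  qed
  have closedC: "closed C" by (simp add: C_def)
  \<comment> \<open>Outside \<open>C\<close> the value is an arbitrary constant, which makes \<pi>
    total and Borel.\<close>
  define \<pi> where "\<pi> t = (if t \<in> C then p t else p 0)" for t
  have \<pi>_meas: "\<pi> \<in> borel_measurable borel"
    unfolding \<pi>_def by (rule borel_measurable_continuous_on_if) (use p_cont closedC in auto)
  then have \<pi>_N: "\<pi> \<in> borel_measurable N" by (simp cong: measurable_cong_sets)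
  define \<nu> where "\<nu> = distr N borel \<pi>"
  have \<nu>: "\<nu> \<in> prob_measures"
    unfolding prob_measures_def \<nu>_def using N.prob_space_distr[OF \<pi>_N] by auto
  have Mconv: "(\<lambda>n. \<integral>x. g (s x) \<partial>\<mu> (r n)) \<longlonglongrightarrow> (\<integral>t. g t \<partial>N)"
    if g: "continuous_on UNIV g" "\<And>t. \<bar>g t\<bar> \<le> B" for g :: "real \<Rightarrow> real" and B
  proof -
    have gm: "g \<in> borel_measurable borel" using g(1) by (rule borel_measurable_continuous_onI)
    have "(\<lambda>n. integral\<^sup>L ((M \<circ> id \<circ> r) n) g) \<longlonglongrightarrow> integral\<^sup>L N g"
      by (rule weak_conv_imp_integral_bdd_continuous_conv[OF _ N conv, where B=B])
        (use g rd in \<open>auto simp: continuous_on_eq_continuous_at\<close>)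
    moreover have "integral\<^sup>L ((M \<circ> id \<circ> r) n) g = (\<integral>x. g (s x) \<partial>\<mu> (r n))" for n
      unfolding M_def using integral_distr[OF s_\<mu>[of "r n"] gm] by simp
    ultimately show ?thesis by simp
  qed
  have neC: "C \<noteq> {}" by (simp add: C_def)
  have AE_C: "AE t in N. t \<in> C"
  proof -
    \<comment> \<open>A bounded continuous function that vanishes exactly on \<open>C\<close>. It is
      0 along the range of \<open>s\<close>, so its integral against \<open>N\<close> is a limit of
      zeros.\<close>
    define h where "h t = min 1 (infdist t C)" for t
    have hc: "continuous_on UNIV h" unfolding h_def by (intro continuous_intros)
    have hb: "0 \<le> h t" "h t \<le> 1" for t by (auto simp: h_def infdist_nonneg)
    have hs: "h (s x) = 0" for x
    proof -
      have "s x \<in> C" unfolding C_def by (rule closure_subset[THEN subsetD]) auto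
      then show ?thesis by (simp add: h_def)
    qed
    have "(\<lambda>n. \<integral>x. h (s x) \<partial>\<mu> (r n)) \<longlonglongrightarrow> (\<integral>t. h t \<partial>N)"
      by (rule Mconv[OF hc, of 1]) (use hb in auto)
    then have "(\<integral>t. h t \<partial>N) = 0" unfolding hs by (simp add: LIMSEQ_const_iff)
    moreover have "integrable N h"
      by (rule N.integrable_const_bound[of _ 1]) (use hb hc in \<open>auto intro!: borel_measurable_continuous_onI cong: measurable_cong_sets\<close>)
    ultimately have "AE t in N. h t = 0" using hb by (subst (asm) integral_nonneg_eq_0_iff_AE) auto
    then show ?thesis
    proof eventually_elim
      fix t assume "h t = 0"
      then have "infdist t C = 0" by (auto simp: h_def min_def split: if_splits)
      then show "t \<in> C" using in_closed_iff_infdist_zero[OF closedC neC] by simp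
    qed
  qed
  have "(\<lambda>n. \<integral>x. u x \<partial>\<mu> (r n)) \<longlonglongrightarrow> (\<integral>x. u x \<partial>\<nu>)" if u: "continuous_on UNIV u" for u :: "'a \<Rightarrow> real"
  proof -
    obtain B where B: "B > 0" "\<And>x. \<bar>u x\<bar> \<le> B" using continuous_bounded[OF u] by blast
    have um: "u \<in> borel_measurable borel" using u by (rule borel_measurable_continuous_onI)
    have "continuous_on C (\<lambda>t. u (p t))" by (rule continuous_on_compose2[OF u p_cont]) auto
    then obtain g where g: "continuous_on UNIV g" "\<And>t. t \<in> C \<Longrightarrow> g t = u (p t)" "\<And>t. norm (g t) \<le> B"
      by (rule Tietze[of C "\<lambda>t. u (p t)" UNIV B]) (use closedC B in auto)
    have gs: "g (s x) = u x" for x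
    proof -
      have "s x \<in> C" unfolding C_def by (rule closure_subset[THEN subsetD]) auto
      then show ?thesis using g(2) p_s by simp
    qed
    have "(\<integral>x. u x \<partial>\<nu>) = (\<integral>t. u (\<pi> t) \<partial>N)" unfolding \<nu>_def by (rule integral_distr[OF \<pi>_N um])
    also have "\<dots> = (\<integral>t. g t \<partial>N)"
    proof (rule integral_cong_AE)
      show "(\<lambda>t. u (\<pi> t)) \<in> borel_measurable N" using measurable_compose[OF \<pi>_N um] .
      show "g \<in> borel_measurable N" using borel_measurable_continuous_onI[OF g(1)] by (simp cong: measurable_cong_sets)
      show "AE t in N. u (\<pi> t) = g t" using AE_C by eventually_elim (simp add: \<pi>_def g(2))
    qed
    finally show ?thesis using Mconv[OF g(1), of B] g(3) unfolding gs by simp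
  qed
  then show ?thesis using r \<nu> by blast
qed

section \<open>Closed sets, test functions and the weak* topology\<close>

lemma closed_outer_functions:
  assumes C: "closed (C :: 'a set)"
  shows "\<exists>v :: nat \<Rightarrow> 'a \<Rightarrow> real. (\<forall>n. continuous_on UNIV (v n)) \<and> (\<forall>n x. indicat_real C x \<le> v n x \<and> v n x \<le> 1)
    \<and> (\<forall>x. (\<lambda>n. v n x) \<longlonglongrightarrow> indicat_real C x)"
proof (cases "C = {}")
  case True
  then show ?thesis by (intro exI[of _ "\<lambda>_ _. 0"]) auto
next
  case False
  define v where "v n x = max 0 (1 - real n * infdist x C)" for n x
  have "continuous_on UNIV (v n)" for n unfolding v_def by (intro continuous_intros)
  moreover have "indicat_real C x \<le> v n x \<and> v n x \<le> 1" for n x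
    by (auto simp: v_def indicator_def infdist_nonneg)
  moreover have "(\<lambda>n. v n x) \<longlonglongrightarrow> indicat_real C x" for x
  proof (cases "x \<in> C")
    case True
    then show ?thesis by (simp add: v_def)
  next
    case xC: False
    then have pos: "infdist x C > 0" using infdist_pos_not_in_closed[OF C False] by simp
    obtain N where N: "real N > 1 / infdist x C" using reals_Archimedean2 by blast
    have "v n x = 0" if "n \<ge> N" for n
    proof -
      have "1 / infdist x C < real n" using N that by (meson less_le_trans of_nat_le_iff)
      then show ?thesis using pos by (simp add: v_def field_simps max_def)
    qed
    then have "\<forall>\<^sub>F n in sequentially. v n x = 0" by (auto simp: eventually_sequentially)
    then show ?thesis using xC by (simp add: tendsto_eventually)
  qed
  ultimately show ?thesis by blast
qed

lemma closed_outer_integral: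
  assumes C: "closed (C :: 'a set)" and \<mu>: "\<mu> \<in> prob_measures"
    and v: "\<And>n. continuous_on UNIV (v n)" "\<And>n x. indicat_real C x \<le> v n x \<and> v n x \<le> 1"
      "\<And>x. (\<lambda>n. v n x) \<longlonglongrightarrow> indicat_real C x"
  shows "(\<lambda>n. \<integral>x. v n x \<partial>\<mu>) \<longlonglongrightarrow> measure \<mu> C"
proof -
  interpret prob_space \<mu> using \<mu> by (auto simp: prob_measures_def)
  have s: "sets \<mu> = sets borel" using \<mu> by (auto simp: prob_measures_def)
  have "(\<lambda>n. \<integral>x. v n x \<partial>\<mu>) \<longlonglongrightarrow> (\<integral>x. indicat_real C x \<partial>\<mu>)"
  proof (rule integral_dominated_convergence[where w="\<lambda>_. 1"])
    show "v n \<in> borel_measurable \<mu>" for n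
      using borel_measurable_continuous_onI[OF v(1)] s by (simp cong: measurable_cong_sets)
    show "indicat_real C \<in> borel_measurable \<mu>" using C s by (intro borel_measurable_indicator) auto
    have "norm (v n x) \<le> 1" for n x
    proof -
      have "0 \<le> indicat_real C x" by simp
      then have "0 \<le> v n x" using v(2)[where n=n and x=x] by linarith
      then show ?thesis using v(2)[where n=n and x=x] by simp
    qed
    then show "AE x in \<mu>. norm (v n x) \<le> 1" for n by simp
  qed (use v(3) in auto)
  then show ?thesis using s C by (simp add: sets_eq_imp_space_eq[OF s])
qed

lemma closed_outer_approximation:
  assumes C: "closed (C :: 'a set)" and \<mu>: "\<mu> \<in> prob_measures" and e: "e > 0"
  obtains u :: "'a \<Rightarrow> real" where "continuous_on UNIV u" "\<And>x. indicat_real C x \<le> u x" "\<And>x. u x \<le> 1"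
    "(\<integral>x. u x \<partial>\<mu>) < measure \<mu> C + e"
proof -
  obtain v :: "nat \<Rightarrow> 'a \<Rightarrow> real" where v: "\<And>n. continuous_on UNIV (v n)" "\<And>n x. indicat_real C x \<le> v n x \<and> v n x \<le> 1"
    "\<And>x. (\<lambda>n. v n x) \<longlonglongrightarrow> indicat_real C x"
    using closed_outer_functions[OF C] by blast
  have "\<forall>\<^sub>F n in sequentially. (\<integral>x. v n x \<partial>\<mu>) < measure \<mu> C + e"
    using closed_outer_integral[OF C \<mu> v] by (rule order_tendstoD) (use e in auto)
  then obtain n where "(\<integral>x. v n x \<partial>\<mu>) < measure \<mu> C + e" by (auto simp: eventually_sequentially)
  then show ?thesis using v by (intro that[of "v n"]) auto
qed

lemma prob_measure_eqI_closed:
  assumes \<mu>: "\<mu> \<in> prob_measures" and \<nu>: "\<nu> \<in> prob_measures"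
    and eq: "\<And>C :: 'a set. closed C \<Longrightarrow> measure \<mu> C = measure \<nu> C"
  shows "\<mu> = \<nu>"
proof (rule measure_eqI_generator_eq[where \<Omega>=UNIV and E="Collect closed" and A="\<lambda>_. UNIV"])
  interpret \<mu>: prob_space \<mu> using \<mu> by (auto simp: prob_measures_def)
  interpret \<nu>: prob_space \<nu> using \<nu> by (auto simp: prob_measures_def)
  show "Int_stable (Collect closed :: 'a set set)" by (auto simp: Int_stable_def)
  show "emeasure \<mu> X = emeasure \<nu> X" if "X \<in> Collect closed" for X
    using eq that by (simp add: \<mu>.emeasure_eq_measure \<nu>.emeasure_eq_measure)
  show "sets \<mu> = sigma_sets UNIV (Collect closed)" "sets \<nu> = sigma_sets UNIV (Collect closed)"
    using \<mu> \<nu> by (auto simp: prob_measures_def borel_eq_closed)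
  show "emeasure \<mu> UNIV \<noteq> \<infinity>" by simp
qed auto

lemma prob_measure_eqI:
  assumes \<mu>: "\<mu> \<in> prob_measures" and \<nu>: "\<nu> \<in> prob_measures"
    and eq: "\<And>u :: 'a \<Rightarrow> real. continuous_on UNIV u \<Longrightarrow> (\<integral>x. u x \<partial>\<mu>) = (\<integral>x. u x \<partial>\<nu>)"
  shows "\<mu> = \<nu>"
proof (rule prob_measure_eqI_closed[OF \<mu> \<nu>])
  fix C :: "'a set" assume C: "closed C"
  obtain v :: "nat \<Rightarrow> 'a \<Rightarrow> real" where v: "\<And>n. continuous_on UNIV (v n)" "\<And>n x. indicat_real C x \<le> v n x \<and> v n x \<le> 1"
    "\<And>x. (\<lambda>n. v n x) \<longlonglongrightarrow> indicat_real C x"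
    using closed_outer_functions[OF C] by blast
  show "measure \<mu> C = measure \<nu> C"
    using closed_outer_integral[OF C \<mu> v] closed_outer_integral[OF C \<nu> v] eq[OF v(1)]
    by (intro LIMSEQ_unique) auto
qed

text \<open>The topology is given by a subbase; induction on its generation yields neighbourhoods
  described by finitely many test functions and one radius around \<mu>.\<close>

lemma weak_star_open_basic:
  assumes "openin weak_star_topology V" "\<mu> \<in> V"
  shows "\<exists>U r. finite U \<and> (\<forall>u\<in>U. continuous_on UNIV (u :: 'a \<Rightarrow> real)) \<and> r > 0 \<and>
    {\<nu> \<in> prob_measures. \<forall>u\<in>U. \<bar>(\<integral>x. u x \<partial>\<nu>) - (\<integral>x. u x \<partial>\<mu>)\<bar> < r} \<subseteq> V"
  using assms unfolding weak_star_topology_def openin_topology_generated_by_iff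
proof (induction rule: generate_topology_on.induct)
  case (Int A B)
  have "\<mu> \<in> A" "\<mu> \<in> B" using Int.prems by auto
  obtain U r where U: "finite U" "\<forall>u\<in>U. continuous_on UNIV (u :: 'a \<Rightarrow> real)" "r > 0"
    "{\<nu> \<in> prob_measures. \<forall>u\<in>U. \<bar>(\<integral>x. u x \<partial>\<nu>) - (\<integral>x. u x \<partial>\<mu>)\<bar> < r} \<subseteq> A"
    using Int.IH(1)[OF \<open>\<mu> \<in> A\<close>] by blast
  obtain U' r' where U': "finite U'" "\<forall>u\<in>U'. continuous_on UNIV (u :: 'a \<Rightarrow> real)" "r' > 0"
    "{\<nu> \<in> prob_measures. \<forall>u\<in>U'. \<bar>(\<integral>x. u x \<partial>\<nu>) - (\<integral>x. u x \<partial>\<mu>)\<bar> < r'} \<subseteq> B"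
    using Int.IH(2)[OF \<open>\<mu> \<in> B\<close>] by blast
  show ?case using U U' by (intro exI[of _ "U \<union> U'"] exI[of _ "min r r'"]) auto
next
  case (UN K)
  then obtain A where A: "A \<in> K" "\<mu> \<in> A" by auto
  from UN.IH[OF this] show ?case using A by (meson Union_upper order_trans)
next
  case (Basis S)
  then obtain u W where u: "continuous_on UNIV (u :: 'a \<Rightarrow> real)" "open W" "S = {\<nu> \<in> prob_measures. (\<integral>x. u x \<partial>\<nu>) \<in> W}" by blast
  have "(\<integral>x. u x \<partial>\<mu>) \<in> W" 
  proof -
    have "\<mu> \<in> {\<nu> \<in> prob_measures. (\<integral>x. u x \<partial>\<nu>) \<in> W}" using Basis.prems by (simp only: u(3))
    then show ?thesis by (rule CollectE) (erule conjunct2)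
  qed
  then obtain r where r: "r > 0" "ball (\<integral>x. u x \<partial>\<mu>) r \<subseteq> W" using openE[OF u(2)] by metis
  have "\<nu> \<in> S" if "\<nu> \<in> prob_measures" "\<bar>(\<integral>x. u x \<partial>\<nu>) - (\<integral>x. u x \<partial>\<mu>)\<bar> < r" for \<nu>
  proof -
    have "(\<integral>x. u x \<partial>\<nu>) \<in> ball (\<integral>x. u x \<partial>\<mu>) r"
      using that(2) by (simp add: dist_real_def abs_minus_commute)
    then show ?thesis unfolding u(3) using that(1) r(2) by blast
  qed
  then have "{\<nu> \<in> prob_measures. \<forall>u\<in>{u}. \<bar>(\<integral>x. u x \<partial>\<nu>) - (\<integral>x. u x \<partial>\<mu>)\<bar> < r} \<subseteq> S" by blast
  then show ?case using u(1) r(1) by (intro exI[of _ "{u}"] exI[of _ r]) simp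
qed auto

lemma openin_basic:
  assumes u: "continuous_on UNIV (u :: 'a \<Rightarrow> real)"
  shows "openin weak_star_topology {\<nu> \<in> prob_measures. \<bar>(\<integral>x. u x \<partial>\<nu>) - c\<bar> < r}"
proof -
  have "{\<nu> \<in> prob_measures. \<bar>(\<integral>x. u x \<partial>\<nu>) - c\<bar> < r} = {\<nu> \<in> prob_measures. (\<integral>x. u x \<partial>\<nu>) \<in> ball c r}"
    by (auto simp: dist_real_def abs_minus_commute)
  moreover have "\<dots> \<in> {{\<mu> \<in> prob_measures. (\<integral>x. u x \<partial>\<mu>) \<in> U} | u U. continuous_on UNIV (u :: 'a \<Rightarrow> real) \<and> open U}"
    using u by blast
  ultimately show ?thesis unfolding weak_star_topology_def by (simp add: topology_generated_by_Basis)
qed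

lemma basic_neighbourhood:
  assumes \<mu>: "\<mu> \<in> prob_measures" and U: "finite U" "\<And>u. u \<in> U \<Longrightarrow> continuous_on UNIV (u :: 'a \<Rightarrow> real)" and r: "r > 0"
  shows "weak_star_neighbourhood {\<nu> \<in> prob_measures. \<forall>u\<in>U. \<bar>(\<integral>x. u x \<partial>\<nu>) - (\<integral>x. u x \<partial>\<mu>)\<bar> < r} \<mu>"
proof -
  let ?V = "\<lambda>u. {\<nu> \<in> prob_measures. \<bar>(\<integral>x. u x \<partial>\<nu>) - (\<integral>x. u x \<partial>\<mu>)\<bar> < r}"
  have "openin weak_star_topology (prob_measures \<inter> (\<Inter>u\<in>U. ?V u))"
  proof (cases "U = {}")
    case False
    have "openin weak_star_topology (?V u)" if "u \<in> U" for u by (rule openin_basic[OF U(2)[OF that]])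
    then have "openin weak_star_topology (\<Inter>u\<in>U. ?V u)"
      by (rule openin_INT2[OF U(1) False])
    moreover have "openin weak_star_topology (prob_measures :: 'a measure set)"
      by (metis openin_topspace topspace_weak_star_topology)
    ultimately show ?thesis by (rule openin_Int[rotated])
  next
    case True
    have "openin weak_star_topology (prob_measures :: 'a measure set)"
      by (metis openin_topspace topspace_weak_star_topology)
    then show ?thesis using True by simp
  qed
  then show ?thesis unfolding weak_star_neighbourhood_def using \<mu> r
    by (intro conjI exI[of _ "prob_measures \<inter> (\<Inter>u\<in>U. ?V u)"]) auto
qed

lemma continuous_map_sequentially:
  fixes \<Xi> :: "'a measure \<Rightarrow> 'y::topological_space"
  assumes \<Xi>: "continuous_map weak_star_topology euclidean \<Xi>" and \<nu>: "\<nu> \<in> prob_measures"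
    and \<mu>: "\<And>n. \<mu> n \<in> prob_measures"
    and conv: "\<And>u :: 'a \<Rightarrow> real. continuous_on UNIV u \<Longrightarrow> (\<lambda>n. \<integral>x. u x \<partial>\<mu> n) \<longlonglongrightarrow> (\<integral>x. u x \<partial>\<nu>)"
  shows "(\<lambda>n. \<Xi> (\<mu> n)) \<longlonglongrightarrow> \<Xi> \<nu>"
proof (rule topological_tendstoI)
  fix W assume W: "open W" "\<Xi> \<nu> \<in> W"
  let ?V = "{\<mu> \<in> prob_measures. \<Xi> \<mu> \<in> W}"
  have "openin weak_star_topology ?V"
    using openin_continuous_map_preimage[OF \<Xi>, of W] W by (simp add: topspace_weak_star_topology)
  then obtain U r where U: "finite U" "\<forall>u\<in>U. continuous_on UNIV (u :: 'a \<Rightarrow> real)" "r > 0"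
    "{\<mu> \<in> prob_measures. \<forall>u\<in>U. \<bar>(\<integral>x. u x \<partial>\<mu>) - (\<integral>x. u x \<partial>\<nu>)\<bar> < r} \<subseteq> ?V"
    using weak_star_open_basic[of ?V \<nu>] W \<nu> by auto
  have "\<forall>\<^sub>F n in sequentially. \<forall>u\<in>U. \<bar>(\<integral>x. u x \<partial>\<mu> n) - (\<integral>x. u x \<partial>\<nu>)\<bar> < r"
    using U(1)
  proof (rule eventually_ball_finite, intro ballI)
    fix u assume "u \<in> U"
    then show "\<forall>\<^sub>F n in sequentially. \<bar>(\<integral>x. u x \<partial>\<mu> n) - (\<integral>x. u x \<partial>\<nu>)\<bar> < r"
      using tendstoD[OF conv U(3)] U(2) by (auto simp: dist_real_def)
  qed
  then show "\<forall>\<^sub>F n in sequentially. \<Xi> (\<mu> n) \<in> W"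
    by eventually_elim (use U(4) \<mu> in blast)
qed

section \<open>Empirical measures and their limits\<close>

lemma empirical_prob: "n \<ge> 1 \<Longrightarrow> empirical T n x \<in> prob_measures"
  unfolding prob_measures_def empirical_def
  by (auto intro!: prob_space.prob_space_distr prob_space_uniform_count_measure
      simp: measurable_def sets_uniform_count_measure space_uniform_count_measure lessThan_empty_iff)

lemma integral_empirical:
  fixes u :: "'a \<Rightarrow> real"
  assumes n: "n \<ge> 1" and u: "u \<in> borel_measurable borel"
  shows "(\<integral>y. u y \<partial>empirical T n x) = (\<Sum>k<n. u ((T ^^ k) x)) / real n"
proof -
  have "(\<integral>y. u y \<partial>empirical T n x) = (\<integral>k. u ((T ^^ k) x) \<partial>uniform_count_measure {..<n})"
    unfolding empirical_def by (rule integral_distr[OF _ u])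
      (auto simp: measurable_def sets_uniform_count_measure space_uniform_count_measure)
  also have "\<dots> = (\<Sum>k<n. u ((T ^^ k) x)) / real n"
    unfolding uniform_count_measure_def
    by (subst lebesgue_integral_point_measure_finite) (use n in \<open>auto simp: sum_divide_distrib\<close>)
  finally show ?thesis .
qed

text \<open>Composing with \<open>T\<close> changes a Birkhoff sum of \<open>u\<close> only in its
  two end terms, so the integrals of \<open>u\<close> and of its composition with \<open>T\<close>
  differ by at most \<open>2 * B / real (r n)\<close>.\<close>

lemma empirical_limit_invariant:
  assumes \<mu>: "\<mu> \<in> prob_measures" and r: "filterlim r at_top sequentially"
    and conv: "\<And>u :: 'a \<Rightarrow> real. continuous_on UNIV u \<Longrightarrow> (\<lambda>n. \<integral>y. u y \<partial>empirical T (r n) x) \<longlonglongrightarrow> (\<integral>y. u y \<partial>\<mu>)"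
  shows "\<mu> \<in> invariant_measures T"
proof -
  have s: "sets \<mu> = sets borel" using \<mu> by (auto simp: prob_measures_def)
  have Tm: "T \<in> measurable \<mu> borel" using T_measurable s by (simp cong: measurable_cong_sets)
  have d: "distr \<mu> borel T \<in> prob_measures"
    using \<mu> Tm by (auto simp: prob_measures_def intro: prob_space.prob_space_distr)
  have "distr \<mu> borel T = \<mu>"
  proof (rule prob_measure_eqI[OF d \<mu>])
    fix u :: "'a \<Rightarrow> real" assume u: "continuous_on UNIV u"
    have um: "u \<in> borel_measurable borel" using u by (rule borel_measurable_continuous_onI)
    have uT: "continuous_on UNIV (\<lambda>y. u (T y))" by (rule continuous_on_compose2[OF u continuous_T]) auto
    obtain B where B: "B > 0" "\<And>x. \<bar>u x\<bar> \<le> B" using continuous_bounded[OF u] by blast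
    have diff: "(\<integral>y. u (T y) \<partial>empirical T n x) - (\<integral>y. u y \<partial>empirical T n x) = (u ((T ^^ n) x) - u x) / real n"
      if n: "n \<ge> 1" for n
    proof -
      have "(\<Sum>k<n. u (T ((T ^^ k) x))) - (\<Sum>k<n. u ((T ^^ k) x)) = u ((T ^^ n) x) - u x"
        using sum_lessThan_telescope[of "\<lambda>k. u ((T ^^ k) x)" n] by (simp add: sum_subtractf)
      then show ?thesis using n um borel_measurable_continuous_onI[OF uT]
        by (simp add: integral_empirical diff_divide_distrib[symmetric])
    qed
    have "(\<lambda>n. (\<integral>y. u (T y) \<partial>empirical T (r n) x) - (\<integral>y. u y \<partial>empirical T (r n) x)) \<longlonglongrightarrow> 0"
    proof (rule Lim_null_comparison)
      show "\<forall>\<^sub>F n in sequentially. norm ((\<integral>y. u (T y) \<partial>empirical T (r n) x) - (\<integral>y. u y \<partial>empirical T (r n) x)) \<le> 2 * B / real (r n)"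
        using filterlim_at_top[THEN iffD1, rule_format, OF r, of 1]
      proof eventually_elim
        case (elim n)
        have "\<bar>u ((T ^^ r n) x) - u x\<bar> \<le> 2 * B" using B(2)[of "(T ^^ r n) x"] B(2)[of x] by linarith
        then show ?case unfolding diff[OF elim] by (simp add: abs_divide divide_right_mono)
      qed
      have "filterlim (\<lambda>n. real (r n)) at_top sequentially"
        using filterlim_compose[OF filterlim_real_sequentially r] .
      then show "(\<lambda>n. 2 * B / real (r n)) \<longlonglongrightarrow> 0" 
        by (intro tendsto_divide_0[OF tendsto_const] filterlim_at_top_imp_at_infinity)
    qed
    then have "(\<integral>y. u (T y) \<partial>\<mu>) - (\<integral>y. u y \<partial>\<mu>) = 0"
      using tendsto_diff[OF conv[OF uT] conv[OF u]] LIMSEQ_unique by blast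
    moreover have "(\<integral>y. u y \<partial>distr \<mu> borel T) = (\<integral>y. u (T y) \<partial>\<mu>)" by (rule integral_distr[OF Tm um])
    ultimately show "(\<integral>y. u y \<partial>distr \<mu> borel T) = (\<integral>y. u y \<partial>\<mu>)" by simp
  qed
  then show ?thesis using \<mu> by (simp add: invariant_measures_def)
qed

end

section \<open>The ergodic theorem\<close>

definition time_avg :: "('a \<Rightarrow> 'a) \<Rightarrow> ('a \<Rightarrow> real) \<Rightarrow> 'a \<Rightarrow> real" where
  "time_avg T F x = lim (\<lambda>n. birkhoff_sum T F n x / real n)"

locale pmp = prob_space \<mu> for \<mu> :: "'a::topological_space measure" +
  fixes T :: "'a \<Rightarrow> 'a"
  assumes sets_\<mu> [measurable_cong]: "sets \<mu> = sets borel"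
    and T_meas [measurable]: "T \<in> borel_measurable borel"
    and T_preserves: "distr \<mu> borel T = \<mu>"
begin

lemma space_\<mu>: "space \<mu> = UNIV" using sets_eq_imp_space_eq[OF sets_\<mu>] by simp

lemma funpow_meas [measurable]: "T ^^ n \<in> borel_measurable borel"
proof (induction n)
  case (Suc n)
  have "T \<circ> (T ^^ n) \<in> borel_measurable borel" by (rule measurable_comp[OF Suc T_meas])
  then show ?case by simp
qed simp

lemma birkhoff_sum_meas [measurable]:
  assumes [measurable]: "F \<in> borel_measurable borel"
  shows "birkhoff_sum T F n \<in> borel_measurable borel"
proof -
  have "(\<lambda>x. F ((T ^^ i) x)) \<in> borel_measurable borel" for i
    by (rule measurable_compose[OF funpow_meas]) simp
  then show ?thesis unfolding birkhoff_sum_def by (intro borel_measurable_sum) auto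
qed

lemma integrable_bounded:
  fixes F :: "'a \<Rightarrow> real"
  assumes "F \<in> borel_measurable borel" "\<And>x. \<bar>F x\<bar> \<le> B"
  shows "integrable \<mu> F"
proof (rule integrable_const_bound[of _ B])
  show "F \<in> borel_measurable \<mu>" using assms(1) by (simp cong: measurable_cong_sets[OF sets_\<mu> refl])
qed (use assms in auto)

lemma integral_T:
  fixes F :: "'a \<Rightarrow> real"
  assumes "F \<in> borel_measurable borel"
  shows "(\<integral>x. F (T x) \<partial>\<mu>) = (\<integral>x. F x \<partial>\<mu>)"
proof -
  have "T \<in> measurable \<mu> borel" using T_meas by (simp cong: measurable_cong_sets[OF sets_\<mu> refl])
  from integral_distr[OF this assms] show ?thesis by (simp add: T_preserves)
qed

lemma integral_funpow:
  fixes F :: "'a \<Rightarrow> real"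
  assumes F: "F \<in> borel_measurable borel"
  shows "(\<integral>x. F ((T ^^ n) x) \<partial>\<mu>) = (\<integral>x. F x \<partial>\<mu>)"
proof (induction n)
  case (Suc n)
  have "(\<lambda>x. F ((T ^^ n) x)) \<in> borel_measurable borel" by (rule measurable_compose[OF funpow_meas F])
  from integral_T[OF this] Suc show ?case by (simp add: funpow_swap1)
qed simp

text \<open>The maximum of the Birkhoff sums of lengths 0 to \<open>N\<close>, written recursively
  so that it can be compared directly with its value at \<open>T x\<close>.\<close>

primrec running_max :: "('a \<Rightarrow> real) \<Rightarrow> nat \<Rightarrow> 'a \<Rightarrow> real" where
  "running_max F 0 x = 0"
| "running_max F (Suc N) x = max 0 (F x + running_max F N (T x))"

lemma birkhoff_sum_Suc_shift: "birkhoff_sum T F (Suc n) x = F x + birkhoff_sum T F n (T x)"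
  unfolding birkhoff_sum_def by (subst sum.lessThan_Suc_shift) (simp add: funpow_swap1)

lemma running_max_nonneg: "0 \<le> running_max F N x"
  by (cases N) auto

lemma running_max_mono: "running_max F N x \<le> running_max F (Suc N) x"
proof (induction N arbitrary: x)
  case (Suc N)
  show ?case using Suc[of "T x"] by simp
qed simp

lemma running_max_ge: "n \<le> N \<Longrightarrow> birkhoff_sum T F n x \<le> running_max F N x"
proof (induction N arbitrary: n x)
  case 0 then show ?case by (simp add: birkhoff_sum_def)
next
  case (Suc N)
  show ?case
  proof (cases n)
    case 0 then show ?thesis by (simp add: birkhoff_sum_def)
  next
    case (Suc m)
    then have "birkhoff_sum T F m (T x) \<le> running_max F N (T x)" using Suc.IH Suc.prems by auto
    then show ?thesis unfolding Suc birkhoff_sum_Suc_shift by simp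
  qed
qed

lemma running_max_attained: "\<exists>n\<le>N. running_max F N x = birkhoff_sum T F n x"
proof (induction N arbitrary: x)
  case 0 then show ?case by (simp add: birkhoff_sum_def)
next
  case (Suc N)
  obtain n where n: "n \<le> N" "running_max F N (T x) = birkhoff_sum T F n (T x)" using Suc by blast
  show ?case
  proof (cases "F x + running_max F N (T x) \<ge> 0")
    case True
    then show ?thesis using n by (intro exI[of _ "Suc n"]) (simp add: birkhoff_sum_Suc_shift)
  next
    case False
    then show ?thesis by (intro exI[of _ 0]) (simp add: birkhoff_sum_def)
  qed
qed

lemma running_max_meas:
  assumes [measurable]: "F \<in> borel_measurable borel"
  shows "running_max F N \<in> borel_measurable borel"
proof (induction N)
  case (Suc N)
  have "(\<lambda>x. running_max F N (T x)) \<in> borel_measurable borel" by (rule measurable_compose[OF T_meas Suc])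
  then show ?case by simp
qed simp

lemma running_max_bounded:
  assumes "\<And>x. \<bar>F x\<bar> \<le> B"
  shows "\<bar>running_max F N x\<bar> \<le> real N * B"
proof (induction N arbitrary: x)
  case (Suc N)
  have "0 \<le> B" using assms[of x] by simp
  moreover have "0 \<le> real N * B" using \<open>0 \<le> B\<close> by simp
  ultimately show ?case using assms[of x] Suc[of "T x"] by (auto simp: algebra_simps max_def abs_le_iff)
qed simp

text \<open>Garsia's proof of the maximal ergodic theorem.\<close>

lemma maximal_ergodic:
  assumes F [measurable]: "F \<in> borel_measurable borel" and B: "\<And>x. \<bar>F x\<bar> \<le> B"
    and E: "E = {x. \<exists>n. 0 < birkhoff_sum T F n x}"
  shows "0 \<le> (\<integral>x. F x * indicat_real E x \<partial>\<mu>)"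
proof -
  have B0: "0 \<le> B" using B[of undefined] by simp
  define EN where "EN N = {x. 0 < running_max F N x}" for N
  have M [measurable]: "running_max F N \<in> borel_measurable borel" for N by (rule running_max_meas[OF F])
  have EN_sets [measurable]: "EN N \<in> sets borel" for N
    using measurable_sets[OF M[of N], of "{0<..}"] by (simp add: EN_def vimage_def)
  have pos: "0 \<le> (\<integral>x. F x * indicat_real (EN N) x \<partial>\<mu>)" for N
  proof -
    have MT: "(\<lambda>x. running_max F N (T x)) \<in> borel_measurable borel" by (rule measurable_compose[OF T_meas M])
    have i1: "integrable \<mu> (running_max F N)" by (rule integrable_bounded[OF M]) (rule running_max_bounded[OF B])
    have i2: "integrable \<mu> (\<lambda>x. running_max F N (T x))" by (rule integrable_bounded[OF MT]) (rule running_max_bounded[OF B])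
    have i3: "integrable \<mu> (\<lambda>x. F x * indicat_real (EN N) x)"
      by (rule integrable_bounded[of _ B]) (use B B0 in \<open>auto simp: indicator_def\<close>)
    have "0 = (\<integral>x. running_max F N x - running_max F N (T x) \<partial>\<mu>)"
      using i1 i2 integral_T[OF M] by simp
    also have "\<dots> \<le> (\<integral>x. F x * indicat_real (EN N) x \<partial>\<mu>)"
    proof (rule integral_mono)
      \<comment> \<open>Where the maximum is positive it equals \<open>F x\<close> plus a shorter
        maximum at \<open>T x\<close>; elsewhere it is 0 and the difference is nonpositive.\<close>
      show "running_max F N x - running_max F N (T x) \<le> F x * indicat_real (EN N) x" for x
      proof (cases "x \<in> EN N")
        case True
        then obtain m where m: "N = Suc m" by (cases N) (auto simp: EN_def)
        have "running_max F N x = F x + running_max F m (T x)" using True unfolding m by (auto simp: EN_def max_def split: if_splits)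
        also have "\<dots> \<le> F x + running_max F N (T x)" unfolding m using running_max_mono[of F m "T x"] by simp
        finally show ?thesis using True by simp
      next
        case False
        then show ?thesis using running_max_nonneg[of F N "T x"] by (simp add: EN_def)
      qed
    qed (use i1 i2 i3 in auto)
    finally show ?thesis .
  qed
  have "(\<lambda>N. \<integral>x. F x * indicat_real (EN N) x \<partial>\<mu>) \<longlonglongrightarrow> (\<integral>x. F x * indicat_real E x \<partial>\<mu>)"
  proof (rule integral_dominated_convergence[where w="\<lambda>_. B"])
    have "(\<lambda>N. indicat_real (EN N) x) \<longlonglongrightarrow> indicat_real E x" for x
    proof (cases "x \<in> E")
      case True
      then obtain n where n: "0 < birkhoff_sum T F n x" by (auto simp: E)
      have "x \<in> EN N" if "N \<ge> n" for N using running_max_ge[OF that, of F x] n by (simp add: EN_def)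
      then have "\<forall>\<^sub>F N in sequentially. indicat_real (EN N) x = indicat_real E x"
        using True by (auto simp: eventually_sequentially intro!: exI[of _ n])
      then show ?thesis by (rule tendsto_eventually)
    next
      case False
      have "x \<notin> EN N" for N
      proof
        assume "x \<in> EN N"
        moreover obtain n where "running_max F N x = birkhoff_sum T F n x" using running_max_attained by blast
        ultimately show False using False by (auto simp: EN_def E)
      qed
      then show ?thesis using False by simp
    qed
    then show "AE x in \<mu>. (\<lambda>N. F x * indicat_real (EN N) x) \<longlonglongrightarrow> F x * indicat_real E x"
      by (auto intro!: tendsto_mult)
    have "E = (\<Union>n. {x. 0 < birkhoff_sum T F n x})" by (auto simp: E)
    moreover have "{x. 0 < birkhoff_sum T F n x} \<in> sets borel" for n
      using measurable_sets[OF birkhoff_sum_meas[OF F], of "{0<..}" n] by (simp add: vimage_def)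
    ultimately have [measurable]: "E \<in> sets borel" by auto
    show "(\<lambda>x. F x * indicat_real E x) \<in> borel_measurable \<mu>" by measurable
  qed (use B B0 in \<open>auto simp: indicator_def\<close>)
  then show ?thesis by (rule LIMSEQ_le_const) (use pos in auto)
qed

section \<open>Pointwise convergence of time averages\<close>

lemma avg_T_diff:
  assumes B: "\<And>x. \<bar>F x\<bar> \<le> B"
  shows "\<bar>birkhoff_sum T F n (T x) / real n - birkhoff_sum T F n x / real n\<bar> \<le> 2 * B / real n"
proof -
  have "birkhoff_sum T F n (T x) - birkhoff_sum T F n x = F ((T ^^ n) x) - F x"
    using birkhoff_sum_Suc_shift[of F n x] by (simp add: birkhoff_sum_def)
  then have "\<bar>birkhoff_sum T F n (T x) - birkhoff_sum T F n x\<bar> \<le> 2 * B"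
    using B[of "(T ^^ n) x"] B[of x] by linarith
  then show ?thesis by (simp add: diff_divide_distrib[symmetric] abs_divide divide_right_mono)
qed

lemma avg_T_tendsto:
  assumes B: "\<And>x. \<bar>F x\<bar> \<le> B"
  shows "(\<lambda>n. birkhoff_sum T F n (T x) / real n - birkhoff_sum T F n x / real n) \<longlonglongrightarrow> 0"
proof (rule Lim_null_comparison)
  show "\<forall>\<^sub>F n in sequentially. norm (birkhoff_sum T F n (T x) / real n - birkhoff_sum T F n x / real n) \<le> 2 * B / real n"
    using avg_T_diff[of F B _ x, OF B] by (intro always_eventually) (auto simp del: of_nat_Suc)
  show "(\<lambda>n. 2 * B / real n) \<longlonglongrightarrow> 0" by (rule lim_const_over_n)
qed

lemma avg_bounded:
  assumes B: "\<And>x. \<bar>F x\<bar> \<le> B"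
  shows "\<bar>birkhoff_sum T F n x / real n\<bar> \<le> B"
proof (cases "n = 0")
  case False
  have "\<bar>birkhoff_sum T F n x\<bar> \<le> (\<Sum>i<n. \<bar>F ((T ^^ i) x)\<bar>)" unfolding birkhoff_sum_def by (rule sum_abs)
  also have "\<dots> \<le> (\<Sum>i<n. B)" by (rule sum_mono) (rule B)
  finally show ?thesis using False by (simp add: abs_divide field_simps)
qed (use B[of x] in simp)

text \<open>Valid at every point: the averages along \<open>x\<close> and \<open>T x\<close> have
  the same limits, so \<open>lim\<close> returns the same value even where neither converges. Level
  sets of \<open>time_avg\<close> are thereby exactly invariant, not just up to null sets.\<close>

lemma time_avg_T:
  assumes B: "\<And>x. \<bar>F x\<bar> \<le> B"
  shows "time_avg T F (T x) = time_avg T F x"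
proof -
  have "(\<lambda>n. birkhoff_sum T F n (T x) / real n) \<longlonglongrightarrow> L \<longleftrightarrow> (\<lambda>n. birkhoff_sum T F n x / real n) \<longlonglongrightarrow> L" for L
    using Lim_transform_eq[OF avg_T_tendsto[of F B x, OF B]] by blast
  then show ?thesis unfolding time_avg_def lim_def by simp
qed

lemma time_avg_meas [measurable]:
  assumes [measurable]: "F \<in> borel_measurable borel"
  shows "time_avg T F \<in> borel_measurable borel"
  unfolding time_avg_def by (intro borel_measurable_lim_metric) simp

text \<open>The set where the upper limit of the averages exceeds \<open>b\<close>. The margin
  \<open>1 / Suc k\<close> expresses strictness by countable operations and leaves room for
  perturbations.\<close>

definition upper_set :: "('a \<Rightarrow> real) \<Rightarrow> real \<Rightarrow> 'a set" where
  "upper_set F b = {x. \<exists>k. \<forall>N. \<exists>n\<ge>N. birkhoff_sum T F n x / real n > b + 1 / real (Suc k)}"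

lemma upper_set_borel [measurable]:
  assumes [measurable]: "F \<in> borel_measurable borel"
  shows "upper_set F b \<in> sets borel"
proof -
  have "upper_set F b = (\<Union>k. \<Inter>N. \<Union>n\<in>{N..}. {x. birkhoff_sum T F n x / real n > b + 1 / real (Suc k)})"
    unfolding upper_set_def by (intro set_eqI) (simp add: Bex_def)
  moreover have "{x. birkhoff_sum T F n x / real n > b + 1 / real (Suc k)} \<in> sets borel" for n k
  proof -
    have "(\<lambda>x. birkhoff_sum T F n x / real n) \<in> borel_measurable borel" by simp
    from measurable_sets[OF this, of "{b + 1 / real (Suc k)<..}"] show ?thesis by (simp add: vimage_def)
  qed
  ultimately show ?thesis by (auto intro!: sets.countable_UN sets.countable_INT)
qed

text \<open>The margin \<open>1 / Suc k\<close> shrinks to \<open>1 / Suc (Suc k)\<close>, and the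
  difference absorbs the null sequence.\<close>

lemma upper_set_perturb:
  assumes close: "(\<lambda>n. p n - q n) \<longlonglongrightarrow> (0::real)" and "\<exists>k. \<forall>N. \<exists>n\<ge>N. p n > b + 1 / real (Suc k)"
  shows "\<exists>k. \<forall>N. \<exists>n\<ge>N. q n > b + 1 / real (Suc k)"
proof -
  obtain k where k: "\<And>N. \<exists>n\<ge>N. p n > b + 1 / real (Suc k)" using assms(2) by blast
  have e: "1 / real (Suc k) - 1 / real (Suc (Suc k)) > 0"
    using divide_strict_left_mono[of "real (Suc k)" "real (Suc (Suc k))" 1] by simp
  obtain N0 where N0: "\<And>n. n \<ge> N0 \<Longrightarrow> \<bar>p n - q n\<bar> < 1 / real (Suc k) - 1 / real (Suc (Suc k))"
    using LIMSEQ_D[OF close e] by auto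
  show ?thesis
  proof (rule exI[of _ "Suc k"], rule allI)
    fix N
    obtain n where "n \<ge> max N N0" "p n > b + 1 / real (Suc k)" using k by blast
    then show "\<exists>n\<ge>N. q n > b + 1 / real (Suc (Suc k))"
      using N0[of n] by (intro exI[of _ n]) auto
  qed
qed

lemma upper_set_invariant:
  assumes B: "\<And>x. \<bar>F x\<bar> \<le> B"
  shows "T x \<in> upper_set F b \<longleftrightarrow> x \<in> upper_set F b"
  unfolding upper_set_def mem_Collect_eq
  using upper_set_perturb[OF avg_T_tendsto[of F B x, OF B]] upper_set_perturb[OF tendsto_minus[OF avg_T_tendsto[of F B x, OF B], simplified]]
  by blast

lemma birkhoff_sum_invariant:
  assumes "\<And>x. T x \<in> E \<longleftrightarrow> x \<in> E"
  shows "birkhoff_sum T (\<lambda>x. G x * indicat_real E x) n x = birkhoff_sum T G n x * indicat_real E x"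
proof -
  have "(T ^^ i) x \<in> E \<longleftrightarrow> x \<in> E" for i by (induction i) (auto simp: assms)
  then show ?thesis by (simp add: birkhoff_sum_def indicator_def sum_distrib_right)
qed

text \<open>The maximal inequality for \<open>F - b\<close> cut off to \<open>E\<close>. By
  invariance the sums vanish off \<open>E\<close>, and on \<open>E\<close> some average exceeds
  \<open>b\<close>; so \<open>E\<close> is precisely the set where some sum is positive.\<close>

lemma upper_integral:
  assumes F [measurable]: "F \<in> borel_measurable borel" and B: "\<And>x. \<bar>F x\<bar> \<le> B"
    and E: "E \<in> sets borel" "\<And>x. T x \<in> E \<longleftrightarrow> x \<in> E" "E \<subseteq> upper_set F b"
  shows "b * measure \<mu> E \<le> (\<integral>x. F x * indicat_real E x \<partial>\<mu>)"
proof -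
  let ?G = "\<lambda>x. (F x - b) * indicat_real E x"
  have [measurable]: "E \<in> sets borel" by fact
  have bd: "\<bar>?G x\<bar> \<le> B + \<bar>b\<bar>" for x using B[of x] by (auto simp: indicator_def)
  have bs: "birkhoff_sum T ?G n x = (birkhoff_sum T F n x - real n * b) * indicat_real E x" for n x
    unfolding birkhoff_sum_invariant[OF E(2)] by (simp add: birkhoff_sum_def sum_subtractf)
  have "{x. \<exists>n. 0 < birkhoff_sum T ?G n x} = E"
  proof
    show "{x. \<exists>n. 0 < birkhoff_sum T ?G n x} \<subseteq> E" unfolding bs by (auto simp: indicator_def split: if_splits)
    show "E \<subseteq> {x. \<exists>n. 0 < birkhoff_sum T ?G n x}"
    proof
      fix x assume x: "x \<in> E"
      then obtain k where "\<forall>N. \<exists>n\<ge>N. birkhoff_sum T F n x / real n > b + 1 / real (Suc k)"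
        using E(3) by (auto simp: upper_set_def)
      then obtain n where n: "n \<ge> 1" "birkhoff_sum T F n x / real n > b + 1 / real (Suc k)" by blast
      have "1 / real (Suc k) > 0" by simp
      then have "birkhoff_sum T F n x / real n > b" using n(2) by linarith
      then show "x \<in> {x. \<exists>n. 0 < birkhoff_sum T ?G n x}" unfolding bs using n(1) x by (auto simp: field_simps)
    qed
  qed
  then have "0 \<le> (\<integral>x. ?G x * indicat_real E x \<partial>\<mu>)" by (intro maximal_ergodic[OF _ bd]) auto
  also have "\<dots> = (\<integral>x. F x * indicat_real E x - b * indicat_real E x \<partial>\<mu>)"
    by (rule Bochner_Integration.integral_cong) (auto simp: indicator_def)
  also have "\<dots> = (\<integral>x. F x * indicat_real E x \<partial>\<mu>) - (\<integral>x. b * indicat_real E x \<partial>\<mu>)"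
  proof (rule Bochner_Integration.integral_diff)
    show "integrable \<mu> (\<lambda>x. F x * indicat_real E x)"
      by (rule integrable_bounded[of _ B]) (use B order_trans[OF abs_ge_zero B] in \<open>auto simp: indicator_def\<close>)
    show "integrable \<mu> (\<lambda>x. b * indicat_real E x)"
      by (rule integrable_bounded[of _ "\<bar>b\<bar>"]) (auto simp: indicator_def)
  qed
  finally show ?thesis by (simp add: space_\<mu>)
qed

text \<open>Two rationals are placed strictly between the lower and the upper limit; the conclusion
  has the form of membership in \<open>upper_set\<close>, once for \<open>p\<close> and once for
  \<open>- p\<close>.\<close>

lemma bounded_nonconvergent:
  fixes p :: "nat \<Rightarrow> real"
  assumes bd: "\<And>n. \<bar>p n\<bar> \<le> B" and nc: "\<not> convergent p"
  shows "\<exists>a b :: rat. a < b \<and> (\<exists>k. \<forall>N. \<exists>n\<ge>N. p n > of_rat b + 1 / real (Suc k)) \<and>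
    (\<exists>k. \<forall>N. \<exists>n\<ge>N. - p n > - of_rat a + 1 / real (Suc k))"
proof -
  let ?p = "\<lambda>n. ereal (p n)"
  have lt: "liminf ?p < limsup ?p"
  proof (rule ccontr)
    assume "\<not> ?thesis"
    then have eq: "liminf ?p = limsup ?p" using Liminf_le_Limsup[of sequentially ?p] by simp
    have "limsup ?p \<le> ereal B" by (rule Limsup_bounded) (use bd in \<open>auto simp: abs_le_iff\<close>)
    moreover have "ereal (-B) \<le> liminf ?p" by (rule Liminf_bounded) (use bd in \<open>auto simp: abs_le_iff minus_le_iff\<close>)
    ultimately obtain L where L: "liminf ?p = ereal L" using eq by (cases "limsup ?p") auto
    have "?p \<longlonglongrightarrow> ereal L"
      by (rule Liminf_eq_Limsup) (use eq L in auto)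
    then have "p \<longlonglongrightarrow> L" by simp
    then show False using nc by (auto simp: convergent_def)
  qed
  obtain u where u: "liminf ?p < ereal u" "ereal u < limsup ?p" using ereal_dense2[OF lt] by blast
  obtain v where v: "ereal u < ereal v" "ereal v < limsup ?p" using ereal_dense2[OF u(2)] by blast
  obtain a where a: "u < of_rat a" "of_rat a < (u + v) / 2" using of_rat_dense[of u "(u + v) / 2"] v by auto
  obtain b where b: "(u + v) / 2 < of_rat b" "of_rat b < v" using of_rat_dense[of "(u + v) / 2" v] v by auto
  have "\<exists>n\<ge>N. p n > v" for N
  proof (rule ccontr)
    assume "\<not> ?thesis"
    then have "limsup ?p \<le> ereal v" by (intro Limsup_bounded) (auto simp: eventually_sequentially not_less)
    then show False using v by simp
  qed
  moreover obtain k where k: "1 / real (Suc k) < v - of_rat b" using reals_Archimedean[of "v - of_rat b"] b by (auto simp: inverse_eq_divide)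
  ultimately have up: "\<forall>N. \<exists>n\<ge>N. p n > of_rat b + 1 / real (Suc k)" by (smt (verit))
  have "\<exists>n\<ge>N. p n < u" for N
  proof (rule ccontr)
    assume "\<not> ?thesis"
    then have "ereal u \<le> liminf ?p" by (intro Liminf_bounded) (auto simp: eventually_sequentially not_less)
    then show False using u by simp
  qed
  moreover obtain k' where k': "1 / real (Suc k') < of_rat a - u" using reals_Archimedean[of "of_rat a - u"] a by (auto simp: inverse_eq_divide)
  ultimately have low: "\<forall>N. \<exists>n\<ge>N. - p n > - of_rat a + 1 / real (Suc k')" by (smt (verit))
  have "a < b" using a b by (metis less_trans of_rat_less)
  then show ?thesis using up low by blast
qed

text \<open>On the invariant set where the averages oscillate across rationals \<open>a < b\<close>,
  \<open>upper_integral\<close> for \<open>F\<close> and \<open>- F\<close> puts the integral of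
  \<open>F\<close> both above \<open>b\<close> and below \<open>a\<close> times its measure. The set
  is therefore null, and there are countably many such pairs.\<close>

lemma birkhoff_AE_convergent:
  assumes F [measurable]: "F \<in> borel_measurable borel" and B: "\<And>x. \<bar>F x\<bar> \<le> B"
  shows "AE x in \<mu>. (\<lambda>n. birkhoff_sum T F n x / real n) \<longlonglongrightarrow> time_avg T F x"
proof -
  have null: "measure \<mu> (upper_set F b \<inter> upper_set (\<lambda>x. - F x) (- a)) = 0" if ab: "a < b" for a b
  proof -
    let ?E = "upper_set F b \<inter> upper_set (\<lambda>x. - F x) (- a)"
    have E: "?E \<in> sets borel" by simp
    have inv: "T x \<in> ?E \<longleftrightarrow> x \<in> ?E" for x
      using upper_set_invariant[of F B x b] upper_set_invariant[of "\<lambda>x. - F x" B x "-a"] B by auto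
    have "b * measure \<mu> ?E \<le> (\<integral>x. F x * indicat_real ?E x \<partial>\<mu>)"
      by (rule upper_integral[OF F B E inv]) auto
    moreover have "- a * measure \<mu> ?E \<le> (\<integral>x. - F x * indicat_real ?E x \<partial>\<mu>)"
      by (rule upper_integral[OF _ _ E inv, of _ B]) (use B in auto)
    ultimately have "(b - a) * measure \<mu> ?E \<le> 0" by (simp add: algebra_simps)
    then show ?thesis using ab measure_nonneg[of \<mu> ?E] by (auto simp: mult_le_0_iff)
  qed
  have "AE x in \<mu>. \<forall>a b :: rat. a < b \<longrightarrow> x \<notin> upper_set F (of_rat b) \<inter> upper_set (\<lambda>x. - F x) (- of_rat a)"
    unfolding AE_all_countable
  proof (intro allI)
    fix a b :: rat
    show "AE x in \<mu>. a < b \<longrightarrow> x \<notin> upper_set F (of_rat b) \<inter> upper_set (\<lambda>x. - F x) (- of_rat a)"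
    proof (cases "a < b")
      case True
      have "AE x in \<mu>. x \<notin> upper_set F (of_rat b) \<inter> upper_set (\<lambda>x. - F x) (- of_rat a)"
        by (rule AE_not_in) (use null[of "of_rat a" "of_rat b"] True in \<open>auto simp: null_sets_def emeasure_eq_measure of_rat_less\<close>)
      then show ?thesis by auto
    qed simp
  qed
  then show ?thesis
  proof eventually_elim
    case (elim x)
    let ?p = "\<lambda>n. birkhoff_sum T F n x / real n"
    have minus: "birkhoff_sum T (\<lambda>x. - F x) n x / real n = - ?p n" for n by (simp add: birkhoff_sum_def sum_negf)
    have "convergent ?p"
    proof (rule ccontr)
      assume "\<not> ?thesis"
      from bounded_nonconvergent[OF _ this, of B] avg_bounded[of F B _ x, OF B] elim show False
        unfolding upper_set_def Int_iff mem_Collect_eq minus by blast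
    qed
    then show ?case unfolding time_avg_def by (simp add: convergent_LIMSEQ_iff)
  qed
qed

lemma time_avg_bounded:
  assumes F [measurable]: "F \<in> borel_measurable borel" and B: "\<And>x. \<bar>F x\<bar> \<le> B"
  shows "AE x in \<mu>. \<bar>time_avg T F x\<bar> \<le> B"
  using birkhoff_AE_convergent[OF F B]
proof eventually_elim
  case (elim x)
  then show ?case by (intro LIMSEQ_le_const2[OF tendsto_rabs[OF elim]]) (use avg_bounded[of F B _ x, OF B] in auto)
qed

text \<open>Dominated convergence: over an invariant set every average has the same integral as
  \<open>F\<close>. This is the property that characterises a conditional expectation given the
  invariant sets.\<close>

lemma integral_time_avg:
  assumes F [measurable]: "F \<in> borel_measurable borel" and B: "\<And>x. \<bar>F x\<bar> \<le> B"
    and E [measurable]: "E \<in> sets borel" and inv: "\<And>x. T x \<in> E \<longleftrightarrow> x \<in> E"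
  shows "(\<integral>x. time_avg T F x * indicat_real E x \<partial>\<mu>) = (\<integral>x. F x * indicat_real E x \<partial>\<mu>)"
proof -
  have B0: "0 \<le> B" using B[of undefined] by simp
  have "(\<lambda>n. \<integral>x. birkhoff_sum T F n x / real n * indicat_real E x \<partial>\<mu>) \<longlonglongrightarrow> (\<integral>x. time_avg T F x * indicat_real E x \<partial>\<mu>)"
  proof (rule integral_dominated_convergence[where w="\<lambda>_. B"])
    show "AE x in \<mu>. (\<lambda>n. birkhoff_sum T F n x / real n * indicat_real E x) \<longlonglongrightarrow> time_avg T F x * indicat_real E x"
      using birkhoff_AE_convergent[OF F B] by eventually_elim (intro tendsto_intros)
    show "AE x in \<mu>. norm (birkhoff_sum T F n x / real n * indicat_real E x) \<le> B" for n
      using avg_bounded[of F B n, OF B] B0 by (auto simp: indicator_def)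
  qed auto
  moreover have "(\<integral>x. birkhoff_sum T F n x / real n * indicat_real E x \<partial>\<mu>) = (\<integral>x. F x * indicat_real E x \<partial>\<mu>)"
    if n: "n \<ge> 1" for n
  proof -
    let ?G = "\<lambda>x. F x * indicat_real E x"
    have G: "?G \<in> borel_measurable borel" by measurable
    have Gb: "\<bar>?G x\<bar> \<le> B" for x using B[of x] B0 by (auto simp: indicator_def)
    have i: "integrable \<mu> (\<lambda>x. ?G ((T ^^ i) x))" for i
      by (rule integrable_bounded[of _ B]) (use Gb measurable_compose[OF funpow_meas G] in auto)
    have "(\<integral>x. birkhoff_sum T F n x / real n * indicat_real E x \<partial>\<mu>) = (\<integral>x. (\<Sum>i<n. ?G ((T ^^ i) x)) / real n \<partial>\<mu>)"
      using birkhoff_sum_invariant[of E F n, OF inv] by (simp add: birkhoff_sum_def)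
    also have "\<dots> = (\<Sum>i<n. \<integral>x. ?G ((T ^^ i) x) \<partial>\<mu>) / real n"
      unfolding Bochner_Integration.integral_divide_zero by (subst Bochner_Integration.integral_sum[OF i]) (rule refl)
    also have "\<dots> = (\<Sum>i<n. \<integral>x. ?G x \<partial>\<mu>) / real n"
      using integral_funpow[OF G] by simp
    finally show ?thesis using n by simp
  qed
  then have "\<forall>\<^sub>F n in sequentially. (\<integral>x. birkhoff_sum T F n x / real n * indicat_real E x \<partial>\<mu>) = (\<integral>x. F x * indicat_real E x \<partial>\<mu>)"
    unfolding eventually_sequentially by blast
  ultimately have "(\<lambda>n. \<integral>x. F x * indicat_real E x \<partial>\<mu>) \<longlonglongrightarrow> (\<integral>x. time_avg T F x * indicat_real E x \<partial>\<mu>)"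
    by (rule Lim_transform_eventually)
  then show ?thesis by (simp add: LIMSEQ_const_iff)
qed

text \<open>Serves to identify \<open>measure (\<kappa> x) A\<close> with a time average. As a
  function of \<open>x\<close> the limit \<open>k\<close> is not known to be measurable, so the
  proof integrates the pointwise \<open>lim\<close> of the \<open>g m\<close> instead.\<close>

lemma AE_eq_of_le:
  fixes g :: "nat \<Rightarrow> 'a \<Rightarrow> real"
  assumes g: "\<And>m. g m \<in> borel_measurable borel" "\<And>m. AE x in \<mu>. \<bar>g m x\<bar> \<le> B"
    and h: "h \<in> borel_measurable borel" "AE x in \<mu>. \<bar>h x\<bar> \<le> B"
    and conv: "AE x in \<mu>. (\<lambda>m. g m x) \<longlonglongrightarrow> k x" and le: "AE x in \<mu>. k x \<le> h x"
    and int: "(\<lambda>m. \<integral>x. g m x \<partial>\<mu>) \<longlonglongrightarrow> (\<integral>x. h x \<partial>\<mu>)"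
  shows "AE x in \<mu>. k x = h x"
proof -
  have [measurable]: "g m \<in> borel_measurable borel" "h \<in> borel_measurable borel" for m using g h by auto
  define k' where "k' x = lim (\<lambda>m. g m x)" for x
  have k' [measurable]: "k' \<in> borel_measurable borel" unfolding k'_def by (rule borel_measurable_lim_metric) simp
  have k'k: "AE x in \<mu>. k' x = k x" using conv by eventually_elim (simp add: k'_def limI)
  have gb: "AE x in \<mu>. \<forall>m. \<bar>g m x\<bar> \<le> B" using g(2) by (simp add: AE_all_countable)
  have k'b: "AE x in \<mu>. \<bar>k' x\<bar> \<le> B" using conv gb k'k
  proof eventually_elim
    case (elim x)
    have "\<bar>k x\<bar> \<le> B" by (rule LIMSEQ_le_const2[OF tendsto_rabs[OF elim(1)]]) (use elim(2) in auto)
    then show ?case using elim(3) by simp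
  qed
  have ik: "integrable \<mu> k'" by (rule integrable_const_bound[of _ B]) (use k'b in auto)
  have ih: "integrable \<mu> h" by (rule integrable_const_bound[of _ B]) (use h in auto)
  have "(\<lambda>m. \<integral>x. g m x \<partial>\<mu>) \<longlonglongrightarrow> (\<integral>x. k' x \<partial>\<mu>)"
  proof (rule integral_dominated_convergence[where w="\<lambda>_. B"])
    show "AE x in \<mu>. (\<lambda>m. g m x) \<longlonglongrightarrow> k' x" using conv k'k by eventually_elim simp
  qed (use g(2) in auto)
  then have "(\<integral>x. k' x \<partial>\<mu>) = (\<integral>x. h x \<partial>\<mu>)" using int LIMSEQ_unique by blast
  then have "(\<integral>x. h x - k' x \<partial>\<mu>) = 0" using ik ih by simp
  moreover have "AE x in \<mu>. 0 \<le> h x - k' x" using le k'k by eventually_elim simp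
  ultimately have "AE x in \<mu>. h x - k' x = 0"
    using ik ih by (subst (asm) integral_nonneg_eq_0_iff_AE) auto
  then show ?thesis using k'k by eventually_elim simp
qed

end

lemma (in pmp) integral_time_avg_UNIV:
  assumes F: "F \<in> borel_measurable borel" and B: "\<And>x. \<bar>F x\<bar> \<le> B"
  shows "(\<integral>x. time_avg T F x \<partial>\<mu>) = (\<integral>x. F x \<partial>\<mu>)"
  using integral_time_avg[of F B UNIV, OF F B] by simp

lemma birkhoff_sum_mono:
  assumes "\<And>x. F x \<le> G x"
  shows "birkhoff_sum T F n x / real n \<le> birkhoff_sum T G n x / real n"
  unfolding birkhoff_sum_def by (intro divide_right_mono sum_mono assms) auto

section \<open>Ergodic components\<close>

locale rho_system = compact_system T for T :: "'a::metric_space \<Rightarrow> 'a" +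
  fixes f :: "nat \<Rightarrow> 'a \<Rightarrow>\<^sub>C real"
  assumes f_unit: "range f \<subseteq> unit_functions" and f_dense: "unit_functions \<subseteq> closure (range f)"
begin

lemma f_01: "0 \<le> apply_bcontfun (f l) x" "apply_bcontfun (f l) x \<le> 1"
  using f_unit by (auto simp: unit_functions_def)

text \<open>The dense family takes values in [0,1], so \<open>u\<close> is first moved into that
  range by an affine map; this is the origin of the slope and the offset.\<close>

lemma dense_approx:
  assumes u: "continuous_on UNIV (u :: 'a \<Rightarrow> real)" and e: "e > 0"
  shows "\<exists>a b l. 0 \<le> a \<and> (\<forall>x. \<bar>u x - (a * apply_bcontfun (f l) x + b)\<bar> < e)"
proof -
  obtain B where B: "B > 0" "\<And>x. \<bar>u x\<bar> \<le> B" using continuous_bounded[OF u] by blast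
  define v where "v x = (u x + B) / (2 * B)" for x
  have v01: "0 \<le> v x \<and> v x \<le> 1" for x using B(2)[of x] B(1) by (auto simp: v_def field_simps abs_le_iff)
  have "v \<in> bcontfun"
  proof (rule bcontfun_normI)
    show "continuous_on UNIV v" unfolding v_def using B by (intro continuous_intros u) auto
    show "norm (v x) \<le> 1" for x using v01[of x] by auto
  qed
  then have ap: "apply_bcontfun (Bcontfun v) = v" by (rule Bcontfun_inverse)
  then have "Bcontfun v \<in> unit_functions" using v01 by (auto simp: unit_functions_def)
  then have "Bcontfun v \<in> closure (range f)" using f_dense by blast
  then obtain l where l: "dist (f l) (Bcontfun v) < e / (2 * B)"
    using B e unfolding closure_approachable by (metis divide_pos_pos mult_pos_pos rangeE zero_less_numeral)
  show ?thesis
  proof (intro exI conjI allI)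
    show "0 \<le> 2 * B" using B by simp
    fix x
    have "\<bar>apply_bcontfun (f l) x - v x\<bar> < e / (2 * B)"
      using dist_bounded[of "f l" x "Bcontfun v"] l ap by (simp add: dist_real_def)
    then have "2 * B * \<bar>apply_bcontfun (f l) x - v x\<bar> < e" using B by (simp add: field_simps)
    moreover have "u x - (2 * B * apply_bcontfun (f l) x + (- B)) = - (2 * B * (apply_bcontfun (f l) x - v x))"
      using B by (simp add: v_def field_simps)
    ultimately show "\<bar>u x - (2 * B * apply_bcontfun (f l) x + (- B))\<bar> < e"
      using B by (simp add: abs_mult)
  qed
qed

definition generic :: "'a measure \<Rightarrow> 'a \<Rightarrow> bool" where
  "generic \<nu> x \<longleftrightarrow> \<nu> \<in> prob_measures \<and>
    (\<forall>u :: 'a \<Rightarrow> real. continuous_on UNIV u \<longrightarrow> (\<lambda>n. birkhoff_sum T u n x / real n) \<longlonglongrightarrow> (\<integral>y. u y \<partial>\<nu>))"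

text \<open>Chosen point by point, with no claim of measurability in \<open>x\<close>; at points
  without a generic measure the value is arbitrary.\<close>

definition \<kappa> :: "'a \<Rightarrow> 'a measure" where "\<kappa> x = (SOME \<nu>. generic \<nu> x)"

lemma birkhoff_empirical:
  fixes u :: "'a \<Rightarrow> real"
  assumes "n \<ge> 1" "u \<in> borel_measurable borel"
  shows "(\<integral>y. u y \<partial>empirical T n x) = birkhoff_sum T u n x / real n"
  using integral_empirical[OF assms] by (simp add: birkhoff_sum_def)

lemma birkhoff_sum_affine:
  "n \<ge> 1 \<Longrightarrow> birkhoff_sum T (\<lambda>x. a * F x + b) n x / real n = a * (birkhoff_sum T F n x / real n) + b"
  by (simp add: birkhoff_sum_def sum.distrib sum_distrib_left[symmetric] add_divide_distrib)

lemma birkhoff_close: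
  assumes "\<And>x. \<bar>F x - G x\<bar> \<le> e" "n \<ge> 1"
  shows "\<bar>birkhoff_sum T F n x / real n - birkhoff_sum T G n x / real n\<bar> \<le> e"
proof -
  have "\<bar>\<Sum>i<n. F ((T ^^ i) x) - G ((T ^^ i) x)\<bar> \<le> (\<Sum>i<n. \<bar>F ((T ^^ i) x) - G ((T ^^ i) x)\<bar>)" by (rule sum_abs)
  also have "\<dots> \<le> (\<Sum>i<n. e)" by (rule sum_mono) (rule assms)
  finally show ?thesis using assms(2)
    by (simp add: birkhoff_sum_def sum_subtractf diff_divide_distrib[symmetric] abs_divide field_simps)
qed

lemma integral_close:
  fixes u v :: "'a \<Rightarrow> real"
  assumes \<nu>: "\<nu> \<in> prob_measures" and u: "continuous_on UNIV u" "continuous_on UNIV v" and e: "\<And>x. \<bar>u x - v x\<bar> \<le> e"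
  shows "\<bar>(\<integral>x. u x \<partial>\<nu>) - (\<integral>x. v x \<partial>\<nu>)\<bar> \<le> e"
proof -
  interpret prob_space \<nu> using \<nu> by (auto simp: prob_measures_def)
  have i: "integrable \<nu> u" "integrable \<nu> v" using continuous_integrable u \<nu> by auto
  have "\<bar>\<integral>x. u x - v x \<partial>\<nu>\<bar> \<le> (\<integral>x. \<bar>u x - v x\<bar> \<partial>\<nu>)" by (rule integral_abs_bound)
  also have "\<dots> \<le> (\<integral>x. e \<partial>\<nu>)" by (rule integral_mono) (use i e in auto)
  finally show ?thesis using i by (simp add: prob_space)
qed

lemma integral_affine:
  fixes u :: "'a \<Rightarrow> real"
  assumes \<nu>: "\<nu> \<in> prob_measures" and u: "continuous_on UNIV u"
  shows "(\<integral>x. a * u x + b \<partial>\<nu>) = a * (\<integral>x. u x \<partial>\<nu>) + b"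
proof -
  interpret prob_space \<nu> using \<nu> by (auto simp: prob_measures_def)
  show ?thesis using continuous_integrable[OF u \<nu>] by (simp add: prob_space)
qed

lemma f_cont: "continuous_on UNIV (apply_bcontfun (f l))" by simp

text \<open>Affinity on the family and control by the uniform norm carry convergence from the
  \<open>f l\<close> to all continuous functions. The functional \<open>I\<close> is abstract
  because it is applied both to Birkhoff averages and to normalised integrals over an invariant
  set.\<close>

lemma dense_convergence:
  fixes I :: "nat \<Rightarrow> ('a \<Rightarrow> real) \<Rightarrow> real"
  assumes \<nu>: "\<nu> \<in> prob_measures"
    and affine: "\<And>n a b l. n \<ge> 1 \<Longrightarrow> I n (\<lambda>x. a * apply_bcontfun (f l) x + b) = a * I n (apply_bcontfun (f l)) + b"
    and close: "\<And>n u v e. n \<ge> 1 \<Longrightarrow> continuous_on UNIV u \<Longrightarrow> continuous_on UNIV v \<Longrightarrow> (\<And>x. \<bar>u x - v x\<bar> \<le> e) \<Longrightarrow> \<bar>I n u - I n v\<bar> \<le> e"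
    and conv: "\<And>l. (\<lambda>n. I n (apply_bcontfun (f l))) \<longlonglongrightarrow> (\<integral>y. apply_bcontfun (f l) y \<partial>\<nu>)"
    and u: "continuous_on UNIV u"
  shows "(\<lambda>n. I n u) \<longlonglongrightarrow> (\<integral>y. u y \<partial>\<nu>)"
proof (rule LIMSEQ_I)
  fix e :: real assume e: "e > 0"
  obtain a b l where l: "0 \<le> a" "\<And>x. \<bar>u x - (a * apply_bcontfun (f l) x + b)\<bar> < e / 3"
    using dense_approx[OF u, of "e / 3"] e by auto
  let ?w = "\<lambda>x. a * apply_bcontfun (f l) x + b"
  have w: "continuous_on UNIV ?w" by (intro continuous_intros f_cont)
  have le: "\<bar>u x - ?w x\<bar> \<le> e / 3" for x using l(2)[of x] by simp
  have "(\<lambda>n. a * I n (apply_bcontfun (f l)) + b) \<longlonglongrightarrow> a * (\<integral>y. apply_bcontfun (f l) y \<partial>\<nu>) + b"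
    by (intro tendsto_intros conv)
  then obtain N where N: "\<And>n. n \<ge> N \<Longrightarrow> \<bar>a * I n (apply_bcontfun (f l)) + b - (a * (\<integral>y. apply_bcontfun (f l) y \<partial>\<nu>) + b)\<bar> < e / 3"
    using LIMSEQ_D[of _ _ "e / 3"] e by (metis real_norm_def zero_less_divide_iff zero_less_numeral)
  have "norm (I n u - (\<integral>y. u y \<partial>\<nu>)) < e" if n: "n \<ge> max N 1" for n
  proof -
    have "\<bar>I n u - I n ?w\<bar> \<le> e / 3" by (rule close[OF _ u w]) (use n le in auto)
    moreover have "I n ?w = a * I n (apply_bcontfun (f l)) + b" by (rule affine) (use n in auto)
    moreover have "\<bar>a * I n (apply_bcontfun (f l)) + b - (a * (\<integral>y. apply_bcontfun (f l) y \<partial>\<nu>) + b)\<bar> < e / 3" using N n by auto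
    moreover have "(\<integral>y. ?w y \<partial>\<nu>) = a * (\<integral>y. apply_bcontfun (f l) y \<partial>\<nu>) + b" by (rule integral_affine[OF \<nu>]) simp
    moreover have "\<bar>(\<integral>y. u y \<partial>\<nu>) - (\<integral>y. ?w y \<partial>\<nu>)\<bar> \<le> e / 3" by (rule integral_close[OF \<nu> u w le])
    ultimately show ?thesis unfolding real_norm_def by linarith
  qed
  then show "\<exists>N. \<forall>n\<ge>N. norm (I n u - (\<integral>y. u y \<partial>\<nu>)) < e" by blast
qed

text \<open>Compactness gives a limit measure along a subsequence; convergence of the averages of
  every \<open>f l\<close> along the full sequence then removes the subsequence.\<close>

lemma generic_exists:
  assumes conv: "\<And>l. convergent (\<lambda>n. birkhoff_sum T (apply_bcontfun (f l)) n x / real n)"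
  shows "\<exists>\<nu>. generic \<nu> x"
proof -
  obtain r \<nu> where r: "strict_mono (r :: nat \<Rightarrow> nat)" and \<nu>: "\<nu> \<in> prob_measures"
    and lim: "\<And>u :: 'a \<Rightarrow> real. continuous_on UNIV u \<Longrightarrow> (\<lambda>n. \<integral>y. u y \<partial>empirical T (Suc (r n)) x) \<longlonglongrightarrow> (\<integral>y. u y \<partial>\<nu>)"
    using prob_measures_sequentially_compact[of "\<lambda>n. empirical T (Suc n) x"] empirical_prob by auto
  have fl: "(\<lambda>n. birkhoff_sum T (apply_bcontfun (f l)) n x / real n) \<longlonglongrightarrow> (\<integral>y. apply_bcontfun (f l) y \<partial>\<nu>)" for l
  proof -
    obtain L where L: "(\<lambda>n. birkhoff_sum T (apply_bcontfun (f l)) n x / real n) \<longlonglongrightarrow> L"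
      using conv by (auto simp: convergent_def)
    have "strict_mono (\<lambda>n. Suc (r n))" using r by (auto simp: strict_mono_def)
    from LIMSEQ_subseq_LIMSEQ[OF L this]
    have "(\<lambda>n. \<integral>y. apply_bcontfun (f l) y \<partial>empirical T (Suc (r n)) x) \<longlonglongrightarrow> L"
      using birkhoff_empirical[of "Suc (r _)" "apply_bcontfun (f l)" x] borel_measurable_continuous_onI[OF f_cont[of l]]
      by (simp add: o_def del: of_nat_Suc)
    with lim[OF f_cont[of l]] have "L = (\<integral>y. apply_bcontfun (f l) y \<partial>\<nu>)" using LIMSEQ_unique by blast
    with L show ?thesis by simp
  qed
  have "(\<lambda>n. birkhoff_sum T u n x / real n) \<longlonglongrightarrow> (\<integral>y. u y \<partial>\<nu>)" if "continuous_on UNIV u" for u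
    by (rule dense_convergence[OF \<nu> birkhoff_sum_affine _ fl that]) (use birkhoff_close in auto)
  then show ?thesis using \<nu> by (auto simp: generic_def)
qed

lemma generic_invariant:
  assumes "generic \<nu> x"
  shows "\<nu> \<in> invariant_measures T"
proof (rule empirical_limit_invariant)
  show "\<nu> \<in> prob_measures" using assms by (simp add: generic_def)
  show "filterlim Suc at_top sequentially" by (rule filterlim_Suc)
  fix u :: "'a \<Rightarrow> real" assume u: "continuous_on UNIV u"
  have "(\<lambda>n. birkhoff_sum T u (Suc n) x / real (Suc n)) \<longlonglongrightarrow> (\<integral>y. u y \<partial>\<nu>)"
    using LIMSEQ_Suc[of "\<lambda>n. birkhoff_sum T u n x / real n"] assms u by (auto simp: generic_def)
  then show "(\<lambda>n. \<integral>y. u y \<partial>empirical T (Suc n) x) \<longlonglongrightarrow> (\<integral>y. u y \<partial>\<nu>)"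
    using birkhoff_empirical[of "Suc _" u x] borel_measurable_continuous_onI[OF u] by (simp del: of_nat_Suc)
qed

lemma pmp_invariant: "\<mu> \<in> invariant_measures T \<Longrightarrow> pmp \<mu> T"
  using T_measurable by (auto simp: pmp_def pmp_axioms_def invariant_measures_def prob_measures_def)

lemma AE_generic:
  assumes \<mu>: "\<mu> \<in> invariant_measures T"
  shows "AE x in \<mu>. generic (\<kappa> x) x"
proof -
  interpret pmp \<mu> T by (rule pmp_invariant[OF \<mu>])
  have "AE x in \<mu>. \<forall>l. (\<lambda>n. birkhoff_sum T (apply_bcontfun (f l)) n x / real n) \<longlonglongrightarrow> time_avg T (apply_bcontfun (f l)) x"
    unfolding AE_all_countable
    by (intro allI birkhoff_AE_convergent[of _ 1] borel_measurable_continuous_onI f_cont) (use f_01 in \<open>auto simp: abs_le_iff intro: order_trans\<close>)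
  then show ?thesis
  proof eventually_elim
    case (elim x)
    then have "\<exists>\<nu>. generic \<nu> x" by (intro generic_exists) (auto simp: convergent_def)
    then show ?case unfolding \<kappa>_def by (rule someI_ex)
  qed
qed

text \<open>Induction over the Dynkin system generated by the closed sets. For closed sets and for
  countable disjoint unions, approximation yields only one inequality between the time average and
  \<open>measure (\<kappa> x)\<close>; equality of integrals upgrades it through
  \<open>AE_eq_of_le\<close>.\<close>

lemma AE_frequency:
  assumes \<mu>: "\<mu> \<in> invariant_measures T" and A: "A \<in> sets borel"
  shows "AE x in \<mu>. (\<lambda>n. birkhoff_sum T (indicat_real A) n x / real n) \<longlonglongrightarrow> measure (\<kappa> x) A"
proof -
  interpret pmp \<mu> T by (rule pmp_invariant[OF \<mu>])
  have im: "indicat_real A \<in> borel_measurable borel" if "A \<in> sets borel" for A :: "'a set" using that by simp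
  have ib: "\<bar>indicat_real A x\<bar> \<le> 1" for A and x :: 'a by (simp add: indicator_def)
  have gen: "AE x in \<mu>. generic (\<kappa> x) x" by (rule AE_generic[OF \<mu>])
  have "Int_stable (Collect closed :: 'a set set)" "Collect closed \<subseteq> Pow (UNIV :: 'a set)"
    by (auto simp: Int_stable_def)
  moreover have "A \<in> sigma_sets UNIV (Collect closed)" using A by (simp add: borel_eq_closed)
  ultimately show ?thesis
  proof (induction A rule: sigma_sets_induct_disjoint)
    case (basic C)
    then have C: "closed C" and Cb: "C \<in> sets borel" by auto
    obtain v :: "nat \<Rightarrow> 'a \<Rightarrow> real" where v: "\<And>n. continuous_on UNIV (v n)" "\<And>n x. indicat_real C x \<le> v n x \<and> v n x \<le> 1"
      "\<And>x. (\<lambda>n. v n x) \<longlonglongrightarrow> indicat_real C x"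
      using closed_outer_functions[OF C] by blast
    have vm: "v n \<in> borel_measurable borel" for n using v(1) by (rule borel_measurable_continuous_onI)
    have v1: "\<bar>v n x\<bar> \<le> 1" for n x
    proof -
      have "indicat_real C x \<le> v n x \<and> v n x \<le> 1" by (rule v(2))
      moreover have "0 \<le> indicat_real C x" by simp
      ultimately show ?thesis by linarith
    qed
    have bC: "AE x in \<mu>. (\<lambda>n. birkhoff_sum T (indicat_real C) n x / real n) \<longlonglongrightarrow> time_avg T (indicat_real C) x"
      by (rule birkhoff_AE_convergent[OF im[OF Cb] ib])
    \<comment> \<open>The signs are reversed since approximation from outside gives
      \<open>time_avg T (indicat_real C) x \<le> measure (\<kappa> x) C\<close>.\<close>
    have "AE x in \<mu>. - measure (\<kappa> x) C = - time_avg T (indicat_real C) x"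
    proof (rule AE_eq_of_le)
      show "(\<lambda>x. - time_avg T (v m) x) \<in> borel_measurable borel" for m using time_avg_meas[OF vm] by simp
      show "AE x in \<mu>. \<bar>- time_avg T (v m) x\<bar> \<le> 1" for m using time_avg_bounded[OF vm v1] by simp
      show "(\<lambda>x. - time_avg T (indicat_real C) x) \<in> borel_measurable borel" using time_avg_meas[OF im[OF Cb]] by simp
      show "AE x in \<mu>. \<bar>- time_avg T (indicat_real C) x\<bar> \<le> 1" using time_avg_bounded[OF im[OF Cb] ib] by simp
      have ta: "time_avg T (v m) x = (\<integral>y. v m y \<partial>\<kappa> x)" if "generic (\<kappa> x) x" for m x
        unfolding time_avg_def by (rule limI) (use that v(1) in \<open>auto simp: generic_def\<close>)
      have cv: "(\<lambda>m. time_avg T (v m) x) \<longlonglongrightarrow> measure (\<kappa> x) C" if "generic (\<kappa> x) x" for x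
        unfolding ta[OF that] by (rule closed_outer_integral[OF C _ v]) (use that in \<open>auto simp: generic_def\<close>)
      show "AE x in \<mu>. (\<lambda>m. - time_avg T (v m) x) \<longlonglongrightarrow> - measure (\<kappa> x) C"
        using gen by eventually_elim (intro tendsto_minus cv)
      show "AE x in \<mu>. - measure (\<kappa> x) C \<le> - time_avg T (indicat_real C) x"
        using gen bC
      proof eventually_elim
        case (elim x)
        have "time_avg T (indicat_real C) x \<le> time_avg T (v m) x" for m
        proof (rule LIMSEQ_le[OF elim(2)])
          show "(\<lambda>n. birkhoff_sum T (v m) n x / real n) \<longlonglongrightarrow> time_avg T (v m) x"
            unfolding ta[OF elim(1)] using elim(1) v(1) by (auto simp: generic_def)
          show "\<exists>N. \<forall>n\<ge>N. birkhoff_sum T (indicat_real C) n x / real n \<le> birkhoff_sum T (v m) n x / real n"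
            using birkhoff_sum_mono[of "indicat_real C" "v m" T _ x] v(2) by blast
        qed
        then have "time_avg T (indicat_real C) x \<le> measure (\<kappa> x) C"
          by (intro LIMSEQ_le_const[OF cv[OF elim(1)]]) auto
        then show ?case by simp
      qed
      have "(\<lambda>m. - (\<integral>x. v m x \<partial>\<mu>)) \<longlonglongrightarrow> - measure \<mu> C"
        by (intro tendsto_minus closed_outer_integral[OF C _ v]) (use \<mu> in \<open>auto simp: invariant_measures_def\<close>)
      moreover have "(\<integral>x. indicat_real C x \<partial>\<mu>) = measure \<mu> C" using Cb by (simp add: space_\<mu>)
      ultimately show "(\<lambda>m. \<integral>x. - time_avg T (v m) x \<partial>\<mu>) \<longlonglongrightarrow> (\<integral>x. - time_avg T (indicat_real C) x \<partial>\<mu>)"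
        using integral_time_avg_UNIV[OF vm v1] integral_time_avg_UNIV[OF im[OF Cb] ib] by simp
    qed
    with bC show ?case by eventually_elim simp
  next
    case empty
    show ?case by (simp add: birkhoff_sum_def)
  next
    case (compl A)
    have Ab: "A \<in> sets borel" using compl.hyps by (simp add: borel_eq_closed)
    show ?case using compl.IH gen
    proof eventually_elim
      case (elim x)
      interpret kx: prob_space "\<kappa> x" using elim(2) by (auto simp: generic_def prob_measures_def)
      have "(\<lambda>n. (-1) * (birkhoff_sum T (indicat_real A) n x / real n) + 1) \<longlonglongrightarrow> (-1) * measure (\<kappa> x) A + 1"
        by (intro tendsto_intros elim)
      moreover have "\<forall>\<^sub>F n in sequentially. (-1) * (birkhoff_sum T (indicat_real A) n x / real n) + 1
          = birkhoff_sum T (indicat_real (UNIV - A)) n x / real n"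
        using eventually_ge_at_top[of 1]
      proof eventually_elim
        case (elim n)
        have "indicat_real (UNIV - A) = (\<lambda>x. (-1) * indicat_real A x + 1)" by (auto simp: indicator_def)
        then show ?case using birkhoff_sum_affine[OF elim, of "-1" "indicat_real A" 1] by simp
      qed
      ultimately have "(\<lambda>n. birkhoff_sum T (indicat_real (UNIV - A)) n x / real n) \<longlonglongrightarrow> (-1) * measure (\<kappa> x) A + 1"
        by (rule Lim_transform_eventually)
      moreover have "measure (\<kappa> x) (UNIV - A) = 1 - measure (\<kappa> x) A"
      proof -
        have s: "sets (\<kappa> x) = sets borel" using elim(2) by (auto simp: generic_def prob_measures_def)
        show ?thesis using kx.prob_compl[of A] s Ab sets_eq_imp_space_eq[OF s] by simp
      qed
      ultimately show ?case by simp
    qed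
  next
    case (union A)
    have Ab: "A i \<in> sets borel" for i using union.hyps by (auto simp: borel_eq_closed)
    let ?U = "\<Union>i. A i"
    have Ub: "?U \<in> sets borel" using Ab by auto
    have bU: "AE x in \<mu>. (\<lambda>n. birkhoff_sum T (indicat_real ?U) n x / real n) \<longlonglongrightarrow> time_avg T (indicat_real ?U) x"
      by (rule birkhoff_AE_convergent[OF im[OF Ub] ib])
    have IH: "AE x in \<mu>. \<forall>i. (\<lambda>n. birkhoff_sum T (indicat_real (A i)) n x / real n) \<longlonglongrightarrow> measure (\<kappa> x) (A i)"
      unfolding AE_all_countable using union.IH by auto
    have ta: "time_avg T (indicat_real (A i)) x = measure (\<kappa> x) (A i)"
      if "\<forall>i. (\<lambda>n. birkhoff_sum T (indicat_real (A i)) n x / real n) \<longlonglongrightarrow> measure (\<kappa> x) (A i)" for x i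
      unfolding time_avg_def by (rule limI) (use that in auto)
    have "AE x in \<mu>. measure (\<kappa> x) ?U = time_avg T (indicat_real ?U) x"
    proof (rule AE_eq_of_le)
      show "(\<lambda>x. \<Sum>i<m. time_avg T (indicat_real (A i)) x) \<in> borel_measurable borel" for m
        using time_avg_meas[OF im[OF Ab]] by (intro borel_measurable_sum) auto
      show "AE x in \<mu>. \<bar>\<Sum>i<m. time_avg T (indicat_real (A i)) x\<bar> \<le> 1" for m
        using IH gen
      proof eventually_elim
        case (elim x)
        interpret kx: prob_space "\<kappa> x" using elim(2) by (auto simp: generic_def prob_measures_def)
        have s: "sets (\<kappa> x) = sets borel" using elim(2) by (auto simp: generic_def prob_measures_def)
        have "(\<Sum>i<m. measure (\<kappa> x) (A i)) = measure (\<kappa> x) (\<Union>i<m. A i)"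
          by (rule kx.finite_measure_finite_Union[symmetric]) (use Ab s union.hyps in \<open>auto simp: disjoint_family_on_def\<close>)
        then show ?case unfolding ta[OF elim(1)] by simp
      qed
      show "time_avg T (indicat_real ?U) \<in> borel_measurable borel" by (rule time_avg_meas[OF im[OF Ub]])
      show "AE x in \<mu>. \<bar>time_avg T (indicat_real ?U) x\<bar> \<le> 1" by (rule time_avg_bounded[OF im[OF Ub] ib])
      show "AE x in \<mu>. (\<lambda>m. \<Sum>i<m. time_avg T (indicat_real (A i)) x) \<longlonglongrightarrow> measure (\<kappa> x) ?U"
        using IH gen
      proof eventually_elim
        case (elim x)
        interpret kx: prob_space "\<kappa> x" using elim(2) by (auto simp: generic_def prob_measures_def)
        have s: "sets (\<kappa> x) = sets borel" using elim(2) by (auto simp: generic_def prob_measures_def)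
        show ?case unfolding ta[OF elim(1)] using kx.finite_measure_UNION[of A] Ab s union.hyps
          by (auto simp: sums_def)
      qed
      show "AE x in \<mu>. measure (\<kappa> x) ?U \<le> time_avg T (indicat_real ?U) x"
        using IH gen bU
      proof eventually_elim
        case (elim x)
        interpret kx: prob_space "\<kappa> x" using elim(2) by (auto simp: generic_def prob_measures_def)
        have s: "sets (\<kappa> x) = sets borel" using elim(2) by (auto simp: generic_def prob_measures_def)
        have sums: "(\<lambda>m. \<Sum>i<m. measure (\<kappa> x) (A i)) \<longlonglongrightarrow> measure (\<kappa> x) ?U"
          using kx.finite_measure_UNION[of A] Ab s union.hyps by (auto simp: sums_def)
        have "(\<Sum>i<m. measure (\<kappa> x) (A i)) \<le> time_avg T (indicat_real ?U) x" for m
        proof (rule LIMSEQ_le[OF _ elim(3)])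
          show "(\<lambda>n. \<Sum>i<m. birkhoff_sum T (indicat_real (A i)) n x / real n) \<longlonglongrightarrow> (\<Sum>i<m. measure (\<kappa> x) (A i))"
            using elim(1) by (intro tendsto_sum) auto
          have ind: "(\<Sum>i<m. indicat_real (A i) y) \<le> indicat_real ?U y" for y
          proof -
            have "(\<Sum>i<m. indicat_real (A i) y) = indicat_real (\<Union>i<m. A i) y"
              by (rule indicator_UN_disjoint[symmetric]) (use union.hyps in \<open>auto simp: disjoint_family_on_def\<close>)
            also have "\<dots> \<le> indicat_real ?U y" by (auto simp: indicator_def)
            finally show ?thesis .
          qed
          have "(\<Sum>i<m. birkhoff_sum T (indicat_real (A i)) n x / real n) \<le> birkhoff_sum T (indicat_real ?U) n x / real n" for n
          proof -
            have "(\<Sum>i<m. birkhoff_sum T (indicat_real (A i)) n x / real n)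
                = birkhoff_sum T (\<lambda>y. \<Sum>i<m. indicat_real (A i) y) n x / real n"
              unfolding birkhoff_sum_def sum_divide_distrib[symmetric] by (subst sum.swap) simp
            also have "\<dots> \<le> birkhoff_sum T (indicat_real ?U) n x / real n" by (rule birkhoff_sum_mono) (rule ind)
            finally show ?thesis .
          qed
          then show "\<exists>N. \<forall>n\<ge>N. (\<Sum>i<m. birkhoff_sum T (indicat_real (A i)) n x / real n) \<le> birkhoff_sum T (indicat_real ?U) n x / real n"
            by blast
        qed
        then show ?case by (intro LIMSEQ_le_const2[OF sums]) auto
      qed
      have int: "integrable \<mu> (time_avg T (indicat_real (A i)))" for i
        by (rule integrable_const_bound[OF time_avg_bounded[OF im[OF Ab] ib, simplified real_norm_def[symmetric]]])
          (use time_avg_meas[OF im[OF Ab]] in auto)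
      have "(\<lambda>m. \<Sum>i<m. measure \<mu> (A i)) \<longlonglongrightarrow> measure \<mu> ?U"
        using finite_measure_UNION[of A] Ab sets_\<mu> union.hyps by (auto simp: sums_def)
      moreover have "(\<integral>x. (\<Sum>i<m. time_avg T (indicat_real (A i)) x) \<partial>\<mu>) = (\<Sum>i<m. measure \<mu> (A i))" for m
        using int integral_time_avg_UNIV[OF im[OF Ab] ib] Ab by (simp add: space_\<mu>)
      moreover have "(\<integral>x. time_avg T (indicat_real ?U) x \<partial>\<mu>) = measure \<mu> ?U"
        using integral_time_avg_UNIV[OF im[OF Ub] ib] Ub by (simp add: space_\<mu>)
      ultimately show "(\<lambda>m. \<integral>x. (\<Sum>i<m. time_avg T (indicat_real (A i)) x) \<partial>\<mu>) \<longlonglongrightarrow> (\<integral>x. time_avg T (indicat_real ?U) x \<partial>\<mu>)"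
        by simp
    qed
    with bU show ?case by eventually_elim simp
  qed
qed

text \<open>Superlevel sets of time averages are invariant, so their frequency at \<open>x\<close>
  is 0 or 1, and so is their measure under \<open>\<kappa> x\<close>; hence each \<open>f l\<close>
  has a constant time average almost surely for \<open>\<kappa> x\<close>. Conditioning
  \<open>\<kappa> x\<close> on an invariant set \<open>E\<close> of positive measure then preserves
  the integral of every \<open>f l\<close>, so it returns \<open>\<kappa> x\<close> itself, and
  \<open>E\<close> has measure 1.\<close>

lemma AE_ergodic:
  assumes \<mu>: "\<mu> \<in> invariant_measures T"
  shows "AE x in \<mu>. \<kappa> x \<in> ergodic_measures T"
proof -
  interpret pmp \<mu> T by (rule pmp_invariant[OF \<mu>])
  let ?g = "\<lambda>l. apply_bcontfun (f l)"
  have gm: "?g l \<in> borel_measurable borel" for l by (rule borel_measurable_continuous_onI) simp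
  have gb: "\<bar>?g l x\<bar> \<le> 1" for l x using f_01[of l x] by simp
  define A where "A l q = {y. of_rat q < time_avg T (?g l) y}" for l and q :: rat
  have Ab: "A l q \<in> sets borel" for l q
    using measurable_sets[OF time_avg_meas[OF gm], of "{of_rat q<..}" l] by (simp add: A_def vimage_def)
  have Ainv: "T x \<in> A l q \<longleftrightarrow> x \<in> A l q" for x l q
    unfolding A_def using time_avg_T[of "?g l" 1 x, OF gb] by simp
  have Aavg: "\<forall>\<^sub>F n in sequentially. birkhoff_sum T (indicat_real (A l q)) n x / real n = indicat_real (A l q) x" for l q x
    using eventually_ge_at_top[of 1]
  proof eventually_elim
    case (elim n)
    have "(T ^^ i) x \<in> A l q \<longleftrightarrow> x \<in> A l q" for i by (induction i) (auto simp: Ainv)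
    then show ?case using elim by (simp add: birkhoff_sum_def indicator_def)
  qed
  have "AE x in \<mu>. \<forall>l q. (\<lambda>n. birkhoff_sum T (indicat_real (A l q)) n x / real n) \<longlonglongrightarrow> measure (\<kappa> x) (A l q)"
    unfolding AE_all_countable using AE_frequency[OF \<mu> Ab] by auto
  then show ?thesis using AE_generic[OF \<mu>]
  proof eventually_elim
    case (elim x)
    have inv: "\<kappa> x \<in> invariant_measures T" by (rule generic_invariant[OF elim(2)])
    interpret k: pmp "\<kappa> x" T by (rule pmp_invariant[OF inv])
    have kp: "\<kappa> x \<in> prob_measures" using inv by (simp add: invariant_measures_def)
    have kA: "measure (\<kappa> x) (A l q) = indicat_real (A l q) x" for l q
      using LIMSEQ_unique[OF elim(1)[rule_format] tendsto_eventually[OF Aavg]] .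
    define c where "c l = (\<integral>y. ?g l y \<partial>\<kappa> x)" for l
    have c: "time_avg T (?g l) x = c l" for l
      unfolding time_avg_def c_def by (rule limI) (use elim(2) in \<open>auto simp: generic_def\<close>)
    have const: "AE y in \<kappa> x. time_avg T (?g l) y = c l" for l
    proof -
      have "AE y in \<kappa> x. \<forall>q :: rat. (c l \<le> of_rat q \<longrightarrow> y \<notin> A l q) \<and> (of_rat q < c l \<longrightarrow> y \<in> A l q)"
        unfolding AE_all_countable
      proof
        fix q :: rat
        show "AE y in \<kappa> x. (c l \<le> of_rat q \<longrightarrow> y \<notin> A l q) \<and> (of_rat q < c l \<longrightarrow> y \<in> A l q)"
        proof (cases "of_rat q < c l")
          case True
          then have "k.prob (A l q) = 1" using kA[of l q] by (simp add: A_def c)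
          then have "AE y in \<kappa> x. y \<in> A l q" using k.prob_eq_1[of "A l q"] Ab k.sets_\<mu> by simp
          then show ?thesis using True by simp
        next
          case False
          then have "k.prob (A l q) = 0" using kA[of l q] by (simp add: A_def c)
          then have "AE y in \<kappa> x. y \<notin> A l q" using k.prob_eq_0[of "A l q"] Ab k.sets_\<mu> by simp
          then show ?thesis using False by simp
        qed
      qed
      then show ?thesis
      proof eventually_elim
        case (elim y)
        show ?case
        proof (rule antisym)
          show "time_avg T (?g l) y \<le> c l"
          proof (rule ccontr)
            assume "\<not> ?thesis"
            then obtain q where "c l < of_rat q" "of_rat q < time_avg T (?g l) y"
              using of_rat_dense[of "c l" "time_avg T (?g l) y"] by auto
            then show False using elim[rule_format, of q] by (auto simp: A_def)
          qed
          show "c l \<le> time_avg T (?g l) y"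
          proof (rule ccontr)
            assume "\<not> ?thesis"
            then obtain q where "time_avg T (?g l) y < of_rat q" "of_rat q < c l"
              using of_rat_dense[of "time_avg T (?g l) y" "c l"] by auto
            then show False using elim[rule_format, of q] by (auto simp: A_def)
          qed
        qed
      qed
    qed
    have "measure (\<kappa> x) E = 0 \<or> measure (\<kappa> x) E = 1" if E: "E \<in> sets borel" "T -` E = E" for E
    proof (rule disjCI)
      assume "measure (\<kappa> x) E \<noteq> 1"
      show "measure (\<kappa> x) E = 0"
      proof (rule ccontr)
        assume nz: "measure (\<kappa> x) E \<noteq> 0"
        have [measurable]: "E \<in> sets borel" by fact
        have einv: "T y \<in> E \<longleftrightarrow> y \<in> E" for y using E(2) by auto
        let ?p = "measure (\<kappa> x) E"
        have gE: "(\<integral>y. ?g l y * indicat_real E y \<partial>\<kappa> x) = ?p * (\<integral>y. ?g l y \<partial>\<kappa> x)" for l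
        proof -
          have "(\<integral>y. ?g l y * indicat_real E y \<partial>\<kappa> x) = (\<integral>y. time_avg T (?g l) y * indicat_real E y \<partial>\<kappa> x)"
            by (rule k.integral_time_avg[OF gm gb E(1) einv, symmetric])
          also have "\<dots> = (\<integral>y. c l * indicat_real E y \<partial>\<kappa> x)"
          proof (rule integral_cong_AE)
            show "AE y in \<kappa> x. time_avg T (?g l) y * indicat_real E y = c l * indicat_real E y"
              using const[of l] by eventually_elim simp
          qed (use gm in auto)
          finally show ?thesis by (simp add: k.space_\<mu> c_def)
        qed
        have uE: "(\<integral>y. u y * indicat_real E y \<partial>\<kappa> x) / ?p = (\<integral>y. u y \<partial>\<kappa> x)" if u: "continuous_on UNIV u" for u
        proof -
          have iE: "integrable (\<kappa> x) (\<lambda>y. u y * indicat_real E y)" if "continuous_on UNIV u" for u :: "'a \<Rightarrow> real"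
            using integrable_mult_indicator[OF _ continuous_integrable[OF that kp], of E] E k.sets_\<mu> by (simp add: mult.commute)
          \<comment> \<open>For a sequence constant in \<open>n\<close> the density lemma becomes an
            equality of integrals.\<close>
          have "(\<lambda>n::nat. (\<integral>y. u y * indicat_real E y \<partial>\<kappa> x) / ?p) \<longlonglongrightarrow> (\<integral>y. u y \<partial>\<kappa> x)"
          proof (rule dense_convergence[OF kp _ _ _ u])
            fix a b l
            have "(\<integral>y. (a * ?g l y + b) * indicat_real E y \<partial>\<kappa> x) = (\<integral>y. a * (?g l y * indicat_real E y) + b * indicat_real E y \<partial>\<kappa> x)"
              by (rule Bochner_Integration.integral_cong) (auto simp: algebra_simps)
            also have "\<dots> = a * (\<integral>y. ?g l y * indicat_real E y \<partial>\<kappa> x) + b * ?p"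
            proof -
              have "integrable (\<kappa> x) (\<lambda>y. b * indicat_real E y)"
                by (rule k.integrable_bounded[of _ "\<bar>b\<bar>"]) (auto simp: indicator_def)
              then show ?thesis using iE[OF f_cont[of l]] by (simp add: k.space_\<mu>)
            qed
            finally show "(\<integral>y. (a * ?g l y + b) * indicat_real E y \<partial>\<kappa> x) / ?p = a * ((\<integral>y. ?g l y * indicat_real E y \<partial>\<kappa> x) / ?p) + b"
              using nz by (simp add: field_simps)
          next
            fix u v :: "'a \<Rightarrow> real" and e
            assume uv: "continuous_on UNIV u" "continuous_on UNIV v" and e: "\<And>x. \<bar>u x - v x\<bar> \<le> e"
            have "\<bar>\<integral>y. (u y - v y) * indicat_real E y \<partial>\<kappa> x\<bar> \<le> (\<integral>y. \<bar>(u y - v y) * indicat_real E y\<bar> \<partial>\<kappa> x)"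
              by (rule integral_abs_bound)
            also have "\<dots> \<le> (\<integral>y. e * indicat_real E y \<partial>\<kappa> x)"
            proof (rule integral_mono)
              show "integrable (\<kappa> x) (\<lambda>y. \<bar>(u y - v y) * indicat_real E y\<bar>)"
                using iE[OF uv(1)] iE[OF uv(2)] by (simp add: left_diff_distrib)
              show "integrable (\<kappa> x) (\<lambda>y. e * indicat_real E y)"
                by (rule k.integrable_bounded[of _ "\<bar>e\<bar>"]) (auto simp: indicator_def)
            qed (use e in \<open>auto simp: indicator_def\<close>)
            also have "\<dots> = e * ?p" by (simp add: k.space_\<mu>)
            finally have "\<bar>(\<integral>y. u y * indicat_real E y \<partial>\<kappa> x) - (\<integral>y. v y * indicat_real E y \<partial>\<kappa> x)\<bar> \<le> e * ?p"
              using iE[OF uv(1)] iE[OF uv(2)] by (simp add: left_diff_distrib)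
            moreover have "?p > 0" using nz measure_nonneg[of "\<kappa> x" E] by linarith
            ultimately show "\<bar>(\<integral>y. u y * indicat_real E y \<partial>\<kappa> x) / ?p - (\<integral>y. v y * indicat_real E y \<partial>\<kappa> x) / ?p\<bar> \<le> e"
              by (simp add: diff_divide_distrib[symmetric] abs_divide field_simps)
          next
            fix l
            show "(\<lambda>n::nat. (\<integral>y. ?g l y * indicat_real E y \<partial>\<kappa> x) / ?p) \<longlonglongrightarrow> (\<integral>y. ?g l y \<partial>\<kappa> x)"
              using gE[of l] nz by simp
          qed
          then show ?thesis by (simp add: LIMSEQ_const_iff)
        qed
        have cl: "measure (\<kappa> x) (C \<inter> E) / ?p = measure (\<kappa> x) C" if C: "closed C" for C
        proof -
          obtain v :: "nat \<Rightarrow> 'a \<Rightarrow> real" where v: "\<And>n. continuous_on UNIV (v n)" "\<And>n x. indicat_real C x \<le> v n x \<and> v n x \<le> 1"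
            "\<And>x. (\<lambda>n. v n x) \<longlonglongrightarrow> indicat_real C x"
            using closed_outer_functions[OF C] by blast
          have [measurable]: "v n \<in> borel_measurable borel" for n using v(1) by (rule borel_measurable_continuous_onI)
          have [measurable]: "C \<in> sets borel" using C by simp
          have v1: "\<bar>v n x\<bar> \<le> 1" for n x
          proof -
            have "indicat_real C x \<le> v n x \<and> v n x \<le> 1" by (rule v(2))
            moreover have "0 \<le> indicat_real C x" by simp
            ultimately show ?thesis by linarith
          qed
          have "(\<lambda>n. \<integral>y. v n y * indicat_real E y \<partial>\<kappa> x) \<longlonglongrightarrow> (\<integral>y. indicat_real C y * indicat_real E y \<partial>\<kappa> x)"
          proof (rule integral_dominated_convergence[where w="\<lambda>_. 1"])
            show "AE y in \<kappa> x. (\<lambda>n. v n y * indicat_real E y) \<longlonglongrightarrow> indicat_real C y * indicat_real E y"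
              by (intro always_eventually allI tendsto_mult v tendsto_const)
            show "AE y in \<kappa> x. norm (v n y * indicat_real E y) \<le> 1" for n
              using v1 by (auto simp: indicator_def)
          qed auto
          also have "(\<integral>y. indicat_real C y * indicat_real E y \<partial>\<kappa> x) = measure (\<kappa> x) (C \<inter> E)"
            by (simp add: indicator_inter_arith[symmetric] k.space_\<mu>)
          finally have "(\<lambda>n. (\<integral>y. v n y * indicat_real E y \<partial>\<kappa> x) / ?p) \<longlonglongrightarrow> measure (\<kappa> x) (C \<inter> E) / ?p"
            using nz by (intro tendsto_divide) auto
          then show ?thesis unfolding uE[OF v(1)] using closed_outer_integral[OF C kp v] LIMSEQ_unique by blast
        qed
        have eE: "emeasure (\<kappa> x) E \<noteq> 0" "emeasure (\<kappa> x) E \<noteq> \<infinity>" using nz by (auto simp: k.emeasure_eq_measure)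
        have mu: "measure (uniform_measure (\<kappa> x) E) C = measure (\<kappa> x) (C \<inter> E) / ?p" if "C \<in> sets borel" for C
          using measure_uniform_measure[OF eE, of C] that k.sets_\<mu> by (simp add: Int_commute)
        have "uniform_measure (\<kappa> x) E = \<kappa> x"
        proof (rule prob_measure_eqI_closed[OF _ kp])
          show "uniform_measure (\<kappa> x) E \<in> prob_measures"
            unfolding prob_measures_def using prob_space_uniform_measure[OF eE] k.sets_\<mu> by simp
          show "measure (uniform_measure (\<kappa> x) E) C = measure (\<kappa> x) C" if "closed C" for C
            using mu[of C] cl[OF that] that by simp
        qed
        then have "?p = ?p / ?p" using mu[of E] by simp
        then show False using nz \<open>?p \<noteq> 1\<close> by simp
      qed
    qed
    then show ?case using inv by (auto simp: ergodic_measures_def)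
  qed
qed

end

text \<open>Only 0 needs care: the right limit of \<open>x * ln x\<close> there is 0, which is also
  the value of the product.\<close>

lemma continuous_on_x_ln_x: "continuous_on {0..} (\<lambda>x::real. x * ln x)"
  unfolding continuous_on
proof
  fix x :: real assume "x \<in> {0..}"
  show "((\<lambda>x. x * ln x) \<longlongrightarrow> x * ln x) (at x within {0..})"
  proof (cases "x = 0")
    case True
    have "((\<lambda>x::real. x * ln x) \<longlongrightarrow> 0) (at_right 0)" by real_asymp
    then show ?thesis using True by (simp add: at_within_Ici_at_right)
  next
    case False
    then show ?thesis by (intro tendsto_intros) auto
  qed
qed

lemma tendsto_shannon:
  assumes A: "finite A" and p: "\<And>n a. a \<in> A \<Longrightarrow> 0 \<le> p n a" "\<And>a. a \<in> A \<Longrightarrow> (\<lambda>n. p n a) \<longlonglongrightarrow> q a"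
  shows "(\<lambda>n. shannon A (p n)) \<longlonglongrightarrow> shannon A q"
  unfolding shannon_def
proof (intro tendsto_sum tendsto_minus)
  fix a assume a: "a \<in> A"
  have "0 \<le> q a" by (rule LIMSEQ_le_const[OF p(2)[OF a]]) (use p(1)[OF a] in auto)
  then show "(\<lambda>n. p n a * ln (p n a)) \<longlonglongrightarrow> q a * ln (q a)"
    by (intro continuous_on_tendsto_compose[OF continuous_on_x_ln_x p(2)[OF a]]) (use p(1)[OF a] in auto)
qed

lemma birkhoff_sum_add: "birkhoff_sum T u (m + n) x = birkhoff_sum T u m x + birkhoff_sum T u n ((T ^^ m) x)"
proof -
  have "birkhoff_sum T u (m + n) x = (\<Sum>i<m. u ((T ^^ i) x)) + (\<Sum>i=m..<m + n. u ((T ^^ i) x))"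
    unfolding birkhoff_sum_def by (simp add: lessThan_atLeast0 sum.atLeastLessThan_concat)
  also have "(\<Sum>i=m..<m + n. u ((T ^^ i) x)) = (\<Sum>i<n. u ((T ^^ i) ((T ^^ m) x)))"
    using sum.shift_bounds_nat_ivl[of "\<lambda>i. u ((T ^^ i) x)" 0 m n]
    by (simp add: lessThan_atLeast0 funpow_add add.commute)
  finally show ?thesis by (simp add: birkhoff_sum_def)
qed

lemma birkhoff_sum_bound:
  assumes "\<And>x. \<bar>u x\<bar> \<le> B"
  shows "\<bar>birkhoff_sum T u n x\<bar> \<le> real n * B"
proof -
  have "\<bar>birkhoff_sum T u n x\<bar> \<le> (\<Sum>i<n. \<bar>u ((T ^^ i) x)\<bar>)" unfolding birkhoff_sum_def by (rule sum_abs)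
  also have "\<dots> \<le> (\<Sum>i<n. B)" by (rule sum_mono) (rule assms)
  finally show ?thesis by simp
qed

lemma birkhoff_sum_blocks:
  fixes l :: "nat \<Rightarrow> nat"
  shows "birkhoff_sum T u (sum l {..<p}) x = (\<Sum>i<p. birkhoff_sum T u (l i) ((T ^^ sum l {..<i}) x))"
proof (induction p)
  case 0
  show ?case by (simp add: birkhoff_sum_def)
next
  case (Suc p)
  then show ?case by (simp add: birkhoff_sum_add)
qed

context rho_system
begin

section \<open>The metric built from the dense family\<close>

abbreviation d :: "'a \<Rightarrow> 'a \<Rightarrow> real" where "d \<equiv> rho_dist f"

lemma d_eq: "d x y = (\<Sum>k. (1 / 2) ^ Suc k * \<bar>apply_bcontfun (f k) x - apply_bcontfun (f k) y\<bar>)"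
proof -
  have "(\<integral>z. apply_bcontfun (f k) z \<partial>return borel x) = apply_bcontfun (f k) x" for k and x :: 'a
    by (rule integral_return) (auto intro: borel_measurable_continuous_onI)
  then show ?thesis by (simp add: rho_dist_def rho_def)
qed

lemma d_diff_le: "\<bar>apply_bcontfun (f k) x - apply_bcontfun (f k) y\<bar> \<le> 1"
  using f_01[of k x] f_01[of k y] by linarith

lemma half_summable: "summable (\<lambda>k. (1 / 2 :: real) ^ Suc k)"
  by (rule summable_mult2[of "\<lambda>k. (1/2::real)^k" "1/2", simplified mult.commute[of _ "1/2"] power_Suc[symmetric]])
    (rule summable_geometric, simp)

lemma d_summable: "summable (\<lambda>k. (1 / 2) ^ Suc k * \<bar>apply_bcontfun (f k) x - apply_bcontfun (f k) y\<bar>)"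
proof (rule summable_comparison_test'[OF half_summable, of 0])
  fix n
  show "norm ((1 / 2) ^ Suc n * \<bar>apply_bcontfun (f n) x - apply_bcontfun (f n) y\<bar>) \<le> (1 / 2) ^ Suc n"
    using mult_left_mono[OF d_diff_le[of n x y], of "(1/2) ^ Suc n"] by (simp add: abs_mult)
qed

lemma d_nonneg: "0 \<le> d x y"
  unfolding d_eq by (rule suminf_nonneg[OF d_summable]) simp

lemma d_refl [simp]: "d x x = 0"
  by (simp add: d_eq)

lemma d_sym: "d x y = d y x"
  unfolding d_eq by (simp add: abs_minus_commute)

lemma d_triangle: "d x z \<le> d x y + d y z"
proof -
  have "d x z \<le> (\<Sum>k. (1 / 2) ^ Suc k * \<bar>apply_bcontfun (f k) x - apply_bcontfun (f k) y\<bar>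
      + (1 / 2) ^ Suc k * \<bar>apply_bcontfun (f k) y - apply_bcontfun (f k) z\<bar>)"
    unfolding d_eq
  proof (rule suminf_le[OF _ d_summable summable_add[OF d_summable d_summable]])
    fix k
    show "(1 / 2) ^ Suc k * \<bar>apply_bcontfun (f k) x - apply_bcontfun (f k) z\<bar>
      \<le> (1 / 2) ^ Suc k * \<bar>apply_bcontfun (f k) x - apply_bcontfun (f k) y\<bar>
      + (1 / 2) ^ Suc k * \<bar>apply_bcontfun (f k) y - apply_bcontfun (f k) z\<bar>"
      unfolding distrib_left[symmetric] by (intro mult_left_mono) auto
  qed
  also have "\<dots> = d x y + d y z" unfolding d_eq by (rule suminf_add[OF d_summable d_summable, symmetric])
  finally show ?thesis .
qed

lemma d_continuous: "continuous_on UNIV (d x)"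
proof -
  have "continuous_on UNIV (\<lambda>y. \<Sum>k. (1 / 2) ^ Suc k * \<bar>apply_bcontfun (f k) x - apply_bcontfun (f k) y\<bar>)"
  proof (rule uniform_limit_theorem[where F=sequentially])
    show "uniform_limit UNIV (\<lambda>n y. \<Sum>k<n. (1 / 2) ^ Suc k * \<bar>apply_bcontfun (f k) x - apply_bcontfun (f k) y\<bar>)
        (\<lambda>y. \<Sum>k. (1 / 2) ^ Suc k * \<bar>apply_bcontfun (f k) x - apply_bcontfun (f k) y\<bar>) sequentially"
    proof (rule Weierstrass_m_test[OF _ half_summable])
      fix n y
      show "norm ((1 / 2) ^ Suc n * \<bar>apply_bcontfun (f n) x - apply_bcontfun (f n) y\<bar>) \<le> (1 / 2) ^ Suc n"
        using mult_left_mono[OF d_diff_le[of n x y], of "(1/2) ^ Suc n"] by (simp add: abs_mult)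
    qed
  qed (auto intro!: always_eventually continuous_intros)
  moreover have "d x = (\<lambda>y. \<Sum>k. (1 / 2) ^ Suc k * \<bar>apply_bcontfun (f k) x - apply_bcontfun (f k) y\<bar>)"
    by (rule ext) (rule d_eq)
  ultimately show ?thesis by simp
qed

lemma d_tendsto: "xs \<longlonglongrightarrow> x \<Longrightarrow> (\<lambda>n. d x (xs n)) \<longlonglongrightarrow> 0"
  using continuous_on_tendsto_compose[OF d_continuous[of x], of xs x sequentially] by simp

text \<open>The distance to \<open>x\<close> is nearly an affine image of a single
  \<open>f l\<close>, so points that no \<open>f l\<close> distinguishes coincide.\<close>

lemma d_zero_imp_eq: assumes "d x y = 0" shows "x = y"
proof (rule ccontr)
  assume ne: "x \<noteq> y"
  have eq: "apply_bcontfun (f k) x = apply_bcontfun (f k) y" for k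
  proof -
    have "\<forall>k. (1 / 2) ^ Suc k * \<bar>apply_bcontfun (f k) x - apply_bcontfun (f k) y\<bar> = 0"
      using assms unfolding d_eq by (subst (asm) suminf_eq_zero_iff[OF d_summable]) auto
    then have "(1 / 2) ^ Suc k * \<bar>apply_bcontfun (f k) x - apply_bcontfun (f k) y\<bar> = 0" by blast
    then show ?thesis by simp
  qed
  have "continuous_on UNIV (\<lambda>z. dist x z)" by (intro continuous_intros)
  from dense_approx[OF this, of "dist x y / 2"] ne
  obtain a b l where "\<And>z. \<bar>dist x z - (a * apply_bcontfun (f l) z + b)\<bar> < dist x y / 2" by auto
  from this[of x, unfolded eq dist_self] this[of y] show False by linarith
qed

lemma dist_imp_d:
  assumes e: "e > 0"
  shows "\<exists>\<delta>>0. \<forall>x y. dist x y < \<delta> \<longrightarrow> d x y < e"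
proof (rule ccontr)
  assume "\<not> ?thesis"
  then have "\<forall>n. \<exists>x y. dist x y < 1 / real (Suc n) \<and> \<not> d x y < e" by (metis of_nat_0_less_iff zero_less_Suc zero_less_divide_1_iff)
  then obtain x y where xy: "\<And>n. dist (x n) (y n) < 1 / real (Suc n)" "\<And>n. \<not> d (x n) (y n) < e" by metis
  obtain l r where r: "strict_mono (r :: nat \<Rightarrow> nat)" "(x \<circ> r) \<longlonglongrightarrow> l" using convergent_subsequence by blast
  have 0: "(\<lambda>n. dist (x n) (y n)) \<longlonglongrightarrow> 0"
    by (rule Lim_null_comparison[OF _ LIMSEQ_inverse_real_of_nat])
      (use xy(1) in \<open>auto intro!: always_eventually less_imp_le simp: inverse_eq_divide\<close>)
  have "(\<lambda>n. dist (x (r n)) (y (r n))) \<longlonglongrightarrow> 0" using LIMSEQ_subseq_LIMSEQ[OF 0 r(1)] by (simp add: o_def)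
  then have yl: "(\<lambda>n. y (r n)) \<longlonglongrightarrow> l"
  proof -
    assume 1: "(\<lambda>n. dist (x (r n)) (y (r n))) \<longlonglongrightarrow> 0"
    have 2: "(\<lambda>n. dist (x (r n)) l) \<longlonglongrightarrow> 0" using r(2) tendsto_dist_iff[of "x \<circ> r"] by (simp add: o_def)
    have "(\<lambda>n. dist (y (r n)) l) \<longlonglongrightarrow> 0"
    proof (rule Lim_null_comparison)
      show "(\<lambda>n. dist (x (r n)) (y (r n)) + dist (x (r n)) l) \<longlonglongrightarrow> 0" using tendsto_add[OF 1 2] by simp
      show "\<forall>\<^sub>F n in sequentially. norm (dist (y (r n)) l) \<le> dist (x (r n)) (y (r n)) + dist (x (r n)) l"
      proof (intro always_eventually allI)
        fix n
        show "norm (dist (y (r n)) l) \<le> dist (x (r n)) (y (r n)) + dist (x (r n)) l"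
          using dist_triangle[of "y (r n)" l "x (r n)"] by (simp add: dist_commute)
      qed
    qed
    then show ?thesis by (rule tendsto_dist_iff[THEN iffD2])
  qed
  have "(\<lambda>n. d l (x (r n)) + d l (y (r n))) \<longlonglongrightarrow> 0 + 0"
    by (intro tendsto_add d_tendsto yl) (use r(2) in \<open>simp add: o_def\<close>)
  then have "\<forall>\<^sub>F n in sequentially. d l (x (r n)) + d l (y (r n)) < e" using e by (intro order_tendstoD) auto
  then obtain n where "d l (x (r n)) + d l (y (r n)) < e" by (auto simp: eventually_sequentially)
  then show False using xy(2)[of "r n"] d_triangle[of "x (r n)" "y (r n)" l] d_sym by (metis le_less_trans)
qed

lemma d_imp_dist:
  assumes e: "e > 0"
  shows "\<exists>\<delta>>0. \<forall>x y. d x y < \<delta> \<longrightarrow> dist x y < e"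
proof (rule ccontr)
  assume "\<not> ?thesis"
  then have "\<forall>n. \<exists>x y. d x y < 1 / real (Suc n) \<and> \<not> dist x y < e" by (metis of_nat_0_less_iff zero_less_Suc zero_less_divide_1_iff)
  then obtain x y where xy: "\<And>n. d (x n) (y n) < 1 / real (Suc n)" "\<And>n. \<not> dist (x n) (y n) < e" by metis
  obtain l r where r: "strict_mono (r :: nat \<Rightarrow> nat)" "(x \<circ> r) \<longlonglongrightarrow> l" using convergent_subsequence by blast
  obtain l' r' where r': "strict_mono (r' :: nat \<Rightarrow> nat)" "((y \<circ> r) \<circ> r') \<longlonglongrightarrow> l'" using convergent_subsequence by blast
  define s where "s n = r (r' n)" for n
  have s: "strict_mono s" unfolding s_def using strict_mono_o[OF r(1) r'(1)] by (simp add: o_def)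
  have xl: "(\<lambda>n. x (s n)) \<longlonglongrightarrow> l" using LIMSEQ_subseq_LIMSEQ[OF r(2) r'(1)] by (simp add: o_def s_def)
  have yl: "(\<lambda>n. y (s n)) \<longlonglongrightarrow> l'" using r'(2) by (simp add: o_def s_def)
  have 0: "(\<lambda>n. d (x n) (y n)) \<longlonglongrightarrow> 0"
    by (rule Lim_null_comparison[OF _ LIMSEQ_inverse_real_of_nat])
      (use xy(1) d_nonneg in \<open>auto intro!: always_eventually less_imp_le simp: inverse_eq_divide\<close>)
  have "(\<lambda>n. d l (x (s n)) + d (x (s n)) (y (s n)) + d l' (y (s n))) \<longlonglongrightarrow> 0 + 0 + 0"
    using LIMSEQ_subseq_LIMSEQ[OF 0 s] by (intro tendsto_add d_tendsto xl yl) (simp add: o_def)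
  then have "(\<lambda>n. d l (x (s n)) + d (x (s n)) (y (s n)) + d l' (y (s n))) \<longlonglongrightarrow> 0" by simp
  then have "d l l' \<le> 0"
  proof (rule LIMSEQ_le_const)
    have "d l l' \<le> d l (x (s n)) + d (x (s n)) (y (s n)) + d l' (y (s n))" for n
      using d_triangle[of l l' "x (s n)"] d_triangle[of "x (s n)" l' "y (s n)"] d_sym[of l' "y (s n)"] by linarith
    then show "\<exists>N. \<forall>n\<ge>N. d l l' \<le> d l (x (s n)) + d (x (s n)) (y (s n)) + d l' (y (s n))" by blast
  qed
  then have "l = l'" using d_nonneg[of l l'] by (intro d_zero_imp_eq) simp
  then have "(\<lambda>n. dist (x (s n)) (y (s n))) \<longlonglongrightarrow> 0" using tendsto_dist[OF xl yl] by simp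
  then have "\<forall>\<^sub>F n in sequentially. dist (x (s n)) (y (s n)) < e" using e by (rule order_tendstoD)
  then show False using xy(2) by (auto simp: eventually_sequentially)
qed

lemma uniformly_continuous_d:
  fixes h :: "'a \<Rightarrow> 'b::metric_space"
  assumes h: "continuous_on UNIV h" and e: "e > 0"
  shows "\<exists>\<delta>>0. \<forall>x y. d x y \<le> \<delta> \<longrightarrow> dist (h x) (h y) < e"
proof -
  have "uniformly_continuous_on UNIV h" by (rule compact_uniformly_continuous[OF h compact_UNIV])
  then obtain \<delta> where \<delta>: "\<delta> > 0" "\<And>x y. dist x y < \<delta> \<Longrightarrow> dist (h x) (h y) < e"
    using e unfolding uniformly_continuous_on_def by (metis UNIV_I dist_commute)
  obtain \<delta>' where \<delta>': "\<delta>' > 0" "\<And>x y. d x y < \<delta>' \<Longrightarrow> dist x y < \<delta>" using d_imp_dist[OF \<delta>(1)] by blast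
  show ?thesis
  proof (intro exI[of _ "\<delta>' / 2"] conjI allI impI)
    show "\<delta>' / 2 > 0" using \<delta>' by simp
    fix x y assume "d x y \<le> \<delta>' / 2"
    then show "dist (h x) (h y) < e" using \<delta>' by (intro \<delta> \<delta>') linarith
  qed
qed

lemma continuous_funpow: "continuous_on UNIV (T ^^ j)"
proof (induction j)
  case (Suc j)
  have "continuous_on UNIV (\<lambda>x. T ((T ^^ j) x))" by (rule continuous_on_compose2[OF continuous_T Suc]) auto
  then show ?case by (simp add: comp_def)
qed (simp add: id_def)

text \<open>Closedness lets tracing points pass to a limit in \<open>tracing_infinite\<close>. For
  fixed \<open>n\<close> there are only finitely many sets of tracked times, each giving a closed
  condition.\<close>

lemma mistake_ball_closed: "closed (mistake_ball d T g n x e)"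
proof -
  have "mistake_ball d T g n x e =
    (\<Union>L\<in>{L. L \<subseteq> {..<n} \<and> card ({..<n} - L) \<le> g n}. \<Inter>j\<in>L. {y. d ((T ^^ j) x) ((T ^^ j) y) \<le> e})"
    by (auto simp: mistake_ball_def)
  moreover have "closed {y. d ((T ^^ j) x) ((T ^^ j) y) \<le> e}" for j
    by (intro closed_Collect_le continuous_on_compose2[OF d_continuous continuous_funpow] continuous_intros) auto
  ultimately show ?thesis by (auto intro!: closed_UN)
qed

lemma partitioned: "finite_partition P \<Longrightarrow> partitioned_map T P"
  using T_measurable by (simp add: partitioned_map_def)

lemma window_freq_itinerary:
  assumes P: "finite_partition P" and k: "k \<ge> 1"
  shows "window_freq k n (partitioned_map.itinerary T P (n + k - 1) x) w
    = birkhoff_sum T (indicat_real {y. partitioned_map.itinerary T P k y = w}) n x / real n"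
proof -
  interpret partitioned_map T P by (rule partitioned[OF P])
  have "take k (drop i (itinerary (n + k - 1) x)) = itinerary k ((T ^^ i) x)" if "i < n" for i
    using that k by (intro itinerary_window) auto
  then have "{i. i < n \<and> take k (drop i (itinerary (n + k - 1) x)) = w} = {i \<in> {..<n}. itinerary k ((T ^^ i) x) = w}"
    by auto
  moreover have "(\<Sum>i<n. indicat_real {y. itinerary k y = w} ((T ^^ i) x)) = real (card {i \<in> {..<n}. itinerary k ((T ^^ i) x) = w})"
    by (simp add: indicator_def sum.If_cases Collect_conj_eq lessThan_def)
  ultimately show ?thesis by (simp add: window_freq_def birkhoff_sum_def)
qed

text \<open>At almost every \<open>x\<close> the \<open>k\<close>-block frequencies converge to the
  word probabilities of \<open>\<kappa> x\<close>, whose entropy per letter is below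
  \<open>c\<close> for large \<open>k\<close>. Both \<open>k\<close> and the time from which this is
  visible depend on \<open>x\<close>; continuity of \<mu> along increasing sets makes them uniform
  outside a set of measure below \<tau>.\<close>

lemma entropy_wrt_le_of_components:
  assumes \<mu>: "\<mu> \<in> invariant_measures T" and P: "finite_partition P"
    and lt: "AE x in \<mu>. entropy_wrt T (\<kappa> x) P < c"
  shows "entropy_wrt T \<mu> P \<le> c"
proof -
  interpret partitioned_map T P by (rule partitioned[OF P])
  interpret pmp \<mu> T by (rule pmp_invariant[OF \<mu>])
  define E where "E k n = {x. shannon (words P k) (window_freq k n (itinerary (n + k - 1) x)) \<le> real k * c}" for k n
  have Eb: "E k n \<in> sets borel" for k n unfolding E_def by (rule itinerary_pred_measurable)
  have fr: "AE x in \<mu>. \<forall>k. \<forall>w\<in>words P k. (\<lambda>n. birkhoff_sum T (indicat_real {y. itinerary k y = w}) n x / real n) \<longlonglongrightarrow> measure (\<kappa> x) {y. itinerary k y = w}"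
    unfolding AE_all_countable
  proof (intro allI AE_finite_allI finite_wordsP)
    fix k w
    show "AE x in \<mu>. (\<lambda>n. birkhoff_sum T (indicat_real {y. itinerary k y = w}) n x / real n) \<longlonglongrightarrow> measure (\<kappa> x) {y. itinerary k y = w}"
      by (rule AE_frequency[OF \<mu> cylinder_measurable])
  qed
  \<comment> \<open>Here every block length from \<open>max K 1\<close> on is eventually good; the
    sets increase with \<open>K\<close>.\<close>
  define G where "G K = (\<Inter>k\<in>{max K 1..}. \<Union>N. \<Inter>n\<in>{N..}. E k n)" for K
  have Gb: "G K \<in> sets borel" for K unfolding G_def
    by (intro sets.countable_INT' sets.countable_UN) (auto intro!: sets.countable_INT' simp: Eb)
  have "AE x in \<mu>. x \<in> (\<Union>K. G K)"
    using lt fr AE_generic[OF \<mu>]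
  proof eventually_elim
    case (elim x)
    have kinv: "\<kappa> x \<in> invariant_measures T" by (rule generic_invariant[OF elim(3)])
    have "\<forall>\<^sub>F k in sequentially. word_entropy (\<kappa> x) k / real k < c"
      using word_entropy_tendsto(1)[OF kinv] elim(1) by (rule order_tendstoD)
    then obtain K where K: "\<And>k. k \<ge> K \<Longrightarrow> word_entropy (\<kappa> x) k / real k < c" by (auto simp: eventually_sequentially)
    have ev: "\<exists>N. \<forall>n\<ge>N. x \<in> E k n" if k: "k \<ge> max K 1" for k
    proof -
      have k1: "k \<ge> 1" "k \<ge> K" using k by auto
      have "(\<lambda>n. shannon (words P k) (window_freq k n (itinerary (n + k - 1) x))) \<longlonglongrightarrow> shannon (words P k) (word_prob (\<kappa> x))"
      proof (rule tendsto_shannon[OF finite_wordsP])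
        fix w assume w: "w \<in> words P k"
        show "(\<lambda>n. window_freq k n (itinerary (n + k - 1) x) w) \<longlonglongrightarrow> word_prob (\<kappa> x) w"
          unfolding window_freq_itinerary[OF P k1(1)] word_prob_words[OF w] using elim(2) w by blast
      qed (auto simp: window_freq_def)
      moreover have "shannon (words P k) (word_prob (\<kappa> x)) < real k * c"
        using K[OF k1(2)] k1(1) by (simp add: word_entropy_def field_simps)
      ultimately have "\<forall>\<^sub>F n in sequentially. shannon (words P k) (window_freq k n (itinerary (n + k - 1) x)) < real k * c"
        by (rule order_tendstoD)
      then show ?thesis by (auto simp: eventually_sequentially E_def intro: less_imp_le)
    qed
    have "x \<in> G K" unfolding G_def
    proof (intro INT_I)
      fix k assume "k \<in> {max K 1..}"
      then obtain N where "\<forall>n\<ge>N. x \<in> E k n" using ev[of k] by auto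
      then show "x \<in> (\<Union>N. \<Inter>n\<in>{N..}. E k n)" by (intro UN_I[of N]) auto
    qed
    then show ?case by blast
  qed
  then have full: "measure \<mu> (\<Union>K. G K) = 1" using prob_eq_1[of "\<Union>K. G K"] Gb sets_\<mu> by auto
  show ?thesis
  proof (rule entropy_wrt_le_of_itineraries[OF \<mu>])
    fix \<tau> :: real assume \<tau>: "\<tau> > 0"
    have incG: "incseq G" by (rule incseq_SucI) (auto simp: G_def)
    have "(\<lambda>K. measure \<mu> (G K)) \<longlonglongrightarrow> 1"
      using finite_Lim_measure_incseq[of G] Gb sets_\<mu> incG full by auto
    then have "\<forall>\<^sub>F K in sequentially. 1 - \<tau> < measure \<mu> (G K)" by (rule order_tendstoD) (use \<tau> in simp)
    then obtain K where K: "1 - \<tau> < measure \<mu> (G K)" by (auto simp: eventually_sequentially)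
    define k where "k = max K 1"
    define H where "H N = (\<Inter>n\<in>{N..}. E k n)" for N
    have Hb: "H N \<in> sets borel" for N unfolding H_def by (intro sets.countable_INT') (auto simp: Eb)
    have incH: "incseq H" by (rule incseq_SucI) (auto simp: H_def)
    have "G K \<subseteq> (\<Union>N. H N)" unfolding G_def H_def k_def by blast
    then have "measure \<mu> (G K) \<le> measure \<mu> (\<Union>N. H N)" by (intro finite_measure_mono) (use Hb sets_\<mu> in auto)
    then have "1 - \<tau> < measure \<mu> (\<Union>N. H N)" using K by linarith
    moreover have "(\<lambda>N. measure \<mu> (H N)) \<longlonglongrightarrow> measure \<mu> (\<Union>N. H N)"
      by (rule finite_Lim_measure_incseq) (use Hb sets_\<mu> incH in auto)
    ultimately have "\<forall>\<^sub>F N in sequentially. 1 - \<tau> < measure \<mu> (H N)" by (intro order_tendstoD)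
    then obtain N where N: "1 - \<tau> < measure \<mu> (H N)" by (auto simp: eventually_sequentially)
    have "1 - \<tau> \<le> measure \<mu> (E k n)" if "n \<ge> N" for n
    proof -
      have "measure \<mu> (H N) \<le> measure \<mu> (E k n)"
        by (rule finite_measure_mono) (use that Eb sets_\<mu> in \<open>auto simp: H_def\<close>)
      then show ?thesis using N by linarith
    qed
    then show "\<exists>k\<ge>1. \<exists>N. \<forall>n\<ge>N. 1 - \<tau> \<le> measure \<mu> {x. shannon (words P k) (window_freq k n (itinerary (n + k - 1) x)) \<le> real k * c}"
      unfolding E_def by (intro exI[of _ k]) (auto simp: k_def)
  qed
qed

lemma finite_family_bounded:
  assumes "finite U" "\<And>u. u \<in> U \<Longrightarrow> continuous_on UNIV (u :: 'a \<Rightarrow> real)"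
  obtains B where "B > 0" "\<And>u x. u \<in> U \<Longrightarrow> \<bar>u x\<bar> \<le> B"
proof -
  have "\<exists>B>0. \<forall>u\<in>U. \<forall>x. \<bar>u x\<bar> \<le> B" using assms
  proof (induction U rule: finite_induct)
    case (insert v U)
    then obtain B where B: "B > 0" "\<forall>u\<in>U. \<forall>x. \<bar>u x\<bar> \<le> B" by auto
    obtain B' where B': "B' > 0" "\<And>x. \<bar>v x\<bar> \<le> B'" using continuous_bounded[of v] insert.prems by auto
    show ?case
    proof (intro exI[of _ "max B B'"] conjI ballI allI)
      fix u x assume "u \<in> insert v U"
      then show "\<bar>u x\<bar> \<le> max B B'" using B(2) B'(2)[of x] by (auto intro: max.coboundedI1 max.coboundedI2)
    qed (use B in auto)
  qed (auto intro: exI[of _ 1])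
  then show ?thesis using that by blast
qed

lemma integral_bounded:
  assumes \<nu>: "\<nu> \<in> prob_measures" and u: "continuous_on UNIV (u :: 'a \<Rightarrow> real)" "\<And>x. \<bar>u x\<bar> \<le> B"
  shows "\<bar>\<integral>x. u x \<partial>\<nu>\<bar> \<le> B"
  using integral_close[OF \<nu> u(1), of "\<lambda>_. 0" B] u(2) by simp

lemma uniform_measure_invariant:
  assumes \<mu>: "\<mu> \<in> invariant_measures T" and A: "A \<in> sets borel" "T -` A = A" and pos: "measure \<mu> A > 0"
  shows "uniform_measure \<mu> A \<in> invariant_measures T"
    and "S \<in> sets borel \<Longrightarrow> measure (uniform_measure \<mu> A) S = measure \<mu> (A \<inter> S) / measure \<mu> A"
proof -
  interpret pmp \<mu> T by (rule pmp_invariant[OF \<mu>])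
  have e: "emeasure \<mu> A \<noteq> 0" "emeasure \<mu> A \<noteq> \<infinity>" using pos by (auto simp: emeasure_eq_measure)
  have Tu: "T \<in> measurable (uniform_measure \<mu> A) borel"
    using T_meas sets_\<mu> by (simp cong: measurable_cong_sets)
  have sp: "space (uniform_measure \<mu> A) = UNIV" by (simp add: space_\<mu>)
  have inv: "measure \<mu> (A \<inter> T -` S) = measure \<mu> (A \<inter> S)" if S: "S \<in> sets borel" for S
  proof -
    have "A \<inter> T -` S = T -` (A \<inter> S)" using A(2) by blast
    moreover have "measure (distr \<mu> borel T) (A \<inter> S) = measure \<mu> (T -` (A \<inter> S))"
      using measure_distr[of T \<mu> borel "A \<inter> S"] S A T_meas sets_\<mu> by (simp add: space_\<mu> cong: measurable_cong_sets)
    ultimately show ?thesis using T_preserves by simp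
  qed
  have TS: "T -` S \<in> sets borel" if "S \<in> sets borel" for S using measurable_sets[OF T_meas that] by simp
  have "distr (uniform_measure \<mu> A) borel T = uniform_measure \<mu> A"
  proof (rule measure_eqI)
    show "sets (distr (uniform_measure \<mu> A) borel T) = sets (uniform_measure \<mu> A)" using sets_\<mu> by simp
    fix S assume "S \<in> sets (distr (uniform_measure \<mu> A) borel T)"
    then have S: "S \<in> sets borel" by simp
    have "emeasure (distr (uniform_measure \<mu> A) borel T) S = emeasure (uniform_measure \<mu> A) (T -` S)"
      using emeasure_distr[OF Tu S] sp by simp
    also have "\<dots> = emeasure \<mu> (A \<inter> T -` S) / emeasure \<mu> A"
      by (rule emeasure_uniform_measure) (use A TS[OF S] sets_\<mu> in auto)
    also have "\<dots> = emeasure \<mu> (A \<inter> S) / emeasure \<mu> A" using inv[OF S] by (simp add: emeasure_eq_measure)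
    also have "\<dots> = emeasure (uniform_measure \<mu> A) S"
      by (rule emeasure_uniform_measure[symmetric]) (use A S sets_\<mu> in auto)
    finally show "emeasure (distr (uniform_measure \<mu> A) borel T) S = emeasure (uniform_measure \<mu> A) S" .
  qed
  then show "uniform_measure \<mu> A \<in> invariant_measures T"
    using prob_space_uniform_measure[OF e] sets_\<mu> by (simp add: invariant_measures_def prob_measures_def)
  show "S \<in> sets borel \<Longrightarrow> measure (uniform_measure \<mu> A) S = measure \<mu> (A \<inter> S) / measure \<mu> A"
    using measure_uniform_measure[OF e, of S] sets_\<mu> by simp
qed

text \<open>A finite form of the ergodic decomposition: the space is cut into finitely many invariant
  pieces on which the ergodic components are close to each other.\<close>

lemma ergodic_combination:
  assumes \<mu>: "\<mu> \<in> invariant_measures T" and P: "finite_partition P"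
    and U: "finite U" "\<And>u. u \<in> U \<Longrightarrow> continuous_on UNIV (u :: 'a \<Rightarrow> real)" and r: "r > 0" and \<eta>: "\<eta> > 0"
  shows "\<exists>(p::nat) \<nu> a. (\<forall>i<p. \<nu> i \<in> ergodic_measures T \<and> 0 < a i) \<and> (\<Sum>i<p. a i) = 1 \<and>
    (\<forall>u\<in>U. \<bar>(\<Sum>i<p. a i * (\<integral>x. u x \<partial>\<nu> i)) - (\<integral>x. u x \<partial>\<mu>)\<bar> < r) \<and>
    entropy_wrt T \<mu> P - \<eta> \<le> (\<Sum>i<p. a i * entropy_wrt T (\<nu> i) P)"
proof -
  interpret partitioned_map T P by (rule partitioned[OF P])
  interpret pmp \<mu> T by (rule pmp_invariant[OF \<mu>])
  obtain B where B: "B > 0" "\<And>u x. u \<in> U \<Longrightarrow> \<bar>u x\<bar> \<le> B" using finite_family_bounded[OF U] by blast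
  have um: "u \<in> borel_measurable borel" if "u \<in> U" for u using U(2)[OF that] by (rule borel_measurable_continuous_onI)
  \<comment> \<open>Clipping at \<open>B\<close> keeps the number of labels finite also where
    \<open>lim\<close> has no meaning. Cells of width \<open>r / 2\<close> keep time averages with
    equal labels within \<open>r / 2\<close> of each other.\<close>
  define cl where "cl u x = max (-B) (min B (time_avg T u x)) / (r / 2)" for u x
  define lab where "lab x = (\<lambda>u\<in>U. \<lfloor>cl u x\<rfloor>)" for x
  define A where "A t = {x. lab x = t}" for t
  have clm: "cl u \<in> borel_measurable borel" if "u \<in> U" for u
    unfolding cl_def using time_avg_meas[OF um[OF that]] by simp
  have "range lab \<subseteq> PiE U (\<lambda>_. {\<lfloor>- B / (r / 2)\<rfloor>..\<lfloor>B / (r / 2)\<rfloor>})"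
  proof (rule image_subsetI)
    fix x
    have "- B / (r / 2) \<le> cl u x \<and> cl u x \<le> B / (r / 2)" for u
      unfolding cl_def using r B(1) by (intro conjI divide_right_mono) auto
    then show "lab x \<in> PiE U (\<lambda>_. {\<lfloor>- B / (r / 2)\<rfloor>..\<lfloor>B / (r / 2)\<rfloor>})"
      unfolding lab_def by (auto intro!: floor_mono)
  qed
  then have finlab: "finite (range lab)" by (rule finite_subset) (intro finite_PiE U finite_atLeastAtMost_int)
  have Ab: "A t \<in> sets borel" for t
  proof (cases "t \<in> extensional U")
    case True
    have "A t = (\<Inter>u\<in>U. {x. of_int (t u) \<le> cl u x} \<inter> {x. cl u x < of_int (t u) + 1})"
    proof (intro set_eqI)
      fix x
      have "lab x = t \<longleftrightarrow> (\<forall>u\<in>U. \<lfloor>cl u x\<rfloor> = t u)"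
        unfolding lab_def using True by (auto simp: extensional_def fun_eq_iff)
      then show "x \<in> A t \<longleftrightarrow> x \<in> (\<Inter>u\<in>U. {x. of_int (t u) \<le> cl u x} \<inter> {x. cl u x < of_int (t u) + 1})"
        by (auto simp: A_def floor_eq_iff)
    qed
    moreover have "{x. of_int (t u) \<le> cl u x} \<in> sets borel" "{x. cl u x < of_int (t u) + 1} \<in> sets borel" if "u \<in> U" for u
      using measurable_sets[OF clm[OF that], of "{of_int (t u)..}"] measurable_sets[OF clm[OF that], of "{..<of_int (t u) + 1}"]
      by (auto simp: vimage_def)
    ultimately show ?thesis using U(1) by (cases "U = {}") (auto intro!: sets.finite_INT)
  next
    case False
    then have "A t = {}" by (auto simp: A_def lab_def)
    then show ?thesis by simp
  qed
  have "lab (T x) = lab x" for x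
    unfolding lab_def cl_def using time_avg_T[of _ B x] B(2) by (intro restrict_ext) simp
  then have Ainv: "T -` A t = A t" for t by (auto simp: A_def)
  define I where "I = {t \<in> range lab. measure \<mu> (A t) > 0}"
  have finI: "finite I" using finlab by (simp add: I_def)
  have total: "(\<Sum>t\<in>I. measure \<mu> (A t \<inter> S)) = measure \<mu> S" if S: "S \<in> sets borel" for S
  proof -
    have "measure \<mu> (\<Union>t\<in>range lab. A t \<inter> S) = (\<Sum>t\<in>range lab. measure \<mu> (A t \<inter> S))"
      by (rule finite_measure_finite_Union[OF finlab]) (use Ab S sets_\<mu> in \<open>auto simp: disjoint_family_on_def A_def\<close>)
    moreover have "(\<Union>t\<in>range lab. A t \<inter> S) = S" by (auto simp: A_def)
    moreover have "(\<Sum>t\<in>range lab. measure \<mu> (A t \<inter> S)) = (\<Sum>t\<in>I. measure \<mu> (A t \<inter> S))"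
    proof (rule sum.mono_neutral_right[OF finlab])
      show "\<forall>t\<in>range lab - I. measure \<mu> (A t \<inter> S) = 0"
      proof
        fix t assume "t \<in> range lab - I"
        then have "measure \<mu> (A t) \<le> 0" by (auto simp: I_def)
        moreover have "measure \<mu> (A t \<inter> S) \<le> measure \<mu> (A t)" by (rule finite_measure_mono) (use Ab sets_\<mu> in auto)
        ultimately show "measure \<mu> (A t \<inter> S) = 0" using measure_nonneg[of \<mu> "A t \<inter> S"] by linarith
      qed
    qed (auto simp: I_def)
    ultimately show ?thesis by simp
  qed
  define \<mu>t where "\<mu>t t = uniform_measure \<mu> (A t)" for t
  have \<mu>t: "\<mu>t t \<in> invariant_measures T"
    and \<mu>tm: "\<And>S. S \<in> sets borel \<Longrightarrow> measure (\<mu>t t) S = measure \<mu> (A t \<inter> S) / measure \<mu> (A t)" if "t \<in> I" for t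
    unfolding \<mu>t_def using uniform_measure_invariant[OF \<mu> Ab Ainv, of t] that by (auto simp: I_def)
  \<comment> \<open>If the piece had no such point, almost all components of \<open>\<mu>t t\<close>
    would have entropy below that of \<open>\<mu>t t\<close> by more than \<eta>, against
    \<open>entropy_wrt_le_of_components\<close>.\<close>
  have "\<exists>x. generic (\<kappa> x) x \<and> \<kappa> x \<in> ergodic_measures T \<and> x \<in> A t \<and> entropy_wrt T (\<mu>t t) P - \<eta> \<le> entropy_wrt T (\<kappa> x) P"
    if t: "t \<in> I" for t
  proof (rule ccontr)
    assume neg: "\<not> ?thesis"
    have "AE x in \<mu>t t. x \<in> A t"
      unfolding \<mu>t_def by (rule AE_uniform_measureI) (use Ab sets_\<mu> in auto)
    then have "AE x in \<mu>t t. entropy_wrt T (\<kappa> x) P < entropy_wrt T (\<mu>t t) P - \<eta>"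
      using AE_generic[OF \<mu>t[OF t]] AE_ergodic[OF \<mu>t[OF t]]
      by eventually_elim (use neg in force)
    then have "entropy_wrt T (\<mu>t t) P \<le> entropy_wrt T (\<mu>t t) P - \<eta>"
      by (rule entropy_wrt_le_of_components[OF \<mu>t[OF t] P])
    then show False using \<eta> by simp
  qed
  then obtain X where X: "\<And>t. t \<in> I \<Longrightarrow> generic (\<kappa> (X t)) (X t)" "\<And>t. t \<in> I \<Longrightarrow> \<kappa> (X t) \<in> ergodic_measures T"
    "\<And>t. t \<in> I \<Longrightarrow> X t \<in> A t" "\<And>t. t \<in> I \<Longrightarrow> entropy_wrt T (\<mu>t t) P - \<eta> \<le> entropy_wrt T (\<kappa> (X t)) P"
    by metis
  have sum1: "(\<Sum>t\<in>I. measure \<mu> (A t)) = 1" using total[of UNIV] prob_space by (simp add: space_\<mu>)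
  have ent: "entropy_wrt T \<mu> P - \<eta> \<le> (\<Sum>t\<in>I. measure \<mu> (A t) * entropy_wrt T (\<kappa> (X t)) P)"
  proof -
    have "entropy_wrt T \<mu> P \<le> (\<Sum>t\<in>I. measure \<mu> (A t) * entropy_wrt T (\<mu>t t) P)"
    proof (rule entropy_wrt_mixture[OF \<mu> finI \<mu>t _ sum1])
      fix S :: "'a set" assume S: "S \<in> sets borel"
      have "(\<Sum>t\<in>I. measure \<mu> (A t) * measure (\<mu>t t) S) = (\<Sum>t\<in>I. measure \<mu> (A t \<inter> S))"
        by (rule sum.cong[OF refl]) (use \<mu>tm S in \<open>auto simp: I_def\<close>)
      then show "measure \<mu> S = (\<Sum>t\<in>I. measure \<mu> (A t) * measure (\<mu>t t) S)" using total[OF S] by simp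
    qed (auto simp: I_def)
    also have "\<dots> \<le> (\<Sum>t\<in>I. measure \<mu> (A t) * (entropy_wrt T (\<kappa> (X t)) P + \<eta>))"
    proof (rule sum_mono)
      fix t assume "t \<in> I"
      then have "entropy_wrt T (\<mu>t t) P \<le> entropy_wrt T (\<kappa> (X t)) P + \<eta>" using X(4)[of t] by linarith
      then show "measure \<mu> (A t) * entropy_wrt T (\<mu>t t) P \<le> measure \<mu> (A t) * (entropy_wrt T (\<kappa> (X t)) P + \<eta>)"
        by (intro mult_left_mono) auto
    qed
    also have "\<dots> = (\<Sum>t\<in>I. measure \<mu> (A t) * entropy_wrt T (\<kappa> (X t)) P) + \<eta>"
      using sum1 by (simp add: distrib_left sum.distrib sum_distrib_right[symmetric])
    finally show ?thesis by simp
  qed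
  have ints: "\<bar>(\<Sum>t\<in>I. measure \<mu> (A t) * (\<integral>x. u x \<partial>\<kappa> (X t))) - (\<integral>x. u x \<partial>\<mu>)\<bar> < r" if u: "u \<in> U" for u
  proof -
    have ta: "time_avg T u x = (\<integral>y. u y \<partial>\<kappa> x)" if "generic (\<kappa> x) x" for x
      unfolding time_avg_def by (rule limI) (use that U(2)[OF u] in \<open>auto simp: generic_def\<close>)
    have tb: "\<bar>time_avg T u x\<bar> \<le> B" if "generic (\<kappa> x) x" for x
      unfolding ta[OF that] by (rule integral_bounded) (use that U(2)[OF u] B(2)[OF u] in \<open>auto simp: generic_def\<close>)
    \<comment> \<open>The integrals at the chosen representatives, spread over their pieces: a step
      function within \<open>r / 2\<close> of the time average.\<close>
    define s where "s x = (\<Sum>t\<in>I. (\<integral>y. u y \<partial>\<kappa> (X t)) * indicat_real (A t) x)" for x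
    have "AE x in \<mu>. x \<in> (\<Union>t\<in>I. A t)"
    proof -
      have "measure \<mu> (\<Union>t\<in>I. A t) = (\<Sum>t\<in>I. measure \<mu> (A t))"
        by (rule finite_measure_finite_Union[OF finI]) (use Ab sets_\<mu> in \<open>auto simp: disjoint_family_on_def A_def\<close>)
      moreover have "(\<Union>t\<in>I. A t) \<in> sets \<mu>" using Ab sets_\<mu> finI by (intro sets.finite_UN) auto
      ultimately show ?thesis using sum1 prob_eq_1[of "\<Union>t\<in>I. A t"] by simp
    qed
    then have close: "AE x in \<mu>. \<bar>s x - time_avg T u x\<bar> \<le> r / 2"
      using AE_generic[OF \<mu>]
    proof eventually_elim
      case (elim x)
      then have tI: "lab x \<in> I" by (auto simp: A_def)
      have "s x = (\<Sum>t\<in>I. if t = lab x then \<integral>y. u y \<partial>\<kappa> (X t) else 0)"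
        unfolding s_def by (rule sum.cong) (auto simp: A_def)
      then have sx: "s x = time_avg T u (X (lab x))" using finI tI ta[OF X(1)[OF tI]] by (simp add: sum.delta)
      have "lab (X (lab x)) = lab x" using X(3)[OF tI] by (simp add: A_def)
      then have "\<lfloor>cl u (X (lab x))\<rfloor> = \<lfloor>cl u x\<rfloor>" unfolding lab_def using u by (metis restrict_apply')
      then have "\<bar>cl u (X (lab x)) - cl u x\<bar> \<le> 1" by linarith
      moreover have "cl u y = time_avg T u y / (r / 2)" if "generic (\<kappa> y) y" for y
        using tb[OF that] by (simp add: cl_def abs_le_iff)
      ultimately have "\<bar>time_avg T u (X (lab x)) / (r / 2) - time_avg T u x / (r / 2)\<bar> \<le> 1"
        using X(1)[OF tI] elim(2) by simp
      then have "\<bar>(time_avg T u (X (lab x)) - time_avg T u x) / (r / 2)\<bar> \<le> 1"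
        by (simp only: diff_divide_distrib)
      then have "\<bar>time_avg T u (X (lab x)) - time_avg T u x\<bar> / (r / 2) \<le> 1"
        using r by (simp only: abs_divide abs_of_pos half_gt_zero)
      then show ?case unfolding sx using r by (simp add: field_simps)
    qed
    have int_ind: "integrable \<mu> (indicat_real (A t))" for t
      using Ab sets_\<mu> by (intro integrable_real_indicator) (auto simp: emeasure_eq_measure)
    then have ints: "integrable \<mu> s" unfolding s_def by (intro Bochner_Integration.integrable_sum integrable_mult_right) auto
    have intt: "integrable \<mu> (time_avg T u)"
      by (rule integrable_const_bound[of _ B]) (use time_avg_bounded[OF um[OF u] B(2)[OF u]] time_avg_meas[OF um[OF u]] in auto)
    have "(\<integral>x. s x \<partial>\<mu>) = (\<Sum>t\<in>I. measure \<mu> (A t) * (\<integral>x. u x \<partial>\<kappa> (X t)))"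
      unfolding s_def using int_ind Ab sets_\<mu> by (subst Bochner_Integration.integral_sum) (auto simp: space_\<mu> mult.commute)
    moreover have "(\<integral>x. time_avg T u x \<partial>\<mu>) = (\<integral>x. u x \<partial>\<mu>)"
      by (rule integral_time_avg_UNIV[OF um[OF u] B(2)[OF u]])
    moreover have "\<bar>(\<integral>x. s x \<partial>\<mu>) - (\<integral>x. time_avg T u x \<partial>\<mu>)\<bar> \<le> r / 2"
    proof -
      have "\<bar>\<integral>x. s x - time_avg T u x \<partial>\<mu>\<bar> \<le> (\<integral>x. \<bar>s x - time_avg T u x\<bar> \<partial>\<mu>)" by (rule integral_abs_bound)
      also have "\<dots> \<le> (\<integral>x. r / 2 \<partial>\<mu>)" by (rule integral_mono_AE) (use ints intt close in auto)
      finally show ?thesis using ints intt by (simp add: prob_space)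
    qed
    ultimately show ?thesis using r by linarith
  qed
  obtain h where h: "bij_betw h {..<card I} I"
    using ex_bij_betw_nat_finite[OF finI] by (auto simp: atLeast0LessThan)
  have re: "(\<Sum>i<card I. G (h i)) = (\<Sum>t\<in>I. G t)" for G :: "_ \<Rightarrow> real" by (rule sum.reindex_bij_betw[OF h])
  have hI: "h i \<in> I" if "i < card I" for i using h that by (auto simp: bij_betw_def)
  show ?thesis
  proof (intro exI[of _ "card I"] exI[of _ "\<lambda>i. \<kappa> (X (h i))"] exI[of _ "\<lambda>i. measure \<mu> (A (h i))"] conjI ballI allI impI)
    show "\<kappa> (X (h i)) \<in> ergodic_measures T" "0 < measure \<mu> (A (h i))" if "i < card I" for i
      using X(2)[OF hI[OF that]] hI[OF that] by (auto simp: I_def)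
    show "(\<Sum>i<card I. measure \<mu> (A (h i))) = 1" using re[of "\<lambda>t. measure \<mu> (A t)"] sum1 by simp
    show "\<bar>(\<Sum>i<card I. measure \<mu> (A (h i)) * (\<integral>x. u x \<partial>\<kappa> (X (h i)))) - (\<integral>x. u x \<partial>\<mu>)\<bar> < r" if "u \<in> U" for u
      using ints[OF that] re[of "\<lambda>t. measure \<mu> (A t) * (\<integral>x. u x \<partial>\<kappa> (X t))"] by simp
    show "entropy_wrt T \<mu> P - \<eta> \<le> (\<Sum>i<card I. measure \<mu> (A (h i)) * entropy_wrt T (\<kappa> (X (h i))) P)"
      using ent re[of "\<lambda>t. measure \<mu> (A t) * entropy_wrt T (\<kappa> (X t)) P"] by simp
  qed
qed

text \<open>\<open>D\<close> is abstract because the bound is needed both for differences of real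
  functions and for distances between values of the observable on Dirac measures.\<close>

lemma mistake_ball_sum:
  assumes z: "z \<in> mistake_ball d T g n x \<theta>" and s: "0 \<le> s" and B: "0 \<le> B"
    and D: "\<And>y y'. d y y' \<le> \<theta> \<Longrightarrow> D y y' \<le> s" "\<And>y y'. D y y' \<le> B"
  shows "(\<Sum>i<n. D ((T ^^ i) x) ((T ^^ i) z)) \<le> real n * s + real (g n) * B"
proof -
  obtain L where L: "L \<subseteq> {..<n}" "card ({..<n} - L) \<le> g n" "\<forall>j\<in>L. d ((T ^^ j) x) ((T ^^ j) z) \<le> \<theta>"
    using z by (auto simp: mistake_ball_def)
  have "(\<Sum>i<n. D ((T ^^ i) x) ((T ^^ i) z)) \<le> (\<Sum>i<n. s + B * indicat_real ({..<n} - L) i)"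
  proof (rule sum_mono)
    fix i assume "i \<in> {..<n}"
    then show "D ((T ^^ i) x) ((T ^^ i) z) \<le> s + B * indicat_real ({..<n} - L) i"
      using L(3) D s by (cases "i \<in> L") (auto simp: indicator_def intro: order_trans[OF D(2)])
  qed
  also have "\<dots> = real n * s + B * real (card ({..<n} - L))"
  proof -
    have "{..<n} \<inter> {i. i \<in> {..<n} - L} = {..<n} - L" by auto
    then have "(\<Sum>i<n. indicat_real ({..<n} - L) i) = real (card ({..<n} - L))"
      unfolding indicator_def by (simp only: sum_of_bool_eq finite_lessThan)
    then show ?thesis by (simp add: sum.distrib sum_distrib_left[symmetric])
  qed
  also have "B * real (card ({..<n} - L)) \<le> B * real (g n)" using L(2) B by (intro mult_left_mono) auto
  finally show ?thesis by (simp add: mult.commute)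
qed

lemma mistake_ball_birkhoff:
  assumes z: "z \<in> mistake_ball d T g n x \<theta>" and s: "0 \<le> s"
    and u: "\<And>y y'. d y y' \<le> \<theta> \<Longrightarrow> \<bar>u y - u y'\<bar> \<le> s" "\<And>y. \<bar>u y\<bar> \<le> B"
  shows "\<bar>birkhoff_sum T u n x - birkhoff_sum T u n z\<bar> \<le> real n * s + real (g n) * (2 * B)"
proof -
  have "\<bar>birkhoff_sum T u n x - birkhoff_sum T u n z\<bar> \<le> (\<Sum>i<n. \<bar>u ((T ^^ i) x) - u ((T ^^ i) z)\<bar>)"
    unfolding birkhoff_sum_def sum_subtractf[symmetric] by (rule sum_abs)
  also have "\<dots> \<le> real n * s + real (g n) * (2 * B)"
  proof (rule mistake_ball_sum[OF z s])
    show "0 \<le> 2 * B" using order_trans[OF abs_ge_zero u(2)] by simp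
    show "\<bar>u y - u y'\<bar> \<le> 2 * B" for y y' using u(2)[of y] u(2)[of y'] by linarith
  qed (rule u(1))
  finally show ?thesis .
qed

text \<open>Each of the two tracing orbits spoils at most \<open>g n\<close> of the separated times;
  at the others the distance drops by at most \<open>2 * \<theta>\<close>.\<close>

lemma mistake_ball_separated:
  assumes z: "z \<in> mistake_ball d T g n x \<theta>" and z': "z' \<in> mistake_ball d T g n x' \<theta>"
    and sep: "separated_points d T \<delta> n \<epsilon> x x'"
  shows "\<delta> * real n - 2 * real (g n) \<le> real (card {j. j < n \<and> \<epsilon> - 2 * \<theta> < d ((T ^^ j) z) ((T ^^ j) z')})"
proof -
  obtain L where L: "L \<subseteq> {..<n}" "card ({..<n} - L) \<le> g n" "\<forall>j\<in>L. d ((T ^^ j) x) ((T ^^ j) z) \<le> \<theta>"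
    using z by (auto simp: mistake_ball_def)
  obtain L' where L': "L' \<subseteq> {..<n}" "card ({..<n} - L') \<le> g n" "\<forall>j\<in>L'. d ((T ^^ j) x') ((T ^^ j) z') \<le> \<theta>"
    using z' by (auto simp: mistake_ball_def)
  let ?S = "{j. j < n \<and> d ((T ^^ j) x) ((T ^^ j) x') > \<epsilon>}"
  let ?R = "{j. j < n \<and> \<epsilon> - 2 * \<theta> < d ((T ^^ j) z) ((T ^^ j) z')}"
  have "?S \<subseteq> ?R \<union> ({..<n} - L) \<union> ({..<n} - L')"
  proof
    fix j assume j: "j \<in> ?S"
    show "j \<in> ?R \<union> ({..<n} - L) \<union> ({..<n} - L')"
    proof (cases "j \<in> L \<and> j \<in> L'")
      case True
      have "d ((T ^^ j) x) ((T ^^ j) x') \<le> d ((T ^^ j) x) ((T ^^ j) z) + (d ((T ^^ j) z) ((T ^^ j) z') + d ((T ^^ j) x') ((T ^^ j) z'))"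
        using d_triangle[of "(T ^^ j) x" "(T ^^ j) x'" "(T ^^ j) z"] d_triangle[of "(T ^^ j) z" "(T ^^ j) x'" "(T ^^ j) z'"]
          d_sym[of "(T ^^ j) x'" "(T ^^ j) z'"] by linarith
      moreover have "d ((T ^^ j) x) ((T ^^ j) z) \<le> \<theta>" "d ((T ^^ j) x') ((T ^^ j) z') \<le> \<theta>" using True L L' by auto
      moreover have "d ((T ^^ j) x) ((T ^^ j) x') > \<epsilon>" using j by simp
      ultimately have "\<epsilon> - 2 * \<theta> < d ((T ^^ j) z) ((T ^^ j) z')" by linarith
      then show ?thesis using j by auto
    qed (use j in auto)
  qed
  then have "card ?S \<le> card (?R \<union> ({..<n} - L) \<union> ({..<n} - L'))" by (rule card_mono[rotated]) auto
  also have "\<dots> \<le> card ?R + card ({..<n} - L) + card ({..<n} - L')"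
    by (meson add_le_mono card_Un_le le_refl order_trans)
  also have "\<dots> \<le> card ?R + g n + g n" using L L' by simp
  finally have "real (card ?S) \<le> real (card ?R) + 2 * real (g n)" by linarith
  then show ?thesis using sep unfolding separated_points_def by linarith
qed

end

section \<open>Gluing separated sets\<close>

locale product_system = rho_system T f for T :: "'a::metric_space \<Rightarrow> 'a" and f +
  fixes g :: "nat \<Rightarrow> nat"
  assumes blow_up: "blow_up g" and product: "almost_product_property d T g"
    and separation: "uniform_separation_property d T"
begin

lemma g_sublinear: "\<beta> > 0 \<Longrightarrow> \<forall>\<^sub>F n in sequentially. real (g n) \<le> \<beta> * real n"
proof -
  assume \<beta>: "\<beta> > 0"
  have "(\<lambda>n. real (g n) / real n) \<longlonglongrightarrow> 0" using blow_up by (simp add: blow_up_def)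
  then have "\<forall>\<^sub>F n in sequentially. real (g n) / real n < \<beta>" using \<beta> by (rule order_tendstoD)
  then show ?thesis using eventually_ge_at_top[of 1]
    by eventually_elim (simp add: field_simps)
qed

lemma tracing:
  "\<exists>m :: real \<Rightarrow> nat. \<forall>k\<ge>1. \<forall>(x :: nat \<Rightarrow> 'a) (\<theta> :: nat \<Rightarrow> real) (n :: nat \<Rightarrow> nat).
    (\<forall>j<k. 0 < \<theta> j \<and> m (\<theta> j) \<le> n j \<and> 1 \<le> n j) \<longrightarrow>
    (\<exists>z. \<forall>j<k. (T ^^ sum n {..<j}) z \<in> mistake_ball d T g (n j) (x j) (\<theta> j))"
proof -
  obtain m :: "real \<Rightarrow> nat" where m: "\<forall>k\<ge>1. \<forall>(x :: nat \<Rightarrow> 'a) (\<theta> :: nat \<Rightarrow> real) (n :: nat \<Rightarrow> nat).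
      (\<forall>j<k. 0 < \<theta> j \<and> m (\<theta> j) \<le> n j \<and> 1 \<le> n j) \<longrightarrow>
      (\<Inter>j<k. (T ^^ (\<Sum>i<j. n i)) -` mistake_ball d T g (n j) (x j) (\<theta> j)) \<noteq> {}"
    using product unfolding almost_product_property_def by (elim exE conjE)
  show ?thesis
  proof (rule exI[of _ m], intro allI impI)
    fix k :: nat and x :: "nat \<Rightarrow> 'a" and \<theta> :: "nat \<Rightarrow> real" and n :: "nat \<Rightarrow> nat"
    assume "k \<ge> 1" "\<forall>j<k. 0 < \<theta> j \<and> m (\<theta> j) \<le> n j \<and> 1 \<le> n j"
    then have "(\<Inter>j<k. (T ^^ (\<Sum>i<j. n i)) -` mistake_ball d T g (n j) (x j) (\<theta> j)) \<noteq> {}"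
      using m by blast
    then obtain z where "z \<in> (\<Inter>j<k. (T ^^ (\<Sum>i<j. n i)) -` mistake_ball d T g (n j) (x j) (\<theta> j))" by blast
    then show "\<exists>z. \<forall>j<k. (T ^^ sum n {..<j}) z \<in> mistake_ball d T g (n j) (x j) (\<theta> j)"
      by (intro exI[of _ z]) auto
  qed
qed

definition separated_family :: "real \<Rightarrow> nat \<Rightarrow> real \<Rightarrow> ('a \<Rightarrow> real) set \<Rightarrow> real \<Rightarrow> 'a measure \<Rightarrow> real \<Rightarrow> 'a set \<Rightarrow> bool" where
  "separated_family \<delta> n \<epsilon> U r \<nu> h E \<longleftrightarrow> finite E \<and> separated_set d T \<delta> n \<epsilon> E \<and>
     (\<forall>x\<in>E. \<forall>u\<in>U. \<bar>birkhoff_sum T u n x / real n - (\<integral>y. u y \<partial>\<nu>)\<bar> < r) \<and>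
     exp (real n * h) \<le> real (card E)"

lemma ergodic_separated_sets:
  assumes \<eta>: "\<eta> > 0"
  shows "\<exists>\<delta>>0. \<exists>\<epsilon>>0. \<forall>\<nu>\<in>ergodic_measures T. \<forall>P U r. finite_partition P \<longrightarrow> finite U \<longrightarrow>
    (\<forall>u\<in>U. continuous_on UNIV (u :: 'a \<Rightarrow> real)) \<longrightarrow> r > 0 \<longrightarrow>
    (\<exists>N. \<forall>n\<ge>N. Ex (separated_family \<delta> n \<epsilon> U r \<nu> (entropy_wrt T \<nu> P - \<eta>)))"
proof -
  obtain \<delta> \<epsilon> where \<delta>: "\<delta> > 0" and \<epsilon>: "\<epsilon> > 0" and sep: "\<forall>\<nu>\<in>ergodic_measures T. \<forall>F. weak_star_neighbourhood F \<nu> \<longrightarrow>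
      (\<exists>N. \<forall>n\<ge>N. max_separated d T F \<delta> n \<epsilon> \<ge> exp_ereal (ereal (real n) * (metric_entropy T \<nu> - ereal (\<eta> / 2))))"
    using separation[unfolded uniform_separation_property_def, THEN spec, THEN mp, OF half_gt_zero[OF \<eta>]]
    by (elim exE conjE)
  have "\<exists>N. \<forall>n\<ge>N. Ex (separated_family \<delta> n \<epsilon> U r \<nu> (entropy_wrt T \<nu> P - \<eta>))"
    if \<nu>: "\<nu> \<in> ergodic_measures T" and P: "finite_partition P" and U: "finite U" "\<And>u. u \<in> U \<Longrightarrow> continuous_on UNIV (u :: 'a \<Rightarrow> real)"
      and r: "r > 0" for \<nu> P U r
  proof -
    interpret partitioned_map T P by (rule partitioned[OF P])
    have \<nu>p: "\<nu> \<in> prob_measures" using \<nu> by (simp add: ergodic_measures_def invariant_measures_def)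
    define F where "F = {\<nu>' \<in> prob_measures. \<forall>u\<in>U. \<bar>(\<integral>x. u x \<partial>\<nu>') - (\<integral>x. u x \<partial>\<nu>)\<bar> < r}"
    have "weak_star_neighbourhood F \<nu>" unfolding F_def by (rule basic_neighbourhood[OF \<nu>p U r])
    from sep[rule_format, OF \<nu> this] obtain N where N: "\<And>n. n \<ge> N \<Longrightarrow> max_separated d T F \<delta> n \<epsilon> \<ge> exp_ereal (ereal (real n) * (metric_entropy T \<nu> - ereal (\<eta> / 2)))"
      by blast
    have "Ex (separated_family \<delta> n \<epsilon> U r \<nu> (entropy_wrt T \<nu> P - \<eta>))" if n: "n \<ge> max N 1" for n
    proof -
      let ?h = "entropy_wrt T \<nu> P"
      have mono: "exp_ereal a \<le> exp_ereal b" if "a \<le> b" for a b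
        using that unfolding exp_ereal_def by (cases a; cases b) auto
      have "ereal (real n * (?h - \<eta> / 2)) \<le> ereal (real n) * (metric_entropy T \<nu> - ereal (\<eta> / 2))"
      proof -
        have "ereal (?h - \<eta> / 2) \<le> metric_entropy T \<nu> - ereal (\<eta> / 2)"
          using ereal_minus_mono[OF entropy_wrt_le_metric_entropy[of \<nu>], of "ereal (\<eta>/2)" "ereal (\<eta>/2)"] by simp
        then have "ereal (real n) * ereal (?h - \<eta> / 2) \<le> ereal (real n) * (metric_entropy T \<nu> - ereal (\<eta> / 2))"
          by (intro ereal_mult_left_mono) auto
        then show ?thesis by simp
      qed
      from mono[OF this] have "ereal (exp (real n * (?h - \<eta> / 2))) \<le> exp_ereal (ereal (real n) * (metric_entropy T \<nu> - ereal (\<eta> / 2)))"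
        by (simp add: exp_ereal_def)
      also have "\<dots> \<le> max_separated d T F \<delta> n \<epsilon>" using N n by auto
      finally have "ereal (exp (real n * (?h - \<eta> / 2))) \<le> max_separated d T F \<delta> n \<epsilon>" .
      \<comment> \<open>The strict decrease from \<open>\<eta> / 2\<close> to \<eta> places the
        number below the supremum, so that an actual finite separated set exceeds it.\<close>
      moreover have "exp (real n * (?h - \<eta>)) < exp (real n * (?h - \<eta> / 2))" using n \<eta> by simp
      ultimately have "ereal (exp (real n * (?h - \<eta>))) < max_separated d T F \<delta> n \<epsilon>"
        using less_le_trans by (metis less_ereal.simps(1))
      then obtain E where E: "finite E" "E \<subseteq> {x. empirical T n x \<in> F}" "separated_set d T \<delta> n \<epsilon> E"
        "ereal (exp (real n * (?h - \<eta>))) < ereal (real (card E))"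
        unfolding max_separated_def less_SUP_iff by blast
      show ?thesis unfolding separated_family_def
      proof (intro exI[of _ E] conjI ballI)
        fix x u assume x: "x \<in> E" and u: "u \<in> U"
        have "\<bar>(\<integral>y. u y \<partial>empirical T n x) - (\<integral>y. u y \<partial>\<nu>)\<bar> < r" using E(2) x u by (auto simp: F_def)
        then show "\<bar>birkhoff_sum T u n x / real n - (\<integral>y. u y \<partial>\<nu>)\<bar> < r"
          using birkhoff_empirical[of n u x] n borel_measurable_continuous_onI[OF U(2)[OF u]] by simp
      qed (use E in auto)
    qed
    then show ?thesis by blast
  qed
  then show ?thesis using \<delta> \<epsilon>
    by (intro exI[of _ \<delta>] exI[of _ \<epsilon>] conjI ballI allI impI) simp_all
qed

text \<open>A block of length \<open>n\<close> is divided among the ergodic measures in proportion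
  to their weights, and a point is traced for each choice of one element from every separated set.
  Choices multiply, so the exponents add up to \<open>n\<close> times the averaged entropy.
  Different choices differ in some portion, whose length is a fixed share of \<open>n\<close>: this
  lowers \<delta> by a factor that depends on \<mu>, while \<epsilon> is merely halved.\<close>

lemma separated_mixture:
  assumes \<eta>: "\<eta> > 0"
  shows "\<exists>\<epsilon>>0. \<forall>\<mu>\<in>invariant_measures T. \<forall>P U r. finite_partition P \<longrightarrow> finite U \<longrightarrow>
    (\<forall>u\<in>U. continuous_on UNIV (u :: 'a \<Rightarrow> real)) \<longrightarrow> r > 0 \<longrightarrow>
    (\<exists>\<delta>>0. \<exists>N. \<forall>n\<ge>N. Ex (separated_family \<delta> n \<epsilon> U r \<mu> (entropy_wrt T \<mu> P - \<eta>)))"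
proof -
  obtain \<delta>0 \<epsilon>0 where \<delta>0: "\<delta>0 > 0" and \<epsilon>0: "\<epsilon>0 > 0" and erg: "\<forall>\<nu>\<in>ergodic_measures T. \<forall>P U r. finite_partition P \<longrightarrow> finite U \<longrightarrow>
    (\<forall>u\<in>U. continuous_on UNIV (u :: 'a \<Rightarrow> real)) \<longrightarrow> r > 0 \<longrightarrow>
    (\<exists>N. \<forall>n\<ge>N. Ex (separated_family \<delta>0 n \<epsilon>0 U r \<nu> (entropy_wrt T \<nu> P - \<eta> / 2)))"
    using ergodic_separated_sets[OF half_gt_zero[OF \<eta>]] by (elim exE conjE)
  obtain m :: "real \<Rightarrow> nat" where trace: "\<forall>k\<ge>1. \<forall>(x :: nat \<Rightarrow> 'a) (\<theta> :: nat \<Rightarrow> real) (n :: nat \<Rightarrow> nat).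
    (\<forall>j<k. 0 < \<theta> j \<and> m (\<theta> j) \<le> n j \<and> 1 \<le> n j) \<longrightarrow>
    (\<exists>z. \<forall>j<k. (T ^^ sum n {..<j}) z \<in> mistake_ball d T g (n j) (x j) (\<theta> j))"
    using tracing by (elim exE)
  have "\<exists>\<delta>>0. \<exists>N. \<forall>n\<ge>N. Ex (separated_family \<delta> n (\<epsilon>0 / 2) U r \<mu> (entropy_wrt T \<mu> P - \<eta>))"
    if \<mu>: "\<mu> \<in> invariant_measures T" and P: "finite_partition P" and U: "finite U" "\<And>u. u \<in> U \<Longrightarrow> continuous_on UNIV (u :: 'a \<Rightarrow> real)"
      and r: "r > 0" for \<mu> P U r
  proof -
    obtain B where B: "B > 0" "\<And>u x. u \<in> U \<Longrightarrow> \<bar>u x\<bar> \<le> B" using finite_family_bounded[OF U] by blast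
    obtain p :: nat and \<nu> a where comb: "(\<forall>i<p. \<nu> i \<in> ergodic_measures T \<and> 0 < a i) \<and> (\<Sum>i<p. a i) = 1 \<and>
      (\<forall>u\<in>U. \<bar>(\<Sum>i<p. a i * (\<integral>x. u x \<partial>\<nu> i)) - (\<integral>x. u x \<partial>\<mu>)\<bar> < r / 4) \<and>
      entropy_wrt T \<mu> P - \<eta> / 4 \<le> (\<Sum>i<p. a i * entropy_wrt T (\<nu> i) P)"
    proof -
      have "\<exists>(p::nat) \<nu> a. (\<forall>i<p. \<nu> i \<in> ergodic_measures T \<and> 0 < a i) \<and> (\<Sum>i<p. a i) = 1 \<and>
        (\<forall>u\<in>U. \<bar>(\<Sum>i<p. a i * (\<integral>x. u x \<partial>\<nu> i)) - (\<integral>x. u x \<partial>\<mu>)\<bar> < r / 4) \<and>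
        entropy_wrt T \<mu> P - \<eta> / 4 \<le> (\<Sum>i<p. a i * entropy_wrt T (\<nu> i) P)"
        by (rule ergodic_combination[OF \<mu> P U(1)]) (use U(2) r \<eta> in simp_all)
      then show thesis by (elim exE) (rule that)
    qed
    have \<nu>: "\<And>i. i < p \<Longrightarrow> \<nu> i \<in> ergodic_measures T" and a: "\<And>i. i < p \<Longrightarrow> 0 < a i"
      and asum: "(\<Sum>i<p. a i) = 1"
      and aint: "\<And>u. u \<in> U \<Longrightarrow> \<bar>(\<Sum>i<p. a i * (\<integral>x. u x \<partial>\<nu> i)) - (\<integral>x. u x \<partial>\<mu>)\<bar> < r / 4"
      and aent: "entropy_wrt T \<mu> P - \<eta> / 4 \<le> (\<Sum>i<p. a i * entropy_wrt T (\<nu> i) P)"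
      using comb by blast+
    have \<nu>p: "\<nu> i \<in> prob_measures" if "i < p" for i
      using \<nu>[OF that] by (simp add: ergodic_measures_def invariant_measures_def)
    have p: "p \<ge> 1" using asum by (cases p) auto
    have "\<forall>i\<in>{..<p}. \<exists>N. \<forall>n\<ge>N. Ex (separated_family \<delta>0 n \<epsilon>0 U (r / 4) (\<nu> i) (entropy_wrt T (\<nu> i) P - \<eta> / 2))"
    proof
      fix i assume "i \<in> {..<p}"
      then show "\<exists>N. \<forall>n\<ge>N. Ex (separated_family \<delta>0 n \<epsilon>0 U (r / 4) (\<nu> i) (entropy_wrt T (\<nu> i) P - \<eta> / 2))"
        using erg[rule_format, OF \<nu> P U(1) U(2), of i "r / 4"] r by simp
    qed
    then obtain N where N: "\<forall>i\<in>{..<p}. \<forall>n\<ge>N i. Ex (separated_family \<delta>0 n \<epsilon>0 U (r / 4) (\<nu> i) (entropy_wrt T (\<nu> i) P - \<eta> / 2))"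
      by (rule bchoice[THEN exE])
    \<comment> \<open>With this \<theta> the distance \<open>\<epsilon>0 - 2 * \<theta>\<close> that
      survives tracing is at least \<open>\<epsilon>0 / 2\<close>.\<close>
    have "\<exists>\<theta>>0. \<theta> \<le> \<epsilon>0 / 4 \<and> (\<forall>u\<in>U. \<forall>x y. d x y \<le> \<theta> \<longrightarrow> \<bar>u x - u y\<bar> \<le> r / 8)"
      using U
    proof (induction U rule: finite_induct)
      case empty then show ?case using \<epsilon>0 by (intro exI[of _ "\<epsilon>0 / 4"]) auto
    next
      case (insert v U)
      then obtain \<theta> where \<theta>: "\<theta> > 0" "\<theta> \<le> \<epsilon>0 / 4" "\<forall>u\<in>U. \<forall>x y. d x y \<le> \<theta> \<longrightarrow> \<bar>u x - u y\<bar> \<le> r / 8" by auto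
      have "continuous_on UNIV v" using insert.prems by auto
      then obtain \<theta>' where \<theta>': "\<theta>' > 0" "\<And>x y. d x y \<le> \<theta>' \<Longrightarrow> dist (v x) (v y) < r / 8"
        using uniformly_continuous_d[of v "r / 8"] r by auto
      show ?case
      proof (intro exI[of _ "min \<theta> \<theta>'"] conjI ballI allI impI)
        fix u x y assume "u \<in> insert v U" "d x y \<le> min \<theta> \<theta>'"
        then show "\<bar>u x - u y\<bar> \<le> r / 8" using \<theta>(3) \<theta>'(2)[of x y] by (auto simp: dist_real_def intro: less_imp_le)
      qed (use \<theta> \<theta>' in auto)
    qed
    then obtain \<theta> where \<theta>: "\<theta> > 0" "\<theta> \<le> \<epsilon>0 / 4" "\<And>u x y. u \<in> U \<Longrightarrow> d x y \<le> \<theta> \<Longrightarrow> \<bar>u x - u y\<bar> \<le> r / 8" by blast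
    \<comment> \<open>The tolerated share of mistakes: \<open>\<delta>0 / 4\<close> leaves half of
      the separated times after two orbits have lost theirs, and the second bound limits the effect
      on Birkhoff sums to \<open>r / 16\<close> per step.\<close>
    define \<beta> where "\<beta> = min (\<delta>0 / 4) (r / (32 * B))"
    have \<beta>: "\<beta> > 0" "\<beta> \<le> \<delta>0 / 4" "\<beta> * (2 * B) \<le> r / 16"
    proof -
      show "\<beta> > 0" "\<beta> \<le> \<delta>0 / 4" using \<delta>0 r B by (auto simp: \<beta>_def)
      have "\<beta> * (2 * B) \<le> r / (32 * B) * (2 * B)" by (intro mult_right_mono) (use B in \<open>auto simp: \<beta>_def\<close>)
      also have "\<dots> = r / 16" using B by simp
      finally show "\<beta> * (2 * B) \<le> r / 16" .
    qed
    define am where "am = Min (a ` {..<p})"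
    have am: "am > 0" "\<And>i. i < p \<Longrightarrow> am \<le> a i" using a p by (auto simp: am_def lessThan_empty_iff)
    \<comment> \<open>For large \<open>n\<close> every portion is at least
      \<open>am * real n / 2\<close> long and keeps a share \<open>\<delta>0 / 2\<close> of
      separated times; this is the product of the two factors.\<close>
    define \<delta> where "\<delta> = \<delta>0 * am / 4"
    have \<delta>: "\<delta> > 0" using \<delta>0 am by (simp add: \<delta>_def)
    define l where "l n i = nat \<lfloor>a i * real n\<rfloor>" for n i
    have l_up: "real (l n i) \<le> a i * real n" and l_lo: "a i * real n - 1 \<le> real (l n i)" if "i < p" for n i
    proof -
      have "0 \<le> a i * real n" using a[OF that] by simp
      then have "real (l n i) = of_int \<lfloor>a i * real n\<rfloor>" by (simp add: l_def)
      then show "real (l n i) \<le> a i * real n" "a i * real n - 1 \<le> real (l n i)" by linarith+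
    qed
    have l_top: "filterlim (\<lambda>n. l n i) at_top sequentially" if i: "i < p" for i
      unfolding filterlim_at_top
    proof
      fix Z :: nat
      have "filterlim (\<lambda>n. a i * real n - 1) at_top sequentially" using a[OF i] by real_asymp
      then have "\<forall>\<^sub>F n in sequentially. real Z \<le> a i * real n - 1" by (auto simp: filterlim_at_top)
      then show "\<forall>\<^sub>F n in sequentially. Z \<le> l n i"
        by eventually_elim (use l_lo[OF i] in \<open>meson of_nat_le_iff order_trans\<close>)
    qed
    have l_sum: "real (sum (l n) {..<p}) \<le> real n" "real n - real p \<le> real (sum (l n) {..<p})" for n
    proof -
      have "real (sum (l n) {..<p}) \<le> (\<Sum>i<p. a i * real n)" unfolding of_nat_sum by (rule sum_mono) (use l_up in auto)
      then show "real (sum (l n) {..<p}) \<le> real n" using asum by (simp add: sum_distrib_right[symmetric])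
      have "(\<Sum>i<p. a i * real n - 1) \<le> real (sum (l n) {..<p})" unfolding of_nat_sum by (rule sum_mono) (use l_lo in auto)
      then show "real n - real p \<le> real (sum (l n) {..<p})" using asum by (simp add: sum_subtractf sum_distrib_right[symmetric])
    qed
    \<comment> \<open>Bounds the effect on the exponent of rounding the portion lengths down; it
      does not grow with \<open>n\<close>.\<close>
    define K where "K = (\<Sum>i<p. \<bar>entropy_wrt T (\<nu> i) P - \<eta> / 2\<bar>)"
    have ev: "\<forall>\<^sub>F n in sequentially. \<forall>i\<in>{..<p}. max (N i) (max (m \<theta>) 1) \<le> l n i \<and> real (g (l n i)) \<le> \<beta> * real (l n i) \<and> 2 / a i \<le> real n"
    proof (rule eventually_ball_finite, simp, intro ballI)
      fix i assume "i \<in> {..<p}"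
      then have i: "i < p" by simp
      have "\<forall>\<^sub>F n in sequentially. max (N i) (max (m \<theta>) 1) \<le> l n i" 
        using l_top[OF i] unfolding filterlim_at_top by blast
      moreover have "\<forall>\<^sub>F n in sequentially. real (g (l n i)) \<le> \<beta> * real (l n i)"
        using filterlim_iff[THEN iffD1, OF l_top[OF i], rule_format, OF g_sublinear[OF \<beta>(1)]] .
      moreover have "\<forall>\<^sub>F n in sequentially. 2 / a i \<le> real n"
        using filterlim_real_sequentially by (auto simp: filterlim_at_top)
      ultimately show "\<forall>\<^sub>F n in sequentially. max (N i) (max (m \<theta>) 1) \<le> l n i \<and> real (g (l n i)) \<le> \<beta> * real (l n i) \<and> 2 / a i \<le> real n"
        by eventually_elim auto
    qed
    have ev2: "\<forall>\<^sub>F n in sequentially. max 1 (max (4 * K / \<eta>) (8 * real p * B / r)) \<le> real n"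
      using filterlim_real_sequentially unfolding filterlim_at_top by blast
    obtain N0 where N0: "\<And>n. n \<ge> N0 \<Longrightarrow> (\<forall>i\<in>{..<p}. max (N i) (max (m \<theta>) 1) \<le> l n i \<and> real (g (l n i)) \<le> \<beta> * real (l n i) \<and> 2 / a i \<le> real n)
        \<and> max 1 (max (4 * K / \<eta>) (8 * real p * B / r)) \<le> real n"
      using eventually_conj[OF ev ev2] unfolding eventually_sequentially by blast
    have "Ex (separated_family \<delta> n (\<epsilon>0 / 2) U r \<mu> (entropy_wrt T \<mu> P - \<eta>))" if n: "n \<ge> N0" for n
    proof -
      have li: "N i \<le> l n i" "m \<theta> \<le> l n i" "1 \<le> l n i" "real (g (l n i)) \<le> \<beta> * real (l n i)" "2 / a i \<le> real n" if "i < p" for i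
        using N0[OF n] that by auto
      have n1: "1 \<le> real n" "4 * K / \<eta> \<le> real n" "8 * real p * B / r \<le> real n" using N0[OF n] by auto
      have nK: "K \<le> real n * (\<eta> / 4)" using n1(2) \<eta> by (simp add: field_simps)
      have npB: "2 * (real p * B) \<le> real n * (r / 4)" using n1(3) r by (simp add: field_simps)
      let ?M = "\<lambda>i. sum (l n) {..<i}"
      have "\<forall>i\<in>{..<p}. \<exists>E. separated_family \<delta>0 (l n i) \<epsilon>0 U (r / 4) (\<nu> i) (entropy_wrt T (\<nu> i) P - \<eta> / 2) E"
        using N li(1) by simp
      then obtain \<Gamma> where \<Gamma>0: "\<forall>i\<in>{..<p}. separated_family \<delta>0 (l n i) \<epsilon>0 U (r / 4) (\<nu> i) (entropy_wrt T (\<nu> i) P - \<eta> / 2) (\<Gamma> i)"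
        by (rule bchoice[THEN exE])
      have \<Gamma>: "\<And>i. i < p \<Longrightarrow> finite (\<Gamma> i)" "\<And>i. i < p \<Longrightarrow> separated_set d T \<delta>0 (l n i) \<epsilon>0 (\<Gamma> i)"
        "\<And>i x u. i < p \<Longrightarrow> x \<in> \<Gamma> i \<Longrightarrow> u \<in> U \<Longrightarrow> \<bar>birkhoff_sum T u (l n i) x / real (l n i) - (\<integral>y. u y \<partial>\<nu> i)\<bar> < r / 4"
        "\<And>i. i < p \<Longrightarrow> exp (real (l n i) * (entropy_wrt T (\<nu> i) P - \<eta> / 2)) \<le> real (card (\<Gamma> i))"
        using \<Gamma>0 unfolding separated_family_def by blast+
      have "\<forall>x. \<exists>z. \<forall>j<p. (T ^^ ?M j) z \<in> mistake_ball d T g (l n j) (x j) \<theta>"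
        using trace[THEN spec, THEN mp, OF p] li \<theta>(1) by simp
      from this[THEN choice] obtain Z where Z0: "\<forall>x. \<forall>j<p. (T ^^ ?M j) (Z x) \<in> mistake_ball d T g (l n j) (x j) \<theta>"
        by (elim exE)
      have Z: "(T ^^ ?M j) (Z x) \<in> mistake_ball d T g (l n j) (x j) \<theta>" if "j < p" for x j using Z0 that by blast
      define X where "X = PiE {..<p} \<Gamma>"
      have finX: "finite X" unfolding X_def by (intro finite_PiE) (use \<Gamma> in auto)
      have Mn: "?M p \<le> n" using l_sum(1)[of n] by (simp only: of_nat_le_iff)
      have Mi: "?M i + l n i \<le> n" if "i < p" for i
      proof -
        have "?M (Suc i) \<le> ?M p" by (rule sum_mono2) (use that in auto)
        then show ?thesis using Mn by simp
      qed
      have sepZ: "separated_points d T \<delta> n (\<epsilon>0 / 2) (Z x) (Z x')" if x: "x \<in> X" "x' \<in> X" "x \<noteq> x'" for x x'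
      proof -
        have "\<exists>i<p. x i \<noteq> x' i"
        proof (rule ccontr)
          assume "\<not> ?thesis"
          then have "x = x'" using x(1,2) unfolding X_def by (intro PiE_ext) auto
          then show False using x by simp
        qed
        then obtain i where i: "i < p" "x i \<noteq> x' i" by blast
        have xi: "x i \<in> \<Gamma> i" "x' i \<in> \<Gamma> i" using x i by (auto simp: X_def)
        then have sp: "separated_points d T \<delta>0 (l n i) \<epsilon>0 (x i) (x' i)" using \<Gamma>(2)[OF i(1)] i(2) by (auto simp: separated_set_def)
        let ?R = "{j. j < l n i \<and> \<epsilon>0 - 2 * \<theta> < d ((T ^^ j) ((T ^^ ?M i) (Z x))) ((T ^^ j) ((T ^^ ?M i) (Z x')))}"
        let ?S = "{j. j < n \<and> d ((T ^^ j) (Z x)) ((T ^^ j) (Z x')) > \<epsilon>0 / 2}"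
        have "(\<lambda>j. j + ?M i) ` ?R \<subseteq> ?S"
          using \<theta>(2) Mi[OF i(1)] by (auto simp: funpow_add)
        then have "card ?R \<le> card ?S"
          using card_mono[of ?S "(\<lambda>j. j + ?M i) ` ?R"] by (simp add: card_image)
        moreover have "\<delta>0 * real (l n i) - 2 * real (g (l n i)) \<le> real (card ?R)"
          by (rule mistake_ball_separated[OF Z[OF i(1), of x] Z[OF i(1), of x'] sp])
        moreover have "2 * real (g (l n i)) \<le> \<delta>0 / 2 * real (l n i)"
        proof -
          have "real (g (l n i)) \<le> \<delta>0 / 4 * real (l n i)"
            using li(4)[OF i(1)] \<beta>(2) by (meson mult_right_mono of_nat_0_le_iff order_trans)
          then show ?thesis by simp
        qed
        moreover have "\<delta> * real n \<le> \<delta>0 / 2 * real (l n i)"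
        proof -
          have "1 \<le> a i * real n / 2" using li(5)[OF i(1)] a[OF i(1)] by (simp add: field_simps)
          then have "a i * real n / 2 \<le> real (l n i)" using l_lo[OF i(1), of n] by linarith
          moreover have "am * real n \<le> a i * real n" using am(2)[OF i(1)] by (intro mult_right_mono) auto
          ultimately have "am * real n / 2 \<le> real (l n i)" by linarith
          then have "\<delta>0 / 2 * (am * real n / 2) \<le> \<delta>0 / 2 * real (l n i)" using \<delta>0 by (intro mult_left_mono) auto
          then show ?thesis by (simp add: \<delta>_def)
        qed
        ultimately have "\<delta> * real n \<le> real (card ?S)" by linarith
        then show ?thesis by (simp add: separated_points_def)
      qed
      have injZ: "inj_on Z X"
      proof (rule inj_onI, rule ccontr)
        fix x x' assume x: "x \<in> X" "x' \<in> X" "Z x = Z x'" "x \<noteq> x'"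
        have "separated_points d T \<delta> n (\<epsilon>0 / 2) (Z x) (Z x)" using sepZ[OF x(1,2,4)] x(3) by simp
        then have "\<delta> * real n \<le> 0" using \<epsilon>0 by (simp add: separated_points_def)
        moreover have "\<delta> * real n > 0" using \<delta> n1 by simp
        ultimately show False by simp
      qed
      show ?thesis unfolding separated_family_def
      proof (intro exI[of _ "Z ` X"] conjI ballI)
        show "finite (Z ` X)" using finX by simp
        show "separated_set d T \<delta> n (\<epsilon>0 / 2) (Z ` X)"
          unfolding separated_set_def using sepZ by blast
      next
        fix z u assume "z \<in> Z ` X" and u: "u \<in> U"
        then obtain x where x: "x \<in> X" "z = Z x" by blast
        let ?R = "n - ?M p" and ?I = "\<lambda>i. \<integral>y. u y \<partial>\<nu> i"
        have "birkhoff_sum T u n z = birkhoff_sum T u (?M p) z + birkhoff_sum T u ?R ((T ^^ ?M p) z)"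
          using birkhoff_sum_add[of T u "?M p" ?R z] Mn by simp
        also have "birkhoff_sum T u (?M p) z = (\<Sum>i<p. birkhoff_sum T u (l n i) ((T ^^ ?M i) z))"
          by (rule birkhoff_sum_blocks)
        finally have split: "birkhoff_sum T u n z = (\<Sum>i<p. birkhoff_sum T u (l n i) ((T ^^ ?M i) z)) + birkhoff_sum T u ?R ((T ^^ ?M p) z)" .
        have rest: "\<bar>birkhoff_sum T u ?R ((T ^^ ?M p) z)\<bar> \<le> real p * B"
        proof -
          have "\<bar>birkhoff_sum T u ?R ((T ^^ ?M p) z)\<bar> \<le> real ?R * B" by (rule birkhoff_sum_bound) (rule B(2)[OF u])
          also have "\<dots> \<le> real p * B" using l_sum(2)[of n] Mn B by (intro mult_right_mono) (auto simp: of_nat_diff)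
          finally show ?thesis .
        qed
        \<comment> \<open>Per step: \<open>r / 8\<close> from tracking, \<open>r / 16\<close> from
          mistakes and \<open>r / 4\<close> within the separated set, together
          \<open>r * 7 / 16\<close>; the term \<open>B\<close> pays for rounding the length.\<close>
        have blk: "\<bar>birkhoff_sum T u (l n i) ((T ^^ ?M i) z) - a i * real n * ?I i\<bar> \<le> a i * real n * (r * 7 / 16) + B" if i: "i < p" for i
        proof -
          let ?l = "real (l n i)"
          have "\<bar>birkhoff_sum T u (l n i) (x i) - birkhoff_sum T u (l n i) ((T ^^ ?M i) z)\<bar> \<le> ?l * (r / 8) + real (g (l n i)) * (2 * B)"
            unfolding x(2) by (rule mistake_ball_birkhoff[OF Z[OF i, of x]]) (use \<theta>(3)[OF u] B(2)[OF u] r in auto)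
          moreover have "real (g (l n i)) * (2 * B) \<le> ?l * (r / 16)"
          proof -
            have "real (g (l n i)) * (2 * B) \<le> (\<beta> * ?l) * (2 * B)" using li(4)[OF i] B by (intro mult_right_mono) auto
            also have "\<dots> = ?l * (\<beta> * (2 * B))" by simp
            also have "\<dots> \<le> ?l * (r / 16)" using \<beta>(3) by (intro mult_left_mono) auto
            finally show ?thesis .
          qed
          moreover have "\<bar>birkhoff_sum T u (l n i) (x i) - ?l * ?I i\<bar> \<le> ?l * (r / 4)"
          proof -
            have "\<bar>birkhoff_sum T u (l n i) (x i) / ?l - ?I i\<bar> < r / 4" by (rule \<Gamma>(3)[OF i _ u]) (use x i in \<open>auto simp: X_def\<close>)
            then have "?l * \<bar>birkhoff_sum T u (l n i) (x i) / ?l - ?I i\<bar> \<le> ?l * (r / 4)" by (intro mult_left_mono) auto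
            also have "?l * \<bar>birkhoff_sum T u (l n i) (x i) / ?l - ?I i\<bar> = \<bar>?l * (birkhoff_sum T u (l n i) (x i) / ?l - ?I i)\<bar>"
              by (simp add: abs_mult)
            also have "?l * (birkhoff_sum T u (l n i) (x i) / ?l - ?I i) = birkhoff_sum T u (l n i) (x i) - ?l * ?I i"
              using li(3)[OF i] by (simp add: right_diff_distrib)
            finally show ?thesis .
          qed
          moreover have "\<bar>?l * ?I i - a i * real n * ?I i\<bar> \<le> B"
          proof -
            have "\<bar>?l - a i * real n\<bar> * \<bar>?I i\<bar> \<le> 1 * B"
              using l_up[OF i, of n] l_lo[OF i, of n] integral_bounded[OF \<nu>p[OF i] U(2)[OF u] B(2)[OF u]]
              by (intro mult_mono) auto
            then show ?thesis by (simp add: left_diff_distrib[symmetric] abs_mult)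
          qed
          moreover have "?l * (r / 8) + ?l * (r / 16) + ?l * (r / 4) \<le> a i * real n * (r * 7 / 16)"
          proof -
            have "?l * (r * 7 / 16) \<le> a i * real n * (r * 7 / 16)" using l_up[OF i, of n] r by (intro mult_right_mono) auto
            then show ?thesis by (simp add: field_simps)
          qed
          ultimately show ?thesis by linarith
        qed
        have "\<bar>(\<Sum>i<p. birkhoff_sum T u (l n i) ((T ^^ ?M i) z)) - (\<Sum>i<p. a i * real n * ?I i)\<bar> \<le> (\<Sum>i<p. a i * real n * (r * 7 / 16) + B)"
          unfolding sum_subtractf[symmetric] by (rule order_trans[OF sum_abs sum_mono]) (use blk in auto)
        also have "\<dots> = real n * (r * 7 / 16) + real p * B"
          unfolding sum.distrib mult.assoc sum_distrib_right[symmetric] asum by simp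
        finally have main: "\<bar>(\<Sum>i<p. birkhoff_sum T u (l n i) ((T ^^ ?M i) z)) - (\<Sum>i<p. a i * real n * ?I i)\<bar> \<le> real n * (r * 7 / 16) + real p * B" .
        have mean: "\<bar>(\<Sum>i<p. a i * real n * ?I i) - real n * (\<integral>y. u y \<partial>\<mu>)\<bar> \<le> real n * (r / 4)"
        proof -
          have "(\<Sum>i<p. a i * real n * ?I i) = real n * (\<Sum>i<p. a i * ?I i)" by (simp add: sum_distrib_left mult_ac)
          then have "\<bar>(\<Sum>i<p. a i * real n * ?I i) - real n * (\<integral>y. u y \<partial>\<mu>)\<bar> = real n * \<bar>(\<Sum>i<p. a i * ?I i) - (\<integral>y. u y \<partial>\<mu>)\<bar>"
            by (simp add: right_diff_distrib[symmetric] abs_mult)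
          moreover have "real n * \<bar>(\<Sum>i<p. a i * ?I i) - (\<integral>y. u y \<partial>\<mu>)\<bar> \<le> real n * (r / 4)"
            using aint[OF u] by (intro mult_left_mono) auto
          ultimately show ?thesis by linarith
        qed
        \<comment> \<open>The portions contribute \<open>7 / 16\<close> of \<open>r\<close> per step
          and the convex combination \<open>1 / 4\<close>; rounding and the leftover end cost
          \<open>2 * (real p * B)\<close>, at most another \<open>1 / 4\<close>.\<close>
        have "\<bar>birkhoff_sum T u n z - real n * (\<integral>y. u y \<partial>\<mu>)\<bar> \<le> real n * (r * 7 / 16) + real n * (r / 4) + 2 * (real p * B)"
          using main mean rest unfolding split by linarith
        also have "\<dots> \<le> real n * (r * 15 / 16)" using npB by (simp add: field_simps)
        also have "\<dots> < real n * r" using n1 r by (intro mult_strict_left_mono) auto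
        finally have "\<bar>birkhoff_sum T u n z - real n * (\<integral>y. u y \<partial>\<mu>)\<bar> / real n < r" using n1 by (simp add: field_simps)
        moreover have "birkhoff_sum T u n z / real n - (\<integral>y. u y \<partial>\<mu>) = (birkhoff_sum T u n z - real n * (\<integral>y. u y \<partial>\<mu>)) / real n"
          using n1 by (simp add: field_simps)
        ultimately show "\<bar>birkhoff_sum T u n z / real n - (\<integral>y. u y \<partial>\<mu>)\<bar> < r" by (simp only: abs_divide abs_of_nat)
      next
        let ?h = "\<lambda>i. entropy_wrt T (\<nu> i) P - \<eta> / 2"
        \<comment> \<open>The loss \<eta> consists of \<open>\<eta> / 4\<close> from the convex
          combination, \<open>\<eta> / 2\<close> from the ergodic separated sets and
          \<open>\<eta> / 4\<close> from rounding.\<close>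
        have "real n * (entropy_wrt T \<mu> P - \<eta>) \<le> (\<Sum>i<p. real (l n i) * ?h i)"
        proof -
          have "a i * real n * ?h i - \<bar>?h i\<bar> \<le> real (l n i) * ?h i" if i: "i < p" for i
          proof -
            have "\<bar>a i * real n - real (l n i)\<bar> * \<bar>?h i\<bar> \<le> 1 * \<bar>?h i\<bar>" using l_up[OF i, of n] l_lo[OF i, of n] by (intro mult_right_mono) auto
            then have "\<bar>(a i * real n - real (l n i)) * ?h i\<bar> \<le> \<bar>?h i\<bar>" by (simp only: abs_mult mult_1)
            then have "(a i * real n - real (l n i)) * ?h i \<le> \<bar>?h i\<bar>" by (simp only: abs_le_iff)
            then show ?thesis by (simp only: left_diff_distrib)
          qed
          then have "(\<Sum>i<p. a i * real n * ?h i - \<bar>?h i\<bar>) \<le> (\<Sum>i<p. real (l n i) * ?h i)" by (intro sum_mono) auto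
          moreover have "(\<Sum>i<p. a i * real n * ?h i - \<bar>?h i\<bar>) = real n * (\<Sum>i<p. a i * ?h i) - K"
            unfolding sum_subtractf K_def sum_distrib_left by (intro arg_cong2[where f=minus] sum.cong refl) (simp add: mult_ac)
          moreover have e3: "(\<Sum>i<p. a i * ?h i) = (\<Sum>i<p. a i * entropy_wrt T (\<nu> i) P) - \<eta> / 2"
            using asum unfolding right_diff_distrib sum_subtractf sum_distrib_right[symmetric] by simp
          moreover have "real n * (entropy_wrt T \<mu> P - \<eta> / 4 - \<eta> / 2) \<le> real n * (\<Sum>i<p. a i * ?h i)"
            unfolding e3 using aent by (intro mult_left_mono) auto
          moreover have "real n * (entropy_wrt T \<mu> P - \<eta> / 4 - \<eta> / 2) = real n * (entropy_wrt T \<mu> P - \<eta>) + real n * (\<eta> / 4)"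
            by (simp add: algebra_simps)
          ultimately show ?thesis using nK by linarith
        qed
        then have "exp (real n * (entropy_wrt T \<mu> P - \<eta>)) \<le> exp (\<Sum>i<p. real (l n i) * ?h i)" by simp
        also have "\<dots> = (\<Prod>i<p. exp (real (l n i) * ?h i))" by (simp add: exp_sum)
        also have "\<dots> \<le> (\<Prod>i<p. real (card (\<Gamma> i)))" by (rule prod_mono) (use \<Gamma>(4) in auto)
        also have "\<dots> = real (card X)" unfolding X_def by (simp add: card_PiE)
        also have "\<dots> = real (card (Z ` X))" using card_image[OF injZ] by simp
        finally show "exp (real n * (entropy_wrt T \<mu> P - \<eta>)) \<le> real (card (Z ` X))" .
      qed
    qed
    then show ?thesis using \<delta> by blast
  qed
  then have "0 < \<epsilon>0 / 2 \<and> (\<forall>\<mu>\<in>invariant_measures T. \<forall>P U r. finite_partition P \<longrightarrow> finite U \<longrightarrow>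
    (\<forall>u\<in>U. continuous_on UNIV (u :: 'a \<Rightarrow> real)) \<longrightarrow> r > 0 \<longrightarrow>
    (\<exists>\<delta>>0. \<exists>N. \<forall>n\<ge>N. Ex (separated_family \<delta> n (\<epsilon>0 / 2) U r \<mu> (entropy_wrt T \<mu> P - \<eta>))))"
    using \<epsilon>0 by simp
  then show ?thesis by (rule exI)
qed

end

section \<open>Topological pressure\<close>

lemma infsum_ennreal_SUP:
  fixes w :: "'b \<Rightarrow> ennreal"
  shows "infsum w A = (SUP F\<in>{F. finite F \<and> F \<subseteq> A}. sum w F)"
  by (rule nonneg_infsum_complete) simp

lemma infsum_ennreal_mono:
  fixes v w :: "'b \<Rightarrow> ennreal"
  assumes "\<And>x. x \<in> A \<Longrightarrow> v x \<le> w x"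
  shows "infsum v A \<le> infsum w A"
  using assms by (intro infsum_mono nonneg_summable_on_complete) auto

lemma infsum_UN_le:
  fixes w :: "'b \<Rightarrow> ennreal"
  shows "infsum w (\<Union>i. C i) \<le> (\<Sum>i. infsum w (C i))"
  unfolding infsum_ennreal_SUP[of w "\<Union>i. C i"]
proof (rule SUP_least)
  fix F assume "F \<in> {F. finite F \<and> F \<subseteq> (\<Union>i. C i)}"
  then have F: "finite F" "F \<subseteq> (\<Union>i. C i)" by auto
  have "\<forall>c\<in>F. \<exists>i. c \<in> C i" using F(2) by auto
  then obtain j :: "'b \<Rightarrow> nat" where j: "\<And>c. c \<in> F \<Longrightarrow> c \<in> C (j c)" by metis
  have "sum w F = (\<Sum>i\<in>j ` F. \<Sum>c\<in>{c\<in>F. j c = i}. w c)"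
    by (rule sum.image_gen[OF F(1)])
  also have "\<dots> \<le> (\<Sum>i\<in>j ` F. infsum w (C i))"
  proof (rule sum_mono)
    fix i
    show "(\<Sum>c\<in>{c\<in>F. j c = i}. w c) \<le> infsum w (C i)"
      unfolding infsum_ennreal_SUP by (rule SUP_upper) (use F j in auto)
  qed
  also have "\<dots> \<le> (\<Sum>i. infsum w (C i))"
    by (rule sum_le_suminf) (use F in auto)
  finally show "sum w F \<le> (\<Sum>i. infsum w (C i))" .
qed

text \<open>Countable subadditivity in the form of the unordered sums that weigh covers; a numbering
  of \<open>C\<close> connects the two.\<close>

lemma emeasure_UN_le_infsum:
  assumes C: "countable C" and Y: "\<And>c. c \<in> C \<Longrightarrow> Y c \<in> sets M"
  shows "emeasure M (\<Union>c\<in>C. Y c) \<le> infsum (\<lambda>c. emeasure M (Y c)) C"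
proof -
  define X where "X i = (if i \<in> to_nat_on C ` C then Y (from_nat_into C i) else {})" for i
  have inj: "inj_on (to_nat_on C) C" using C by (rule inj_on_to_nat_on)
  have XY: "X (to_nat_on C c) = Y c" if "c \<in> C" for c
    using that C by (simp add: X_def)
  have Xs: "X i \<in> sets M" for i
    using Y C by (auto simp: X_def)
  have "(\<Union>c\<in>C. Y c) = (\<Union>i. X i)"
  proof
    show "(\<Union>c\<in>C. Y c) \<subseteq> (\<Union>i. X i)" using XY by blast
    show "(\<Union>i. X i) \<subseteq> (\<Union>c\<in>C. Y c)" using C by (auto simp: X_def split: if_splits)
  qed
  then have "emeasure M (\<Union>c\<in>C. Y c) \<le> (\<Sum>i. emeasure M (X i))"
    using emeasure_subadditive_countably[of X M] Xs by auto
  also have "\<dots> = (SUP n. \<Sum>i<n. emeasure M (X i))" by (rule suminf_eq_SUP)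
  also have "\<dots> \<le> infsum (\<lambda>c. emeasure M (Y c)) C"
  proof (rule SUP_least)
    fix n
    let ?F = "{c\<in>C. to_nat_on C c < n}"
    have fin: "finite ?F"
      by (rule inj_on_finite[of "to_nat_on C" _ "{..<n}"]) (use inj in \<open>auto intro: inj_on_subset\<close>)
    have "(\<Sum>i<n. emeasure M (X i)) = (\<Sum>i\<in>to_nat_on C ` ?F. emeasure M (X i))"
      by (rule sum.mono_neutral_right) (auto simp: X_def)
    also have "\<dots> = (\<Sum>c\<in>?F. emeasure M (Y c))"
      by (subst sum.reindex) (use inj XY in \<open>auto intro: inj_on_subset\<close>)
    also have "\<dots> \<le> infsum (\<lambda>c. emeasure M (Y c)) C"
      unfolding infsum_ennreal_SUP by (rule SUP_upper) (use fin in auto)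
    finally show "(\<Sum>i<n. emeasure M (X i)) \<le> infsum (\<lambda>c. emeasure M (Y c)) C" .
  qed
  finally show ?thesis .
qed

text \<open>A smaller radius admits fewer covers but also lowers the suprema in the weights, so
  \<open>pressure_at\<close> is monotone only up to the oscillation of \<phi>. This still forces the
  limit in the definition of \<open>pressure\<close> to exist.\<close>

lemma limit_of_almost_antitone:
  fixes p :: "real \<Rightarrow> ereal"
  assumes "\<And>\<eta>. \<eta> > 0 \<Longrightarrow> \<exists>\<epsilon>0>0. \<forall>\<epsilon>1 \<epsilon>2. 0 < \<epsilon>1 \<longrightarrow> \<epsilon>1 \<le> \<epsilon>2 \<longrightarrow> \<epsilon>2 \<le> \<epsilon>0 \<longrightarrow> p \<epsilon>2 \<le> p \<epsilon>1 + ereal \<eta>"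
  shows "(p \<longlongrightarrow> Lim (at_right 0) p) (at_right 0)"
proof -
  have le: "Limsup (at_right 0) p \<le> Liminf (at_right 0) p"
  proof (rule ereal_le_epsilon2)
    fix \<eta> :: real assume \<eta>: "\<eta> > 0"
    obtain \<epsilon>0 where \<epsilon>0: "\<epsilon>0 > 0" "\<And>\<epsilon>1 \<epsilon>2. 0 < \<epsilon>1 \<Longrightarrow> \<epsilon>1 \<le> \<epsilon>2 \<Longrightarrow> \<epsilon>2 \<le> \<epsilon>0 \<Longrightarrow> p \<epsilon>2 \<le> p \<epsilon>1 + ereal \<eta>"
      using assms[OF \<eta>] by blast
    have ev: "\<forall>\<^sub>F \<epsilon> in at_right 0. \<epsilon> \<in> {0<..<b}" if "b > 0" for b :: real
      using that by (rule eventually_at_right_real)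
    have "p \<epsilon>2 \<le> Liminf (at_right 0) p + ereal \<eta>" if e2: "0 < \<epsilon>2" "\<epsilon>2 \<le> \<epsilon>0" for \<epsilon>2
    proof -
      have "p \<epsilon>2 - ereal \<eta> \<le> Liminf (at_right 0) p"
      proof (rule Liminf_bounded)
        show "\<forall>\<^sub>F \<epsilon> in at_right 0. p \<epsilon>2 - ereal \<eta> \<le> p \<epsilon>"
          using ev[OF e2(1)]
        proof eventually_elim
          case (elim \<epsilon>)
          then have "p \<epsilon>2 \<le> p \<epsilon> + ereal \<eta>" using e2 by (intro \<epsilon>0) auto
          then show ?case by (simp add: ereal_minus_le)
        qed
      qed
      then show ?thesis by (simp add: ereal_minus_le)
    qed
    then show "Limsup (at_right 0) p \<le> Liminf (at_right 0) p + ereal \<eta>"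
      using ev[OF \<epsilon>0(1)] by (intro Limsup_bounded) (auto elim!: eventually_mono)
  qed
  then have "(p \<longlongrightarrow> Liminf (at_right 0) p) (at_right 0)"
    using Liminf_le_Limsup[of "at_right 0" p] by (intro Liminf_eq_Limsup) auto
  then show ?thesis using tendsto_Lim[of "at_right 0" p] by simp
qed

definition cover_weight :: "('a \<Rightarrow> 'a \<Rightarrow> real) \<Rightarrow> ('a \<Rightarrow> 'a) \<Rightarrow> ('a \<Rightarrow> real) \<Rightarrow> real \<Rightarrow> real \<Rightarrow> nat \<times> 'a \<Rightarrow> ennreal" where
  "cover_weight d T \<phi> t \<epsilon> = (\<lambda>(m, x). ennreal (exp (- t * real m + (SUP y \<in> bowen_ball d T m x \<epsilon>. birkhoff_sum T \<phi> m y))))"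

lemma pressure_sum_eq: "pressure_sum d T Z t \<phi> n \<epsilon> = (INF C \<in> bowen_covers d T Z n \<epsilon>. infsum (cover_weight d T \<phi> t \<epsilon>) C)"
  by (simp add: pressure_sum_def cover_weight_def)

lemma pressure_sum_mono_n:
  assumes "n \<le> n'"
  shows "pressure_sum d T Z t \<phi> n \<epsilon> \<le> pressure_sum d T Z t \<phi> n' \<epsilon>"
  unfolding pressure_sum_eq by (rule INF_superset_mono) (use assms in \<open>fastforce simp: bowen_covers_def\<close>, simp)

lemma pressure_sum_antimono_t:
  assumes "t \<le> t'"
  shows "pressure_sum d T Z t' \<phi> n \<epsilon> \<le> pressure_sum d T Z t \<phi> n \<epsilon>"
  unfolding pressure_sum_eq
proof (rule INF_mono)
  fix C assume "C \<in> bowen_covers d T Z n \<epsilon>"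
  then show "\<exists>C'\<in>bowen_covers d T Z n \<epsilon>. infsum (cover_weight d T \<phi> t' \<epsilon>) C' \<le> infsum (cover_weight d T \<phi> t \<epsilon>) C"
    using assms by (intro bexI[of _ C] infsum_ennreal_mono)
      (auto simp: cover_weight_def intro!: ennreal_leI mult_right_mono)
qed

lemma pressure_outer_SUP: "pressure_outer d T Z t \<phi> \<epsilon> = (SUP n. pressure_sum d T Z t \<phi> n \<epsilon>)"
  unfolding pressure_outer_def by (intro limI LIMSEQ_SUP incseq_SucI pressure_sum_mono_n) simp

lemma pressure_outer_zero_iff: "pressure_outer d T Z t \<phi> \<epsilon> = 0 \<longleftrightarrow> (\<forall>n. pressure_sum d T Z t \<phi> n \<epsilon> = 0)"
proof -
  have "pressure_outer d T Z t \<phi> \<epsilon> = 0 \<longleftrightarrow> pressure_outer d T Z t \<phi> \<epsilon> \<le> 0" by simp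
  also have "\<dots> \<longleftrightarrow> (\<forall>n. pressure_sum d T Z t \<phi> n \<epsilon> \<le> 0)" unfolding pressure_outer_SUP by (simp only: SUP_le_iff) simp
  finally show ?thesis by simp
qed

text \<open>Pressure sums decrease in \<open>t\<close>, so positivity for one \<open>n\<close>
  excludes every parameter up to \<open>t\<close> from the infimum.\<close>

lemma pressure_at_ge:
  assumes "pressure_sum d T Z t \<phi> n \<epsilon> > 0"
  shows "ereal t \<le> pressure_at d T Z \<phi> \<epsilon>"
  unfolding pressure_at_def
proof (rule INF_greatest)
  fix t' assume "t' \<in> {t. pressure_outer d T Z t \<phi> \<epsilon> = 0}"
  then have "pressure_sum d T Z t' \<phi> n \<epsilon> = 0" using pressure_outer_zero_iff by blast
  then have "\<not> t' \<le> t" using pressure_sum_antimono_t[of t' t d T Z \<phi> n \<epsilon>] assms by auto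
  then show "ereal t \<le> ereal t'" by simp
qed

lemma pressure_at_le:
  assumes "\<And>n. pressure_sum d T Z t \<phi> n \<epsilon> = 0"
  shows "pressure_at d T Z \<phi> \<epsilon> \<le> ereal t"
  unfolding pressure_at_def by (rule INF_lower) (simp add: pressure_outer_zero_iff assms)

lemma pressure_sum_empty: "pressure_sum d T {} t \<phi> n \<epsilon> = 0"
proof -
  have "pressure_sum d T {} t \<phi> n \<epsilon> \<le> infsum (cover_weight d T \<phi> t \<epsilon>) {}"
    unfolding pressure_sum_eq by (rule INF_lower) (auto simp: bowen_covers_def)
  then show ?thesis by simp
qed

lemma pressure_sum_Union_zero:
  assumes "\<And>i. pressure_sum d T (Z i) t \<phi> n \<epsilon> = 0"
  shows "pressure_sum d T (\<Union>i::nat. Z i) t \<phi> n \<epsilon> = 0"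
proof -
  have le: "pressure_sum d T (\<Union>i. Z i) t \<phi> n \<epsilon> \<le> ennreal e" if e: "e > 0" for e
  proof -
    have "\<exists>C\<in>bowen_covers d T (Z i) n \<epsilon>. infsum (cover_weight d T \<phi> t \<epsilon>) C < ennreal (e * (1 / 2) ^ Suc i)" for i
    proof -
      have "pressure_sum d T (Z i) t \<phi> n \<epsilon> < ennreal (e * (1 / 2) ^ Suc i)"
        using assms e by simp
      then show ?thesis unfolding pressure_sum_eq INF_less_iff .
    qed
    then obtain C where C: "\<And>i. C i \<in> bowen_covers d T (Z i) n \<epsilon>"
      "\<And>i. infsum (cover_weight d T \<phi> t \<epsilon>) (C i) < ennreal (e * (1 / 2) ^ Suc i)" by metis
    have "(\<Union>i. C i) \<in> bowen_covers d T (\<Union>i. Z i) n \<epsilon>"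
    proof -
      have "countable (C i)" "\<forall>(m, x)\<in>C i. n \<le> m" "Z i \<subseteq> (\<Union>(m, x)\<in>C i. bowen_ball d T m x \<epsilon>)" for i
        using C(1)[of i] by (simp_all add: bowen_covers_def)
      then show ?thesis unfolding bowen_covers_def by (intro CollectI conjI) (auto, blast)
    qed
    then have "pressure_sum d T (\<Union>i. Z i) t \<phi> n \<epsilon> \<le> infsum (cover_weight d T \<phi> t \<epsilon>) (\<Union>i. C i)"
      unfolding pressure_sum_eq by (rule INF_lower)
    also have "\<dots> \<le> (\<Sum>i. infsum (cover_weight d T \<phi> t \<epsilon>) (C i))" by (rule infsum_UN_le)
    also have "\<dots> \<le> (\<Sum>i. ennreal (e * (1 / 2) ^ Suc i))"
      by (rule suminf_le) (use C(2) in \<open>auto intro: less_imp_le\<close>)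
    also have "\<dots> = ennreal e"
    proof (rule suminf_ennreal_eq)
      show "(\<lambda>i. e * (1 / 2) ^ Suc i) sums e" using sums_mult[OF power_half_series, of e] by simp
    qed (use e in auto)
    finally show ?thesis .
  qed
  have "pressure_sum d T (\<Union>i. Z i) t \<phi> n \<epsilon> \<le> 0"
  proof (rule ennreal_le_epsilon)
    fix e :: real assume "e > 0"
    then show "pressure_sum d T (\<Union>i. Z i) t \<phi> n \<epsilon> \<le> 0 + ennreal e" using le[of e] by simp
  qed
  then show ?thesis by simp
qed

context rho_system
begin

lemma bowen_ball_center: "0 \<le> \<epsilon> \<Longrightarrow> x \<in> bowen_ball d T m x \<epsilon>"
  by (simp add: bowen_ball_def)

context
  fixes \<phi> :: "'a \<Rightarrow> real"
  assumes \<phi>: "continuous_on UNIV \<phi>"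
begin

lemma birkhoff_sum_le_SUP:
  assumes "y \<in> bowen_ball d T m x \<epsilon>"
  shows "birkhoff_sum T \<phi> m y \<le> (SUP y \<in> bowen_ball d T m x \<epsilon>. birkhoff_sum T \<phi> m y)"
proof (rule cSUP_upper[OF assms])
  obtain B where B: "\<And>x. \<bar>\<phi> x\<bar> \<le> B" using continuous_bounded[OF \<phi>] by blast
  show "bdd_above (birkhoff_sum T \<phi> m ` bowen_ball d T m x \<epsilon>)"
    using birkhoff_sum_bound[of \<phi> B, OF B] by (intro bdd_aboveI2[of _ _ "real m * B"]) (simp add: abs_le_iff)
qed

lemma SUP_le_birkhoff_sum:
  assumes "0 \<le> \<epsilon>" and \<omega>: "\<And>x y. d x y \<le> \<epsilon> \<Longrightarrow> \<bar>\<phi> x - \<phi> y\<bar> \<le> \<omega>"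
  shows "(SUP y \<in> bowen_ball d T m x \<epsilon>. birkhoff_sum T \<phi> m y) \<le> birkhoff_sum T \<phi> m x + real m * \<omega>"
proof (rule cSUP_least)
  show "bowen_ball d T m x \<epsilon> \<noteq> {}" using bowen_ball_center[OF assms(1)] by blast
  fix y assume y: "y \<in> bowen_ball d T m x \<epsilon>"
  have "birkhoff_sum T \<phi> m y \<le> (\<Sum>i<m. \<phi> ((T ^^ i) x) + \<omega>)"
    unfolding birkhoff_sum_def
  proof (rule sum_mono)
    fix i assume "i \<in> {..<m}"
    then show "\<phi> ((T ^^ i) y) \<le> \<phi> ((T ^^ i) x) + \<omega>"
      using \<omega>[of "(T ^^ i) x" "(T ^^ i) y"] y by (auto simp: bowen_ball_def abs_le_iff)
  qed
  then show "birkhoff_sum T \<phi> m y \<le> birkhoff_sum T \<phi> m x + real m * \<omega>"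
    by (simp add: birkhoff_sum_def sum.distrib)
qed

text \<open>A cover at radius \<open>\<epsilon>1\<close> is a cover at \<open>\<epsilon>2\<close>
  whose weights grow by at most \<open>exp (real m * \<omega>)\<close>; raising \<open>t\<close> by
  \<omega> absorbs this.\<close>

lemma pressure_at_shrink:
  assumes e: "0 < \<epsilon>1" "\<epsilon>1 \<le> \<epsilon>2" and \<omega>: "\<And>x y. d x y \<le> \<epsilon>2 \<Longrightarrow> \<bar>\<phi> x - \<phi> y\<bar> \<le> \<omega>"
  shows "pressure_at d T Z \<phi> \<epsilon>2 \<le> pressure_at d T Z \<phi> \<epsilon>1 + ereal \<omega>"
proof -
  have le: "pressure_sum d T Z (t + \<omega>) \<phi> n \<epsilon>2 \<le> pressure_sum d T Z t \<phi> n \<epsilon>1" for t n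
    unfolding pressure_sum_eq
  proof (rule INF_mono)
    fix C assume C: "C \<in> bowen_covers d T Z n \<epsilon>1"
    have "bowen_ball d T m x \<epsilon>1 \<subseteq> bowen_ball d T m x \<epsilon>2" for m x using e by (auto simp: bowen_ball_def intro: order_trans)
    then have "(\<Union>(m, x)\<in>C. bowen_ball d T m x \<epsilon>1) \<subseteq> (\<Union>(m, x)\<in>C. bowen_ball d T m x \<epsilon>2)"
      by (intro UN_mono) auto
    moreover have "countable C" "\<forall>(m, x)\<in>C. n \<le> m" "Z \<subseteq> (\<Union>(m, x)\<in>C. bowen_ball d T m x \<epsilon>1)"
      using C by (simp_all add: bowen_covers_def)
    ultimately have C2: "C \<in> bowen_covers d T Z n \<epsilon>2" unfolding bowen_covers_def
      by (intro CollectI conjI) (assumption, assumption, rule order_trans)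
    have "cover_weight d T \<phi> (t + \<omega>) \<epsilon>2 (m, x) \<le> cover_weight d T \<phi> t \<epsilon>1 (m, x)" for m x
    proof -
      have "(SUP y \<in> bowen_ball d T m x \<epsilon>2. birkhoff_sum T \<phi> m y) \<le> birkhoff_sum T \<phi> m x + real m * \<omega>"
        by (rule SUP_le_birkhoff_sum) (use e \<omega> in auto)
      also have "birkhoff_sum T \<phi> m x \<le> (SUP y \<in> bowen_ball d T m x \<epsilon>1. birkhoff_sum T \<phi> m y)"
        by (rule birkhoff_sum_le_SUP[OF bowen_ball_center]) (use e in auto)
      finally show ?thesis by (auto simp: cover_weight_def algebra_simps intro!: ennreal_leI)
    qed
    then have "infsum (cover_weight d T \<phi> (t + \<omega>) \<epsilon>2) C \<le> infsum (cover_weight d T \<phi> t \<epsilon>1) C"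
      by (intro infsum_ennreal_mono) auto
    with C2 show "\<exists>C'\<in>bowen_covers d T Z n \<epsilon>2. infsum (cover_weight d T \<phi> (t + \<omega>) \<epsilon>2) C' \<le> infsum (cover_weight d T \<phi> t \<epsilon>1) C" by blast
  qed
  have "pressure_at d T Z \<phi> \<epsilon>2 - ereal \<omega> \<le> pressure_at d T Z \<phi> \<epsilon>1"
    unfolding pressure_at_def[of d T Z \<phi> \<epsilon>1]
  proof (rule INF_greatest)
    fix t assume "t \<in> {t. pressure_outer d T Z t \<phi> \<epsilon>1 = 0}"
    then have "pressure_sum d T Z t \<phi> n \<epsilon>1 = 0" for n using pressure_outer_zero_iff by blast
    then have "pressure_sum d T Z (t + \<omega>) \<phi> n \<epsilon>2 = 0" for n using le[of t n] by simp
    then have "pressure_at d T Z \<phi> \<epsilon>2 \<le> ereal (t + \<omega>)" by (rule pressure_at_le)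
    then show "pressure_at d T Z \<phi> \<epsilon>2 - ereal \<omega> \<le> ereal t" by (simp add: ereal_minus_le)
  qed
  then show ?thesis by (simp add: ereal_minus_le)
qed

lemma pressure_tendsto: "((\<lambda>\<epsilon>. pressure_at d T Z \<phi> \<epsilon>) \<longlongrightarrow> pressure d T Z \<phi>) (at_right 0)"
  unfolding pressure_def
proof (rule limit_of_almost_antitone)
  fix \<eta> :: real assume "\<eta> > 0"
  then obtain \<delta> where \<delta>: "\<delta> > 0" "\<And>x y. d x y \<le> \<delta> \<Longrightarrow> dist (\<phi> x) (\<phi> y) < \<eta>"
    using uniformly_continuous_d[OF \<phi>] by blast
  show "\<exists>\<epsilon>0>0. \<forall>\<epsilon>1 \<epsilon>2. 0 < \<epsilon>1 \<longrightarrow> \<epsilon>1 \<le> \<epsilon>2 \<longrightarrow> \<epsilon>2 \<le> \<epsilon>0 \<longrightarrow> pressure_at d T Z \<phi> \<epsilon>2 \<le> pressure_at d T Z \<phi> \<epsilon>1 + ereal \<eta>"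
  proof (intro exI[of _ \<delta>] conjI allI impI \<delta>(1))
    fix \<epsilon>1 \<epsilon>2 assume e: "0 < \<epsilon>1" "\<epsilon>1 \<le> \<epsilon>2" "\<epsilon>2 \<le> \<delta>"
    show "pressure_at d T Z \<phi> \<epsilon>2 \<le> pressure_at d T Z \<phi> \<epsilon>1 + ereal \<eta>"
    proof (rule pressure_at_shrink[OF e(1,2)])
      fix x y assume "d x y \<le> \<epsilon>2"
      then show "\<bar>\<phi> x - \<phi> y\<bar> \<le> \<eta>" using \<delta>(2)[of x y] e by (simp add: dist_real_def)
    qed
  qed
qed

lemma pressure_geI:
  assumes "\<And>\<eta>. \<eta> > 0 \<Longrightarrow> \<exists>\<epsilon>0>0. \<forall>\<epsilon>. 0 < \<epsilon> \<longrightarrow> \<epsilon> < \<epsilon>0 \<longrightarrow> ereal (c - \<eta>) \<le> pressure_at d T Z \<phi> \<epsilon>"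
  shows "ereal c \<le> pressure d T Z \<phi>"
proof (rule ereal_le_epsilon2)
  fix \<eta> :: real assume "\<eta> > 0"
  then obtain \<epsilon>0 where \<epsilon>0: "\<epsilon>0 > 0" "\<And>\<epsilon>. 0 < \<epsilon> \<Longrightarrow> \<epsilon> < \<epsilon>0 \<Longrightarrow> ereal (c - \<eta>) \<le> pressure_at d T Z \<phi> \<epsilon>" using assms by blast
  have "\<forall>\<^sub>F \<epsilon> in at_right 0. ereal (c - \<eta>) \<le> pressure_at d T Z \<phi> \<epsilon>"
    using eventually_at_right_real[OF \<epsilon>0(1)] by eventually_elim (use \<epsilon>0(2) in auto)
  then have "ereal (c - \<eta>) \<le> pressure d T Z \<phi>"
    by (intro tendsto_lowerbound[OF pressure_tendsto]) auto
  then have "ereal (c - \<eta>) + ereal \<eta> \<le> pressure d T Z \<phi> + ereal \<eta>" by (rule add_right_mono)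
  then show "ereal c \<le> pressure d T Z \<phi> + ereal \<eta>" by simp
qed

lemma pressure_leI:
  assumes "\<And>\<eta>. \<eta> > 0 \<Longrightarrow> \<exists>\<epsilon>0>0. \<forall>\<epsilon>. 0 < \<epsilon> \<longrightarrow> \<epsilon> < \<epsilon>0 \<longrightarrow> pressure_at d T Z \<phi> \<epsilon> \<le> ereal (c + \<eta>)"
  shows "pressure d T Z \<phi> \<le> ereal c"
proof (rule ereal_le_epsilon2)
  fix \<eta> :: real assume "\<eta> > 0"
  then obtain \<epsilon>0 where \<epsilon>0: "\<epsilon>0 > 0" "\<And>\<epsilon>. 0 < \<epsilon> \<Longrightarrow> \<epsilon> < \<epsilon>0 \<Longrightarrow> pressure_at d T Z \<phi> \<epsilon> \<le> ereal (c + \<eta>)" using assms by blast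
  have "\<forall>\<^sub>F \<epsilon> in at_right 0. pressure_at d T Z \<phi> \<epsilon> \<le> ereal (c + \<eta>)"
    using eventually_at_right_real[OF \<epsilon>0(1)] by eventually_elim (use \<epsilon>0(2) in auto)
  then show "pressure d T Z \<phi> \<le> ereal c + ereal \<eta>"
    by (intro tendsto_upperbound[OF pressure_tendsto]) auto
qed

end

end

section \<open>The observable along orbits\<close>

locale observable = rho_system T f for T :: "'a::metric_space \<Rightarrow> 'a" and f +
  fixes \<Xi> :: "'a measure \<Rightarrow> 'y::{real_vector, metric_space}"
  assumes dist_add: "\<And>x1 x2 y1 y2 :: 'y. dist (x1 + x2) (y1 + y2) \<le> dist x1 y1 + dist x2 y2"
    and dist_scale: "\<And>(c :: real) (x :: 'y) y. dist (c *\<^sub>R x) (c *\<^sub>R y) \<le> \<bar>c\<bar> * dist x y"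
    and \<Xi>_cont: "continuous_map weak_star_topology euclidean \<Xi>" and \<Xi>_affine: "affine_on_prob_measures \<Xi>"
begin

definition e where "e x = \<Xi> (return borel x)"

lemma return_prob: "return borel (x :: 'a) \<in> prob_measures"
  by (simp add: prob_measures_def prob_space_return)

lemma e_continuous: "continuous_on UNIV e"
proof (rule continuous_on_sequentiallyI)
  fix u :: "nat \<Rightarrow> 'a" and a assume u: "u \<longlonglongrightarrow> a"
  show "(\<lambda>n. e (u n)) \<longlonglongrightarrow> e a"
    unfolding e_def
  proof (rule continuous_map_sequentially[OF \<Xi>_cont return_prob return_prob])
    fix v :: "'a \<Rightarrow> real" assume v: "continuous_on UNIV v"
    have "(\<integral>x. v x \<partial>return borel y) = v y" for y
      by (rule integral_return) (use v in \<open>auto intro: borel_measurable_continuous_onI\<close>)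
    then show "(\<lambda>n. \<integral>x. v x \<partial>return borel (u n)) \<longlonglongrightarrow> (\<integral>x. v x \<partial>return borel a)"
      using continuous_on_tendsto_compose[OF v u] by simp
  qed
qed

lemma \<Xi>_affineD:
  assumes "\<mu> \<in> prob_measures" "\<nu> \<in> prob_measures" "\<nu>' \<in> prob_measures" "0 \<le> a" "a \<le> 1"
    "\<And>A. A \<in> sets borel \<Longrightarrow> measure \<nu>' A = a * measure \<mu> A + (1 - a) * measure \<nu> A"
  shows "\<Xi> \<nu>' = a *\<^sub>R \<Xi> \<mu> + (1 - a) *\<^sub>R \<Xi> \<nu>"
  using \<Xi>_affine assms unfolding affine_on_prob_measures_def by simp

definition avg where "avg n x = (1 / real n) *\<^sub>R (\<Sum>i<n. e ((T ^^ i) x))"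

text \<open>The empirical measure of one more step is a convex combination of the previous one and a
  Dirac measure, so affinity for two measures suffices by induction. From here on only vector
  averages of \<open>e\<close> occur.\<close>

lemma \<Xi>_empirical: "\<Xi> (empirical T (Suc n) x) = avg (Suc n) x"
proof (induction n)
  case 0
  have "\<Xi> (empirical T 1 x) = 1 *\<^sub>R \<Xi> (return borel x) + (1 - 1) *\<^sub>R \<Xi> (return borel x)"
    by (rule \<Xi>_affineD[OF return_prob return_prob empirical_prob]) (auto simp: measure_empirical)
  then show ?case by (simp add: avg_def e_def)
next
  case (Suc n)
  let ?n = "Suc n"
  define a where "a = real ?n / real (Suc ?n)"
  have a: "1 - a = 1 / real (Suc ?n)" unfolding a_def by (simp add: field_simps)
  have "\<Xi> (empirical T (Suc ?n) x) = a *\<^sub>R \<Xi> (empirical T ?n x) + (1 - a) *\<^sub>R \<Xi> (return borel ((T ^^ ?n) x))"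
  proof (rule \<Xi>_affineD[OF empirical_prob return_prob empirical_prob])
    show "0 \<le> a" "a \<le> 1" by (auto simp: a_def)
    fix A :: "'a set" assume A: "A \<in> sets borel"
    have "a * measure (empirical T ?n x) A = (1 / real (Suc ?n)) * (\<Sum>k<?n. measure (return borel ((T ^^ k) x)) A)"
      using measure_empirical[OF _ A, of ?n T x] by (simp add: a_def)
    then show "measure (empirical T (Suc ?n) x) A = a * measure (empirical T ?n x) A + (1 - a) * measure (return borel ((T ^^ ?n) x)) A"
      using measure_empirical[OF _ A, of "Suc ?n" T x] unfolding a by (simp add: distrib_left)
  qed auto
  also have "\<dots> = avg (Suc ?n) x"
    unfolding Suc a unfolding avg_def a_def
    by (simp add: e_def scaleR_right_distrib del: of_nat_Suc)
  finally show ?case .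
qed

lemma dist_sum_le:
  fixes u v :: "'b \<Rightarrow> 'y"
  shows "dist (sum u I) (sum v I) \<le> (\<Sum>i\<in>I. dist (u i) (v i))"
proof (induction I rule: infinite_finite_induct)
  case (insert i I)
  then show ?case using dist_add[of "u i" "sum u I" "v i" "sum v I"] by simp
qed auto

lemma dist_avg_avg:
  "dist (avg n x) (avg n z) \<le> (\<Sum>i<n. dist (e ((T ^^ i) x)) (e ((T ^^ i) z))) / real n"
proof -
  have "dist (avg n x) (avg n z) \<le> \<bar>1 / real n\<bar> * dist (\<Sum>i<n. e ((T ^^ i) x)) (\<Sum>i<n. e ((T ^^ i) z))"
    unfolding avg_def by (rule dist_scale)
  also have "\<dots> \<le> \<bar>1 / real n\<bar> * (\<Sum>i<n. dist (e ((T ^^ i) x)) (e ((T ^^ i) z)))"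
    by (intro mult_left_mono dist_sum_le) auto
  finally show ?thesis by simp
qed

text \<open>Unnormalised sums satisfy exact additivity, so distances of averages are compared
  through the vectors \<open>n *\<^sub>R y\<close>.\<close>

lemma dist_avg_blocks:
  fixes l :: "nat \<Rightarrow> nat"
  assumes n: "n \<ge> 1" and le: "sum l {..<J} \<le> n" and D: "\<And>w. dist (e w) y \<le> D"
  shows "real n * dist (avg n z) y \<le> (\<Sum>j<J. real (l j) * dist (avg (l j) ((T ^^ sum l {..<j}) z)) y) + (real n - real (sum l {..<J})) * D"
proof -
  let ?S = "\<lambda>n z. \<Sum>i<n. e ((T ^^ i) z)" and ?M = "sum l {..<J}"
  have S: "?S n z = real n *\<^sub>R avg n z" for n z by (cases "n = 0") (auto simp: avg_def)
  have add: "?S (a + b) z = ?S a z + ?S b ((T ^^ a) z)" for a b z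
  proof -
    have "?S (a + b) z = (\<Sum>i<a. e ((T ^^ i) z)) + (\<Sum>i=a..<a + b. e ((T ^^ i) z))"
      by (simp add: lessThan_atLeast0 sum.atLeastLessThan_concat)
    also have "(\<Sum>i=a..<a + b. e ((T ^^ i) z)) = ?S b ((T ^^ a) z)"
      using sum.shift_bounds_nat_ivl[of "\<lambda>i. e ((T ^^ i) z)" 0 a b]
      by (simp add: lessThan_atLeast0 funpow_add add.commute)
    finally show ?thesis .
  qed
  have blocks: "?S (sum l {..<p}) z = (\<Sum>j<p. ?S (l j) ((T ^^ sum l {..<j}) z))" for p
    by (induction p) (simp_all add: add)
  have e1: "?S n z = (\<Sum>j<J. ?S (l j) ((T ^^ sum l {..<j}) z)) + ?S (n - ?M) ((T ^^ ?M) z)"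
    using add[of z ?M "n - ?M"] le blocks[of J] by simp
  have e2: "real n *\<^sub>R y = (\<Sum>j<J. real (l j) *\<^sub>R y) + (\<Sum>i<n - ?M. y)"
  proof -
    have "(\<Sum>j<J. real (l j) *\<^sub>R y) = real ?M *\<^sub>R y" by (simp add: scaleR_sum_left)
    moreover have "(\<Sum>i<n - ?M. y) = real (n - ?M) *\<^sub>R y" by (simp add: sum_constant_scaleR)
    ultimately show ?thesis using le by (simp add: scaleR_left_distrib[symmetric] of_nat_diff)
  qed
  have "dist (?S n z) (real n *\<^sub>R y)
      \<le> dist (\<Sum>j<J. ?S (l j) ((T ^^ sum l {..<j}) z)) (\<Sum>j<J. real (l j) *\<^sub>R y)
        + dist (?S (n - ?M) ((T ^^ ?M) z)) (\<Sum>i<n - ?M. y)"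
    unfolding e1 e2 by (rule dist_add)
  also have "dist (\<Sum>j<J. ?S (l j) ((T ^^ sum l {..<j}) z)) (\<Sum>j<J. real (l j) *\<^sub>R y)
      \<le> (\<Sum>j<J. real (l j) * dist (avg (l j) ((T ^^ sum l {..<j}) z)) y)"
  proof (rule order_trans[OF dist_sum_le sum_mono])
    fix j
    show "dist (?S (l j) ((T ^^ sum l {..<j}) z)) (real (l j) *\<^sub>R y) \<le> real (l j) * dist (avg (l j) ((T ^^ sum l {..<j}) z)) y"
      using dist_scale[of "real (l j)" "avg (l j) ((T ^^ sum l {..<j}) z)" y] S[of "(T ^^ sum l {..<j}) z" "l j"] by simp
  qed
  also have "dist (?S (n - ?M) ((T ^^ ?M) z)) (\<Sum>i<n - ?M. y) \<le> (\<Sum>i<n - ?M. D)"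
    by (rule order_trans[OF dist_sum_le sum_mono]) (rule D)
  also have "\<dots> = (real n - real ?M) * D" using le by (simp add: of_nat_diff)
  finally have 1: "dist (?S n z) (real n *\<^sub>R y) \<le> (\<Sum>j<J. real (l j) * dist (avg (l j) ((T ^^ sum l {..<j}) z)) y) + (real n - real ?M) * D" by simp
  have "dist (avg n z) y = dist ((1 / real n) *\<^sub>R ?S n z) ((1 / real n) *\<^sub>R (real n *\<^sub>R y))"
    using n by (simp add: avg_def)
  also have "\<dots> \<le> \<bar>1 / real n\<bar> * dist (?S n z) (real n *\<^sub>R y)" by (rule dist_scale)
  finally have "real n * dist (avg n z) y \<le> dist (?S n z) (real n *\<^sub>R y)" using n by (simp add: field_simps)
  with 1 show ?thesis by linarith
qed

lemma e_bounded:
  assumes "bounded Q"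
  shows "\<exists>D>0. \<forall>w. (\<forall>y\<in>Q. dist (e w) y \<le> D) \<and> (\<forall>w'. dist (e w) (e w') \<le> D)"
proof -
  have "bounded (range e)" using compact_continuous_image[OF e_continuous compact_UNIV] by (rule compact_imp_bounded)
  then have "bounded (range e \<union> Q)" using assms by simp
  then obtain a r where r: "\<And>y. y \<in> range e \<union> Q \<Longrightarrow> dist a y \<le> r" by (auto simp: bounded_def)
  have "dist x y \<le> 2 * \<bar>r\<bar> + 1" if "x \<in> range e \<union> Q" "y \<in> range e \<union> Q" for x y
    using r[OF that(1)] r[OF that(2)] dist_triangle3[of x y a] by linarith
  then show ?thesis by (intro exI[of _ "2 * \<bar>r\<bar> + 1"]) auto
qed

end

context product_system
begin

text \<open>The product property traces finitely many blocks; a limit point of such tracing points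
  traces all of them, since iterates are continuous and mistake balls are closed.\<close>

lemma tracing_infinite:
  "\<exists>m :: real \<Rightarrow> nat. \<forall>(x :: nat \<Rightarrow> 'a) (\<theta> :: nat \<Rightarrow> real) (n :: nat \<Rightarrow> nat).
    (\<forall>j. 0 < \<theta> j \<and> m (\<theta> j) \<le> n j \<and> 1 \<le> n j) \<longrightarrow>
    (\<exists>z. \<forall>j. (T ^^ sum n {..<j}) z \<in> mistake_ball d T g (n j) (x j) (\<theta> j))"
proof -
  obtain m :: "real \<Rightarrow> nat" where trace: "\<forall>k\<ge>1. \<forall>(x :: nat \<Rightarrow> 'a) (\<theta> :: nat \<Rightarrow> real) (n :: nat \<Rightarrow> nat).
    (\<forall>j<k. 0 < \<theta> j \<and> m (\<theta> j) \<le> n j \<and> 1 \<le> n j) \<longrightarrow>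
    (\<exists>z. \<forall>j<k. (T ^^ sum n {..<j}) z \<in> mistake_ball d T g (n j) (x j) (\<theta> j))"
    using tracing by (elim exE)
  show ?thesis
  proof (rule exI[of _ m], intro allI impI)
    fix x :: "nat \<Rightarrow> 'a" and \<theta> :: "nat \<Rightarrow> real" and n :: "nat \<Rightarrow> nat"
    assume *: "\<forall>j. 0 < \<theta> j \<and> m (\<theta> j) \<le> n j \<and> 1 \<le> n j"
    have "\<forall>k. \<exists>z. \<forall>j<Suc k. (T ^^ sum n {..<j}) z \<in> mistake_ball d T g (n j) (x j) (\<theta> j)"
      using trace * by (metis le_add1 plus_1_eq_Suc)
    then obtain zs where zs: "\<And>k j. j < Suc k \<Longrightarrow> (T ^^ sum n {..<j}) (zs k) \<in> mistake_ball d T g (n j) (x j) (\<theta> j)" by metis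
    obtain z r where r: "strict_mono (r :: nat \<Rightarrow> nat)" "(zs \<circ> r) \<longlonglongrightarrow> z" using convergent_subsequence by blast
    have "(T ^^ sum n {..<j}) z \<in> mistake_ball d T g (n j) (x j) (\<theta> j)" for j
    proof (rule Lim_in_closed_set[OF mistake_ball_closed])
      show "((\<lambda>k. (T ^^ sum n {..<j}) ((zs \<circ> r) k)) \<longlongrightarrow> (T ^^ sum n {..<j}) z) sequentially"
        by (rule continuous_on_tendsto_compose[OF continuous_funpow r(2)]) auto
      show "\<forall>\<^sub>F k in sequentially. (T ^^ sum n {..<j}) ((zs \<circ> r) k) \<in> mistake_ball d T g (n j) (x j) (\<theta> j)"
        using eventually_ge_at_top[of j]
      proof eventually_elim
        case (elim k)
        then show ?case using zs[of j "r k"] seq_suble[OF r(1), of k] by simp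
      qed
    qed simp
    then show "\<exists>z. \<forall>j. (T ^^ sum n {..<j}) z \<in> mistake_ball d T g (n j) (x j) (\<theta> j)" by blast
  qed
qed

end

section \<open>Concatenated blocks and the lower bound\<close>

text \<open>The coefficient of \<open>n k\<close> is the number of repetitions of the \<open>k\<close>-th block, chosen so that
  the time before stage \<open>k\<close> and the length of a block of stage \<open>k + 1\<close> are both negligible against
  the time at which stage \<open>k + 1\<close> starts.\<close>

primrec stage_time :: "(nat \<Rightarrow> nat) \<Rightarrow> nat \<Rightarrow> nat" where
  "stage_time n 0 = 0"
| "stage_time n (Suc k) = stage_time n k + ((k + 1) * (stage_time n k + n (Suc k)) + 1) * n k"

definition repetitions :: "(nat \<Rightarrow> nat) \<Rightarrow> nat \<Rightarrow> nat" where
  "repetitions n k = (k + 1) * (stage_time n k + n (Suc k)) + 1"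

lemma repetitions_pos: "1 \<le> repetitions n k" by (simp add: repetitions_def)

text \<open>\<open>stage\<close> takes the number of a block, \<open>stage_at\<close> a time; blocks
  are grouped into stages by \<open>repetitions\<close>, times into blocks by
  \<open>lengths\<close>.\<close>

definition stage :: "(nat \<Rightarrow> nat) \<Rightarrow> nat \<Rightarrow> nat" where
  "stage n = block_index (repetitions n)"

definition lengths :: "(nat \<Rightarrow> nat) \<Rightarrow> nat \<Rightarrow> nat" where
  "lengths n j = n (stage n j)"

definition stage_at :: "(nat \<Rightarrow> nat) \<Rightarrow> nat \<Rightarrow> nat" where
  "stage_at n i = stage n (block_index (lengths n) i)"

context
  fixes n :: "nat \<Rightarrow> nat"
  assumes n_pos: "\<And>k. 1 \<le> n k"
begin

lemma lengths_pos: "1 \<le> lengths n j" unfolding lengths_def by (rule n_pos)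

lemma stage_bounds:
  "sum (repetitions n) {..<stage n j} \<le> j" "j < sum (repetitions n) {..<Suc (stage n j)}"
  unfolding stage_def
  using block_index_lower[of "repetitions n" j, OF repetitions_pos] block_index_upper[of "repetitions n" j, OF repetitions_pos]
  by auto

lemma stage_time_eq: "sum (lengths n) {..<sum (repetitions n) {..<k}} = stage_time n k"
proof (induction k)
  case (Suc k)
  let ?s = "sum (repetitions n) {..<k}"
  have "sum (lengths n) {..<sum (repetitions n) {..<Suc k}} = sum (lengths n) {..<?s + repetitions n k}" by simp
  also have "\<dots> = sum (lengths n) {..<?s} + sum (lengths n) {?s..<?s + repetitions n k}"
    by (simp add: lessThan_atLeast0 sum.atLeastLessThan_concat)
  also have "sum (lengths n) {?s..<?s + repetitions n k} = (\<Sum>j\<in>{?s..<?s + repetitions n k}. n k)"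
  proof (rule sum.cong[OF refl])
    fix j assume "j \<in> {?s..<?s + repetitions n k}"
    then have "stage n j = k" unfolding stage_def
      by (intro block_index_unique[of "repetitions n", OF repetitions_pos]) auto
    then show "lengths n j = n k" by (simp add: lengths_def)
  qed
  finally show ?case using Suc by (simp add: repetitions_def)
qed simp

lemma stage_time_le: "stage_time n (stage n j) \<le> sum (lengths n) {..<j}"
  unfolding stage_time_eq[symmetric] by (rule sum_mono2) (use stage_bounds(1) in auto)

lemma stage_time_growth: "Suc k * (stage_time n k + n (Suc k)) \<le> stage_time n (Suc k)"
proof -
  have "Suc k * (stage_time n k + n (Suc k)) * 1 \<le> (Suc k * (stage_time n k + n (Suc k)) + 1) * n k"
    by (intro mult_le_mono) (use n_pos in auto)
  then show ?thesis by simp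
qed

lemma stage_at_start: "stage_at n (stage_time n k) = k"
  unfolding stage_at_def stage_time_eq[symmetric] stage_def
  using block_index_start[of "lengths n", OF lengths_pos] block_index_start[of "repetitions n", OF repetitions_pos] by simp

lemma stage_at_at_top: "filterlim (stage_at n) at_top sequentially"
  unfolding stage_at_def stage_def
  by (intro filterlim_compose[OF block_index_at_top[of "repetitions n", OF repetitions_pos]]
      block_index_at_top[of "lengths n", OF lengths_pos])

lemma stage_time_ge: "k \<le> stage_time n k"
proof -
  have "k \<le> sum (repetitions n) {..<k}" by (rule block_sum_ge[of "repetitions n", OF repetitions_pos])
  also have "\<dots> \<le> sum (lengths n) {..<sum (repetitions n) {..<k}}" by (rule block_sum_ge[of "lengths n", OF lengths_pos])
  finally show ?thesis by (simp add: stage_time_eq)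
qed

text \<open>During stage \<open>Suc k\<close> the unfinished block and everything before stage
  \<open>k\<close> each take up at most the fraction \<open>1 / Suc k\<close> of the elapsed time,
  by the size of \<open>repetitions\<close>. Only completed blocks of stages \<open>k\<close> and
  \<open>Suc k\<close> matter for averages.\<close>

lemma remainder_le:
  assumes k: "stage_at n i = Suc k"
  shows "sum (lengths n) {..<block_index (lengths n) i} \<le> i"
    "Suc k * (i - sum (lengths n) {..<block_index (lengths n) i}) \<le> i" "Suc k * stage_time n k \<le> i"
proof -
  let ?J = "block_index (lengths n) i"
  let ?M = "sum (lengths n) {..<?J}"
  show M: "?M \<le> i" by (rule block_index_lower[of "lengths n", OF lengths_pos])
  have up: "i < ?M + lengths n ?J" using block_index_upper[of "lengths n" i, OF lengths_pos] by simp
  have st: "stage n ?J = Suc k" using k by (simp add: stage_at_def)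
  have "Suc k * (stage_time n k + n (Suc k)) \<le> ?M"
    using stage_time_growth[of k] stage_time_le[of ?J] st by simp
  then have *: "Suc k * stage_time n k + Suc k * n (Suc k) \<le> i" using M by (simp add: distrib_left)
  then show "Suc k * stage_time n k \<le> i" by linarith
  have "i - ?M \<le> n (Suc k)" using up st by (simp add: lengths_def)
  then have "Suc k * (i - ?M) \<le> Suc k * n (Suc k)" by (rule mult_le_mono2)
  then show "Suc k * (i - ?M) \<le> i" using * by linarith
qed

end

section \<open>Stages above a sequence in the target space\<close>

locale product_observable = product_system T f g + observable T f \<Xi>
  for T :: "'a::metric_space \<Rightarrow> 'a" and f g and \<Xi> :: "'a measure \<Rightarrow> 'y::{real_vector, metric_space}" +
  fixes \<phi> :: "'a \<Rightarrow> real"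
  assumes \<phi>_cont: "continuous_on UNIV \<phi>"
begin

text \<open>The entropy \<open>h\<close> may change from stage to stage: the logarithm of the
  cardinality is about \<open>n * h\<close> and Birkhoff sums are about \<open>n * (c - h)\<close>
  or more, so that their total is governed by \<open>c\<close> alone. The factor
  \<open>3 / 4\<close> collects three errors of \<open>\<eta> / 4\<close>.\<close>

definition stage_block :: "real \<Rightarrow> real \<Rightarrow> real \<Rightarrow> real \<Rightarrow> (real \<Rightarrow> nat) \<Rightarrow> 'y \<Rightarrow> nat \<Rightarrow> real \<Rightarrow> 'a set \<Rightarrow> real \<Rightarrow> bool" where
  "stage_block \<epsilon> c \<eta> \<zeta> m y n \<theta> \<Gamma> h \<longleftrightarrow> 1 \<le> n \<and> 0 < \<theta> \<and> m \<theta> \<le> n \<and> finite \<Gamma> \<and>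
     exp (real n * (h - \<eta>)) \<le> real (card \<Gamma>) \<and>
     (\<forall>x\<in>\<Gamma>. \<forall>x'\<in>\<Gamma>. \<forall>z z'. x \<noteq> x' \<longrightarrow> z \<in> mistake_ball d T g n x \<theta> \<longrightarrow> z' \<in> mistake_ball d T g n x' \<theta> \<longrightarrow>
        (\<exists>i<n. \<epsilon> / 2 < d ((T ^^ i) z) ((T ^^ i) z'))) \<and>
     (\<forall>x\<in>\<Gamma>. \<forall>z\<in>mistake_ball d T g n x \<theta>. real n * (c - h - 3 / 4 * \<eta>) \<le> birkhoff_sum T \<phi> n z \<and> dist (avg n z) y \<le> \<zeta>)"

text \<open>\<epsilon> is fixed before the target \<open>y\<close>, the accuracy \<zeta> and the
  measure, so that all stages are separated at a common scale; the length \<open>n\<close> and the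
  tracing accuracy \<theta> adapt to each stage.\<close>

lemma stage_exists:
  assumes \<eta>: "\<eta> > 0"
  shows "\<exists>\<epsilon>>0. \<forall>c \<zeta> m y. 0 < \<zeta> \<longrightarrow>
    (\<exists>\<mu>\<in>invariant_measures T. \<exists>P. finite_partition P \<and> \<Xi> \<mu> = y \<and> c < entropy_wrt T \<mu> P + (\<integral>x. \<phi> x \<partial>\<mu>)) \<longrightarrow>
    (\<exists>n \<theta> \<Gamma> h. stage_block \<epsilon> c \<eta> \<zeta> m y n \<theta> \<Gamma> h)"
proof -
  obtain \<epsilon> where \<epsilon>: "\<epsilon> > 0" and mix: "\<forall>\<mu>\<in>invariant_measures T. \<forall>P U r. finite_partition P \<longrightarrow> finite U \<longrightarrow>
    (\<forall>u\<in>U. continuous_on UNIV (u :: 'a \<Rightarrow> real)) \<longrightarrow> r > 0 \<longrightarrow>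
    (\<exists>\<delta>>0. \<exists>N. \<forall>n\<ge>N. Ex (separated_family \<delta> n \<epsilon> U r \<mu> (entropy_wrt T \<mu> P - \<eta>)))"
    using separated_mixture[OF \<eta>] by (elim exE conjE)
  have "\<exists>n \<theta> \<Gamma> h. stage_block \<epsilon> c \<eta> \<zeta> m y n \<theta> \<Gamma> h"
    if \<zeta>: "0 < \<zeta>" and ex: "\<exists>\<mu>\<in>invariant_measures T. \<exists>P. finite_partition P \<and> \<Xi> \<mu> = y \<and> c < entropy_wrt T \<mu> P + (\<integral>x. \<phi> x \<partial>\<mu>)"
    for c \<zeta> m y
  proof -
    obtain \<mu> P where \<mu>: "\<mu> \<in> invariant_measures T" and P: "finite_partition P" and y: "\<Xi> \<mu> = y"
      and c: "c < entropy_wrt T \<mu> P + (\<integral>x. \<phi> x \<partial>\<mu>)" using ex by blast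
    have \<mu>p: "\<mu> \<in> prob_measures" using \<mu> by (simp add: invariant_measures_def)
    define h where "h = entropy_wrt T \<mu> P"
    \<comment> \<open>Nearness of the observable to \<open>y\<close> is a weak* open condition; the
      finitely many test functions describing it join \<phi> in what is asked of the separated
      family.\<close>
    define V where "V = {\<nu> \<in> prob_measures. \<Xi> \<nu> \<in> ball y (\<zeta> / 3)}"
    have Vo: "openin weak_star_topology V"
      unfolding V_def using openin_continuous_map_preimage[OF \<Xi>_cont, of "ball y (\<zeta> / 3)"]
      by (simp add: topspace_weak_star_topology)
    have Vm: "\<mu> \<in> V" using \<mu>p y \<zeta> by (simp add: V_def)
    obtain U r where U: "finite U" "\<forall>u\<in>U. continuous_on UNIV (u :: 'a \<Rightarrow> real)" "r > 0"
      "{\<nu> \<in> prob_measures. \<forall>u\<in>U. \<bar>(\<integral>x. u x \<partial>\<nu>) - (\<integral>x. u x \<partial>\<mu>)\<bar> < r} \<subseteq> V"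
      using weak_star_open_basic[OF Vo Vm] by (elim exE conjE)
    obtain \<delta> N where \<delta>: "\<delta> > 0" and N: "\<forall>n\<ge>N. Ex (separated_family \<delta> n \<epsilon> (insert \<phi> U) (min r (\<eta> / 4)) \<mu> (h - \<eta>))"
      using mix[rule_format, OF \<mu> P, of "insert \<phi> U" "min r (\<eta> / 4)"] U \<phi>_cont \<eta> by (auto simp: h_def)
    obtain B where B: "B > 0" "\<And>x. \<bar>\<phi> x\<bar> \<le> B" using continuous_bounded[OF \<phi>_cont] by blast
    obtain D where D: "D > 0" "\<And>w w'. dist (e w) (e w') \<le> D" using e_bounded[of "{}"] by auto
    obtain \<theta>1 where \<theta>1: "\<theta>1 > 0" "\<And>x y. d x y \<le> \<theta>1 \<Longrightarrow> dist (\<phi> x) (\<phi> y) < \<eta> / 4"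
      using uniformly_continuous_d[OF \<phi>_cont, of "\<eta> / 4"] \<eta> by auto
    obtain \<theta>2 where \<theta>2: "\<theta>2 > 0" "\<And>x y. d x y \<le> \<theta>2 \<Longrightarrow> dist (e x) (e y) < \<zeta> / 3"
      using uniformly_continuous_d[OF e_continuous, of "\<zeta> / 3"] \<zeta> by auto
    define \<theta> where "\<theta> = min (\<epsilon> / 4) (min \<theta>1 \<theta>2)"
    have \<theta>: "\<theta> > 0" "\<theta> \<le> \<epsilon> / 4" "\<theta> \<le> \<theta>1" "\<theta> \<le> \<theta>2" using \<epsilon> \<theta>1 \<theta>2 by (auto simp: \<theta>_def)
    \<comment> \<open>Mistakes may use up half of the separated times, \<open>\<eta> / 4\<close> per
      step of the Birkhoff sums of \<phi> and \<open>\<zeta> / 3\<close> of the distance between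
      averages.\<close>
    define \<beta> where "\<beta> = min (\<delta> / 4) (min (\<eta> / (8 * B)) (\<zeta> / (3 * D)))"
    have \<beta>: "\<beta> > 0" "\<beta> \<le> \<delta> / 4" "\<beta> \<le> \<eta> / (8 * B)" "\<beta> \<le> \<zeta> / (3 * D)" using \<delta> \<eta> \<zeta> B D by (auto simp: \<beta>_def)
    obtain N2 where N2: "\<And>n. n \<ge> N2 \<Longrightarrow> real (g n) \<le> \<beta> * real n"
      using g_sublinear[OF \<beta>(1)] by (auto simp: eventually_sequentially)
    define n where "n = max (max N N2) (max (m \<theta>) 1)"
    have n: "n \<ge> N" "n \<ge> N2" "n \<ge> m \<theta>" "n \<ge> 1" by (auto simp: n_def)
    have gn: "real (g n) \<le> \<beta> * real n" by (rule N2[OF n(2)])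
    have n0: "real n > 0" using n by simp
    obtain \<Gamma> where \<Gamma>: "finite \<Gamma>" "separated_set d T \<delta> n \<epsilon> \<Gamma>" "exp (real n * (h - \<eta>)) \<le> real (card \<Gamma>)"
      "\<And>x u. x \<in> \<Gamma> \<Longrightarrow> u \<in> insert \<phi> U \<Longrightarrow> \<bar>birkhoff_sum T u n x / real n - (\<integral>y. u y \<partial>\<mu>)\<bar> < min r (\<eta> / 4)"
      using N[rule_format, OF n(1)] unfolding separated_family_def by auto
    have gB: "real (g n) * (2 * B) \<le> real n * (\<eta> / 4)"
    proof -
      have "real (g n) * (2 * B) \<le> (\<eta> / (8 * B) * real n) * (2 * B)"
        using gn \<beta>(3) B by (intro mult_right_mono order_trans[OF gn] mult_right_mono) auto
      then show ?thesis using B by (simp add: field_simps)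
    qed
    have gD: "real (g n) * D \<le> real n * (\<zeta> / 3)"
    proof -
      have "real (g n) * D \<le> (\<zeta> / (3 * D) * real n) * D"
        using gn \<beta>(4) D by (intro mult_right_mono order_trans[OF gn] mult_right_mono) auto
      then show ?thesis using D by (simp add: field_simps)
    qed
    have "stage_block \<epsilon> c \<eta> \<zeta> m y n \<theta> \<Gamma> h"
      unfolding stage_block_def
    proof (intro conjI ballI allI impI n(4) \<theta>(1) n(3) \<Gamma>(1) \<Gamma>(3))
      fix x x' z z' assume x: "x \<in> \<Gamma>" "x' \<in> \<Gamma>" "x \<noteq> x'" and z: "z \<in> mistake_ball d T g n x \<theta>" "z' \<in> mistake_ball d T g n x' \<theta>"
      have "separated_points d T \<delta> n \<epsilon> x x'" using \<Gamma>(2) x by (auto simp: separated_set_def)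
      from mistake_ball_separated[OF z this]
      have "\<delta> * real n - 2 * real (g n) \<le> real (card {j. j < n \<and> \<epsilon> - 2 * \<theta> < d ((T ^^ j) z) ((T ^^ j) z')})" .
      moreover have "2 * real (g n) \<le> \<delta> / 2 * real n"
        using gn mult_right_mono[OF \<beta>(2), of "real n"] by simp
      moreover have "\<delta> / 2 * real n > 0" using \<delta> n0 by simp
      ultimately have "real (card {j. j < n \<and> \<epsilon> - 2 * \<theta> < d ((T ^^ j) z) ((T ^^ j) z')}) > 0" by linarith
      then have "card {j. j < n \<and> \<epsilon> - 2 * \<theta> < d ((T ^^ j) z) ((T ^^ j) z')} \<noteq> 0" by (simp only: of_nat_0_less_iff)
      then have "{j. j < n \<and> \<epsilon> - 2 * \<theta> < d ((T ^^ j) z) ((T ^^ j) z')} \<noteq> {}" by (metis card.empty)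
      then obtain i where "i < n" "\<epsilon> - 2 * \<theta> < d ((T ^^ i) z) ((T ^^ i) z')" by auto
      then show "\<exists>i<n. \<epsilon> / 2 < d ((T ^^ i) z) ((T ^^ i) z')"
        using \<theta>(2) by (intro exI[of _ i]) auto
    next
      fix x z assume x: "x \<in> \<Gamma>" and z: "z \<in> mistake_ball d T g n x \<theta>"
      have "\<bar>birkhoff_sum T \<phi> n x - birkhoff_sum T \<phi> n z\<bar> \<le> real n * (\<eta> / 4) + real (g n) * (2 * B)"
      proof (rule mistake_ball_birkhoff[OF z])
        fix y y' assume "d y y' \<le> \<theta>"
        then show "\<bar>\<phi> y - \<phi> y'\<bar> \<le> \<eta> / 4" using \<theta>1(2)[of y y'] \<theta>(3) by (simp add: dist_real_def)
      qed (use \<eta> B in auto)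
      moreover have "real n * ((\<integral>x. \<phi> x \<partial>\<mu>) - \<eta> / 4) \<le> birkhoff_sum T \<phi> n x"
      proof -
        have "\<bar>birkhoff_sum T \<phi> n x / real n - (\<integral>y. \<phi> y \<partial>\<mu>)\<bar> < \<eta> / 4" using \<Gamma>(4)[OF x, of \<phi>] by simp
        then have "(\<integral>x. \<phi> x \<partial>\<mu>) - \<eta> / 4 \<le> birkhoff_sum T \<phi> n x / real n" by linarith
        then show ?thesis using n0 by (simp add: field_simps)
      qed
      moreover have "real n * (c - h - 3 / 4 * \<eta>) \<le> real n * ((\<integral>x. \<phi> x \<partial>\<mu>) - 3 / 4 * \<eta>)"
        using c by (intro mult_left_mono) (auto simp: h_def)
      moreover have "real n * ((\<integral>x. \<phi> x \<partial>\<mu>) - 3 / 4 * \<eta>) = real n * ((\<integral>x. \<phi> x \<partial>\<mu>) - \<eta> / 4) - real n * (\<eta> / 4) - real n * (\<eta> / 4)"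
        by (simp add: field_simps)
      ultimately show "real n * (c - h - 3 / 4 * \<eta>) \<le> birkhoff_sum T \<phi> n z" using gB by linarith
    next
      fix x z assume x: "x \<in> \<Gamma>" and z: "z \<in> mistake_ball d T g n x \<theta>"
      obtain n' where n': "n = Suc n'" using n by (cases n) auto
      have "empirical T n x \<in> V"
      proof (rule U(4)[THEN subsetD], intro CollectI conjI ballI)
        show "empirical T n x \<in> prob_measures" by (rule empirical_prob[OF n(4)])
        fix u assume u: "u \<in> U"
        have "\<bar>birkhoff_sum T u n x / real n - (\<integral>y. u y \<partial>\<mu>)\<bar> < r" using \<Gamma>(4)[OF x, of u] u by simp
        then show "\<bar>(\<integral>y. u y \<partial>empirical T n x) - (\<integral>y. u y \<partial>\<mu>)\<bar> < r"
          using birkhoff_empirical[OF n(4), of u x] borel_measurable_continuous_onI[of u] U(2) u by simp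
      qed
      then have "dist (avg n x) y < \<zeta> / 3" using \<Xi>_empirical[of n' x] by (simp add: V_def n' dist_commute)
      moreover have "dist (avg n x) (avg n z) \<le> \<zeta> * (2 / 3)"
      proof -
        have "(\<Sum>i<n. dist (e ((T ^^ i) x)) (e ((T ^^ i) z))) \<le> real n * (\<zeta> / 3) + real (g n) * D"
        proof (rule mistake_ball_sum[OF z])
          fix y y' assume "d y y' \<le> \<theta>"
          then show "dist (e y) (e y') \<le> \<zeta> / 3" using \<theta>2(2)[of y y'] \<theta>(4) by simp
        qed (use \<zeta> D in auto)
        also have "\<dots> \<le> real n * (\<zeta> * (2 / 3))" using gD by (simp add: field_simps)
        finally have "(\<Sum>i<n. dist (e ((T ^^ i) x)) (e ((T ^^ i) z))) / real n \<le> \<zeta> * (2 / 3)"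
          using n0 by (simp add: field_simps)
        then show ?thesis using dist_avg_avg[of n x z] by linarith
      qed
      ultimately show "dist (avg n z) y \<le> \<zeta>" using dist_triangle3[of "avg n z" y "avg n x"] by linarith
    qed
    then show ?thesis by blast
  qed
  then have "0 < \<epsilon> \<and> (\<forall>c \<zeta> m y. 0 < \<zeta> \<longrightarrow>
    (\<exists>\<mu>\<in>invariant_measures T. \<exists>P. finite_partition P \<and> \<Xi> \<mu> = y \<and> c < entropy_wrt T \<mu> P + (\<integral>x. \<phi> x \<partial>\<mu>)) \<longrightarrow>
    (\<exists>n \<theta> \<Gamma> h. stage_block \<epsilon> c \<eta> \<zeta> m y n \<theta> \<Gamma> h))" using \<epsilon> by blast
  then show ?thesis by (rule exI)
qed

text \<open>Blocks before stage \<open>k\<close> and the unfinished block together have weight at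
  most \<open>2 / Suc k\<close> and error at most \<open>D\<close>. All other blocks have averages
  close to \<open>y k\<close> or \<open>y (Suc k)\<close>, whose distance enters the bound.\<close>

lemma concatenation_average:
  assumes n: "\<And>k. 1 \<le> n k"
    and D: "0 \<le> D" "\<And>w k. dist (e w) (y k) \<le> D"
    and blk: "\<And>j. dist (avg (lengths n j) ((T ^^ sum (lengths n) {..<j}) z)) (y (stage n j)) \<le> 1 / real (Suc (stage n j))"
    and k: "stage_at n i = Suc k" and i: "i \<ge> 1"
  shows "dist (avg i z) (y (Suc k)) \<le> (2 * D + 1) / real (Suc k) + dist (y k) (y (Suc k)) + 1 / real (Suc (Suc k))"
proof -
  let ?J = "block_index (lengths n) i"
  let ?M = "sum (lengths n) {..<?J}"
  let ?a = "1 / real (Suc k) + dist (y k) (y (Suc k)) + 1 / real (Suc (Suc k))"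
  note rem = remainder_le[of n, OF n k]
  have stJ: "stage n ?J = Suc k" using k by (simp add: stage_at_def)
  have bl: "real (lengths n j) * dist (avg (lengths n j) ((T ^^ sum (lengths n) {..<j}) z)) (y (Suc k))
    \<le> real (lengths n j) * ?a + (if j < sum (repetitions n) {..<k} then real (lengths n j) * D else 0)" if j: "j < ?J" for j
  proof -
    let ?b = "avg (lengths n j) ((T ^^ sum (lengths n) {..<j}) z)"
    have le: "stage n j \<le> Suc k"
    proof -
      have "j < sum (repetitions n) {..<Suc (Suc k)}" using j stage_bounds(2)[of n ?J, OF n] stJ by simp
      then show ?thesis unfolding stage_def by (intro block_index_le[of "repetitions n", OF repetitions_pos])
    qed
    \<comment> \<open>With no blocks at all the block estimate charges every step the crude bound
      \<open>D\<close>.\<close>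
    have dD: "dist ?b (y (Suc k)) \<le> D"
      using dist_avg_blocks[of "lengths n j" "\<lambda>_. 0" 0 "y (Suc k)" D "(T ^^ sum (lengths n) {..<j}) z"] D lengths_pos[of n j, OF n] by simp
    show ?thesis
    proof (cases "stage n j < k")
      case True
      then have "sum (repetitions n) {..<Suc (stage n j)} \<le> sum (repetitions n) {..<k}" by (intro sum_mono2) auto
      then have "j < sum (repetitions n) {..<k}" using stage_bounds(2)[of n j, OF n] by linarith
      moreover have "real (lengths n j) * dist ?b (y (Suc k)) \<le> real (lengths n j) * D" using dD by (intro mult_left_mono) auto
      moreover have "0 \<le> real (lengths n j) * ?a" by simp
      ultimately show ?thesis by (simp only: if_True)
    next
      case False
      then consider "stage n j = k" | "stage n j = Suc k" using le by linarith
      then have "dist ?b (y (Suc k)) \<le> ?a"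
      proof cases
        case 1
        then have "dist ?b (y k) \<le> 1 / real (Suc k)" using blk[of j] by simp
        moreover have "0 \<le> 1 / real (Suc (Suc k))" by simp
        ultimately show ?thesis using dist_triangle[of ?b "y (Suc k)" "y k"] by linarith
      next
        case 2
        then have "dist ?b (y (Suc k)) \<le> 1 / real (Suc (Suc k))" using blk[of j] by simp
        moreover have "0 \<le> 1 / real (Suc k) + dist (y k) (y (Suc k))" by simp
        ultimately show ?thesis by linarith
      qed
      then have "real (lengths n j) * dist ?b (y (Suc k)) \<le> real (lengths n j) * ?a" by (intro mult_left_mono) auto
      moreover have "0 \<le> (if j < sum (repetitions n) {..<k} then real (lengths n j) * D else 0)" using D by simp
      ultimately show ?thesis by linarith
    qed
  qed
  have "real i * dist (avg i z) (y (Suc k)) \<le> (\<Sum>j<?J. real (lengths n j) * dist (avg (lengths n j) ((T ^^ sum (lengths n) {..<j}) z)) (y (Suc k)))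
      + (real i - real ?M) * D"
    by (rule dist_avg_blocks[OF i rem(1)]) (rule D)
  also have "(\<Sum>j<?J. real (lengths n j) * dist (avg (lengths n j) ((T ^^ sum (lengths n) {..<j}) z)) (y (Suc k)))
      \<le> (\<Sum>j<?J. real (lengths n j) * ?a + (if j < sum (repetitions n) {..<k} then real (lengths n j) * D else 0))"
    by (rule sum_mono) (use bl in auto)
  also have "\<dots> = real ?M * ?a + (\<Sum>j<?J. if j < sum (repetitions n) {..<k} then real (lengths n j) * D else 0)"
    by (simp add: sum.distrib sum_distrib_right)
  also have "(\<Sum>j<?J. if j < sum (repetitions n) {..<k} then real (lengths n j) * D else 0)
      \<le> (\<Sum>j<sum (repetitions n) {..<k}. real (lengths n j) * D)"
    unfolding sum.inter_filter[OF finite_lessThan, symmetric] by (rule sum_mono2) (use D in auto)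
  also have "\<dots> = real (stage_time n k) * D"
    using stage_time_eq[of n k, OF n] by (simp add: sum_distrib_right[symmetric] of_nat_sum[symmetric] del: of_nat_sum)
  finally have "real i * dist (avg i z) (y (Suc k)) \<le> real ?M * ?a + real (stage_time n k) * D + (real i - real ?M) * D" by simp
  moreover have "real ?M * ?a \<le> real i * ?a"
  proof (rule mult_right_mono)
    show "real ?M \<le> real i" using rem(1) by (simp only: of_nat_le_iff)
  qed simp
  moreover have "real (stage_time n k) * D \<le> real i * (D / real (Suc k))"
  proof -
    have "real (Suc k) * real (stage_time n k) \<le> real i" using rem(3) by (simp only: of_nat_mult[symmetric] of_nat_le_iff)
    then have "real (Suc k) * real (stage_time n k) * D \<le> real i * D" using D by (intro mult_right_mono) auto
    then show ?thesis by (simp add: field_simps)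
  qed
  moreover have "(real i - real ?M) * D \<le> real i * (D / real (Suc k))"
  proof -
    have "real (Suc k) * (real i - real ?M) \<le> real i" using rem(1,2) by (simp only: of_nat_mult[symmetric] of_nat_le_iff of_nat_diff[symmetric])
    then have "real (Suc k) * (real i - real ?M) * D \<le> real i * D" using D by (intro mult_right_mono) auto
    then show ?thesis by (simp add: field_simps)
  qed
  ultimately have "real i * dist (avg i z) (y (Suc k)) \<le> real i * ?a + real i * (D / real (Suc k)) + real i * (D / real (Suc k))" by linarith
  also have "\<dots> = real i * ((2 * D + 1) / real (Suc k) + dist (y k) (y (Suc k)) + 1 / real (Suc (Suc k)))"
    by (simp add: distrib_left add_divide_distrib)
  finally show ?thesis using i by (simp add: mult_le_cancel_left_pos)
qed

text \<open>The average at time \<open>i\<close> follows \<open>y (stage_at n i)\<close> with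
  vanishing error, and every stage is reached; so the averages accumulate where \<open>y\<close>
  does.\<close>

lemma concatenation_accumulation:
  assumes n: "\<And>k. 1 \<le> n k" and Q: "compact Q" "\<And>k. y k \<in> Q"
    and slow: "(\<lambda>k. dist (y k) (y (Suc k))) \<longlonglongrightarrow> 0"
    and dense: "\<And>q e N. q \<in> Q \<Longrightarrow> e > 0 \<Longrightarrow> \<exists>k\<ge>N. dist (y k) q < e"
    and blk: "\<And>j. dist (avg (lengths n j) ((T ^^ sum (lengths n) {..<j}) z)) (y (stage n j)) \<le> 1 / real (Suc (stage n j))"
  shows "accumulation_points (\<lambda>i. avg (Suc i) z) = Q"
proof -
  obtain D where D: "D > 0" "\<And>w q. q \<in> Q \<Longrightarrow> dist (e w) q \<le> D" using e_bounded[OF compact_imp_bounded[OF Q(1)]] by blast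
  define err where "err k = (2 * D + 1) / real (Suc k) + dist (y k) (y (Suc k)) + 1 / real (Suc (Suc k))" for k
  have "(\<lambda>k. (2 * D + 1) / real (Suc k)) \<longlonglongrightarrow> 0" "(\<lambda>k. 1 / real (Suc (Suc k))) \<longlonglongrightarrow> 0" by real_asymp+
  then have err0: "err \<longlonglongrightarrow> 0" unfolding err_def using tendsto_add[OF tendsto_add[OF _ slow]] by fastforce
  have close: "dist (avg i z) (y (Suc k)) \<le> err k" if "stage_at n i = Suc k" "i \<ge> 1" for i k
    unfolding err_def by (rule concatenation_average[of n D y z i k]) (use n D Q blk that in auto)
  have ev: "\<exists>I. \<forall>i\<ge>I. dist (avg i z) (y (stage_at n i)) < r" if r: "r > 0" for r
  proof -
    obtain K where K: "\<And>k. k \<ge> K \<Longrightarrow> err k < r" using order_tendstoD(2)[OF err0 r] by (auto simp: eventually_sequentially)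
    have "\<forall>\<^sub>F i in sequentially. Suc K \<le> stage_at n i" using stage_at_at_top[of n, OF n] unfolding filterlim_at_top by blast
    then have "\<forall>\<^sub>F i in sequentially. dist (avg i z) (y (stage_at n i)) < r"
      using eventually_ge_at_top[of 1]
    proof eventually_elim
      case (elim i)
      then obtain k where k: "stage_at n i = Suc k" "k \<ge> K" by (cases "stage_at n i") auto
      then show ?case using close[OF k(1) elim(2)] K[OF k(2)] by simp
    qed
    then show ?thesis by (simp add: eventually_sequentially)
  qed
  show ?thesis
  proof
    show "accumulation_points (\<lambda>i. avg (Suc i) z) \<subseteq> Q"
    proof
      fix l assume l: "l \<in> accumulation_points (\<lambda>i. avg (Suc i) z)"
      have "l \<in> closure Q"
        unfolding closure_approachable
      proof (intro allI impI)
        fix r :: real assume r: "r > 0"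
        obtain I where I: "\<And>i. i \<ge> I \<Longrightarrow> dist (avg i z) (y (stage_at n i)) < r / 2" using ev[of "r / 2"] r by auto
        obtain i where i: "i \<ge> I" "dist (avg (Suc i) z) l < r / 2"
          using l r unfolding accumulation_points_iff by (meson half_gt_zero)
        have "dist (avg (Suc i) z) (y (stage_at n (Suc i))) < r / 2" by (rule I) (use i in simp)
        then have "dist (y (stage_at n (Suc i))) l < r"
          using i(2) dist_triangle3[of "y (stage_at n (Suc i))" l "avg (Suc i) z"] by linarith
        then show "\<exists>q\<in>Q. dist q l < r" using Q(2) by blast
      qed
      then show "l \<in> Q" using compact_imp_closed[OF Q(1)] by simp
    qed
    show "Q \<subseteq> accumulation_points (\<lambda>i. avg (Suc i) z)"
    proof
      fix q assume q: "q \<in> Q"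
      show "q \<in> accumulation_points (\<lambda>i. avg (Suc i) z)"
        unfolding accumulation_points_iff
      proof (intro allI impI)
        fix r :: real and N assume r: "r > 0"
        obtain I where I: "\<And>i. i \<ge> I \<Longrightarrow> dist (avg i z) (y (stage_at n i)) < r / 2" using ev[of "r / 2"] r by auto
        obtain k where k: "k \<ge> Suc (max I N)" "dist (y k) q < r / 2" using dense[OF q, of "r / 2"] r by auto
        \<comment> \<open>The first moment of stage \<open>k\<close>, at which the average is
          compared with \<open>y k\<close> itself.\<close>
        define i where "i = stage_time n k"
        have ik: "i \<ge> k" unfolding i_def by (rule stage_time_ge[of n, OF n])
        then obtain i' where i': "i = Suc i'" using k by (cases i) auto
        have "stage_at n i = k" unfolding i_def by (rule stage_at_start[of n, OF n])
        then have "dist (avg i z) (y k) < r / 2" using I[of i] ik k by simp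
        then have "dist (avg i z) q < r" using k(2) dist_triangle[of "avg i z" q "y k"] by linarith
        then show "\<exists>i\<ge>N. dist (avg (Suc i) z) q < r" using i' ik k by (intro exI[of _ i']) auto
      qed
    qed
  qed
qed

text \<open>Mass distribution principle: under the product of the uniform measures on the \<open>\<Gamma> k\<close>, the
  choices \<open>\<omega>\<close> whose orbit enters a given Bowen ball agree on all blocks completed before its
  length, so they form a set of mass at most the weight of the ball.\<close>

lemma cover_mass_bound:
  fixes z :: "(nat \<Rightarrow> 'a) \<Rightarrow> 'a" and n :: "nat \<Rightarrow> nat" and \<Gamma> :: "nat \<Rightarrow> 'a set"
  assumes \<eta>: "\<eta> > 0" and n: "\<And>k. 1 \<le> n k" and \<Gamma>: "\<And>k. finite (\<Gamma> k)"
    and card: "\<And>k. exp (real (n k) * (h k - \<eta>)) \<le> real (card (\<Gamma> k))"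
    and sep: "\<And>\<omega> \<omega>' j. (\<And>i. \<omega> i \<in> \<Gamma> (stage n i)) \<Longrightarrow> (\<And>i. \<omega>' i \<in> \<Gamma> (stage n i)) \<Longrightarrow> \<omega> j \<noteq> \<omega>' j \<Longrightarrow>
      \<exists>i<lengths n j. \<epsilon> / 2 < d ((T ^^ i) ((T ^^ sum (lengths n) {..<j}) (z \<omega>))) ((T ^^ i) ((T ^^ sum (lengths n) {..<j}) (z \<omega>')))"
    and bs: "\<And>\<omega> j. (\<And>i. \<omega> i \<in> \<Gamma> (stage n i)) \<Longrightarrow>
      real (lengths n j) * (c - h (stage n j) - 3 / 4 * \<eta>) \<le> birkhoff_sum T \<phi> (lengths n j) ((T ^^ sum (lengths n) {..<j}) (z \<omega>))"
    and Z: "\<And>\<omega>. (\<And>i. \<omega> i \<in> \<Gamma> (stage n i)) \<Longrightarrow> z \<omega> \<in> Z"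
    and r: "0 < r" "4 * r < \<epsilon>"
  shows "ereal (c - 2 * \<eta>) \<le> pressure_at d T Z \<phi> r"
proof -
  let ?L = "lengths n" and ?b = "block_index (lengths n)"
  let ?M = "\<lambda>j. sum (lengths n) {..<j}"
  obtain B where B: "B > 0" "\<And>x. \<bar>\<phi> x\<bar> \<le> B" using continuous_bounded[OF \<phi>_cont] by blast
  have cpos: "card (\<Gamma> k) > 0" for k
  proof -
    have "real (card (\<Gamma> k)) > 0" using less_le_trans[OF exp_gt_zero card] .
    then show ?thesis by simp
  qed
  then have ne: "\<Gamma> k \<noteq> {}" for k by (metis card.empty less_irrefl)
  \<comment> \<open>\<open>A\<close> bounds the cost per step of the unfinished last block.
    \<open>K\<close> makes the share of that block so small that it costs at most
    \<open>\<eta> / 4\<close> per unit of total time; with the \<open>7 / 4 * \<eta>\<close> of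
    completed blocks this gives \<open>2 * \<eta>\<close>.\<close>
  define A where "A = \<bar>c - 7 / 4 * \<eta>\<bar> + B"
  have A: "A \<ge> 0" using B by (simp add: A_def)
  obtain K :: nat where K: "real K > 4 * A / \<eta>" using reals_Archimedean2 by blast
  have "\<forall>\<^sub>F i in sequentially. Suc K \<le> stage_at n i" using stage_at_at_top[of n, OF n] unfolding filterlim_at_top by blast
  then obtain m0 where m0: "\<And>i. i \<ge> m0 \<Longrightarrow> Suc K \<le> stage_at n i" by (auto simp: eventually_sequentially)
  let ?U = "\<lambda>j. uniform_count_measure (\<Gamma> (stage n j))"
  have pU: "prob_space (?U j)" for j by (rule prob_space_uniform_count_measure[OF \<Gamma> ne])
  interpret product_prob_space ?U UNIV by (rule product_prob_spaceI) (rule pU)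
  let ?\<Omega> = "Pi\<^sub>M UNIV ?U"
  have sp: "space ?\<Omega> = PiE UNIV (\<lambda>j. \<Gamma> (stage n j))"
    by (simp add: space_PiM space_uniform_count_measure)
  define cyl where "cyl \<omega> J = prod_emb UNIV ?U {..<J} (PiE {..<J} (\<lambda>j. {\<omega> j}))" for \<omega> :: "nat \<Rightarrow> 'a" and J
  have cyl_sets: "cyl \<omega> J \<in> sets ?\<Omega>" and cyl_measure: "emeasure ?\<Omega> (cyl \<omega> J) = ennreal (\<Prod>j<J. 1 / real (card (\<Gamma> (stage n j))))"
    if \<omega>: "\<omega> \<in> space ?\<Omega>" for \<omega> J
  proof -
    have s: "{\<omega> j} \<in> sets (?U j)" for j using \<omega> sp by (auto simp: sets_uniform_count_measure)
    show "cyl \<omega> J \<in> sets ?\<Omega>" unfolding cyl_def by (rule sets_PiM_I) (use s in auto)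
    have "emeasure ?\<Omega> (cyl \<omega> J) = (\<Prod>j<J. emeasure (?U j) {\<omega> j})"
      unfolding cyl_def by (rule emeasure_PiM_emb) (use s in auto)
    also have "\<dots> = (\<Prod>j<J. ennreal (1 / real (card (\<Gamma> (stage n j)))))"
    proof (rule prod.cong[OF refl])
      fix j
      have "emeasure (?U j) {\<omega> j} = ennreal (card {\<omega> j} / card (\<Gamma> (stage n j)))"
        by (rule emeasure_uniform_count_measure[OF \<Gamma>]) (use \<omega> sp in auto)
      then show "emeasure (?U j) {\<omega> j} = ennreal (1 / real (card (\<Gamma> (stage n j))))" by simp
    qed
    finally show "emeasure ?\<Omega> (cyl \<omega> J) = ennreal (\<Prod>j<J. 1 / real (card (\<Gamma> (stage n j))))"
      by (simp add: prod_ennreal)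
  qed
  have in_cyl: "\<omega>' \<in> cyl \<omega> J" if "\<omega>' \<in> space ?\<Omega>" "\<And>j. j < J \<Longrightarrow> \<omega>' j = \<omega> j" for \<omega> \<omega>' J
    using that sp by (auto simp: cyl_def prod_emb_def space_uniform_count_measure restrict_def PiE_iff extensional_def)
  have "pressure_sum d T Z (c - 2 * \<eta>) \<phi> m0 r \<ge> 1"
    unfolding pressure_sum_eq
  proof (rule INF_greatest)
    fix C assume "C \<in> bowen_covers d T Z m0 r"
    then have C: "countable C" "\<And>m x. (m, x) \<in> C \<Longrightarrow> m0 \<le> m" "Z \<subseteq> (\<Union>(m, x)\<in>C. bowen_ball d T m x r)"
      by (auto simp: bowen_covers_def)
    \<comment> \<open>The choices whose point lies in the ball need not form a measurable set; they
      are enclosed in the cylinder \<open>Y c\<close> around one of them.\<close>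
    define S where "S c = {\<omega> \<in> space ?\<Omega>. z \<omega> \<in> bowen_ball d T (fst c) (snd c) r}" for c :: "nat \<times> 'a"
    define Y where "Y c = (if S c = {} then {} else cyl (SOME \<omega>. \<omega> \<in> S c) (?b (fst c)))" for c
    have pick: "(SOME \<omega>. \<omega> \<in> S c) \<in> S c" if "S c \<noteq> {}" for c using that some_in_eq by blast
    have Ys: "Y c \<in> sets ?\<Omega>" for c
      using cyl_sets pick[of c] by (auto simp: Y_def S_def)
    have SY: "S c \<subseteq> Y c" for c
    proof
      fix \<omega> assume \<omega>: "\<omega> \<in> S c"
      obtain m x where c: "c = (m, x)" by (cases c)
      define \<omega>0 where "\<omega>0 = (SOME \<omega>. \<omega> \<in> S c)"
      have \<omega>0: "\<omega>0 \<in> S c" unfolding \<omega>0_def using pick[of c] \<omega> by blast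
      have "\<omega> \<in> cyl \<omega>0 (?b m)"
      proof (rule in_cyl)
        show "\<omega> \<in> space ?\<Omega>" using \<omega> by (simp add: S_def)
        fix j assume j: "j < ?b m"
        show "\<omega> j = \<omega>0 j"
        proof (rule ccontr)
          assume "\<omega> j \<noteq> \<omega>0 j"
          then obtain i where i: "i < ?L j" "\<epsilon> / 2 < d ((T ^^ i) ((T ^^ ?M j) (z \<omega>))) ((T ^^ i) ((T ^^ ?M j) (z \<omega>0)))"
            using sep[of \<omega> \<omega>0 j] \<omega> \<omega>0 sp by (auto simp: S_def)
          have "?M (Suc j) \<le> ?M (?b m)" by (rule sum_mono2) (use j in auto)
          also have "\<dots> \<le> m" by (rule block_index_lower[of "lengths n"]) (rule lengths_pos[of n, OF n])
          finally have im: "i + ?M j < m" using i(1) by simp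
          have eq: "(T ^^ i) ((T ^^ ?M j) w) = (T ^^ (i + ?M j)) w" for w by (simp add: funpow_add)
          have "d ((T ^^ (i + ?M j)) x) ((T ^^ (i + ?M j)) (z \<omega>)) \<le> r" "d ((T ^^ (i + ?M j)) x) ((T ^^ (i + ?M j)) (z \<omega>0)) \<le> r"
            using \<omega> \<omega>0 im by (auto simp: S_def c bowen_ball_def)
          \<comment> \<open>Two points of one ball stay within \<open>2 * r\<close>, which is below
            the separation \<open>\<epsilon> / 2\<close> of different choices.\<close>
          then have "d ((T ^^ (i + ?M j)) (z \<omega>)) ((T ^^ (i + ?M j)) (z \<omega>0)) \<le> 2 * r"
            using d_triangle[of "(T ^^ (i + ?M j)) (z \<omega>)" "(T ^^ (i + ?M j)) (z \<omega>0)" "(T ^^ (i + ?M j)) x"]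
              d_sym[of "(T ^^ (i + ?M j)) (z \<omega>)" "(T ^^ (i + ?M j)) x"] by linarith
          then show False using i(2) r(2) unfolding eq by linarith
        qed
      qed
      then show "\<omega> \<in> Y c" using \<omega> by (auto simp: Y_def \<omega>0_def c)
    qed
    have le: "emeasure ?\<Omega> (Y p) \<le> cover_weight d T \<phi> (c - 2 * \<eta>) r p" if pC: "p \<in> C" for p
    proof (cases "S p = {}")
      case True
      then show ?thesis by (simp add: Y_def)
    next
      case False
      obtain m x where p: "p = (m, x)" by (cases p)
      define \<omega>0 where "\<omega>0 = (SOME \<omega>. \<omega> \<in> S p)"
      have \<omega>0: "\<omega>0 \<in> S p" unfolding \<omega>0_def using pick[OF False] .
      let ?J = "?b m"
      have m: "m0 \<le> m" using C(2) pC p by blast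
      have kJ: "Suc K \<le> stage_at n m" by (rule m0[OF m])
      then obtain k where k: "stage_at n m = Suc k" "K \<le> k" by (cases "stage_at n m") auto
      have rem: "?M ?J \<le> m" "Suc k * (m - ?M ?J) \<le> m"
        using remainder_le[of n m k, OF n k(1)] by auto
      let ?R = "real m - real (?M ?J)"
      have R: "?R \<ge> 0" "real (Suc k) * ?R \<le> real m"
      proof -
        have "real (Suc k * (m - ?M ?J)) \<le> real m" using rem(2) of_nat_mono by blast
        then show "real (Suc k) * ?R \<le> real m" using rem(1) by (simp only: of_nat_mult of_nat_diff)
      qed (use rem(1) in \<open>simp del: of_nat_sum\<close>)
      have RA: "?R * A \<le> real m * \<eta> / 4"
      proof -
        have "4 * A / \<eta> \<le> real (Suc k)" using K k(2) by linarith
        then have "4 * A \<le> real (Suc k) * \<eta>" using \<eta> by (simp add: pos_divide_le_eq)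
        then have "?R * (4 * A) \<le> ?R * (real (Suc k) * \<eta>)" using R(1) by (rule mult_left_mono)
        also have "\<dots> = (real (Suc k) * ?R) * \<eta>" by simp
        also have "\<dots> \<le> real m * \<eta>" using R(2) \<eta> by (intro mult_right_mono) auto
        finally show ?thesis by simp
      qed
      let ?s = "\<Sum>j<?J. real (?L j) * (h (stage n j) - \<eta>)"
      have \<omega>0_mem: "\<And>i. \<omega>0 i \<in> \<Gamma> (stage n i)" and \<omega>0_ball: "z \<omega>0 \<in> bowen_ball d T m x r"
        using \<omega>0 sp by (auto simp: S_def p)
      have "(\<Prod>j<?J. 1 / real (card (\<Gamma> (stage n j)))) \<le> (\<Prod>j<?J. exp (- (real (?L j) * (h (stage n j) - \<eta>))))"
      proof (rule prod_mono)
        fix j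
        have "1 / real (card (\<Gamma> (stage n j))) \<le> 1 / exp (real (?L j) * (h (stage n j) - \<eta>))"
          using card[of "stage n j"] cpos[of "stage n j"] by (intro divide_left_mono) (auto simp: lengths_def)
        then show "0 \<le> 1 / real (card (\<Gamma> (stage n j))) \<and> 1 / real (card (\<Gamma> (stage n j))) \<le> exp (- (real (?L j) * (h (stage n j) - \<eta>)))"
          by (simp add: exp_minus inverse_eq_divide)
      qed
      also have "\<dots> = exp (- ?s)" by (simp add: exp_sum[symmetric] sum_negf)
      finally have up: "emeasure ?\<Omega> (Y p) \<le> ennreal (exp (- ?s))"
        using cyl_measure[of \<omega>0 ?J] \<omega>0 False by (auto simp: Y_def S_def p \<omega>0_def intro: ennreal_leI)
      have e1: "birkhoff_sum T \<phi> m (z \<omega>0) = birkhoff_sum T \<phi> (?M ?J) (z \<omega>0) + birkhoff_sum T \<phi> (m - ?M ?J) ((T ^^ ?M ?J) (z \<omega>0))"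
        using birkhoff_sum_add[of T \<phi> "?M ?J" "m - ?M ?J" "z \<omega>0"] rem(1) by simp
      have e2: "birkhoff_sum T \<phi> (?M ?J) (z \<omega>0) \<ge> (\<Sum>j<?J. real (?L j) * (c - h (stage n j) - 3 / 4 * \<eta>))"
        unfolding birkhoff_sum_blocks by (rule sum_mono) (rule bs[OF \<omega>0_mem])
      have e3: "(\<Sum>j<?J. real (?L j) * (c - h (stage n j) - 3 / 4 * \<eta>)) = real (?M ?J) * (c - 7 / 4 * \<eta>) - ?s"
      proof -
        have "real (?L j) * (c - h (stage n j) - 3 / 4 * \<eta>) = real (?L j) * (c - 7 / 4 * \<eta>) - real (?L j) * (h (stage n j) - \<eta>)" for j
          by (simp add: algebra_simps)
        then show ?thesis by (simp only: sum_subtractf sum_distrib_right of_nat_sum)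
      qed
      have e4: "\<bar>birkhoff_sum T \<phi> (m - ?M ?J) ((T ^^ ?M ?J) (z \<omega>0))\<bar> \<le> ?R * B"
        using birkhoff_sum_bound[of \<phi> B T "m - ?M ?J" "(T ^^ ?M ?J) (z \<omega>0)", OF B(2)] rem(1) by (simp add: of_nat_diff del: of_nat_sum)
      have e5: "real m * (c - 7 / 4 * \<eta>) - real (?M ?J) * (c - 7 / 4 * \<eta>) \<le> ?R * \<bar>c - 7 / 4 * \<eta>\<bar>"
        using mult_left_mono[OF abs_ge_self R(1), of "c - 7 / 4 * \<eta>"] by (simp only: left_diff_distrib)
      have e6: "?R * A = ?R * \<bar>c - 7 / 4 * \<eta>\<bar> + ?R * B" unfolding A_def by (rule distrib_left)
      have e7: "real m * (c - 7 / 4 * \<eta>) = real m * (c - 2 * \<eta>) + real m * \<eta> / 4" by (simp add: algebra_simps)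
      \<comment> \<open>Linear arithmetic over variables, keeping the large terms opaque; it is
        instantiated with \<open>e1\<close> to \<open>e7\<close> and \<open>RA\<close>. The entropy
        sum occurs on both sides and cancels.\<close>
      have lin: "- s \<le> - t + b" if "b = b1 + b2" "b1 \<ge> S" "S = Y - s" "\<bar>b2\<bar> \<le> V" "X - Y \<le> U" "W = U + V" "X = t + q" "W \<le> q"
        for s t b b1 b2 S X Y U V W q :: real using that by linarith
      have "- ?s \<le> - (real m * (c - 2 * \<eta>)) + birkhoff_sum T \<phi> m (z \<omega>0)"
        by (rule lin[OF e1 e2 e3 e4 e5 e6 e7 RA])
      then have "- ?s \<le> - (c - 2 * \<eta>) * real m + birkhoff_sum T \<phi> m (z \<omega>0)"
        by (simp only: minus_mult_left mult.commute)
      also have "\<dots> \<le> - (c - 2 * \<eta>) * real m + (SUP y \<in> bowen_ball d T m x r. birkhoff_sum T \<phi> m y)"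
        using birkhoff_sum_le_SUP[OF \<phi>_cont \<omega>0_ball] by simp
      finally have "ennreal (exp (- ?s)) \<le> cover_weight d T \<phi> (c - 2 * \<eta>) r p"
        unfolding cover_weight_def p prod.case by (intro ennreal_leI) simp
      with up show ?thesis by (rule order_trans)
    qed
    have "space ?\<Omega> \<subseteq> (\<Union>p\<in>C. Y p)"
    proof
      fix \<omega> assume \<omega>: "\<omega> \<in> space ?\<Omega>"
      have "z \<omega> \<in> Z" by (rule Z) (use \<omega> sp in auto)
      then obtain p where "p \<in> C" "z \<omega> \<in> bowen_ball d T (fst p) (snd p) r" using C(3) by fastforce
      then show "\<omega> \<in> (\<Union>p\<in>C. Y p)" using SY[of p] \<omega> by (auto simp: S_def)
    qed
    then have "emeasure ?\<Omega> (space ?\<Omega>) \<le> emeasure ?\<Omega> (\<Union>p\<in>C. Y p)"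
      by (rule emeasure_mono) (use C(1) Ys in auto)
    then have "1 \<le> emeasure ?\<Omega> (\<Union>p\<in>C. Y p)" by (simp add: P.emeasure_space_1)
    also have "\<dots> \<le> infsum (\<lambda>p. emeasure ?\<Omega> (Y p)) C" by (rule emeasure_UN_le_infsum[OF C(1) Ys])
    also have "\<dots> \<le> infsum (cover_weight d T \<phi> (c - 2 * \<eta>) r) C" by (rule infsum_ennreal_mono) (rule le)
    finally show "1 \<le> infsum (cover_weight d T \<phi> (c - 2 * \<eta>) r) C" .
  qed
  then show ?thesis by (intro pressure_at_ge[of _ _ _ _ _ m0]) (auto intro: less_le_trans[OF zero_less_one])
qed

text \<open>Stage \<open>k\<close> is built for \<open>y k\<close> with accuracy
  \<open>1 / Suc k\<close>, and every sequence of choices receives one tracing point. As the stages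
  share \<epsilon>, all radii below \<open>\<epsilon> / 4\<close> are treated alike.\<close>

lemma moran_lower_bound:
  assumes Q: "compact Q" "connected Q" "Q \<noteq> {}" and \<eta>: "\<eta> > 0"
    and big: "\<And>y. y \<in> Q \<Longrightarrow> \<exists>\<mu>\<in>invariant_measures T. \<exists>P. finite_partition P \<and> \<Xi> \<mu> = y \<and> c < entropy_wrt T \<mu> P + (\<integral>x. \<phi> x \<partial>\<mu>)"
    and Z: "{x. accumulation_points (\<lambda>i. avg (Suc i) x) = Q} \<subseteq> Z"
  shows "\<exists>\<epsilon>0>0. \<forall>r. 0 < r \<longrightarrow> r < \<epsilon>0 \<longrightarrow> ereal (c - 2 * \<eta>) \<le> pressure_at d T Z \<phi> r"
proof -
  obtain \<epsilon> where \<epsilon>: "\<epsilon> > 0" and blocks: "\<forall>c \<zeta> m y. 0 < \<zeta> \<longrightarrow>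
    (\<exists>\<mu>\<in>invariant_measures T. \<exists>P. finite_partition P \<and> \<Xi> \<mu> = y \<and> c < entropy_wrt T \<mu> P + (\<integral>x. \<phi> x \<partial>\<mu>)) \<longrightarrow>
    (\<exists>n \<theta> \<Gamma> h. stage_block \<epsilon> c \<eta> \<zeta> m y n \<theta> \<Gamma> h)"
    using stage_exists[OF \<eta>] by (elim exE conjE)
  obtain y where y: "\<And>k. y k \<in> Q" "(\<lambda>k. dist (y k) (y (Suc k))) \<longlonglongrightarrow> 0"
    "\<And>q e N. q \<in> Q \<Longrightarrow> e > 0 \<Longrightarrow> \<exists>k\<ge>N. dist (y k) q < e"
  proof -
    obtain y where "\<forall>k. y k \<in> Q" "(\<lambda>k. dist (y k) (y (Suc k))) \<longlonglongrightarrow> 0"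
      "\<forall>q\<in>Q. \<forall>e>0. \<forall>N. \<exists>k\<ge>N. dist (y k) q < e"
      using slow_dense_sequence[OF Q] by (elim exE conjE)
    then show ?thesis by (intro that[of y]) auto
  qed
  obtain m :: "real \<Rightarrow> nat" where m: "\<forall>(x :: nat \<Rightarrow> 'a) (\<theta> :: nat \<Rightarrow> real) (n :: nat \<Rightarrow> nat).
    (\<forall>j. 0 < \<theta> j \<and> m (\<theta> j) \<le> n j \<and> 1 \<le> n j) \<longrightarrow>
    (\<exists>z. \<forall>j. (T ^^ sum n {..<j}) z \<in> mistake_ball d T g (n j) (x j) (\<theta> j))"
    using tracing_infinite by (elim exE)
  have "\<exists>n \<theta> \<Gamma> h. stage_block \<epsilon> c \<eta> (1 / real (Suc k)) m (y k) n \<theta> \<Gamma> h" for k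
    by (rule blocks[rule_format]) (use big y(1) in auto)
  then obtain n \<theta> \<Gamma> h where st: "\<And>k. stage_block \<epsilon> c \<eta> (1 / real (Suc k)) m (y k) (n k) (\<theta> k) (\<Gamma> k) (h k)" by metis
  have n: "1 \<le> n k" and \<theta>: "0 < \<theta> k" "m (\<theta> k) \<le> n k" and \<Gamma>: "finite (\<Gamma> k)" "exp (real (n k) * (h k - \<eta>)) \<le> real (card (\<Gamma> k))"
    and sep: "x \<in> \<Gamma> k \<Longrightarrow> x' \<in> \<Gamma> k \<Longrightarrow> x \<noteq> x' \<Longrightarrow> w \<in> mistake_ball d T g (n k) x (\<theta> k) \<Longrightarrow> w' \<in> mistake_ball d T g (n k) x' (\<theta> k) \<Longrightarrow>
       \<exists>i<n k. \<epsilon> / 2 < d ((T ^^ i) w) ((T ^^ i) w')"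
    and avgs: "x \<in> \<Gamma> k \<Longrightarrow> w \<in> mistake_ball d T g (n k) x (\<theta> k) \<Longrightarrow> real (n k) * (c - h k - 3 / 4 * \<eta>) \<le> birkhoff_sum T \<phi> (n k) w"
      "x \<in> \<Gamma> k \<Longrightarrow> w \<in> mistake_ball d T g (n k) x (\<theta> k) \<Longrightarrow> dist (avg (n k) w) (y k) \<le> 1 / real (Suc k)"
    for k x x' w w'
    using st[of k] unfolding stage_block_def by blast+
  have "\<exists>z. \<forall>j. (T ^^ sum (lengths n) {..<j}) z \<in> mistake_ball d T g (lengths n j) (\<omega> j) (\<theta> (stage n j))" for \<omega> :: "nat \<Rightarrow> 'a"
    by (rule m[rule_format]) (use n \<theta> in \<open>auto simp: lengths_def simp del: One_nat_def\<close>)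
  then obtain z :: "(nat \<Rightarrow> 'a) \<Rightarrow> 'a" where z: "\<And>\<omega> j. (T ^^ sum (lengths n) {..<j}) (z \<omega>) \<in> mistake_ball d T g (n (stage n j)) (\<omega> j) (\<theta> (stage n j))"
    unfolding lengths_def by metis
  have "ereal (c - 2 * \<eta>) \<le> pressure_at d T Z \<phi> r" if r: "0 < r" "4 * r < \<epsilon>" for r
  proof (rule cover_mass_bound[OF \<eta> n \<Gamma>(1) \<Gamma>(2) _ _ _ r])
    fix \<omega> \<omega>' :: "nat \<Rightarrow> 'a" and j assume \<omega>: "\<And>i. \<omega> i \<in> \<Gamma> (stage n i)" "\<And>i. \<omega>' i \<in> \<Gamma> (stage n i)" "\<omega> j \<noteq> \<omega>' j"
    show "\<exists>i<lengths n j. \<epsilon> / 2 < d ((T ^^ i) ((T ^^ sum (lengths n) {..<j}) (z \<omega>))) ((T ^^ i) ((T ^^ sum (lengths n) {..<j}) (z \<omega>')))"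
      using sep[of "\<omega> j" "stage n j" "\<omega>' j", OF \<omega> z[where \<omega>=\<omega> and j=j] z[where \<omega>=\<omega>' and j=j]] by (simp only: lengths_def)
  next
    fix \<omega> :: "nat \<Rightarrow> 'a" and j assume \<omega>: "\<And>i. \<omega> i \<in> \<Gamma> (stage n i)"
    show "real (lengths n j) * (c - h (stage n j) - 3 / 4 * \<eta>) \<le> birkhoff_sum T \<phi> (lengths n j) ((T ^^ sum (lengths n) {..<j}) (z \<omega>))"
      using avgs(1)[OF \<omega> z[where \<omega>=\<omega> and j=j]] by (simp only: lengths_def)
  next
    fix \<omega> :: "nat \<Rightarrow> 'a" assume \<omega>: "\<And>i. \<omega> i \<in> \<Gamma> (stage n i)"
    have "accumulation_points (\<lambda>i. avg (Suc i) (z \<omega>)) = Q"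
    proof (rule concatenation_accumulation[OF n Q(1) y])
      fix j show "dist (avg (lengths n j) ((T ^^ sum (lengths n) {..<j}) (z \<omega>))) (y (stage n j)) \<le> 1 / real (Suc (stage n j))"
        using avgs(2)[OF \<omega> z[where \<omega>=\<omega> and j=j]] by (simp only: lengths_def)
    qed
    then show "z \<omega> \<in> Z" using Z by blast
  qed
  then show ?thesis using \<epsilon> by (intro exI[of _ "\<epsilon> / 4"]) auto
qed

end

section \<open>The upper bound\<close>

text \<open>Upper bounds on all coordinates force lower bounds, because both vectors sum to 1.
  Continuity of entropy does the rest, by contradiction along the radii
  \<open>1 / Suc n\<close>.\<close>

lemma shannon_upper_stable:
  assumes A: "finite A" and p: "\<And>a. a \<in> A \<Longrightarrow> 0 \<le> p a" "sum p A = 1" and h: "h > 0"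
  shows "\<exists>r>0. \<forall>q. (\<forall>a\<in>A. 0 \<le> q a \<and> q a < p a + r) \<longrightarrow> sum q A = 1 \<longrightarrow> shannon A q < shannon A p + h"
proof (rule ccontr)
  assume "\<not> ?thesis"
  then have "\<exists>q. (\<forall>a\<in>A. 0 \<le> q a \<and> q a < p a + 1 / real (Suc n)) \<and> sum q A = 1 \<and> \<not> shannon A q < shannon A p + h" for n
    by (metis of_nat_0_less_iff zero_less_Suc zero_less_divide_1_iff)
  then have "\<exists>q. \<forall>n. (\<forall>a\<in>A. 0 \<le> q n a \<and> q n a < p a + 1 / real (Suc n)) \<and> sum (q n) A = 1 \<and> \<not> shannon A (q n) < shannon A p + h"
    by (intro choice) blast
  then obtain q where q: "\<And>n a. a \<in> A \<Longrightarrow> 0 \<le> q n a" "\<And>n a. a \<in> A \<Longrightarrow> q n a < p a + 1 / real (Suc n)"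
    "\<And>n. sum (q n) A = 1" "\<And>n. \<not> shannon A (q n) < shannon A p + h" by blast
  have z: "(\<lambda>n. 1 / real (Suc n)) \<longlonglongrightarrow> 0" using LIMSEQ_inverse_real_of_nat by (simp add: inverse_eq_divide)
  have "(\<lambda>n. shannon A (q n)) \<longlonglongrightarrow> shannon A p"
  proof (rule tendsto_shannon[OF A])
    fix a assume a: "a \<in> A"
    have low: "p a - real (card A) * (1 / real (Suc n)) \<le> q n a" for n
    proof -
      have "sum (q n) (A - {a}) \<le> (\<Sum>b\<in>A - {a}. p b + 1 / real (Suc n))"
        by (rule sum_mono) (use q(2)[of _ n] in \<open>auto intro: less_imp_le\<close>)
      also have "\<dots> = sum p (A - {a}) + real (card (A - {a})) * (1 / real (Suc n))" by (simp add: sum.distrib)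
      also have "\<dots> \<le> sum p (A - {a}) + real (card A) * (1 / real (Suc n))"
        by (intro add_left_mono mult_right_mono) (use A in \<open>auto intro: card_mono\<close>)
      finally show ?thesis using q(3)[of n] p(2) A a by (simp add: sum_diff1)
    qed
    show "(\<lambda>n. q n a) \<longlonglongrightarrow> p a"
    proof (rule tendsto_sandwich)
      show "(\<lambda>n. p a - real (card A) * (1 / real (Suc n))) \<longlonglongrightarrow> p a" by (rule tendsto_eq_intros z refl)+ simp
      show "(\<lambda>n. p a + 1 / real (Suc n)) \<longlonglongrightarrow> p a" by (rule tendsto_eq_intros z refl)+ simp
    qed (use low less_imp_le[OF q(2)[OF a]] in auto)
  qed (use q in auto)
  then have "\<forall>\<^sub>F n in sequentially. shannon A (q n) < shannon A p + h" by (rule order_tendstoD) (use h in simp)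
  then show False using q(4) by (auto simp: eventually_sequentially)
qed

lemma pressure_sum_mono:
  assumes "Z \<subseteq> Z'"
  shows "pressure_sum d T Z t \<phi> n \<epsilon> \<le> pressure_sum d T Z' t \<phi> n \<epsilon>"
  unfolding pressure_sum_eq by (rule INF_superset_mono) (use assms in \<open>auto simp: bowen_covers_def\<close>)

section \<open>Partitions with null boundaries\<close>

context compact_system
begin

text \<open>Spheres around one centre are disjoint, so only countably many radii carry mass;
  formally these are the atoms of the law of \<open>dist x\<close>.\<close>

lemma null_sphere:
  assumes \<mu>: "\<mu> \<in> prob_measures" and b: "b > 0"
  shows "\<exists>r. 0 < r \<and> r < b \<and> measure \<mu> (sphere (x :: 'a) r) = 0"
proof -
  have s: "sets \<mu> = sets borel" and p: "prob_space \<mu>" using \<mu> by (auto simp: prob_measures_def)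
  have sp: "space \<mu> = UNIV" using sets_eq_imp_space_eq[OF s] by simp
  have dm: "dist x \<in> borel_measurable \<mu>"
    using borel_measurable_continuous_onI[OF continuous_on_dist[OF continuous_on_const[of UNIV x] continuous_on_id]] s
    by (simp cong: measurable_cong_sets)
  interpret D: prob_space "distr \<mu> borel (dist x)" using p dm by (rule prob_space.prob_space_distr)
  have "countable {r. measure (distr \<mu> borel (dist x)) {r} \<noteq> 0}" by (rule D.countable_support)
  then have "\<not> {0<..<b} \<subseteq> {r. measure (distr \<mu> borel (dist x)) {r} \<noteq> 0}"
    using uncountable_open_interval[of 0 b] b countable_subset by blast
  then obtain r where r: "0 < r" "r < b" "measure (distr \<mu> borel (dist x)) {r} = 0" by auto
  have "measure (distr \<mu> borel (dist x)) {r} = measure \<mu> (dist x -` {r} \<inter> space \<mu>)" by (rule measure_distr[OF dm]) simp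
  also have "dist x -` {r} \<inter> space \<mu> = sphere x r" by (auto simp: sp sphere_def)
  finally show ?thesis using r by auto
qed

text \<open>Finitely many small balls with null spheres cover the space. Their successive
  differences form the partition, and whatever a closure adds lies in the union \<open>N\<close> of
  the spheres.\<close>

lemma null_boundary_partition:
  assumes \<mu>: "\<mu> \<in> prob_measures" and \<delta>: "\<delta> > 0"
  shows "\<exists>P N. finite_partition P \<and> (\<forall>A\<in>P. \<forall>x\<in>A. \<forall>y\<in>A. dist x y < \<delta>) \<and>
    closed N \<and> measure \<mu> N = 0 \<and> (\<forall>A\<in>P. closure (A :: 'a set) \<subseteq> A \<union> N)"
proof -
  have s: "sets \<mu> = sets borel" and p: "prob_space \<mu>" using \<mu> by (auto simp: prob_measures_def)
  interpret prob_space \<mu> by fact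
  have "\<exists>r. \<forall>x. 0 < r x \<and> r x < \<delta> / 2 \<and> measure \<mu> (sphere (x :: 'a) (r x)) = 0"
    by (intro choice allI null_sphere \<mu>) (use \<delta> in simp)
  then obtain r where r: "\<And>x :: 'a. 0 < r x" "\<And>x. r x < \<delta> / 2" "\<And>x. measure \<mu> (sphere x (r x)) = 0" by blast
  obtain F where F: "finite F" "(UNIV :: 'a set) \<subseteq> (\<Union>x\<in>F. ball x (r x))"
  proof (rule compactE_image[OF compact_UNIV, of UNIV "\<lambda>x. ball x (r x)"])
    show "(UNIV :: 'a set) \<subseteq> (\<Union>x. ball x (r x))" using r(1) by auto
  qed auto
  obtain xs where xs: "set xs = F" using finite_list[OF F(1)] by blast
  define B where "B i = ball (xs ! i) (r (xs ! i))" for i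
  define A where "A i = B i - (\<Union>j<i. B j)" for i
  define N where "N = (\<Union>x\<in>F. sphere x (r x))"
  have cov: "\<exists>i<length xs. y \<in> B i" for y
  proof -
    obtain x where "x \<in> F" "y \<in> ball x (r x)" using F(2) by blast
    then show ?thesis using xs by (auto simp: B_def in_set_conv_nth)
  qed
  have covA: "\<exists>i<length xs. y \<in> A i" for y
  proof -
    define i where "i = (LEAST i. y \<in> B i)"
    obtain j where j: "j < length xs" "y \<in> B j" using cov by blast
    have "y \<in> B i" "i \<le> j" unfolding i_def using j(2) by (auto intro: LeastI Least_le)
    moreover have "y \<notin> B l" if "l < i" for l using not_less_Least[of l "\<lambda>i. y \<in> B i"] that by (simp add: i_def)
    ultimately show ?thesis using j(1) by (intro exI[of _ i]) (auto simp: A_def)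
  qed
  have disjA: "A i \<inter> A j = {}" if "i \<noteq> j" for i j
    using that by (cases "i < j") (auto simp: A_def not_less)
  let ?P = "A ` {..<length xs} - {{}}"
  have part: "finite_partition ?P"
    unfolding finite_partition_def
  proof (intro conjI)
    show "?P \<subseteq> sets borel" by (auto simp: A_def B_def)
    show "partition_on UNIV ?P"
    proof (rule partition_onI)
      show "\<Union>?P = UNIV" using covA by (auto; blast)
      show "disjnt X Y" if XY: "X \<in> ?P" "Y \<in> ?P" "X \<noteq> Y" for X Y
      proof -
        obtain i j where "X = A i" "Y = A j" using XY by auto
        then show ?thesis using \<open>X \<noteq> Y\<close> disjA[of i j] by (auto simp: disjnt_def)
      qed
    qed auto
  qed simp
  have sph: "closed (sphere x t)" for x :: 'a and t
  proof -
    have "sphere x t = cball x t - ball x t" by auto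
    then show ?thesis by (simp add: closed_Diff)
  qed
  have N: "closed N" unfolding N_def by (intro closed_UN F ballI sph)
  have "measure \<mu> N \<le> (\<Sum>x\<in>F. measure \<mu> (sphere x (r x)))"
    unfolding N_def by (rule finite_measure_subadditive_finite) (use F s sph in auto)
  then have N0: "measure \<mu> N = 0" using r(3) by (simp add: measure_le_0_iff)
  have cl: "closure X \<subseteq> X \<union> N" if "X \<in> ?P" for X
  proof
    fix y assume y: "y \<in> closure X"
    obtain i where i: "i < length xs" "X = A i" using \<open>X \<in> ?P\<close> by auto
    have "closure X \<subseteq> cball (xs ! i) (r (xs ! i))"
      by (rule closure_minimal) (auto simp: i A_def B_def)
    moreover have "closure X \<subseteq> - B j" if "j < i" for j
      by (rule closure_minimal) (use that in \<open>auto simp: i A_def B_def\<close>)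
    ultimately have "dist (xs ! i) y \<le> r (xs ! i)" "\<And>j. j < i \<Longrightarrow> y \<notin> B j" using y by auto
    then show "y \<in> X \<union> N" using i xs by (auto simp: A_def B_def N_def)
  qed
  have diam: "dist x y < \<delta>" if "X \<in> ?P" "x \<in> X" "y \<in> X" for X x y
  proof -
    obtain i where "X = A i" using \<open>X \<in> ?P\<close> by auto
    then have "dist (xs ! i) x < r (xs ! i)" "dist (xs ! i) y < r (xs ! i)" using that by (auto simp: A_def B_def)
    then show ?thesis using dist_triangle3[of x y "xs ! i"] r(2)[of "xs ! i"] by linarith
  qed
  show ?thesis
    using part diam N N0 cl by (intro exI[of _ ?P] exI[of _ N] conjI ballI) auto
qed

end

context rho_system
begin

text \<open>Passing to the closure adds at most preimages of \<open>N\<close> under iterates of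
  \<open>T\<close>, which are null by invariance.\<close>

lemma closure_cylinder:
  assumes P: "finite_partition P" and \<mu>: "\<mu> \<in> invariant_measures T" and N: "closed N" "measure \<mu> N = 0"
    and cl: "\<And>A. A \<in> P \<Longrightarrow> closure A \<subseteq> A \<union> N" and w: "w \<in> words P k"
  shows "measure \<mu> (closure {x. partitioned_map.itinerary T P k x = w}) \<le> partitioned_map.word_prob T P \<mu> w"
proof -
  interpret partitioned_map T P by (rule partitioned[OF P])
  have s: "sets \<mu> = sets borel" and p: "prob_space \<mu>" and dT: "distr \<mu> borel T = \<mu>"
    using \<mu> by (auto simp: invariant_measures_def prob_measures_def)
  interpret prob_space \<mu> by fact
  let ?C = "{x. itinerary k x = w}" and ?N = "\<Union>i<k. (T ^^ i) -` N"
  have Ni: "(T ^^ i) -` N \<in> sets borel" for i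
    using measurable_sets[OF funpow_measurable, of N i] N(1) by simp
  have wP: "w ! i \<in> P" if "i < k" for i using w that by (auto simp: words_def)
  have sub: "closure ?C \<subseteq> ?C \<union> ?N"
  proof
    fix y assume y: "y \<in> closure ?C"
    have "(T ^^ i) y \<in> w ! i \<union> N" if i: "i < k" for i
    proof -
      have "(T ^^ i) ` closure ?C \<subseteq> closure ((T ^^ i) ` ?C)"
        by (rule image_closure_subset) (auto intro: continuous_on_subset[OF continuous_funpow] closure_subset[THEN subsetD])
      moreover have "(T ^^ i) ` ?C \<subseteq> w ! i" using itinerary_eq_iff[OF w] i by auto
      ultimately have "(T ^^ i) y \<in> closure (w ! i)" using y closure_mono by blast
      then show ?thesis using cl[OF wP[OF i]] by blast
    qed
    then show "y \<in> ?C \<union> ?N" using itinerary_eq_iff[OF w] by blast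
  qed
  have Ns: "?N \<in> sets borel" using Ni by auto
  have "measure \<mu> ?N \<le> (\<Sum>i<k. measure \<mu> ((T ^^ i) -` N))"
    by (rule finite_measure_subadditive_finite) (use Ni s in auto)
  also have "\<dots> = 0" using funpow_preserves[OF s dT, of N] N by simp
  finally have N0: "measure \<mu> ?N \<le> 0" .
  have "measure \<mu> (closure ?C) \<le> measure \<mu> (?C \<union> ?N)"
    by (rule finite_measure_mono[OF sub]) (use Ns s in auto)
  also have "\<dots> \<le> measure \<mu> ?C + measure \<mu> ?N"
    by (rule measure_Un_le) (use Ns s in auto)
  finally show ?thesis using N0 by (simp add: word_prob_words[OF w])
qed

definition recurrent_to :: "('a \<Rightarrow> real) set \<Rightarrow> real \<Rightarrow> 'a measure \<Rightarrow> 'a set" where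
  "recurrent_to U r \<mu> = {x. \<exists>\<^sub>\<infinity>n. \<forall>u\<in>U. \<bar>birkhoff_sum T u n x / real n - (\<integral>y. u y \<partial>\<mu>)\<bar> < r}"

text \<open>Integrals of continuous functions only control cylinders from above, through their closures;
  with null boundaries these are not larger in measure, and frequencies summing to 1 then turn
  the upper bounds into closeness.\<close>

lemma few_names_near_measure:
  assumes \<mu>: "\<mu> \<in> invariant_measures T" and h: "metric_entropy T \<mu> \<le> ereal h" and \<epsilon>: "\<epsilon> > 0" and \<eta>: "\<eta> > 0"
  shows "\<exists>U r. finite U \<and> (\<forall>u\<in>U. continuous_on UNIV (u :: 'a \<Rightarrow> real)) \<and> r > 0 \<and>
    (\<exists>N. \<forall>n\<ge>N. \<forall>Z\<subseteq>{x. \<forall>u\<in>U. \<bar>birkhoff_sum T u n x / real n - (\<integral>y. u y \<partial>\<mu>)\<bar> < r}.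
       \<exists>E. finite E \<and> real (card E) \<le> exp (real n * (h + 3 * \<eta>)) \<and> E \<subseteq> Z \<and> Z \<subseteq> (\<Union>x\<in>E. bowen_ball d T n x \<epsilon>))"
proof -
  have \<mu>p: "\<mu> \<in> prob_measures" using \<mu> by (simp add: invariant_measures_def)
  have s: "sets \<mu> = sets borel" and p: "prob_space \<mu>" using \<mu>p by (auto simp: prob_measures_def)
  obtain \<delta> where \<delta>: "\<delta> > 0" "\<And>x y. dist x y < \<delta> \<Longrightarrow> d x y < \<epsilon>" using dist_imp_d[OF \<epsilon>] by blast
  obtain P N where P: "finite_partition P" and diam: "\<And>A x y. A \<in> P \<Longrightarrow> x \<in> A \<Longrightarrow> y \<in> A \<Longrightarrow> dist x y < \<delta>"
    and N: "closed N" "measure \<mu> N = 0" and cl: "\<And>A. A \<in> P \<Longrightarrow> closure A \<subseteq> A \<union> N"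
    using null_boundary_partition[OF \<mu>p \<delta>(1)] by (elim exE conjE) blast
  interpret partitioned_map T P by (rule partitioned[OF P])
  have "entropy_wrt T \<mu> P \<le> h" using order_trans[OF entropy_wrt_le_metric_entropy h] by simp
  then have "\<forall>\<^sub>F k in sequentially. word_entropy \<mu> k / real k < h + \<eta>"
    using \<eta> by (intro order_tendstoD(2)[OF word_entropy_tendsto(1)[OF \<mu>]]) simp
  then obtain K where K: "\<And>k. k \<ge> K \<Longrightarrow> word_entropy \<mu> k / real k < h + \<eta>" by (auto simp: eventually_sequentially)
  define k where "k = max K 1"
  have k: "k \<ge> 1" "word_entropy \<mu> k < real k * (h + \<eta>)"
    using K[of k] by (auto simp: k_def field_simps)
  have keta: "real k * \<eta> > 0" using k \<eta> by simp
  obtain r0 where r0: "r0 > 0" and stable: "\<forall>q. (\<forall>w\<in>words P k. 0 \<le> q w \<and> q w < word_prob \<mu> w + r0) \<longrightarrow> sum q (words P k) = 1 \<longrightarrow>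
      shannon (words P k) q < shannon (words P k) (word_prob \<mu>) + real k * \<eta>"
    using shannon_upper_stable[OF finite_wordsP _ sum_word_prob[OF p s, of k] keta] word_prob_01[OF p] by blast
  let ?cyl = "\<lambda>w. {x. itinerary k x = w}"
  have "\<exists>u. continuous_on UNIV u \<and> (\<forall>x. indicat_real (?cyl w) x \<le> u x) \<and> (w \<in> words P k \<longrightarrow> (\<integral>x. u x \<partial>\<mu>) < word_prob \<mu> w + r0 / 2)" for w
  proof -
    obtain u :: "'a \<Rightarrow> real" where u: "continuous_on UNIV u" "\<And>x. indicat_real (closure (?cyl w)) x \<le> u x"
      "\<And>x. u x \<le> 1" "(\<integral>x. u x \<partial>\<mu>) < measure \<mu> (closure (?cyl w)) + r0 / 2"
      by (rule closed_outer_approximation[OF closed_closure[of "?cyl w"] \<mu>p half_gt_zero[OF r0]], rule that)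
    have "indicat_real (?cyl w) x \<le> indicat_real (closure (?cyl w)) x" for x
      using closure_subset[of "?cyl w"] by (auto simp: indicator_def)
    then show ?thesis using u closure_cylinder[OF P \<mu> N cl, of w k] by (intro exI[of _ u]) (auto intro: order_trans)
  qed
  then have "\<exists>u. \<forall>w. continuous_on UNIV (u w) \<and> (\<forall>x. indicat_real (?cyl w) x \<le> u w x) \<and> (w \<in> words P k \<longrightarrow> (\<integral>x. u w x \<partial>\<mu>) < word_prob \<mu> w + r0 / 2)"
    by (intro choice allI)
  then obtain u where u: "\<And>w. continuous_on UNIV (u w)" "\<And>w x. indicat_real (?cyl w) x \<le> u w x"
    "\<And>w. w \<in> words P k \<Longrightarrow> (\<integral>x. u w x \<partial>\<mu>) < word_prob \<mu> w + r0 / 2" by blast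
  let ?U = "u ` words P k"
  let ?V = "\<lambda>n. {x. \<forall>u\<in>?U. \<bar>birkhoff_sum T u n x / real n - (\<integral>y. u y \<partial>\<mu>)\<bar> < r0 / 2}"
  obtain N0 where N0: "N0 \<ge> 1" "\<And>n c. n \<ge> N0 \<Longrightarrow>
      real (card {w \<in> words P (n + k - 1). shannon (words P k) (window_freq k n w) \<le> real k * c}) \<le> exp (real n * (c + \<eta>))"
    using card_low_entropy_words[OF finite_P P_nonempty k(1) \<eta>] by blast
  have key: "\<exists>E. finite E \<and> real (card E) \<le> exp (real n * (h + 3 * \<eta>)) \<and> E \<subseteq> Z \<and> Z \<subseteq> (\<Union>x\<in>E. bowen_ball d T n x \<epsilon>)"
    if n: "n \<ge> N0" and Z: "Z \<subseteq> ?V n" for n Z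
  proof -
    let ?name = "itinerary (n + k - 1)"
    let ?L = "{w \<in> words P (n + k - 1). shannon (words P k) (window_freq k n w) \<le> real k * (h + 2 * \<eta>)}"
    have n1: "n \<ge> 1" using n N0(1) by simp
    have low: "?name x \<in> ?L" if x: "x \<in> ?V n" for x
    proof -
      have "window_freq k n (?name x) w < word_prob \<mu> w + r0" if w: "w \<in> words P k" for w
      proof -
        have "window_freq k n (?name x) w = birkhoff_sum T (indicat_real (?cyl w)) n x / real n" by (rule window_freq_itinerary[OF P k(1)])
        also have "\<dots> \<le> birkhoff_sum T (u w) n x / real n" by (rule birkhoff_sum_mono) (rule u(2))
        also have "\<dots> < (\<integral>y. u w y \<partial>\<mu>) + r0 / 2"
        proof -
          have "\<bar>birkhoff_sum T (u w) n x / real n - (\<integral>y. u w y \<partial>\<mu>)\<bar> < r0 / 2" using x w by blast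
          then show ?thesis by linarith
        qed
        also have "\<dots> < word_prob \<mu> w + r0" using u(3)[OF w] by simp
        finally show ?thesis .
      qed
      moreover have "sum (window_freq k n (?name x)) (words P k) = 1"
        using sum_window_freq[OF finite_P itinerary_words n1, of k x "\<lambda>_. 1"] n1 by simp
      ultimately have "shannon (words P k) (window_freq k n (?name x)) < shannon (words P k) (word_prob \<mu>) + real k * \<eta>"
        using stable by (auto simp: window_freq_def)
      also have "\<dots> \<le> real k * (h + 2 * \<eta>)" using k(2) by (simp add: word_entropy_def algebra_simps)
      finally show ?thesis using itinerary_words by auto
    qed
    have fin: "finite ?L" using finite_wordsP by auto
    \<comment> \<open>Centres are taken in \<open>Z\<close> itself, so that later the Birkhoff sums
      of \<phi> at the centres are controlled by membership in \<open>Z\<close>.\<close>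
    define ch where "ch w = (SOME x. x \<in> Z \<and> ?name x = w)" for w
    have ch: "ch (?name x) \<in> Z \<and> ?name (ch (?name x)) = ?name x" if "x \<in> Z" for x
      unfolding ch_def by (rule someI[of _ x]) (use that in simp)
    let ?E = "ch ` ?name ` Z"
    have sub: "?name ` Z \<subseteq> ?L" using low Z by blast
    show ?thesis
    proof (intro exI[of _ ?E] conjI)
      show "finite ?E" using finite_subset[OF sub fin] by simp
      have "card ?E \<le> card (?name ` Z)" by (rule card_image_le) (rule finite_subset[OF sub fin])
      also have "\<dots> \<le> card ?L" by (rule card_mono[OF fin sub])
      finally have "real (card ?E) \<le> real (card ?L)" by simp
      also have "\<dots> \<le> exp (real n * ((h + 2 * \<eta>) + \<eta>))" by (rule N0(2)[OF n])
      finally show "real (card ?E) \<le> exp (real n * (h + 3 * \<eta>))" by (simp add: algebra_simps)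
      show "?E \<subseteq> Z" using ch by blast
      show "Z \<subseteq> (\<Union>x\<in>?E. bowen_ball d T n x \<epsilon>)"
      proof
        fix x assume x: "x \<in> Z"
        have "x \<in> bowen_ball d T n (ch (?name x)) \<epsilon>"
          unfolding bowen_ball_def
        proof (intro CollectI allI impI)
          fix i assume i: "i < n"
          have "?name (ch (?name x)) ! i = ?name x ! i" using ch[OF x] by simp
          then have "cell ((T ^^ i) (ch (?name x))) = cell ((T ^^ i) x)" using i k(1) by (simp add: itinerary_def)
          then have "(T ^^ i) (ch (?name x)) \<in> cell ((T ^^ i) x)" using cell(2) by metis
          then have "dist ((T ^^ i) (ch (?name x))) ((T ^^ i) x) < \<delta>" using diam cell by blast
          then show "d ((T ^^ i) (ch (?name x))) ((T ^^ i) x) \<le> \<epsilon>" using \<delta>(2) less_imp_le by blast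
        qed
        then show "x \<in> (\<Union>x\<in>?E. bowen_ball d T n x \<epsilon>)" using x by blast
      qed
    qed
  qed
  have "\<exists>N. \<forall>n\<ge>N. \<forall>Z\<subseteq>?V n. \<exists>E. finite E \<and> real (card E) \<le> exp (real n * (h + 3 * \<eta>)) \<and> E \<subseteq> Z \<and> Z \<subseteq> (\<Union>x\<in>E. bowen_ball d T n x \<epsilon>)"
    by (intro exI[of _ N0] allI impI) (rule key)
  moreover have "finite ?U" "\<forall>u\<in>?U. continuous_on UNIV u" "r0 / 2 > 0" using finite_wordsP u(1) r0 by auto
  ultimately show ?thesis by (intro exI[of _ ?U] exI[of _ "r0 / 2"] conjI)
qed

text \<open>At time \<open>n\<close> at most \<open>exp (real n * (h + 3 * \<eta>))\<close> balls
  cover the visitors, each of weight at most \<open>exp (real n * (- h - 4 * \<eta>))\<close>. Using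
  all late times at once gives a geometric tail with ratio \<open>exp (- \<eta>)\<close>, which
  vanishes as the first time is pushed to infinity.\<close>

lemma recurrent_pressure_zero:
  fixes \<phi> :: "'a \<Rightarrow> real"
  assumes \<phi>: "continuous_on UNIV \<phi>" and \<mu>: "\<mu> \<in> invariant_measures T"
    and t: "metric_entropy T \<mu> + ereal (\<integral>x. \<phi> x \<partial>\<mu>) \<le> ereal t" and \<epsilon>: "\<epsilon> > 0" and \<eta>: "\<eta> > 0"
    and \<omega>: "\<And>x y. d x y \<le> \<epsilon> \<Longrightarrow> \<bar>\<phi> x - \<phi> y\<bar> \<le> \<omega>"
  shows "\<exists>U r. finite U \<and> (\<forall>u\<in>U. continuous_on UNIV (u :: 'a \<Rightarrow> real)) \<and> r > 0 \<and>
    (\<forall>n. pressure_sum d T (recurrent_to U r \<mu>) (t + \<omega> + 5 * \<eta>) \<phi> n \<epsilon> = 0)"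
proof -
  define I where "I = (\<integral>x. \<phi> x \<partial>\<mu>)"
  define h where "h = t - I"
  have h: "metric_entropy T \<mu> \<le> ereal h" using t by (cases "metric_entropy T \<mu>") (auto simp: h_def I_def)
  obtain U r N where U: "finite U" "\<forall>u\<in>U. continuous_on UNIV (u :: 'a \<Rightarrow> real)" and r: "r > 0"
    and names: "\<forall>n\<ge>N. \<forall>Z\<subseteq>{x. \<forall>u\<in>U. \<bar>birkhoff_sum T u n x / real n - (\<integral>y. u y \<partial>\<mu>)\<bar> < r}.
       \<exists>E. finite E \<and> real (card E) \<le> exp (real n * (h + 3 * \<eta>)) \<and> E \<subseteq> Z \<and> Z \<subseteq> (\<Union>x\<in>E. bowen_ball d T n x \<epsilon>)"
    using few_names_near_measure[OF \<mu> h \<epsilon> \<eta>] by (elim exE conjE)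
  \<comment> \<open>Adding \<phi> to the test functions fixes the Birkhoff sums at the centres up to
    \<eta> per step.\<close>
  define V where "V n = {x. \<forall>u\<in>insert \<phi> U. \<bar>birkhoff_sum T u n x / real n - (\<integral>y. u y \<partial>\<mu>)\<bar> < min r \<eta>}" for n
  have "\<exists>E. \<forall>n\<ge>N. finite (E n) \<and> real (card (E n)) \<le> exp (real n * (h + 3 * \<eta>)) \<and> E n \<subseteq> V n \<and> V n \<subseteq> (\<Union>x\<in>E n. bowen_ball d T n x \<epsilon>)"
  proof (rule choice, intro allI)
    fix n
    show "\<exists>E. n \<ge> N \<longrightarrow> finite E \<and> real (card E) \<le> exp (real n * (h + 3 * \<eta>)) \<and> E \<subseteq> V n \<and> V n \<subseteq> (\<Union>x\<in>E. bowen_ball d T n x \<epsilon>)"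
    proof (cases "n \<ge> N")
      case True
      have sub: "V n \<subseteq> {x. \<forall>u\<in>U. \<bar>birkhoff_sum T u n x / real n - (\<integral>y. u y \<partial>\<mu>)\<bar> < r}" by (auto simp: V_def)
      show ?thesis using names[rule_format, OF True sub] by simp
    qed simp
  qed
  then obtain E where E: "\<And>n. n \<ge> N \<Longrightarrow> finite (E n)" "\<And>n. n \<ge> N \<Longrightarrow> real (card (E n)) \<le> exp (real n * (h + 3 * \<eta>))"
    "\<And>n. n \<ge> N \<Longrightarrow> E n \<subseteq> V n" "\<And>n. n \<ge> N \<Longrightarrow> V n \<subseteq> (\<Union>x\<in>E n. bowen_ball d T n x \<epsilon>)" by blast
  let ?t = "t + \<omega> + 5 * \<eta>"
  define q where "q = exp (- \<eta>)"
  have q: "0 < q" "q < 1" using \<eta> by (auto simp: q_def)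
  have weight: "infsum (cover_weight d T \<phi> ?t \<epsilon>) (Pair n ` E n) \<le> ennreal (q ^ n)" if n: "n \<ge> max N 1" for n
  proof -
    have nN: "n \<ge> N" "n \<ge> 1" using n by auto
    have "cover_weight d T \<phi> ?t \<epsilon> (n, x) \<le> ennreal (exp (real n * (- h - 4 * \<eta>)))" if x: "x \<in> E n" for x
    proof -
      have "\<bar>birkhoff_sum T \<phi> n x / real n - I\<bar> < \<eta>" using E(3)[OF nN(1)] x by (auto simp: V_def I_def)
      then have "birkhoff_sum T \<phi> n x / real n \<le> I + \<eta>" by linarith
      then have "birkhoff_sum T \<phi> n x \<le> real n * (I + \<eta>)" using nN(2) by (simp add: field_simps)
      moreover have "(SUP y \<in> bowen_ball d T n x \<epsilon>. birkhoff_sum T \<phi> n y) \<le> birkhoff_sum T \<phi> n x + real n * \<omega>"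
        by (rule SUP_le_birkhoff_sum[OF \<phi>]) (use \<epsilon> \<omega> in auto)
      moreover have "- ?t * real n + (real n * (I + \<eta>) + real n * \<omega>) = real n * (- h - 4 * \<eta>)" by (simp add: h_def algebra_simps)
      ultimately have "- ?t * real n + (SUP y \<in> bowen_ball d T n x \<epsilon>. birkhoff_sum T \<phi> n y) \<le> real n * (- h - 4 * \<eta>)"
        by linarith
      then show ?thesis unfolding cover_weight_def prod.case by (intro ennreal_leI) simp
    qed
    then have "(\<Sum>x\<in>E n. cover_weight d T \<phi> ?t \<epsilon> (n, x)) \<le> (\<Sum>x\<in>E n. ennreal (exp (real n * (- h - 4 * \<eta>))))"
      by (rule sum_mono)
    also have "\<dots> = ennreal (real (card (E n)) * exp (real n * (- h - 4 * \<eta>)))"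
      by (simp add: ennreal_mult ennreal_of_nat_eq_real_of_nat)
    also have "\<dots> \<le> ennreal (exp (real n * (h + 3 * \<eta>)) * exp (real n * (- h - 4 * \<eta>)))"
      by (intro ennreal_leI mult_right_mono E(2) nN) simp
    also have "exp (real n * (h + 3 * \<eta>)) * exp (real n * (- h - 4 * \<eta>)) = q ^ n"
      by (simp add: q_def exp_add[symmetric] exp_of_nat_mult[symmetric] algebra_simps)
    finally show ?thesis using E(1)[OF nN(1)] by (simp add: infsum_finite sum.reindex inj_on_def)
  qed
  have bound: "pressure_sum d T (recurrent_to (insert \<phi> U) (min r \<eta>) \<mu>) ?t \<phi> n \<epsilon> \<le> ennreal (q ^ M / (1 - q))"
    if M: "M \<ge> max n (max N 1)" for n M
  proof -
    define C where "C i = Pair (M + i) ` E (M + i)" for i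
    have MN: "M + i \<ge> N" for i using M by simp
    have "(\<Union>i. C i) \<in> bowen_covers d T (recurrent_to (insert \<phi> U) (min r \<eta>) \<mu>) n \<epsilon>"
      unfolding bowen_covers_def
    proof (intro CollectI conjI)
      have "countable (C i)" for i using E(1)[OF MN] by (auto simp: C_def intro: countable_finite)
      then show "countable (\<Union>i. C i)" by simp
      show "\<forall>(m, x)\<in>\<Union>i. C i. n \<le> m" using M by (auto simp: C_def)
      show "recurrent_to (insert \<phi> U) (min r \<eta>) \<mu> \<subseteq> (\<Union>(m, x)\<in>\<Union>i. C i. bowen_ball d T m x \<epsilon>)"
      proof
        fix x assume "x \<in> recurrent_to (insert \<phi> U) (min r \<eta>) \<mu>"
        then have "\<exists>\<^sub>\<infinity>n. x \<in> V n" by (simp add: recurrent_to_def V_def)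
        then obtain m where m: "m > M" "x \<in> V m" unfolding INFM_nat by blast
        then obtain y where y: "y \<in> E m" "x \<in> bowen_ball d T m y \<epsilon>" using E(4)[of m] M by auto
        have "(m, y) \<in> C (m - M)" using m y by (simp add: C_def)
        then show "x \<in> (\<Union>(m, x)\<in>\<Union>i. C i. bowen_ball d T m x \<epsilon>)" using y(2) by (intro UN_I[of "(m, y)"]) auto
      qed
    qed
    then have "pressure_sum d T (recurrent_to (insert \<phi> U) (min r \<eta>) \<mu>) ?t \<phi> n \<epsilon> \<le> infsum (cover_weight d T \<phi> ?t \<epsilon>) (\<Union>i. C i)"
      unfolding pressure_sum_eq by (rule INF_lower)
    also have "\<dots> \<le> (\<Sum>i. infsum (cover_weight d T \<phi> ?t \<epsilon>) (C i))" by (rule infsum_UN_le)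
    also have "\<dots> \<le> (\<Sum>i. ennreal (q ^ M * q ^ i))"
    proof (rule suminf_le)
      show "infsum (cover_weight d T \<phi> ?t \<epsilon>) (C i) \<le> ennreal (q ^ M * q ^ i)" for i
        using weight[of "M + i"] M by (simp add: C_def power_add)
    qed auto
    also have "\<dots> = ennreal (q ^ M / (1 - q))"
    proof (rule suminf_ennreal_eq)
      show "(\<lambda>i. q ^ M * q ^ i) sums (q ^ M / (1 - q))"
        using sums_mult[OF geometric_sums, of q "q ^ M"] q by simp
    qed (use q in auto)
    finally show ?thesis .
  qed
  have "pressure_sum d T (recurrent_to (insert \<phi> U) (min r \<eta>) \<mu>) ?t \<phi> n \<epsilon> = 0" for n
  proof -
    have "(\<lambda>M. q ^ M / (1 - q)) \<longlonglongrightarrow> 0 / (1 - q)"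
      by (intro tendsto_divide LIMSEQ_power_zero tendsto_const) (use q in auto)
    then have "(\<lambda>M. ennreal (q ^ M / (1 - q))) \<longlonglongrightarrow> ennreal 0" by (intro tendsto_ennrealI) simp
    then have "pressure_sum d T (recurrent_to (insert \<phi> U) (min r \<eta>) \<mu>) ?t \<phi> n \<epsilon> \<le> ennreal 0"
      by (rule LIMSEQ_le_const) (use bound in blast)
    then show ?thesis by simp
  qed
  then show ?thesis using U r \<eta> \<phi> by (intro exI[of _ "insert \<phi> U"] exI[of _ "min r \<eta>"]) auto
qed

text \<open>A single \<open>f l\<close> approximates \<open>u\<close> up to an affine map, so
  closeness on the first \<open>N\<close> functions suffices once \<open>N > l\<close> and the bound
  is small. The value \<open>2 / Suc N\<close> comes from two numbers within
  \<open>1 / Suc N\<close> of the same rational.\<close>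

lemma integrals_near:
  assumes \<mu>: "\<mu> \<in> prob_measures" and u: "continuous_on UNIV (u :: 'a \<Rightarrow> real)" and r: "r > 0"
  shows "\<forall>\<^sub>F N in sequentially. \<forall>\<nu>\<in>prob_measures.
    (\<forall>i<N. \<bar>(\<integral>x. apply_bcontfun (f i) x \<partial>\<nu>) - (\<integral>x. apply_bcontfun (f i) x \<partial>\<mu>)\<bar> < 2 / real (Suc N)) \<longrightarrow>
    \<bar>(\<integral>x. u x \<partial>\<nu>) - (\<integral>x. u x \<partial>\<mu>)\<bar> < r"
proof -
  obtain a b l where l: "0 \<le> a" "\<And>x. \<bar>u x - (a * apply_bcontfun (f l) x + b)\<bar> < r / 4"
    using dense_approx[OF u, of "r / 4"] r by auto
  let ?w = "\<lambda>x. a * apply_bcontfun (f l) x + b"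
  have w: "continuous_on UNIV ?w" by (intro continuous_intros f_cont)
  have le: "\<bar>u x - ?w x\<bar> \<le> r / 4" for x using l(2)[of x] by simp
  have "(\<lambda>N. a * (2 / real (Suc N))) \<longlonglongrightarrow> 0" by real_asymp
  then have "\<forall>\<^sub>F N in sequentially. a * (2 / real (Suc N)) < r / 4" by (rule order_tendstoD) (use r in simp)
  then show ?thesis using eventually_gt_at_top[of l]
  proof eventually_elim
    case (elim N)
    show ?case
    proof (intro ballI impI)
      fix \<nu> :: "'a measure" assume \<nu>: "\<nu> \<in> prob_measures"
        and close: "\<forall>i<N. \<bar>(\<integral>x. apply_bcontfun (f i) x \<partial>\<nu>) - (\<integral>x. apply_bcontfun (f i) x \<partial>\<mu>)\<bar> < 2 / real (Suc N)"
      let ?I = "\<lambda>\<nu>. \<integral>x. apply_bcontfun (f l) x \<partial>\<nu>"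
      have "a * \<bar>?I \<nu> - ?I \<mu>\<bar> \<le> a * (2 / real (Suc N))" using close elim(2) l(1) by (intro mult_left_mono) (auto intro: less_imp_le)
      then have "\<bar>a * ?I \<nu> - a * ?I \<mu>\<bar> < r / 4" using elim(1) l(1)
        by (simp add: abs_mult right_diff_distrib[symmetric])
      moreover have "\<bar>(\<integral>x. u x \<partial>\<nu>) - (a * ?I \<nu> + b)\<bar> \<le> r / 4" "\<bar>(\<integral>x. u x \<partial>\<mu>) - (a * ?I \<mu> + b)\<bar> \<le> r / 4"
        using integral_close[OF \<nu> u w le] integral_close[OF \<mu> u w le] integral_affine[OF \<nu> f_cont, of a l b] integral_affine[OF \<mu> f_cont, of a l b] by auto
      ultimately show "\<bar>(\<integral>x. u x \<partial>\<nu>) - (\<integral>x. u x \<partial>\<mu>)\<bar> < r" by linarith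
    qed
  qed
qed

text \<open>Countably many sets that refer to no measure: rational data stand in for the integrals
  of the first \<open>N\<close> functions.\<close>

definition rational_cell :: "nat \<Rightarrow> rat list \<Rightarrow> 'a set" where
  "rational_cell N qs = {x. \<exists>\<^sub>\<infinity>n. \<forall>i<N. \<bar>birkhoff_sum T (apply_bcontfun (f i)) n x / real n - of_rat (qs ! i)\<bar> < 1 / real (Suc N)}"

text \<open>Rationals within \<open>1 / Suc N\<close> of the integrals of \<mu> put \<open>x\<close>
  into the cell. Conversely a visit recorded by the cell brings the integrals within
  \<open>2 / Suc N\<close> of those of \<mu>, hence into the given neighbourhood.\<close>

lemma recurrent_rational_cell:
  assumes \<mu>: "\<mu> \<in> prob_measures" and U: "finite U" "\<forall>u\<in>U. continuous_on UNIV (u :: 'a \<Rightarrow> real)" and r: "r > 0"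
    and s: "strict_mono (s :: nat \<Rightarrow> nat)"
    and lim: "\<And>u :: 'a \<Rightarrow> real. continuous_on UNIV u \<Longrightarrow> (\<lambda>n. \<integral>y. u y \<partial>empirical T (Suc (s n)) x) \<longlonglongrightarrow> (\<integral>y. u y \<partial>\<mu>)"
  shows "\<exists>N qs. rational_cell N qs \<subseteq> recurrent_to U r \<mu> \<and> x \<in> rational_cell N qs"
proof -
  let ?I = "\<lambda>i \<nu>. \<integral>x. apply_bcontfun (f i) x \<partial>\<nu>"
  have "\<forall>\<^sub>F N in sequentially. \<forall>u\<in>U. \<forall>\<nu>\<in>prob_measures. (\<forall>i<N. \<bar>?I i \<nu> - ?I i \<mu>\<bar> < 2 / real (Suc N)) \<longrightarrow>
      \<bar>(\<integral>x. u x \<partial>\<nu>) - (\<integral>x. u x \<partial>\<mu>)\<bar> < r"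
    by (rule eventually_ball_finite[OF U(1)]) (use integrals_near[OF \<mu> _ r] U(2) in blast)
  then obtain N where N0: "\<forall>u\<in>U. \<forall>\<nu>\<in>prob_measures. (\<forall>i<N. \<bar>?I i \<nu> - ?I i \<mu>\<bar> < 2 / real (Suc N)) \<longrightarrow>
      \<bar>(\<integral>x. u x \<partial>\<nu>) - (\<integral>x. u x \<partial>\<mu>)\<bar> < r"
    using eventually_happens'[OF sequentially_bot, THEN exE] by blast
  have N: "\<And>u \<nu>. u \<in> U \<Longrightarrow> \<nu> \<in> prob_measures \<Longrightarrow> (\<forall>i<N. \<bar>?I i \<nu> - ?I i \<mu>\<bar> < 2 / real (Suc N)) \<Longrightarrow>
      \<bar>(\<integral>x. u x \<partial>\<nu>) - (\<integral>x. u x \<partial>\<mu>)\<bar> < r"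
    using N0 by blast
  have "\<exists>q :: rat. \<bar>?I i \<mu> - of_rat q\<bar> < 1 / real (Suc N)" for i
  proof -
    obtain q :: rat where "?I i \<mu> < of_rat q" "of_rat q < ?I i \<mu> + 1 / real (Suc N)"
      using of_rat_dense[of "?I i \<mu>" "?I i \<mu> + 1 / real (Suc N)"] by auto
    then show ?thesis by (intro exI[of _ q]) auto
  qed
  then obtain q :: "nat \<Rightarrow> rat" where q: "\<And>i. \<bar>?I i \<mu> - of_rat (q i)\<bar> < 1 / real (Suc N)" by metis
  let ?qs = "map q [0..<N]"
  have "rational_cell N ?qs \<subseteq> recurrent_to U r \<mu>"
  proof
    fix y assume "y \<in> rational_cell N ?qs"
    then have "\<exists>\<^sub>\<infinity>n. \<forall>i<N. \<bar>birkhoff_sum T (apply_bcontfun (f i)) n y / real n - of_rat (q i)\<bar> < 1 / real (Suc N)"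
      by (simp add: rational_cell_def)
    then have "\<exists>\<^sub>\<infinity>n. n \<ge> 1 \<and> (\<forall>i<N. \<bar>birkhoff_sum T (apply_bcontfun (f i)) n y / real n - of_rat (q i)\<bar> < 1 / real (Suc N))"
      by (auto simp: INFM_nat) (metis Suc_leI gr0I less_max_iff_disj less_nat_zero_code max_less_iff_conj not_less_eq_eq)
    then have "\<exists>\<^sub>\<infinity>n. \<forall>u\<in>U. \<bar>birkhoff_sum T u n y / real n - (\<integral>y. u y \<partial>\<mu>)\<bar> < r"
    proof (rule INFM_mono)
      fix n assume n: "n \<ge> 1 \<and> (\<forall>i<N. \<bar>birkhoff_sum T (apply_bcontfun (f i)) n y / real n - of_rat (q i)\<bar> < 1 / real (Suc N))"
      show "\<forall>u\<in>U. \<bar>birkhoff_sum T u n y / real n - (\<integral>y. u y \<partial>\<mu>)\<bar> < r"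
      proof
        fix u assume u: "u \<in> U"
        have emp: "(\<integral>z. v z \<partial>empirical T n y) = birkhoff_sum T v n y / real n" if "continuous_on UNIV v" for v :: "'a \<Rightarrow> real"
          using n by (intro birkhoff_empirical borel_measurable_continuous_onI that) auto
        have "\<bar>?I i (empirical T n y) - ?I i \<mu>\<bar> < 2 / real (Suc N)" if "i < N" for i
        proof -
          have "\<bar>?I i (empirical T n y) - of_rat (q i)\<bar> < 1 / real (Suc N)" using n that by (simp add: emp[OF f_cont])
          then show ?thesis using q[of i] by linarith
        qed
        then show "\<bar>birkhoff_sum T u n y / real n - (\<integral>y. u y \<partial>\<mu>)\<bar> < r"
          using N[OF u empirical_prob, of n y] n U(2) u by (simp add: emp)
      qed
    qed
    then show "y \<in> recurrent_to U r \<mu>" by (simp add: recurrent_to_def)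
  qed
  moreover have "x \<in> rational_cell N ?qs"
  proof -
    have "\<forall>\<^sub>F n in sequentially. \<forall>i\<in>{..<N}. \<bar>?I i (empirical T (Suc (s n)) x) - of_rat (q i)\<bar> < 1 / real (Suc N)"
    proof (rule eventually_ball_finite, simp, intro ballI)
      fix i
      have "(\<lambda>n. \<bar>?I i (empirical T (Suc (s n)) x) - of_rat (q i)\<bar>) \<longlonglongrightarrow> \<bar>?I i \<mu> - of_rat (q i)\<bar>"
        by (intro tendsto_intros lim f_cont)
      then show "\<forall>\<^sub>F n in sequentially. \<bar>?I i (empirical T (Suc (s n)) x) - of_rat (q i)\<bar> < 1 / real (Suc N)"
        using q[of i] by (rule order_tendstoD)
    qed
    then obtain M where M: "\<And>n i. n \<ge> M \<Longrightarrow> i < N \<Longrightarrow> \<bar>?I i (empirical T (Suc (s n)) x) - of_rat (q i)\<bar> < 1 / real (Suc N)"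
      by (auto simp: eventually_sequentially)
    have "\<exists>n>m. \<forall>i<N. \<bar>birkhoff_sum T (apply_bcontfun (f i)) n x / real n - of_rat (q i)\<bar> < 1 / real (Suc N)" for m
    proof (intro exI conjI allI impI)
      show "m < Suc (s (m + M))" using seq_suble[OF s, of "m + M"] by simp
      fix i assume "i < N"
      moreover have "?I i (empirical T (Suc (s (m + M))) x) = birkhoff_sum T (apply_bcontfun (f i)) (Suc (s (m + M))) x / real (Suc (s (m + M)))"
        by (intro birkhoff_empirical borel_measurable_continuous_onI f_cont) simp
      ultimately show "\<bar>birkhoff_sum T (apply_bcontfun (f i)) (Suc (s (m + M))) x / real (Suc (s (m + M))) - of_rat (q i)\<bar> < 1 / real (Suc N)"
        using M[of "m + M" i] by simp
    qed
    then show ?thesis by (simp add: rational_cell_def INFM_nat)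
  qed
  ultimately show ?thesis by blast
qed

text \<open>Each point comes with its own measure and its own neighbourhood; rational cells with
  vanishing pressure sum, countable in number, capture all of them.\<close>

lemma bowen_upper_bound:
  fixes \<phi> :: "'a \<Rightarrow> real"
  assumes \<phi>: "continuous_on UNIV \<phi>"
    and Z: "\<And>x. x \<in> Z \<Longrightarrow> \<exists>\<mu>\<in>invariant_measures T. metric_entropy T \<mu> + ereal (\<integral>x. \<phi> x \<partial>\<mu>) \<le> ereal t \<and>
      (\<exists>s :: nat \<Rightarrow> nat. strict_mono s \<and> (\<forall>u :: 'a \<Rightarrow> real. continuous_on UNIV u \<longrightarrow>
        (\<lambda>n. \<integral>y. u y \<partial>empirical T (Suc (s n)) x) \<longlonglongrightarrow> (\<integral>y. u y \<partial>\<mu>)))"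
  shows "pressure d T Z \<phi> \<le> ereal t"
proof (rule pressure_leI[OF \<phi>])
  fix \<eta> :: real assume \<eta>: "\<eta> > 0"
  obtain \<epsilon>0 where \<epsilon>0: "\<epsilon>0 > 0" "\<And>x y. d x y \<le> \<epsilon>0 \<Longrightarrow> dist (\<phi> x) (\<phi> y) < \<eta> / 6"
    using uniformly_continuous_d[OF \<phi>, of "\<eta> / 6"] \<eta> by auto
  have "pressure_at d T Z \<phi> \<epsilon> \<le> ereal (t + \<eta>)" if \<epsilon>: "0 < \<epsilon>" "\<epsilon> < \<epsilon>0" for \<epsilon>
  proof (rule pressure_at_le)
    fix n
    let ?zero = "\<lambda>c. pressure_sum d T (rational_cell (fst c) (snd c)) (t + \<eta>) \<phi> n \<epsilon> = 0"
    \<comment> \<open>Cells whose pressure sum does not vanish are replaced by the empty set, which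
      makes the countable union null while it still contains \<open>Z\<close>.\<close>
    define Y where "Y i = (let c = from_nat i in if ?zero c then rational_cell (fst c) (snd c) else {})" for i :: nat
    have "pressure_sum d T (\<Union>i. Y i) (t + \<eta>) \<phi> n \<epsilon> = 0"
      by (rule pressure_sum_Union_zero) (simp add: Y_def Let_def pressure_sum_empty)
    moreover have "Z \<subseteq> (\<Union>i. Y i)"
    proof
      fix x assume "x \<in> Z"
      then obtain \<mu> s where \<mu>: "\<mu> \<in> invariant_measures T" "metric_entropy T \<mu> + ereal (\<integral>x. \<phi> x \<partial>\<mu>) \<le> ereal t"
        and s: "strict_mono (s :: nat \<Rightarrow> nat)" "\<And>u :: 'a \<Rightarrow> real. continuous_on UNIV u \<Longrightarrow> (\<lambda>n. \<integral>y. u y \<partial>empirical T (Suc (s n)) x) \<longlonglongrightarrow> (\<integral>y. u y \<partial>\<mu>)"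
        using Z by blast
      have \<omega>: "\<bar>\<phi> x - \<phi> y\<bar> \<le> \<eta> / 6" if "d x y \<le> \<epsilon>" for x y
        using \<epsilon>0(2)[of x y] that \<epsilon> by (simp add: dist_real_def)
      obtain U r where U: "finite U" "\<forall>u\<in>U. continuous_on UNIV (u :: 'a \<Rightarrow> real)" "r > 0"
        and zero: "\<forall>n. pressure_sum d T (recurrent_to U r \<mu>) (t + \<eta> / 6 + 5 * (\<eta> / 6)) \<phi> n \<epsilon> = 0"
        using recurrent_pressure_zero[OF \<phi> \<mu> \<epsilon>(1) _ \<omega>, of "\<eta> / 6"] \<eta> by auto
      have \<mu>p: "\<mu> \<in> prob_measures" using \<mu>(1) by (simp add: invariant_measures_def)
      obtain N qs where cell: "rational_cell N qs \<subseteq> recurrent_to U r \<mu>" "x \<in> rational_cell N qs"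
        using recurrent_rational_cell[OF \<mu>p U s] by blast
      have "pressure_sum d T (rational_cell N qs) (t + \<eta>) \<phi> n \<epsilon> \<le> pressure_sum d T (recurrent_to U r \<mu>) (t + \<eta>) \<phi> n \<epsilon>"
        by (rule pressure_sum_mono[OF cell(1)])
      also have "\<dots> = 0"
      proof -
        have "t + \<eta> / 6 + 5 * (\<eta> / 6) = t + \<eta>" by simp
        then show ?thesis using zero by metis
      qed
      finally have "?zero (N, qs)" by simp
      then have "x \<in> Y (to_nat (N, qs))" using cell(2) by (simp add: Y_def)
      then show "x \<in> (\<Union>i. Y i)" by blast
    qed
    ultimately show "pressure_sum d T Z (t + \<eta>) \<phi> n \<epsilon> = 0"
      using pressure_sum_mono[of Z "\<Union>i. Y i" d T "t + \<eta>" \<phi> n \<epsilon>] by simp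
  qed
  then show "\<exists>\<epsilon>0>0. \<forall>\<epsilon>. 0 < \<epsilon> \<longrightarrow> \<epsilon> < \<epsilon>0 \<longrightarrow> pressure_at d T Z \<phi> \<epsilon> \<le> ereal (t + \<eta>)"
    using \<epsilon>0(1) by blast
qed

end

section \<open>Accumulation points of the empirical averages\<close>

lemma accumulation_points_closed:
  fixes s :: "nat \<Rightarrow> 'y::metric_space"
  shows "closed (accumulation_points s)"
  unfolding closed_limpt islimpt_approachable
proof (intro allI impI)
  fix l assume l: "\<forall>e>0. \<exists>y\<in>accumulation_points s. y \<noteq> l \<and> dist y l < e"
  show "l \<in> accumulation_points s" unfolding accumulation_points_iff
  proof (intro allI impI)
    fix e :: real and N assume e: "e > 0"
    obtain y where y: "y \<in> accumulation_points s" "dist y l < e / 2" using l e half_gt_zero by blast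
    then obtain n where n: "n \<ge> N" "dist (s n) y < e / 2" using e half_gt_zero unfolding accumulation_points_iff by blast
    then have "dist (s n) l < e" using y(2) dist_triangle[of "s n" l y] by linarith
    then show "\<exists>n\<ge>N. dist (s n) l < e" using n(1) by blast
  qed
qed

lemma accumulation_points_subseq:
  assumes "strict_mono (r :: nat \<Rightarrow> nat)"
  shows "accumulation_points (s \<circ> r) \<subseteq> accumulation_points s"
  using assms unfolding accumulation_points_def comp_assoc by (auto intro: strict_mono_o)

lemma accumulation_points_compact:
  fixes s :: "nat \<Rightarrow> 'y::metric_space"
  assumes K: "compact K" and s: "\<And>n. s n \<in> K"
  shows "accumulation_points s \<noteq> {}" "compact (accumulation_points s)"
proof -
  obtain l r where "l \<in> K" "strict_mono (r :: nat \<Rightarrow> nat)" "(s \<circ> r) \<longlonglongrightarrow> l"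
    using K s unfolding compact_def by metis
  then show "accumulation_points s \<noteq> {}" unfolding accumulation_points_def by blast
  have "accumulation_points s \<subseteq> K"
  proof
    fix l assume "l \<in> accumulation_points s"
    then obtain r where r: "(s \<circ> r) \<longlonglongrightarrow> l" by (auto simp: accumulation_points_def)
    show "l \<in> K" by (rule Lim_in_closed_set[OF compact_imp_closed[OF K] _ _ r]) (auto simp: s)
  qed
  then show "compact (accumulation_points s)"
    using compact_Int_closed[OF K accumulation_points_closed[of s]] by (simp add: Int_absorb1)
qed

text \<open>If the set split into two closed parts at distance \<delta>, the sequence would finally
  stay within \<open>\<delta> / 3\<close> of their union with steps below
  \<open>\<delta> / 3\<close>; once near one part, it could never come near the other.\<close>

lemma accumulation_points_connected:
  fixes s :: "nat \<Rightarrow> 'y::metric_space"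
  assumes K: "compact K" and s: "\<And>n. s n \<in> K" and slow: "(\<lambda>n. dist (s n) (s (Suc n))) \<longlonglongrightarrow> 0"
  shows "connected (accumulation_points s)"
  unfolding connected_closed
proof
  let ?A = "accumulation_points s"
  assume "\<exists>A B. closed A \<and> closed B \<and> ?A \<subseteq> A \<union> B \<and> A \<inter> B \<inter> ?A = {} \<and> A \<inter> ?A \<noteq> {} \<and> B \<inter> ?A \<noteq> {}"
  then obtain A B where AB: "closed A" "closed B" "?A \<subseteq> A \<union> B" "A \<inter> B \<inter> ?A = {}" "A \<inter> ?A \<noteq> {}" "B \<inter> ?A \<noteq> {}"
    by (elim exE conjE)
  have cA: "compact ?A" by (rule accumulation_points_compact[OF K s])
  have cAB: "compact (A \<inter> ?A)" "compact (B \<inter> ?A)"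
    using closed_Int_compact[OF AB(1) cA] closed_Int_compact[OF AB(2) cA] by auto
  have "\<exists>p\<in>(A \<inter> ?A) \<times> (B \<inter> ?A). \<forall>q\<in>(A \<inter> ?A) \<times> (B \<inter> ?A). dist (fst p) (snd p) \<le> dist (fst q) (snd q)"
    by (rule continuous_attains_inf[OF compact_Times[OF cAB]]) (use AB(5,6) in \<open>auto intro!: continuous_intros\<close>)
  then obtain a0 b0 where ab: "a0 \<in> A \<inter> ?A" "b0 \<in> B \<inter> ?A"
    "\<And>a b. a \<in> A \<inter> ?A \<Longrightarrow> b \<in> B \<inter> ?A \<Longrightarrow> dist a0 b0 \<le> dist a b" by fastforce
  define \<delta> where "\<delta> = dist a0 b0"
  have \<delta>: "\<delta> > 0" "\<And>a b. a \<in> A \<inter> ?A \<Longrightarrow> b \<in> B \<inter> ?A \<Longrightarrow> \<delta> \<le> dist a b"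
    using ab AB(4) by (auto simp: \<delta>_def)
  have third: "\<delta> / 3 > 0" using \<delta>(1) by simp
  \<comment> \<open>Otherwise the far terms form a subsequence in \<open>K\<close>, whose own
    accumulation point belongs to the set.\<close>
  have "\<exists>N. \<forall>n\<ge>N. \<exists>a\<in>?A. dist (s n) a < \<delta> / 3"
  proof (rule ccontr)
    assume "\<nexists>N. \<forall>n\<ge>N. \<exists>a\<in>?A. dist (s n) a < \<delta> / 3"
    then have "\<exists>\<^sub>\<infinity>n. \<forall>a\<in>?A. \<delta> / 3 \<le> dist (s n) a"
      unfolding INFM_nat_le by (meson not_less)
    then have inf: "infinite {n. \<forall>a\<in>?A. \<delta> / 3 \<le> dist (s n) a}" by (simp add: frequently_cofinite)
    let ?r = "enumerate {n. \<forall>a\<in>?A. \<delta> / 3 \<le> dist (s n) a}"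
    have r: "strict_mono ?r" using inf by (rule strict_mono_enumerate)
    have mem: "\<forall>a\<in>?A. \<delta> / 3 \<le> dist (s (?r n)) a" for n using enumerate_in_set[OF inf, of n] by simp
    obtain l where l: "l \<in> accumulation_points (s \<circ> ?r)" using accumulation_points_compact(1)[OF K, of "s \<circ> ?r"] s by auto
    then obtain n where "dist ((s \<circ> ?r) n) l < \<delta> / 3"
      using l[unfolded accumulation_points_iff, rule_format, OF third, of 0] by blast
    moreover have "l \<in> ?A" using l accumulation_points_subseq[OF r] by blast
    ultimately show False using mem[of n] by fastforce
  qed
  then obtain N where N: "\<And>n. n \<ge> N \<Longrightarrow> \<exists>a\<in>?A. dist (s n) a < \<delta> / 3" by blast
  have "\<forall>\<^sub>F n in sequentially. dist (s n) (s (Suc n)) < \<delta> / 3" using slow by (rule order_tendstoD) (use \<delta> in simp)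
  then obtain M where M: "\<And>n. n \<ge> M \<Longrightarrow> dist (s n) (s (Suc n)) < \<delta> / 3" by (auto simp: eventually_sequentially)
  obtain a where a: "a \<in> A \<inter> ?A" using AB(5) by blast
  obtain b where b: "b \<in> B \<inter> ?A" using AB(6) by blast
  have acc: "\<exists>n\<ge>m. dist (s n) c < \<delta> / 3" if "c \<in> ?A" for c m
    using that[unfolded accumulation_points_iff, rule_format, OF third] .
  obtain n0 where n0: "n0 \<ge> max M N" "dist (s n0) a < \<delta> / 3" using acc[of a "max M N"] a by blast
  have stay: "\<exists>a\<in>A \<inter> ?A. dist (s n) a < \<delta> / 3" if "n \<ge> n0" for n
    using that
  proof (induction n rule: dec_induct)
    case base
    then show ?case using a n0(2) by blast
  next
    case (step n)
    obtain a where a: "a \<in> A \<inter> ?A" "dist (s n) a < \<delta> / 3" using step.IH by blast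
    obtain a' where a': "a' \<in> ?A" "dist (s (Suc n)) a' < \<delta> / 3" using N[of "Suc n"] step n0 by auto
    have "dist (s n) (s (Suc n)) < \<delta> / 3" using M[of n] step n0 by auto
    then have "dist a a' < \<delta>"
      using a(2) a'(2) dist_triangle[of a a' "s n"] dist_triangle[of "s n" a' "s (Suc n)"] dist_commute[of a "s n"] by linarith
    then have "a' \<notin> B \<inter> ?A" using \<delta>(2)[OF a(1), of a'] by auto
    then show ?case using a' AB(3) by blast
  qed
  obtain n where n: "n \<ge> n0" "dist (s n) b < \<delta> / 3" using acc[of b n0] b by blast
  obtain a where a: "a \<in> A \<inter> ?A" "dist (s n) a < \<delta> / 3" using stay[OF n(1)] by blast
  have "dist a b < \<delta>" using a(2) n(2) \<delta>(1) dist_triangle3[of a b "s n"] by linarith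
  then show False using \<delta>(2)[OF a(1) b] by simp
qed

context observable
begin

lemma compact_image: "compact (\<Xi> ` prob_measures)"
  unfolding compact_def
proof (intro allI impI)
  fix y :: "nat \<Rightarrow> 'y" assume "\<forall>n. y n \<in> \<Xi> ` prob_measures"
  then have "\<forall>n. \<exists>\<mu>. \<mu> \<in> prob_measures \<and> \<Xi> \<mu> = y n" by (metis imageE)
  then obtain \<mu> where \<mu>: "\<And>n. \<mu> n \<in> prob_measures" "\<And>n. \<Xi> (\<mu> n) = y n" by metis
  obtain r \<nu> where r: "strict_mono (r :: nat \<Rightarrow> nat)" "\<nu> \<in> prob_measures"
    "\<And>u :: 'a \<Rightarrow> real. continuous_on UNIV u \<Longrightarrow> (\<lambda>n. \<integral>x. u x \<partial>\<mu> (r n)) \<longlonglongrightarrow> (\<integral>x. u x \<partial>\<nu>)"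
    using prob_measures_sequentially_compact[of \<mu>, OF \<mu>(1)] by blast
  have "(\<lambda>n. \<Xi> (\<mu> (r n))) \<longlonglongrightarrow> \<Xi> \<nu>" by (rule continuous_map_sequentially[OF \<Xi>_cont r(2) \<mu>(1) r(3)])
  then show "\<exists>l\<in>\<Xi> ` prob_measures. \<exists>r. strict_mono r \<and> (y \<circ> r) \<longlonglongrightarrow> l"
    using r \<mu>(2) by (intro bexI[of _ "\<Xi> \<nu>"] exI[of _ r]) (auto simp: comp_def)
qed

lemma avg_in_image: "avg (Suc n) x \<in> \<Xi> ` prob_measures"
  unfolding \<Xi>_empirical[symmetric] by (rule imageI) (simp add: empirical_prob)

text \<open>The shorter average is treated as a single block compared with itself, at distance 0;
  the one additional step contributes at most \<open>D\<close> out of \<open>Suc (Suc n)\<close>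
  steps.\<close>

lemma avg_slow: "(\<lambda>n. dist (avg (Suc n) x) (avg (Suc (Suc n)) x)) \<longlonglongrightarrow> 0"
proof -
  obtain D where D: "D > 0" "\<And>w y. y \<in> \<Xi> ` prob_measures \<Longrightarrow> dist (e w) y \<le> D"
    using e_bounded[OF compact_imp_bounded[OF compact_image]] by blast
  have le: "dist (avg (Suc n) x) (avg (Suc (Suc n)) x) \<le> D / real (Suc (Suc n))" for n
  proof -
    have "real (Suc (Suc n)) * dist (avg (Suc (Suc n)) x) (avg (Suc n) x)
      \<le> (\<Sum>j<(1::nat). real (Suc n) * dist (avg (Suc n) ((T ^^ sum (\<lambda>_. Suc n) {..<j}) x)) (avg (Suc n) x))
        + (real (Suc (Suc n)) - real (sum (\<lambda>_. Suc n) {..<1::nat})) * D"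
      by (rule dist_avg_blocks[where n="Suc (Suc n)" and l="\<lambda>_. Suc n" and J=1 and y="avg (Suc n) x" and D=D and z=x]) (use D(2)[OF avg_in_image] in auto)
    also have "\<dots> = D" by simp
    finally show ?thesis by (simp only: pos_le_divide_eq[OF of_nat_0_less_iff[THEN iffD2, OF zero_less_Suc]] dist_commute mult.commute)
  qed
  have "(\<lambda>n. D / real (Suc (Suc n))) \<longlonglongrightarrow> 0" by real_asymp
  then show ?thesis by (rule Lim_null_comparison[rotated]) (use le in simp)
qed

text \<open>Along a further subsequence the empirical measures converge; continuity of the
  observable identifies the image of the limit with \<open>y\<close>.\<close>

lemma accumulation_measure:
  assumes y: "y \<in> accumulation_points (\<lambda>n. avg (Suc n) x)"
  shows "\<exists>\<mu>\<in>invariant_measures T. \<Xi> \<mu> = y \<and> (\<exists>s :: nat \<Rightarrow> nat. strict_mono s \<and>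
    (\<forall>u :: 'a \<Rightarrow> real. continuous_on UNIV u \<longrightarrow> (\<lambda>n. \<integral>y. u y \<partial>empirical T (Suc (s n)) x) \<longlonglongrightarrow> (\<integral>y. u y \<partial>\<mu>)))"
proof -
  obtain r where r: "strict_mono (r :: nat \<Rightarrow> nat)" "(\<lambda>n. avg (Suc (r n)) x) \<longlonglongrightarrow> y"
    using y by (auto simp: accumulation_points_def comp_def)
  have p: "empirical T (Suc n) x \<in> prob_measures" for n by (rule empirical_prob) simp
  obtain r' \<mu> where r': "strict_mono (r' :: nat \<Rightarrow> nat)" "\<mu> \<in> prob_measures"
    "\<And>u :: 'a \<Rightarrow> real. continuous_on UNIV u \<Longrightarrow> (\<lambda>n. \<integral>y. u y \<partial>empirical T (Suc (r (r' n))) x) \<longlonglongrightarrow> (\<integral>y. u y \<partial>\<mu>)"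
    using prob_measures_sequentially_compact[of "\<lambda>n. empirical T (Suc (r n)) x", OF p] by blast
  have s: "strict_mono (r \<circ> r')" by (rule strict_mono_o[OF r(1) r'(1)])
  have "(\<lambda>n. \<Xi> (empirical T (Suc (r (r' n))) x)) \<longlonglongrightarrow> \<Xi> \<mu>"
    by (rule continuous_map_sequentially[OF \<Xi>_cont r'(2) p r'(3)])
  moreover have "(\<lambda>n. \<Xi> (empirical T (Suc (r (r' n))) x)) \<longlonglongrightarrow> y"
    using LIMSEQ_subseq_LIMSEQ[OF r(2) r'(1)] by (simp add: \<Xi>_empirical comp_def)
  ultimately have "\<Xi> \<mu> = y" by (rule LIMSEQ_unique)
  moreover have "\<mu> \<in> invariant_measures T"
  proof (rule empirical_limit_invariant[OF r'(2)])
    show "filterlim (\<lambda>n. Suc ((r \<circ> r') n)) at_top sequentially"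
      by (intro filterlim_compose[OF filterlim_Suc] filterlim_subseq s)
  qed (use r'(3) in auto)
  ultimately show ?thesis using s r'(3) by (intro bexI[of _ \<mu>] conjI exI[of _ "r \<circ> r'"]) auto
qed

end

section \<open>Pressure of sets with prescribed accumulation points\<close>

context product_observable
begin

abbreviation limit_set :: "'a \<Rightarrow> 'y set" where "limit_set x \<equiv> accumulation_points (\<lambda>n. avg (Suc n) x)"

text \<open>One suitable accumulation point per \<open>x\<close> is enough, which fits two
  situations: any accumulation point in \<open>S2\<close>, and a prescribed one from
  \<open>S1\<close>. The bound is tested against real \<open>t\<close>, as \<open>l\<close> may be
  infinite.\<close>

lemma pressure_le_Lam:
  assumes "\<And>x. x \<in> Z \<Longrightarrow> \<exists>y\<in>limit_set x. Lam T \<Xi> \<phi> y \<le> l"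
  shows "pressure d T Z \<phi> \<le> l"
proof (rule ereal_le_real)
  fix t assume t: "l \<le> ereal t"
  show "pressure d T Z \<phi> \<le> ereal t"
  proof (rule bowen_upper_bound[OF \<phi>_cont])
    fix x assume "x \<in> Z"
    then obtain y where y: "y \<in> limit_set x" "Lam T \<Xi> \<phi> y \<le> l" using assms by blast
    obtain \<mu> where \<mu>: "\<mu> \<in> invariant_measures T" "\<Xi> \<mu> = y" and s: "\<exists>s :: nat \<Rightarrow> nat. strict_mono s \<and>
      (\<forall>u :: 'a \<Rightarrow> real. continuous_on UNIV u \<longrightarrow> (\<lambda>n. \<integral>y. u y \<partial>empirical T (Suc (s n)) x) \<longlonglongrightarrow> (\<integral>y. u y \<partial>\<mu>))"
      using accumulation_measure[OF y(1)] by (elim bexE conjE)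
    have "metric_entropy T \<mu> + ereal (\<integral>x. \<phi> x \<partial>\<mu>) \<le> Lam T \<Xi> \<phi> y"
      unfolding Lam_def by (rule SUP_upper) (use \<mu> in simp)
    then have "metric_entropy T \<mu> + ereal (\<integral>x. \<phi> x \<partial>\<mu>) \<le> ereal t" using y(2) t by (meson order_trans)
    then show "\<exists>\<mu>\<in>invariant_measures T. metric_entropy T \<mu> + ereal (\<integral>x. \<phi> x \<partial>\<mu>) \<le> ereal t \<and>
      (\<exists>s :: nat \<Rightarrow> nat. strict_mono s \<and> (\<forall>u :: 'a \<Rightarrow> real. continuous_on UNIV u \<longrightarrow>
        (\<lambda>n. \<integral>y. u y \<partial>empirical T (Suc (s n)) x) \<longlonglongrightarrow> (\<integral>y. u y \<partial>\<mu>)))"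
      using \<mu>(1) s by (intro bexI[of _ \<mu>] conjI)
  qed
qed

text \<open>A real number strictly below the supremum is already exceeded by one measure with one
  finite partition, so infinite entropy causes no separate case later.\<close>

lemma Lam_gt:
  assumes "ereal c < Lam T \<Xi> \<phi> y"
  shows "\<exists>\<mu>\<in>invariant_measures T. \<exists>P. finite_partition P \<and> \<Xi> \<mu> = y \<and> c < entropy_wrt T \<mu> P + (\<integral>x. \<phi> x \<partial>\<mu>)"
proof -
  obtain \<mu> where \<mu>: "\<mu> \<in> invariant_measures T" "\<Xi> \<mu> = y" "ereal c < metric_entropy T \<mu> + ereal (\<integral>x. \<phi> x \<partial>\<mu>)"
    using assms unfolding Lam_def less_SUP_iff by blast
  then have "ereal (c - (\<integral>x. \<phi> x \<partial>\<mu>)) < metric_entropy T \<mu>" by (cases "metric_entropy T \<mu>") auto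
  then obtain P where "finite_partition P" "ereal (c - (\<integral>x. \<phi> x \<partial>\<mu>)) < ereal (entropy_wrt T \<mu> P)"
    unfolding metric_entropy_def less_SUP_iff by blast
  then show ?thesis using \<mu> by (intro bexI[of _ \<mu>] exI[of _ P]) auto
qed

text \<open>Each real \<open>c\<close> below the infimum is reached by the Moran construction, run
  with \<open>\<eta> / 2\<close> because it loses twice its parameter.\<close>

lemma pressure_ge_INF_Lam:
  assumes Q: "compact Q" "connected Q" "Q \<noteq> {}" and Z: "{x. limit_set x = Q} \<subseteq> Z"
  shows "(INF y\<in>Q. Lam T \<Xi> \<phi> y) \<le> pressure d T Z \<phi>"
proof (rule ccontr)
  assume "\<not> ?thesis"
  then obtain c where c: "pressure d T Z \<phi> < ereal c" "ereal c < (INF y\<in>Q. Lam T \<Xi> \<phi> y)"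
    using ereal_dense2 by (meson not_le)
  have big: "\<exists>\<mu>\<in>invariant_measures T. \<exists>P. finite_partition P \<and> \<Xi> \<mu> = y \<and> c < entropy_wrt T \<mu> P + (\<integral>x. \<phi> x \<partial>\<mu>)"
    if "y \<in> Q" for y
    by (rule Lam_gt) (use less_le_trans[OF c(2) INF_lower[OF that]] in blast)
  have "ereal c \<le> pressure d T Z \<phi>"
  proof (rule pressure_geI[OF \<phi>_cont])
    fix \<eta> :: real assume "\<eta> > 0"
    then show "\<exists>\<epsilon>0>0. \<forall>\<epsilon>. 0 < \<epsilon> \<longrightarrow> \<epsilon> < \<epsilon>0 \<longrightarrow> ereal (c - \<eta>) \<le> pressure_at d T Z \<phi> \<epsilon>"
      using moran_lower_bound[OF Q half_gt_zero[of \<eta>] big Z] by simp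
  qed
  then show False using c(1) by simp
qed

lemma Delta_eq: "Delta T \<Xi> S1 S2 = {x. S1 \<subseteq> limit_set x \<and> limit_set x \<subseteq> S2}"
  by (simp add: Delta_def \<Xi>_empirical)

lemma limit_set_nonempty: "limit_set x \<noteq> {}"
  by (rule accumulation_points_compact(1)[OF compact_image avg_in_image])

text \<open>The limit set of a point is connected, lies in \<open>S2\<close> and contains
  \<open>S1\<close>; it therefore sits in the component of any point of \<open>S1\<close>.\<close>

lemma Delta_component:
  assumes S1: "S1 \<noteq> {}" and x: "x \<in> Delta T \<Xi> S1 S2"
  shows "\<exists>C\<in>components S2. S1 \<subseteq> C"
proof -
  have sub: "S1 \<subseteq> limit_set x" "limit_set x \<subseteq> S2" using x by (auto simp: Delta_eq)
  obtain y where y: "y \<in> S1" using S1 by blast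
  have "connected (limit_set x)" by (rule accumulation_points_connected[OF compact_image avg_in_image avg_slow])
  then have "limit_set x \<subseteq> connected_component_set S2 y"
    by (rule connected_component_maximal[rotated]) (use sub y in auto)
  then show ?thesis using sub y by (intro bexI[of _ "connected_component_set S2 y"]) (auto simp: components_def)
qed

end

theorem theorem1p3:
  fixes T :: "'a::metric_space \<Rightarrow> 'a"
    and f :: "nat \<Rightarrow> 'a \<Rightarrow>\<^sub>C real"
    and \<Xi> :: "'a measure \<Rightarrow> 'y::{real_vector, metric_space}"
    and g :: "nat \<Rightarrow> nat"
    and \<phi> :: "'a \<Rightarrow> real"
    and S1 S2 :: "'y set"
  assumes "compact (UNIV :: 'a set)"
    and "continuous_on UNIV T"
    and "range f \<subseteq> unit_functions"
    and "unit_functions \<subseteq> closure (range f)"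
    and "\<And>x1 x2 y1 y2 :: 'y. dist (x1 + x2) (y1 + y2) \<le> dist x1 y1 + dist x2 y2"
    and "\<And>(c :: real) (x :: 'y) y. dist (c *\<^sub>R x) (c *\<^sub>R y) \<le> \<bar>c\<bar> * dist x y"
    and "continuous_map weak_star_topology euclidean \<Xi>"
    and "affine_on_prob_measures \<Xi>"
    and "blow_up g"
    and "almost_product_property (rho_dist f) T g"
    and "uniform_separation_property (rho_dist f) T"
    and "continuous_on UNIV \<phi>"
    and "S1 \<subseteq> \<Xi> ` invariant_measures T"
  shows "(S1 = {} \<longrightarrow>
            pressure (rho_dist f) T (Delta T \<Xi> S1 S2) \<phi> = (SUP y\<in>S2. Lam T \<Xi> \<phi> y))
    \<and> (S1 \<noteq> {} \<and> (\<exists>C \<in> components S2. S1 \<subseteq> C) \<longrightarrow>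
         (SUP Q \<in> {Q. S1 \<subseteq> Q \<and> Q \<subseteq> S2 \<and> Q \<subseteq> \<Xi> ` invariant_measures T \<and> compact Q \<and> connected Q}.
            INF y\<in>Q. Lam T \<Xi> \<phi> y) \<le> pressure (rho_dist f) T (Delta T \<Xi> S1 S2) \<phi>
         \<and> pressure (rho_dist f) T (Delta T \<Xi> S1 S2) \<phi> \<le> (INF y\<in>S1. Lam T \<Xi> \<phi> y))
    \<and> (S1 \<noteq> {} \<and> \<not> (\<exists>C \<in> components S2. S1 \<subseteq> C) \<longrightarrow> Delta T \<Xi> S1 S2 = {})"
proof -
  interpret product_observable T f g \<Xi> \<phi>
    by unfold_locales (fact assms)+
  let ?Z = "Delta T \<Xi> S1 S2"
  have ge: "(INF y\<in>Q. Lam T \<Xi> \<phi> y) \<le> pressure d T ?Z \<phi>"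
    if "S1 \<subseteq> Q" "Q \<subseteq> S2" "Q \<noteq> {}" "compact Q" "connected Q" for Q
    by (rule pressure_ge_INF_Lam) (use that in \<open>auto simp: Delta_eq\<close>)
  show ?thesis
  proof (intro conjI impI)
    assume S1: "S1 = {}"
    show "pressure d T ?Z \<phi> = (SUP y\<in>S2. Lam T \<Xi> \<phi> y)"
    proof (rule antisym)
      show "pressure d T ?Z \<phi> \<le> (SUP y\<in>S2. Lam T \<Xi> \<phi> y)"
      proof (rule pressure_le_Lam)
        fix x assume "x \<in> ?Z"
        then obtain y where "y \<in> limit_set x" "y \<in> S2" using limit_set_nonempty[of x] by (auto simp: Delta_eq)
        then show "\<exists>y\<in>limit_set x. Lam T \<Xi> \<phi> y \<le> (SUP y\<in>S2. Lam T \<Xi> \<phi> y)" by (blast intro: SUP_upper)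
      qed
      show "(SUP y\<in>S2. Lam T \<Xi> \<phi> y) \<le> pressure d T ?Z \<phi>"
      proof (rule SUP_least)
        fix y assume "y \<in> S2"
        \<comment> \<open>A single point is a compact connected \<open>Q\<close>, and the infimum
          over it is the value of \<open>Lam\<close> there.\<close>
        then show "Lam T \<Xi> \<phi> y \<le> pressure d T ?Z \<phi>" using ge[of "{y}"] S1 by simp
      qed
    qed
  next
    assume S1: "S1 \<noteq> {} \<and> (\<exists>C \<in> components S2. S1 \<subseteq> C)"
    show "(SUP Q \<in> {Q. S1 \<subseteq> Q \<and> Q \<subseteq> S2 \<and> Q \<subseteq> \<Xi> ` invariant_measures T \<and> compact Q \<and> connected Q}.
            INF y\<in>Q. Lam T \<Xi> \<phi> y) \<le> pressure d T ?Z \<phi>"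
      by (rule SUP_least) (use ge S1 in auto)
    show "pressure d T ?Z \<phi> \<le> (INF y\<in>S1. Lam T \<Xi> \<phi> y)"
    proof (rule INF_greatest)
      fix y assume "y \<in> S1"
      then show "pressure d T ?Z \<phi> \<le> Lam T \<Xi> \<phi> y" by (intro pressure_le_Lam) (auto simp: Delta_eq)
    qed
  next
    assume "S1 \<noteq> {} \<and> \<not> (\<exists>C \<in> components S2. S1 \<subseteq> C)"
    then show "?Z = {}" using Delta_component by blast
  qed
qed

end
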